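(* Let $\theta \geq 95^{\circ}$ and assume that $u: [0,1]\times \Omega_{\theta} \rightarrow \mathbb{R}$ satisfies, for some constants $C, M<\infty$, $$|(\partial_t + \Delta)u| \leq C(|u|+|\nabla u|) \ \text{ in } [0,1]\times \Omega_{\theta},$$ $$u(0,x) = 0 \ \text{ in } \Omega_{\theta},$$ $$|u| \leq M \ \text{ in } [0,1]\times \Omega_{\theta}.$$ Then $u\equiv 0$.
   Context: $\Omega_{\theta}= \left\{ (x_{1},x_{2})\in \mathbb{R}^2 : \tan(\theta/2)\geq \frac{|x_{2}|}{x_{1}},\ x_{1}\geq 0 \right\}$ is the planar conical domain with opening angle $\theta$. Here $u=u(t,x)$ with $t\in[0,1]$ and $x\in\Omega_\theta$, and $\nabla$ and $\Delta$ act in the spatial variable $x$ only. No boundary condition is imposed on $\partial\Omega_\theta$. *)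

theory Defs
  imports "HOL-Analysis.Analysis"
begin

text \<open>
  The planar cone of opening angle \<open>\<theta>\<close>, for \<open>0 < \<theta> \<le> pi\<close>. The condition
  \<open>\<bar>x$2\<bar> / x$1 \<le> tan (\<theta> / 2)\<close> is written without the quotient, since \<open>a / 0 = 0\<close> in HOL would put
  the whole line \<open>x$1 = 0\<close> into the set; here that line contributes only the apex when
  \<open>\<theta> < pi\<close>. For \<open>\<theta> = pi\<close> the tangent is read as \<open>+\<infinity>\<close> (while \<open>tan (pi / 2) = 0\<close> in HOL), so the
  cone is the closed half-plane.
\<close>
definition conical_domain :: "real \<Rightarrow> (real^2) set" where
  "conical_domain \<theta> = {x. 0 \<le> x$1 \<and> (\<theta> < pi \<longrightarrow> \<bar>x$2\<bar> \<le> tan (\<theta> / 2) * x$1)}"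

definition partial :: "'n \<Rightarrow> (real^'n \<Rightarrow> real) \<Rightarrow> real^'n \<Rightarrow> real" where
  "partial i f x = frechet_derivative f (at x) (axis i 1)"

definition grad :: "(real^'n \<Rightarrow> real) \<Rightarrow> real^'n \<Rightarrow> real^'n" where
  "grad f x = (\<chi> i. partial i f x)"

definition laplacian :: "(real^'n \<Rightarrow> real) \<Rightarrow> real^'n \<Rightarrow> real" where
  "laplacian f x = (\<Sum>i\<in>UNIV. partial i (partial i f) x)"

definition time_deriv :: "(real \<Rightarrow> 'a \<Rightarrow> real) \<Rightarrow> real \<Rightarrow> 'a \<Rightarrow> real" where
  "time_deriv u t x = deriv (\<lambda>s. u s x) t"

text \<open>
  The class \<open>C\<^sup>1\<^sup>,\<^sup>2\<close> on \<open>I \<times> D\<close>, for open \<open>I\<close> and \<open>D\<close>: the derivatives \<open>u\<^sub>t\<close>, \<open>\<nabla>u\<close> and \<open>\<nabla>\<^sup>2u\<close> exist and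
  are jointly continuous in \<open>(t, x)\<close>.
\<close>
definition C12_on :: "real set \<Rightarrow> (real^'n) set \<Rightarrow> (real \<Rightarrow> real^'n \<Rightarrow> real) \<Rightarrow> bool" where
  "C12_on I D u \<longleftrightarrow>
     (\<forall>t\<in>I. \<forall>x\<in>D. (\<lambda>s. u s x) differentiable (at t)) \<and>
     (\<forall>t\<in>I. \<forall>x\<in>D. u t differentiable (at x)) \<and>
     (\<forall>t\<in>I. \<forall>x\<in>D. \<forall>i. partial i (u t) differentiable (at x)) \<and>
     continuous_on (I \<times> D) (\<lambda>(t, x). time_deriv u t x) \<and>
     continuous_on (I \<times> D) (\<lambda>(t, x). grad (u t) x) \<and>
     (\<forall>i j. continuous_on (I \<times> D) (\<lambda>(t, x). partial i (partial j (u t)) x))"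

end

theory Submission
  imports Defs
begin

text \<open>
  If \<open>e\<^sup>f (\<partial>\<^sub>t + \<Delta>) e\<^sup>-\<^sup>f = S + A\<close> with \<open>S\<close> symmetric and \<open>A\<close> antisymmetric, then
  \<open>\<parallel>(S + A) v\<parallel>\<^sup>2 \<ge> 2 \<langle>S v, (A - m) v\<rangle> - \<parallel>m v\<parallel>\<^sup>2\<close> for every function \<open>m\<close>, and integration by parts turns the
  right-hand side into a quadratic form in \<open>(v, \<nabla>v)\<close>. Wherever this form is coercive, a Carleman inequality
  for the weight \<open>f\<close> follows.

  A first weight, concave in \<open>x\<close> but very convex in \<open>t\<close>, shows that \<open>u\<close> has size
  \<open>e\<^bsup>-c R\<^sup>2\<^esup>\<close> at small times on a ball of radius comparable to \<open>R\<close> at distance of order \<open>R\<close> from the boundary. The second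
  weight is \<open>a \<eta>(t) x\<^sub>1\<^sup>\<kappa> P(x\<^sub>2 / x\<^sub>1)\<close>, where \<open>\<kappa>\<close> is slightly below \<open>2\<close>, so that the decay dominates
  \<open>e\<^sup>f\<close> at infinity for every \<open>a\<close>, and \<open>P\<close> vanishes before the slope \<open>tan 47.5\<degree>\<close> of the boundary, so that
  cutting off at a small level of the weight costs nothing as \<open>a \<rightarrow> \<infinity>\<close>. Coercivity reduces to the positivity
  of four polynomials in the slope; it is here that the opening angle has to be large.

  Thus \<open>u\<close> vanishes on the axis of the cone for a time that depends only on \<open>C\<close>. Moving the apex inside the
  domain gives this at every interior point, and iterating in time gives \<open>u = 0\<close>.
\<close>

section \<open>Integration by parts along directions\<close>

text \<open>The gradient part of the form is 4 D^2 f(\<nabla>v, \<nabla>v) + 2 m |\<nabla>v|^2. With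
  m = 0 it would ask for a convex weight, but a convex function that vanishes on both sides of a
  sector cannot be positive in between. A positive m repairs this, at the price of 2 m |\<nabla>f|^2
  v^2, which has to be paid by 4 D^2 f(\<nabla>f, \<nabla>f). Both demands can be met only where the
  least eigenvalue of D^2 f plus the value of D^2 f in the direction of \<nabla>f is positive; the
  profile P is built around this condition. Nothing is known about \<open>u\<close> on the lateral
  boundary, so the weight must fall below a fixed level before that boundary is reached. Two
  obstacles concern regularity. The solution is of class C^(1,2) only, so derivatives are taken
  along single directions (\<open>has_pd\<close>) and no derivative of \<open>u\<close> in both time
  and space may occur. At time 0 it is merely continuous, so no estimate may rely on a rate at which
  \<open>u\<close> tends to 0 there.\<close>

definition has_pd :: "'a::real_normed_vector \<Rightarrow> 'a set \<Rightarrow> ('a \<Rightarrow> real) \<Rightarrow> ('a \<Rightarrow> real) \<Rightarrow> bool" where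
  "has_pd e U f f' \<longleftrightarrow> (\<forall>z\<in>U. ((\<lambda>s. f (z + s *\<^sub>R e)) has_real_derivative f' z) (at 0))"

definition cut :: "'a set \<Rightarrow> ('a \<Rightarrow> real) \<Rightarrow> 'a \<Rightarrow> real" where
  "cut K f z = (if z \<in> K then f z else 0)"

lemma has_pdD: "has_pd e U f f' \<Longrightarrow> z \<in> U \<Longrightarrow> ((\<lambda>s. f (z + s *\<^sub>R e)) has_real_derivative f' z) (at 0)"
  by (simp add: has_pd_def)

lemma has_pd_line:
  assumes "has_pd e U f f'" "z + s *\<^sub>R e \<in> U"
  shows "((\<lambda>s. f (z + s *\<^sub>R e)) has_real_derivative f' (z + s *\<^sub>R e)) (at s)"
proof -
  have "((\<lambda>r. f ((z + s *\<^sub>R e) + r *\<^sub>R e)) has_real_derivative f' (z + s *\<^sub>R e)) (at 0)"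
    using assms by (simp add: has_pd_def)
  then have "((\<lambda>r. f (z + (r + s) *\<^sub>R e)) has_real_derivative f' (z + s *\<^sub>R e)) (at 0)"
    by (simp add: algebra_simps)
  then show ?thesis
    using DERIV_shift[of "\<lambda>s. f (z + s *\<^sub>R e)" _ 0 s] by simp
qed

lemma eventually_line_in_open:
  fixes z e :: "'a::real_normed_vector"
  assumes "open U" "z \<in> U"
  shows "eventually (\<lambda>s. z + s *\<^sub>R e \<in> U) (nhds (0::real))"
proof -
  have "open ((\<lambda>s::real. z + s *\<^sub>R e) -` U)"
    by (rule open_vimage[OF assms(1)]) (intro continuous_intros)
  then show ?thesis
    using eventually_nhds_in_open[of "(\<lambda>s::real. z + s *\<^sub>R e) -` U" 0] assms(2) by simp
qed

lemma has_pd_cong_open: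
  assumes "open U" "has_pd e U f f'" "\<And>z. z \<in> U \<Longrightarrow> f z = g z" "\<And>z. z \<in> U \<Longrightarrow> f' z = g' z"
  shows "has_pd e U g g'"
  unfolding has_pd_def
proof
  fix z assume z: "z \<in> U"
  have ev: "eventually (\<lambda>s. f (z + s *\<^sub>R e) = g (z + s *\<^sub>R e)) (nhds (0::real))"
    using eventually_line_in_open[OF assms(1) z, of e] by (rule eventually_mono) (rule assms(3))
  have "((\<lambda>s. f (z + s *\<^sub>R e)) has_real_derivative f' z) (at 0)"
    using assms(2) z by (simp add: has_pd_def)
  then show "((\<lambda>s. g (z + s *\<^sub>R e)) has_real_derivative g' z) (at 0)"
    using DERIV_cong_ev[OF refl ev assms(4)[OF z]] by simp
qed

lemma has_pd_subset: "has_pd e U f f' \<Longrightarrow> V \<subseteq> U \<Longrightarrow> has_pd e V f f'"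
  by (auto simp: has_pd_def)

lemma has_pd_add: "has_pd e U f f' \<Longrightarrow> has_pd e U g g' \<Longrightarrow> has_pd e U (\<lambda>z. f z + g z) (\<lambda>z. f' z + g' z)"
  by (auto simp: has_pd_def intro!: derivative_eq_intros)

lemma has_pd_diff: "has_pd e U f f' \<Longrightarrow> has_pd e U g g' \<Longrightarrow> has_pd e U (\<lambda>z. f z - g z) (\<lambda>z. f' z - g' z)"
  by (auto simp: has_pd_def intro!: derivative_eq_intros)

lemma has_pd_mult: "has_pd e U f f' \<Longrightarrow> has_pd e U g g' \<Longrightarrow> has_pd e U (\<lambda>z. f z * g z) (\<lambda>z. f' z * g z + f z * g' z)"
  unfolding has_pd_def by (auto intro!: derivative_eq_intros)

lemma has_pd_const: "has_pd e U (\<lambda>z. c) (\<lambda>z. 0)"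
  by (auto simp: has_pd_def)

lemma has_pd_comp:
  assumes "\<And>r. (F has_real_derivative F' r) (at r)" "has_pd e U f f'"
  shows "has_pd e U (\<lambda>z. F (f z)) (\<lambda>z. F' (f z) * f' z)"
  unfolding has_pd_def
proof
  fix z assume "z \<in> U"
  then have "((\<lambda>s. f (z + s *\<^sub>R e)) has_real_derivative f' z) (at 0)"
    using assms by (simp add: has_pd_def)
  moreover have "(F has_real_derivative F' (f z)) (at (f (z + 0 *\<^sub>R e)))"
    using assms(1) by simp
  ultimately show "((\<lambda>s. F (f (z + s *\<^sub>R e))) has_real_derivative F' (f z) * f' z) (at 0)"
    by (rule DERIV_chain2[rotated])
qed

lemma has_pd_zero_off:
  assumes U: "open U" and K: "closed K" and "has_pd e U f f'" and "\<And>z. z \<in> U - K \<Longrightarrow> f z = 0" and z: "z \<in> U - K"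
  shows "f' z = 0"
proof -
  have "has_pd e (U - K) f f'" by (rule has_pd_subset[OF assms(3)]) auto
  moreover have "open (U - K)" using U K by auto
  ultimately have "has_pd e (U - K) (\<lambda>z. 0) f'"
    using has_pd_cong_open[of "U - K" e f f' "\<lambda>z. 0" f'] assms(4) by simp
  then have "((\<lambda>s. 0) has_real_derivative f' z) (at 0)" using z by (simp add: has_pd_def)
  then show ?thesis using DERIV_unique[OF DERIV_const] by force
qed

lemma cut_in_open: "\<forall>z\<in>U - K. f z = 0 \<Longrightarrow> z \<in> U \<Longrightarrow> cut K f z = f z"
  by (auto simp: cut_def)

text \<open>\<open>U\<close> and \<open>- K\<close> are open and cover the space; on the first the
  zero extension is \<open>f\<close>, on the second it is 0. In this way functions known only on
  \<open>U\<close> enter integrals over the whole space.\<close>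

lemma continuous_on_cut:
  assumes "open U" "closed K" "K \<subseteq> U" "continuous_on U f" "\<forall>z\<in>U - K. f z = 0"
  shows "continuous_on UNIV (cut K f)"
proof -
  have "continuous_on U (cut K f)"
    using assms(4,5) continuous_on_cong[of U U "cut K f" f] cut_in_open[of U K f] by auto
  moreover have "continuous_on (- K) (cut K f)"
    using continuous_on_const[of "-K" "0::real"] continuous_on_cong[of "-K" "-K" "cut K f" "\<lambda>_. 0"]
    by (auto simp: cut_def)
  moreover have "U \<union> - K = UNIV" using assms by auto
  ultimately show ?thesis
    using continuous_on_open_Un[of U "- K" "cut K f"] assms(1,2) by auto
qed

lemma has_pd_cut:
  assumes "open U" "closed K" "K \<subseteq> U" "has_pd e U f f'" "\<forall>z\<in>U - K. f z = 0"
  shows "has_pd e UNIV (cut K f) (cut K f')"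
proof -
  have f': "f' z = 0" if "z \<in> U - K" for z
    using has_pd_zero_off[OF assms(1,2,4) _ that] assms(5) by blast
  have "has_pd e U (cut K f) (cut K f')"
    by (rule has_pd_cong_open[OF assms(1,4)]) (use assms(5) f' in \<open>auto simp: cut_def\<close>)
  moreover have "has_pd e (- K) (cut K f) (cut K f')"
    by (rule has_pd_cong_open[OF _ has_pd_const[of e "-K" 0]]) (use assms(2) in \<open>auto simp: cut_def open_Compl\<close>)
  ultimately show ?thesis using assms(3) by (auto simp: has_pd_def)
qed

section \<open>Integration by parts from translation invariance and difference quotients\<close>

lemma integrable_cut_bound:
  fixes f :: "'a::euclidean_space \<Rightarrow> real"
  assumes "continuous_on UNIV f" "\<And>z. z \<notin> K \<Longrightarrow> f z = 0" "compact K"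
  shows "integrable lborel f"
proof -
  have "integrable lborel (\<lambda>z. indicator K z *\<^sub>R f z)"
    using assms by (intro borel_integrable_compact) (auto intro: continuous_on_subset)
  moreover have "(\<lambda>z. indicator K z *\<^sub>R f z) = f"
    using assms(2) by (auto simp: indicator_def fun_eq_iff)
  ultimately show ?thesis by simp
qed

lemma integral_shift:
  fixes f :: "'a::euclidean_space \<Rightarrow> real"
  assumes "f \<in> borel_measurable borel"
  shows "(LINT z|lborel. f (z + a)) = (LINT z|lborel. f z)"
proof -
  have "(LINT z|lborel. f z) = (LINT z|distr lborel borel ((+) a). f z)"
    by (simp add: lborel_distr_plus)
  also have "\<dots> = (LINT z|lborel. f (a + z))"
    using assms by (subst integral_distr) auto
  finally show ?thesis by (simp add: add.commute)
qed

lemma tendsto_integral_bounded: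
  fixes f :: "'a::euclidean_space \<Rightarrow> real"
  assumes F: "\<And>n. continuous_on UNIV (F n)" and f: "continuous_on UNIV f"
    and B: "\<And>n z. \<bar>F n z\<bar> \<le> B" and Q: "\<And>n z. r < norm z \<Longrightarrow> F n z = 0"
    and lim: "\<And>z. (\<lambda>n. F n z) \<longlonglongrightarrow> f z"
  shows "(\<lambda>n. LINT z|lborel. F n z) \<longlonglongrightarrow> (LINT z|lborel. f z)"
proof (rule integral_dominated_convergence[where w="\<lambda>z. B * indicator (cball 0 r) z"])
  have "integrable lborel (indicator (cball (0::'a) r) :: _ \<Rightarrow> real)"
    using emeasure_lborel_cball_finite[of "0::'a" r] by (simp add: integrable_indicator_iff less_top[symmetric])
  then show "integrable lborel (\<lambda>z. B * indicator (cball (0::'a) r) z :: real)" by simp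
  show "AE z in lborel. norm (F n z) \<le> B * indicator (cball 0 r) z" for n
    using B[of n] Q[of _ n] by (intro AE_I2) (force simp: indicator_def not_le)
qed (use F f lim in \<open>auto intro: borel_measurable_continuous_onI\<close>)

definition hseq :: "nat \<Rightarrow> real" where "hseq n = inverse (real (Suc n))"

lemma hseq: "0 < hseq n" "hseq n \<le> 1" "hseq \<longlonglongrightarrow> 0"
  by (simp_all add: hseq_def divide_simps) (use LIMSEQ_inverse_real_of_nat in \<open>simp add: hseq_def[abs_def]\<close>)

lemma norm_shift_le:
  assumes "\<bar>s\<bar> \<le> 1" shows "norm z \<le> norm (z + s *\<^sub>R e) + norm e"
proof -
  have "norm z \<le> norm (z + s *\<^sub>R e) + norm (s *\<^sub>R e)"
    using norm_triangle_ineq4[of "z + s *\<^sub>R e" "s *\<^sub>R e"] by simp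
  moreover have "norm (s *\<^sub>R e) \<le> norm e" using assms by (simp add: mult_left_le_one_le)
  ultimately show ?thesis by simp
qed

lemma has_pd_quotient_lim:
  assumes "has_pd e UNIV F DF" "s \<longlonglongrightarrow> 0" "\<And>n. s n \<noteq> 0"
  shows "(\<lambda>n. (F (z + s n *\<^sub>R e) - F z) / s n) \<longlonglongrightarrow> DF z"
proof -
  have "((\<lambda>s. (F (z + s *\<^sub>R e) - F z) / s) \<longlongrightarrow> DF z) (at 0)"
    using assms(1) by (simp add: has_pd_def DERIV_def)
  moreover have "filterlim s (at 0) sequentially"
    unfolding filterlim_at using assms(2,3) by auto
  ultimately show ?thesis by (rule filterlim_compose)
qed

lemma has_pd_quotient_MVT:
  assumes "has_pd e UNIV F DF" "s > 0"
  obtains r where "0 < r" "r < s" "(F (z + s *\<^sub>R e) - F z) / s = DF (z + r *\<^sub>R e)"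
proof -
  obtain r where "0 < r" "r < s" "F (z + s *\<^sub>R e) - F (z + 0 *\<^sub>R e) = (s - 0) * DF (z + r *\<^sub>R e)"
    using MVT2[of 0 s "\<lambda>s. F (z + s *\<^sub>R e)" "\<lambda>s. DF (z + s *\<^sub>R e)"] assms(2)
      has_pd_line[OF assms(1)] by blast
  then show ?thesis using that[of r] assms(2) by simp
qed

lemma compact_support_bounds:
  fixes K :: "'a::real_normed_vector set"
  assumes "compact K" "continuous_on UNIV f" "\<And>z. z \<notin> K \<Longrightarrow> f z = (0::real)"
  obtains B where "0 \<le> B" "\<And>z. \<bar>f z\<bar> \<le> B"
proof -
  obtain B where "\<And>z. z \<in> K \<Longrightarrow> \<bar>f z\<bar> \<le> B"
    using compact_imp_bounded[OF compact_continuous_image[OF continuous_on_subset[OF assms(2)] assms(1)]]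
    by (auto simp: bounded_iff)
  then have "\<bar>f z\<bar> \<le> max B 0" for z using assms(3)[of z] by (cases "z \<in> K") (auto simp: le_max_iff_disj)
  then show ?thesis by (intro that[of "max B 0"]) auto
qed

text \<open>The difference quotients of \<open>F\<close> have integral 0 by translation invariance.
  By the mean value theorem they obey the same bound as \<open>DF\<close>, so dominated convergence
  passes the value 0 on to the integral of \<open>DF\<close>.\<close>

lemma integral_pd_UNIV:
  fixes F DF :: "'a::euclidean_space \<Rightarrow> real"
  assumes pd: "has_pd e UNIV F DF" and cF: "continuous_on UNIV F" and cD: "continuous_on UNIV DF"
    and K: "compact K" and F0: "\<And>z. z \<notin> K \<Longrightarrow> F z = 0" and D0: "\<And>z. z \<notin> K \<Longrightarrow> DF z = 0"
  shows "(LINT z|lborel. DF z) = 0"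
proof -
  define D where "D n z = (F (z + hseq n *\<^sub>R e) - F z) / hseq n" for n z
  obtain B where B: "0 \<le> B" "\<And>z. \<bar>DF z\<bar> \<le> B" using compact_support_bounds[OF K cD D0] by blast
  obtain r where r: "\<And>z. z \<in> K \<Longrightarrow> norm z \<le> r"
    using compact_imp_bounded[OF K] by (auto simp: bounded_iff)
  have off: "z + hseq n *\<^sub>R e \<notin> K" if "r + norm e < norm z" for z n
    using that r[of "z + hseq n *\<^sub>R e"] norm_shift_le[of "hseq n" z e] hseq(1,2)[of n] by force
  have off': "z \<notin> K" if "r + norm e < norm z" for z
    using that r[of z] norm_ge_zero[of e] by linarith
  have cFs: "continuous_on UNIV (\<lambda>z. F (z + s *\<^sub>R e))" for s
    by (rule continuous_on_compose2[OF cF]) (auto intro!: continuous_intros)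
  have mF: "F \<in> borel_measurable borel" using cF by (rule borel_measurable_continuous_onI)
  have "integrable lborel F" by (rule integrable_cut_bound[OF cF F0 K])
  moreover have "integrable lborel (\<lambda>z. F (z + hseq n *\<^sub>R e))" for n
    by (rule integrable_cut_bound[of _ "cball 0 (r + norm e)"]) (auto intro!: cFs F0 off)
  ultimately have intD: "(LINT z|lborel. D n z) = 0" for n
    unfolding D_def using integral_shift[OF mF, of "hseq n *\<^sub>R e"] by simp
  have "(\<lambda>n. LINT z|lborel. D n z) \<longlonglongrightarrow> (LINT z|lborel. DF z)"
  proof (rule tendsto_integral_bounded[OF _ cD])
    show "continuous_on UNIV (D n)" for n
      unfolding D_def using cFs[of "hseq n"] cF hseq(1)[of n] by (intro continuous_intros) auto
    show "\<bar>D n z\<bar> \<le> B" for n z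
      using has_pd_quotient_MVT[OF pd hseq(1)[of n], of z] B by (metis D_def)
    show "D n z = 0" if "r + norm e < norm z" for n z
      using off[OF that] off'[OF that] F0 by (simp add: D_def)
    show "(\<lambda>n. D n z) \<longlonglongrightarrow> DF z" for z
      unfolding D_def by (rule has_pd_quotient_lim[OF pd hseq(3)]) (use hseq(1) in \<open>simp add: less_imp_neq[symmetric]\<close>)
  qed
  then show ?thesis using intD LIMSEQ_unique[OF _ tendsto_const] by simp
qed

text \<open>This replaces \<open>2 v\<^sub>x\<^sub>x v\<^sub>t = 2 (v\<^sub>x v\<^sub>t)\<^sub>x - (v\<^sub>x\<^sup>2)\<^sub>t\<close>, which is not available as
  \<open>v\<^sub>x\<^sub>t\<close> need not exist.\<close>
lemma integral_time_space_UNIV: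
  fixes v p r vt g g' :: "'a::euclidean_space \<Rightarrow> real"
  assumes vp: "has_pd e UNIV v p" and pr: "has_pd e UNIV p r" and vt: "has_pd d UNIV v vt"
    and ge: "has_pd e UNIV g (\<lambda>z. 0)" and gd: "has_pd d UNIV g g'"
    and cont: "continuous_on UNIV v" "continuous_on UNIV p" "continuous_on UNIV r" "continuous_on UNIV vt"
      "continuous_on UNIV g" "continuous_on UNIV g'"
    and K: "compact K"
    and off: "\<And>z. z \<notin> K \<Longrightarrow> v z = 0" "\<And>z. z \<notin> K \<Longrightarrow> p z = 0" "\<And>z. z \<notin> K \<Longrightarrow> r z = 0" "\<And>z. z \<notin> K \<Longrightarrow> vt z = 0"
    and g0: "\<And>z. 0 \<le> g z"
  shows "(LINT z|lborel. g' z * (p z)\<^sup>2) \<le> (LINT z|lborel. 2 * g z * r z * vt z)"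
proof -
  define W where "W n z = (v (z + hseq n *\<^sub>R d) - v z) / hseq n" for n z
  define P where "P n z = (p (z + hseq n *\<^sub>R d) - p z) / hseq n" for n z
  \<comment> \<open>The quotient of \<open>g\<close> runs backwards: moving the translation from
    \<open>p\<close> to \<open>g\<close> under the integral reverses its direction.\<close>
  define G where "G n z = (g (z + (- hseq n) *\<^sub>R d) - g z) / (- hseq n)" for n z
  obtain \<rho> where \<rho>: "\<And>z. z \<in> K \<Longrightarrow> norm z \<le> \<rho>"
    using compact_imp_bounded[OF K] by (auto simp: bounded_iff)
  define Q where "Q = cball (0::'a) (\<rho> + norm d)"
  have Q: "compact Q" by (simp add: Q_def)
  have offQ: "z \<notin> K" "z + hseq n *\<^sub>R d \<notin> K" if "z \<notin> Q" for z n
    using that \<rho>[of z] \<rho>[of "z + hseq n *\<^sub>R d"] norm_shift_le[of "hseq n" z d] hseq(1,2)[of n] norm_ge_zero[of d]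
    by (force simp: Q_def)+
  have cs: "continuous_on UNIV (\<lambda>z. f (z + s *\<^sub>R d))" if "continuous_on UNIV f" for f :: "'a \<Rightarrow> real" and s
    by (rule continuous_on_compose2[OF that]) (auto intro!: continuous_intros)
  have hn: "hseq n \<noteq> 0" for n using hseq(1)[of n] by simp
  have cW: "continuous_on UNIV (W n)" for n
    unfolding W_def using cs[OF cont(1), of "hseq n"] cont(1) hn[of n] by (intro continuous_intros) auto
  have cP: "continuous_on UNIV (P n)" for n
    unfolding P_def using cs[OF cont(2), of "hseq n"] cont(2) hn[of n] by (intro continuous_intros) auto
  have cG: "continuous_on UNIV (G n)" for n
    unfolding G_def using cs[OF cont(5), of "- hseq n"] cont(5) hn[of n] by (intro continuous_intros) auto
  have shift_pd: "has_pd e UNIV (\<lambda>z. v (z + a)) (\<lambda>z. p (z + a))" for a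
    unfolding has_pd_def
  proof
    fix z
    have "(\<lambda>s. v (z + s *\<^sub>R e + a)) = (\<lambda>s. v (z + a + s *\<^sub>R e))" by (simp add: add_ac)
    then show "((\<lambda>s. v (z + s *\<^sub>R e + a)) has_real_derivative p (z + a)) (at 0)"
      using has_pdD[OF vp, of "z + a"] by simp
  qed
  have pdW: "has_pd e UNIV (W n) (P n)" for n
    unfolding W_def P_def has_pd_def
    using has_pdD[OF shift_pd[of "hseq n *\<^sub>R d"]] has_pdD[OF vp] hn[of n]
    by (auto intro!: derivative_eq_intros simp: divide_simps)
  \<comment> \<open>The time quotient \<open>W n\<close> of \<open>v\<close> does have a derivative
    along \<open>e\<close>, namely the time quotient \<open>P n\<close> of \<open>p\<close>.
    Integrating by parts along \<open>e\<close> with \<open>W n\<close> in place of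
    \<open>vt\<close> thus avoids the mixed derivative.\<close>
  have key: "(LINT z|lborel. G n z * (p z)\<^sup>2) \<le> (LINT z|lborel. 2 * (g z * r z * W n z))" for n
  proof -
    have pdF: "has_pd e UNIV (\<lambda>z. g z * p z * W n z) (\<lambda>z. (0 * p z + g z * r z) * W n z + g z * p z * P n z)"
      by (intro has_pd_mult ge pr pdW)
    have "(LINT z|lborel. (0 * p z + g z * r z) * W n z + g z * p z * P n z) = 0"
      by (rule integral_pd_UNIV[OF pdF _ _ K]) (use off cont cW cP in \<open>auto intro!: continuous_intros\<close>)
    moreover have i1: "integrable lborel (\<lambda>z. g z * r z * W n z)"
      by (rule integrable_cut_bound[OF _ _ K]) (use off cont cW in \<open>auto intro!: continuous_intros\<close>)
    moreover have i2: "integrable lborel (\<lambda>z. g z * p z * P n z)"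
      by (rule integrable_cut_bound[OF _ _ K]) (use off cont cP in \<open>auto intro!: continuous_intros\<close>)
    ultimately have A: "(LINT z|lborel. g z * r z * W n z) = - (LINT z|lborel. g z * p z * P n z)"
      by (simp add: Bochner_Integration.integral_add)
    have i3: "integrable lborel (\<lambda>z. g z * (p (z + hseq n *\<^sub>R d))\<^sup>2)"
      by (rule integrable_cut_bound[OF _ _ Q]) (use off offQ cont cs[OF cont(2)] in \<open>auto intro!: continuous_intros\<close>)
    have i4: "integrable lborel (\<lambda>z. g z * (p z)\<^sup>2)"
      by (rule integrable_cut_bound[OF _ _ K]) (use off cont in \<open>auto intro!: continuous_intros\<close>)
    have c5: "continuous_on UNIV (\<lambda>z. g (z + (- hseq n) *\<^sub>R d) * (p z)\<^sup>2)"
      by (intro continuous_intros cs cont)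
    have i5: "integrable lborel (\<lambda>z. g (z + (- hseq n) *\<^sub>R d) * (p z)\<^sup>2)"
      by (rule integrable_cut_bound[OF c5 _ K]) (use off in auto)
    have sh: "(LINT z|lborel. g (z + (- hseq n) *\<^sub>R d) * (p z)\<^sup>2) = (LINT z|lborel. g z * (p (z + hseq n *\<^sub>R d))\<^sup>2)"
      using integral_shift[of "\<lambda>z. g (z + (- hseq n) *\<^sub>R d) * (p z)\<^sup>2" "hseq n *\<^sub>R d"] c5
      by (simp add: borel_measurable_continuous_onI)
    have "(LINT z|lborel. 2 * (g z * p z * P n z)) \<le> (LINT z|lborel. (g z * (p (z + hseq n *\<^sub>R d))\<^sup>2 - g z * (p z)\<^sup>2) / hseq n)"
    proof (rule integral_mono)
      fix z
      \<comment> \<open>The discarded square of the increment of \<open>p\<close> has a favourable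
        sign because \<open>g\<close> is nonnegative; this is where the identity becomes an
        inequality.\<close>
      have "2 * (p z * (p (z + hseq n *\<^sub>R d) - p z)) \<le> (p (z + hseq n *\<^sub>R d))\<^sup>2 - (p z)\<^sup>2"
        using sum_squares_ge_zero[of "p (z + hseq n *\<^sub>R d) - p z" 0] by (simp add: power2_eq_square algebra_simps)
      then have "g z * (2 * (p z * (p (z + hseq n *\<^sub>R d) - p z))) / hseq n \<le> g z * ((p (z + hseq n *\<^sub>R d))\<^sup>2 - (p z)\<^sup>2) / hseq n"
        using g0[of z] hseq(1)[of n] by (intro divide_right_mono mult_left_mono) auto
      then show "2 * (g z * p z * P n z) \<le> (g z * (p (z + hseq n *\<^sub>R d))\<^sup>2 - g z * (p z)\<^sup>2) / hseq n"
        by (simp add: P_def algebra_simps)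
    qed (use i2 i3 i4 in auto)
    also have "\<dots> = - (LINT z|lborel. G n z * (p z)\<^sup>2)"
    proof -
      have "(LINT z|lborel. G n z * (p z)\<^sup>2) = (LINT z|lborel. (g z * (p z)\<^sup>2 - g (z + (- hseq n) *\<^sub>R d) * (p z)\<^sup>2) / hseq n)"
        by (rule Bochner_Integration.integral_cong) (auto simp: G_def diff_divide_distrib algebra_simps)
      also have "\<dots> = ((LINT z|lborel. g z * (p z)\<^sup>2) - (LINT z|lborel. g z * (p (z + hseq n *\<^sub>R d))\<^sup>2)) / hseq n"
        using i4 i5 sh by simp
      finally show ?thesis using i3 i4 by (simp add: diff_divide_distrib)
    qed
    finally show ?thesis using A by simp
  qed
  obtain Bv where Bv: "0 \<le> Bv" "\<And>z. \<bar>vt z\<bar> \<le> Bv" using compact_support_bounds[OF K cont(4) off(4)] by blast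
  obtain Br where Br: "0 \<le> Br" "\<And>z. \<bar>g z * r z\<bar> \<le> Br"
    using compact_support_bounds[OF K, of "\<lambda>z. g z * r z"] cont off by (auto intro!: continuous_intros)
  obtain Bp where Bp: "0 \<le> Bp" "\<And>z. \<bar>(p z)\<^sup>2\<bar> \<le> Bp"
    using compact_support_bounds[OF K, of "\<lambda>z. (p z)\<^sup>2"] cont off by (auto intro!: continuous_intros)
  obtain Bg where Bg: "\<And>z. z \<in> Q \<Longrightarrow> \<bar>g' z\<bar> \<le> Bg"
    using compact_imp_bounded[OF compact_continuous_image[OF continuous_on_subset[OF cont(6)] Q]]
    by (auto simp: bounded_iff)
  have WB: "\<bar>W n z\<bar> \<le> Bv" for n z
    using has_pd_quotient_MVT[OF vt hseq(1)[of n], of z] Bv by (metis W_def)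
  \<comment> \<open>The support of \<open>g\<close> need not be compact, so its quotients are
    bounded on \<open>K\<close> only; the points produced by the mean value theorem lie in the
    larger ball \<open>Q\<close>.\<close>
  have GB: "\<bar>G n z\<bar> \<le> Bg" if "z \<in> K" for n z
  proof -
    obtain s where s: "0 < s" "s < hseq n"
      "(g ((z - hseq n *\<^sub>R d) + hseq n *\<^sub>R d) - g (z - hseq n *\<^sub>R d)) / hseq n = g' ((z - hseq n *\<^sub>R d) + s *\<^sub>R d)"
      using has_pd_quotient_MVT[OF gd hseq(1)[of n]] by blast
    have "G n z = g' (z + (s - hseq n) *\<^sub>R d)"
      using s(3) by (simp add: G_def algebra_simps minus_divide_left[symmetric] diff_divide_distrib)
    moreover have "norm (z + (s - hseq n) *\<^sub>R d) \<le> \<rho> + norm d"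
    proof -
      have "norm ((s - hseq n) *\<^sub>R d) \<le> norm d" using s hseq(2)[of n] by (simp add: mult_left_le_one_le)
      then show ?thesis using \<rho>[OF that] norm_triangle_ineq[of z "(s - hseq n) *\<^sub>R d"] by linarith
    qed
    ultimately show ?thesis using Bg[of "z + (s - hseq n) *\<^sub>R d"] by (simp add: Q_def)
  qed
  have L1: "(\<lambda>n. LINT z|lborel. G n z * (p z)\<^sup>2) \<longlonglongrightarrow> (LINT z|lborel. g' z * (p z)\<^sup>2)"
  proof (rule tendsto_integral_bounded[where B="max Bg 0 * Bp" and r=\<rho>])
    show "\<bar>G n z * (p z)\<^sup>2\<bar> \<le> max Bg 0 * Bp" for n z
    proof (cases "z \<in> K")
      case True
      then show ?thesis using GB[OF True, of n] Bp(2)[of z] Bp(1) unfolding abs_mult by (intro mult_mono) auto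
    qed (use off Bp in auto)
    show "G n z * (p z)\<^sup>2 = 0" if "\<rho> < norm z" for n z using off(2)[of z] \<rho>[of z] that by force
    show "(\<lambda>n. G n z * (p z)\<^sup>2) \<longlonglongrightarrow> g' z * (p z)\<^sup>2" for z
      unfolding G_def
      by (intro tendsto_mult tendsto_const has_pd_quotient_lim[OF gd]) (use tendsto_minus[OF hseq(3)] hn in auto)
  qed (use cG cont in \<open>auto intro!: continuous_intros\<close>)
  have L2: "(\<lambda>n. LINT z|lborel. 2 * (g z * r z * W n z)) \<longlonglongrightarrow> (LINT z|lborel. 2 * (g z * r z * vt z))"
  proof (rule tendsto_integral_bounded[where B="2 * (Br * Bv)" and r=\<rho>])
    show "\<bar>2 * (g z * r z * W n z)\<bar> \<le> 2 * (Br * Bv)" for n z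
      using mult_mono[OF Br(2)[of z] WB[of n z] Br(1)] by (simp add: abs_mult)
    show "2 * (g z * r z * W n z) = 0" if "\<rho> < norm z" for n z using off(3)[of z] \<rho>[of z] that by force
    show "(\<lambda>n. 2 * (g z * r z * W n z)) \<longlonglongrightarrow> 2 * (g z * r z * vt z)" for z
      unfolding W_def
      by (intro tendsto_mult tendsto_const has_pd_quotient_lim[OF vt hseq(3)]) (use hn in auto)
  qed (use cW cont in \<open>auto intro!: continuous_intros\<close>)
  show ?thesis using LIMSEQ_le[OF L1 L2] key by (simp add: mult.assoc)
qed

section \<open>Integrals over compact sets of space-time\<close>

type_synonym pt = "real \<times> (real^2)"

abbreviation dT :: pt where "dT \<equiv> (1, 0)"
abbreviation dX :: pt where "dX \<equiv> (0, axis 1 1)"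
abbreviation dY :: pt where "dY \<equiv> (0, axis 2 1)"

definition lint :: "pt set \<Rightarrow> (pt \<Rightarrow> real) \<Rightarrow> real" where
  "lint K f = (LINT z|lborel. cut K f z)"

lemma cut_indicator: "cut K f = (\<lambda>z. indicator K z *\<^sub>R f z)"
  by (auto simp: cut_def indicator_def fun_eq_iff)

lemma integrable_cut:
  fixes f :: "'a::euclidean_space \<Rightarrow> real"
  shows "compact K \<Longrightarrow> continuous_on K f \<Longrightarrow> integrable lborel (cut K f)"
  unfolding cut_indicator by (rule borel_integrable_compact)

lemma lint_add:
  assumes "compact K" "continuous_on K f" "continuous_on K g"
  shows "lint K (\<lambda>z. f z + g z) = lint K f + lint K g"
proof -
  have "cut K (\<lambda>z. f z + g z) = (\<lambda>z. cut K f z + cut K g z)" by (auto simp: cut_def)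
  then show ?thesis unfolding lint_def using assms by (simp add: integrable_cut)
qed

lemma lint_cmult: "lint K (\<lambda>z. c * f z) = c * lint K f"
proof -
  have "cut K (\<lambda>z. c * f z) = (\<lambda>z. c * cut K f z)" by (auto simp: cut_def)
  then show ?thesis unfolding lint_def by simp
qed

lemma lint_nonneg: "(\<And>z. z \<in> K \<Longrightarrow> 0 \<le> f z) \<Longrightarrow> 0 \<le> lint K f"
  unfolding lint_def by (rule integral_nonneg_AE) (auto simp: cut_def)

lemma lint_mono:
  assumes "compact K" "continuous_on K f" "continuous_on K g" "\<And>z. z \<in> K \<Longrightarrow> f z \<le> g z"
  shows "lint K f \<le> lint K g"
  unfolding lint_def using assms by (intro integral_mono integrable_cut) (auto simp: cut_def)

lemma lint_mono_sets:
  assumes "compact K" "continuous_on K f" "compact L" "continuous_on L g"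
    "\<And>z. z \<in> K \<Longrightarrow> z \<in> L \<and> f z \<le> g z" "\<And>z. z \<in> L \<Longrightarrow> 0 \<le> g z"
  shows "lint K f \<le> lint L g"
  unfolding lint_def using assms by (intro integral_mono integrable_cut) (auto simp: cut_def)

lemma lint_mono_sum:
  assumes K: "compact K" and c: "continuous_on K a" "continuous_on K b" "continuous_on K c"
     "continuous_on K d1" "continuous_on K d2" "continuous_on K d3" "continuous_on K l" "continuous_on K m"
    and le: "\<And>z. a z + b z + (c z + ((d1 z + d2 z) + d3 z)) \<le> l z + m z"
  shows "lint K a + lint K b + (lint K c + ((lint K d1 + lint K d2) + lint K d3)) \<le> lint K l + lint K m"
proof -
  note cs = continuous_on_add[where 'b=real]
  have ab: "continuous_on K (\<lambda>z. a z + b z)" and d12: "continuous_on K (\<lambda>z. d1 z + d2 z)" using c by (auto intro: cs)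
  have d: "continuous_on K (\<lambda>z. (d1 z + d2 z) + d3 z)" using cs[OF d12 c(6)] .
  have cd: "continuous_on K (\<lambda>z. c z + ((d1 z + d2 z) + d3 z))" using cs[OF c(3) d] .
  have "lint K (\<lambda>z. a z + b z + (c z + ((d1 z + d2 z) + d3 z))) \<le> lint K (\<lambda>z. l z + m z)"
    by (rule lint_mono[OF K cs[OF ab cd] cs[OF c(7,8)]]) (rule le)
  then show ?thesis
    by (simp only: lint_add[OF K ab cd] lint_add[OF K c(1,2)] lint_add[OF K c(3) d] lint_add[OF K d12 c(6)]
      lint_add[OF K c(4,5)] lint_add[OF K c(7,8)])
qed

lemma lint_const:
  assumes "compact K" shows "lint K (\<lambda>z. c) = c * measure lborel K"
proof -
  have "lint K (\<lambda>z. c) = (LINT z|lborel. c * indicator K z)"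
    unfolding lint_def by (rule Bochner_Integration.integral_cong) (auto simp: cut_def)
  then show ?thesis using assms by simp
qed

lemma lint_pd:
  assumes "open U" "compact K" "K \<subseteq> U" "has_pd e U F DF" "continuous_on U F" "continuous_on U DF"
    "\<And>z. z \<in> U - K \<Longrightarrow> F z = 0"
  shows "lint K DF = 0"
  unfolding lint_def
proof (rule integral_pd_UNIV[where F="cut K F" and K=K])
  have K: "closed K" using assms(2) by (rule compact_imp_closed)
  have D0: "\<forall>z\<in>U - K. DF z = 0" using has_pd_zero_off[OF assms(1) K assms(4)] assms(7) by blast
  show "has_pd e UNIV (cut K F) (cut K DF)" by (rule has_pd_cut) (use assms K in auto)
  show "continuous_on UNIV (cut K F)" by (rule continuous_on_cut) (use assms K in auto)
  show "continuous_on UNIV (cut K DF)" by (rule continuous_on_cut) (use assms K D0 in auto)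
qed (use assms in \<open>auto simp: cut_def\<close>)

lemma lint_time_space:
  assumes U: "open U" and K: "compact K" "K \<subseteq> U"
    and pd: "has_pd e U v p" "has_pd e U p r" "has_pd dT U v vt" and e: "fst e = 0"
    and g: "\<And>t. (g has_real_derivative g' t) (at t)" "continuous_on UNIV g'" "\<And>t. 0 \<le> g t"
    and cont: "continuous_on U v" "continuous_on U p" "continuous_on U r" "continuous_on U vt"
    and off: "\<And>z. z \<in> U - K \<Longrightarrow> v z = 0"
  shows "lint K (\<lambda>z. g' (fst z) * (p z)\<^sup>2) \<le> lint K (\<lambda>z. 2 * g (fst z) * r z * vt z)"
proof -
  have cK: "closed K" using K(1) by (rule compact_imp_closed)
  have p0: "z \<in> U - K \<Longrightarrow> p z = 0" for z using has_pd_zero_off[OF U cK pd(1)] off by blast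
  have r0: "z \<in> U - K \<Longrightarrow> r z = 0" for z using has_pd_zero_off[OF U cK pd(2)] p0 by blast
  have vt0: "z \<in> U - K \<Longrightarrow> vt z = 0" for z using has_pd_zero_off[OF U cK pd(3)] off by blast
  have cg: "continuous_on UNIV g" using g(1) by (intro DERIV_continuous_on) auto
  have "(LINT z|lborel. g' (fst z) * (cut K p z)\<^sup>2) \<le> (LINT z|lborel. 2 * g (fst z) * cut K r z * cut K vt z)"
  proof (rule integral_time_space_UNIV[where e=e and d=dT and v="cut K v" and K=K])
    show "has_pd e UNIV (cut K v) (cut K p)" "has_pd e UNIV (cut K p) (cut K r)" "has_pd dT UNIV (cut K v) (cut K vt)"
      by (rule has_pd_cut[OF U cK K(2)]; use pd off p0 in blast)+
    show "has_pd e UNIV (\<lambda>z. g (fst z)) (\<lambda>z. 0)" using e by (simp add: has_pd_def)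
    show "has_pd dT UNIV (\<lambda>z. g (fst z)) (\<lambda>z. g' (fst z))"
      unfolding has_pd_def
    proof
      fix z :: pt
      have "((\<lambda>s. g (s + fst z)) has_real_derivative g' (fst z)) (at 0)"
        using g(1)[of "fst z"] DERIV_shift[of g "g' (fst z)" 0 "fst z"] by simp
      then show "((\<lambda>s. g (fst (z + s *\<^sub>R dT))) has_real_derivative g' (fst z)) (at 0)"
        by (simp add: add.commute)
    qed
    show "continuous_on UNIV (cut K v)" "continuous_on UNIV (cut K p)" "continuous_on UNIV (cut K r)" "continuous_on UNIV (cut K vt)"
      by (rule continuous_on_cut[OF U cK K(2)]; use cont off p0 r0 vt0 in blast)+
    show "continuous_on UNIV (\<lambda>z::pt. g (fst z))" "continuous_on UNIV (\<lambda>z::pt. g' (fst z))"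
      by (rule continuous_on_compose2[OF cg] continuous_on_compose2[OF g(2)]; auto intro!: continuous_intros)+
  qed (use g K in \<open>auto simp: cut_def\<close>)
  moreover have "(\<lambda>z. g' (fst z) * (cut K p z)\<^sup>2) = cut K (\<lambda>z. g' (fst z) * (p z)\<^sup>2)"
    "(\<lambda>z. 2 * g (fst z) * cut K r z * cut K vt z) = cut K (\<lambda>z. 2 * g (fst z) * r z * vt z)"
    by (auto simp: cut_def)
  ultimately show ?thesis by (simp add: lint_def)
qed

section \<open>The Carleman inequality\<close>

text \<open>A function is carried along with its derivatives, as a family indexed by \<open>ix\<close>; \<open>C12 U j\<close> states that the
  members of the family \<open>j\<close> are continuous and related to each other as the indices say.\<close>

datatype ix = Jv | Jt | Jx | Jy | Jxx | Jxy | Jyy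

definition C12 :: "pt set \<Rightarrow> (ix \<Rightarrow> pt \<Rightarrow> real) \<Rightarrow> bool" where
  "C12 U j \<longleftrightarrow> has_pd dT U (j Jv) (j Jt) \<and> has_pd dX U (j Jv) (j Jx) \<and> has_pd dY U (j Jv) (j Jy) \<and>
    has_pd dX U (j Jx) (j Jxx) \<and> has_pd dY U (j Jx) (j Jxy) \<and> has_pd dX U (j Jy) (j Jxy) \<and>
    has_pd dY U (j Jy) (j Jyy) \<and> (\<forall>i. continuous_on U (j i))"

lemma C12D:
  assumes "C12 U j"
  shows "has_pd dT U (j Jv) (j Jt)" "has_pd dX U (j Jv) (j Jx)" "has_pd dY U (j Jv) (j Jy)"
    "has_pd dX U (j Jx) (j Jxx)" "has_pd dY U (j Jx) (j Jxy)" "has_pd dX U (j Jy) (j Jxy)"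
    "has_pd dY U (j Jy) (j Jyy)" "continuous_on U (j i)"
  using assms by (auto simp: C12_def)

lemma C12_zero_off:
  assumes "open U" "closed K" "C12 U j" "\<And>z. z \<in> U - K \<Longrightarrow> j Jv z = 0" "z \<in> U - K"
  shows "j i z = 0"
proof -
  note d = C12D[OF assms(3)]
  have x: "j Jx z = 0" if "z \<in> U - K" for z using has_pd_zero_off[OF assms(1,2) d(2)] assms(4) that by blast
  have y: "j Jy z = 0" if "z \<in> U - K" for z using has_pd_zero_off[OF assms(1,2) d(3)] assms(4) that by blast
  show ?thesis
    using has_pd_zero_off[OF assms(1,2) d(1)] has_pd_zero_off[OF assms(1,2) d(4)]
      has_pd_zero_off[OF assms(1,2) d(5)] has_pd_zero_off[OF assms(1,2) d(7)] x y assms(4,5) by (cases i) blast+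
qed

text \<open>With \<open>P = \<partial>\<^sub>t + \<Delta>\<close> and \<open>q = \<bar>\<nabla>f\<bar>\<^sup>2 - f\<^sub>t\<close>, \<open>e\<^sup>f P e\<^sup>-\<^sup>f = S + A\<close> where \<open>S v = \<Delta>v + q v\<close> and
  \<open>A v = v\<^sub>t - 2 \<nabla>f \<cdot> \<nabla>v - v \<Delta>f\<close>, and \<open>(S v + A v)\<^sup>2 \<ge> 2 S v (A v - m v) - m\<^sup>2 v\<^sup>2\<close> for every \<open>m\<close>.\<close>
lemma commutator_identity:
  fixes v vt vx vy vxx vxy vyy ft fx fy fxx fxy fyy ftt ftx fty N Nx Ny g g' q m qx qy qt :: real
  defines "q \<equiv> fx\<^sup>2 + fy\<^sup>2 - ft" and "m \<equiv> N - (fxx + fyy)"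
    and "qx \<equiv> 2 * fx * fxx + 2 * fy * fxy - ftx" and "qy \<equiv> 2 * fx * fxy + 2 * fy * fyy - fty" and "qt \<equiv> 2 * fx * ftx + 2 * fy * fty - ftt"
  shows "2 * (vxx + vyy + q * v) * (vt - 2 * (fx * vx + fy * vy) - (fxx+fyy) * v - m * v) - m\<^sup>2 * v\<^sup>2
   = 2 * vxx * vt + 2 * vyy * vt
    + (4 * (fxx * vx\<^sup>2 + 2 * fxy * vx * vy + fyy * vy\<^sup>2) + 2 * m * (vx\<^sup>2+vy\<^sup>2) + 2 * v * (Nx * vx+Ny * vy)
       + v\<^sup>2 * (ftt - 4 * (fx * ftx+fy * fty) + 4 * (fxx * fx\<^sup>2+2 * fxy * fx * fy+fyy * fy\<^sup>2) - 2 * m * q - m\<^sup>2))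
    + (-4 * (vxx * (fx * vx+fy * vy) + vx * (fxx * vx+fx * vxx+fxy * vy+fy * vxy)) + 2 * (fxx * (vx\<^sup>2+vy\<^sup>2) + fx * (2 * vx * vxx+2 * vy * vxy))
       - 2 * (Nx * v * vx+N * vx\<^sup>2+N * v * vxx) - 2 * (qx * fx * v\<^sup>2+q * fxx * v\<^sup>2+2 * q * fx * v * vx))
    + (-4 * (vyy * (fx * vx+fy * vy) + vy * (fxy * vx+fx * vxy+fyy * vy+fy * vyy)) + 2 * (fyy * (vx\<^sup>2+vy\<^sup>2) + fy * (2 * vx * vxy+2 * vy * vyy))
       - 2 * (Ny * v * vy+N * vy\<^sup>2+N * v * vyy) - 2 * (qy * fy * v\<^sup>2+q * fyy * v\<^sup>2+2 * q * fy * v * vy))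
    + (qt * v\<^sup>2 + 2 * q * v * vt)"
  unfolding assms by algebra

text \<open>\<open>N\<close> stands for m + \<Delta>f. In the commutator, m and \<Delta>f are
  differentiated in this combination only, so prescribing \<open>N\<close> keeps third space
  derivatives of the weight out. The nondecreasing factor \<open>g\<close> switches the estimate on
  after the initial time: the part of \<open>g'\<close> that meets |\<nabla>v|^2 has a good sign,
  and the part that meets v^2 is kept on the right.\<close>

lemma carleman:
  fixes v f :: "ix \<Rightarrow> pt \<Rightarrow> real" and ftt ftx fty N Nx Ny :: "pt \<Rightarrow> real" and g g' :: "real \<Rightarrow> real"
  assumes U: "open U" and K: "compact K" "K \<subseteq> U"
    and v: "C12 U v" "\<And>z. z \<in> U - K \<Longrightarrow> v Jv z = 0" and f: "C12 U f"
    and ft: "has_pd dT U (f Jt) ftt" "has_pd dX U (f Jt) ftx" "has_pd dY U (f Jt) fty"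
      "has_pd dT U (f Jx) ftx" "has_pd dT U (f Jy) fty"
    and cf: "continuous_on U ftt" "continuous_on U ftx" "continuous_on U fty"
    and N: "has_pd dX U N Nx" "has_pd dY U N Ny" "continuous_on U N" "continuous_on U Nx" "continuous_on U Ny"
    and g: "\<And>t. (g has_real_derivative g' t) (at t)" "continuous_on UNIV g'" "\<And>t. 0 \<le> g t" "\<And>t. 0 \<le> g' t"
  defines "q \<equiv> \<lambda>z. (f Jx z)\<^sup>2 + (f Jy z)\<^sup>2 - f Jt z"
    and "m \<equiv> \<lambda>z. N z - (f Jxx z + f Jyy z)"
  shows "lint K (\<lambda>z. g (fst z) *
      (4 * (f Jxx z * (v Jx z)\<^sup>2 + 2 * f Jxy z * v Jx z * v Jy z + f Jyy z * (v Jy z)\<^sup>2)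
       + 2 * m z * ((v Jx z)\<^sup>2 + (v Jy z)\<^sup>2) + 2 * v Jv z * (Nx z * v Jx z + Ny z * v Jy z)
       + (v Jv z)\<^sup>2 * (ftt z - 4 * (f Jx z * ftx z + f Jy z * fty z)
          + 4 * (f Jxx z * (f Jx z)\<^sup>2 + 2 * f Jxy z * f Jx z * f Jy z + f Jyy z * (f Jy z)\<^sup>2)
          - 2 * m z * q z - (m z)\<^sup>2)))
    \<le> lint K (\<lambda>z. g (fst z) * (v Jt z + v Jxx z + v Jyy z - 2 * (f Jx z * v Jx z + f Jy z * v Jy z)
          + (q z - (f Jxx z + f Jyy z)) * v Jv z)\<^sup>2)
      + lint K (\<lambda>z. g' (fst z) * (q z * (v Jv z)\<^sup>2))"
    (is "lint K ?Q \<le> lint K ?L + lint K ?G")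
proof -
  note vd = C12D[OF v(1)] and fd = C12D[OF f]
  have cg: "continuous_on UNIV g" using g(1) by (intro DERIV_continuous_on) auto
  have cg1: "continuous_on V (\<lambda>z::pt. g (fst z))" "continuous_on V (\<lambda>z::pt. g' (fst z))" for V
    by (rule continuous_on_compose2[OF cg] continuous_on_compose2[OF g(2)]; auto intro!: continuous_intros)+
  have gT: "has_pd dT U (\<lambda>z. g (fst z)) (\<lambda>z. g' (fst z))"
    unfolding has_pd_def
  proof
    fix z :: pt
    have "((\<lambda>s. g (s + fst z)) has_real_derivative g' (fst z)) (at 0)"
      using g(1)[of "fst z"] DERIV_shift[of g "g' (fst z)" 0 "fst z"] by simp
    then show "((\<lambda>s. g (fst (z + s *\<^sub>R dT))) has_real_derivative g' (fst z)) (at 0)"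
      by (simp add: add.commute)
  qed
  have gX: "has_pd dX U (\<lambda>z. g (fst z)) (\<lambda>z. 0)" "has_pd dY U (\<lambda>z. g (fst z)) (\<lambda>z. 0)"
    by (simp_all add: has_pd_def)
  define qx where "qx z = 2 * f Jx z * f Jxx z + 2 * f Jy z * f Jxy z - ftx z" for z
  define qy where "qy z = 2 * f Jx z * f Jxy z + 2 * f Jy z * f Jyy z - fty z" for z
  define qt where "qt z = 2 * f Jx z * ftx z + 2 * f Jy z * fty z - ftt z" for z
  have sq: "has_pd e V (\<lambda>z. (h z)\<^sup>2) (\<lambda>z. 2 * h z * h' z)" if "has_pd e V h h'" for e V h h'
    using has_pd_mult[OF that that] by (simp add: power2_eq_square algebra_simps has_pd_def)
  have q: "has_pd dX U q qx" "has_pd dY U q qy" "has_pd dT U q qt"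
    unfolding q_def qx_def[abs_def] qy_def[abs_def] qt_def[abs_def] by (intro has_pd_add has_pd_diff sq fd ft)+
  have cq: "continuous_on U q" "continuous_on U qx" "continuous_on U qy" "continuous_on U qt"
    unfolding q_def qx_def[abs_def] qy_def[abs_def] qt_def[abs_def] by (intro continuous_intros fd cf)+
  have cm: "continuous_on U m" unfolding m_def by (intro continuous_intros fd N)
  \<comment> \<open>\<open>F1\<close> and \<open>F2\<close> are the space components and
    \<open>F3\<close> is the time component of a flux whose divergence \<open>D1 + D2 + D3\<close>
    integrates to 0. Apart from the term with \<open>g'\<close>, this divergence accounts for
    everything in the expanded product except the quadratic form and 2 \<Delta>v v_t.\<close>
  define F1 where "F1 z = g (fst z) * (-4 * (v Jx z * (f Jx z * v Jx z + f Jy z * v Jy z))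
     + 2 * (f Jx z * ((v Jx z)\<^sup>2 + (v Jy z)\<^sup>2)) - 2 * (N z * v Jv z * v Jx z) - 2 * (q z * f Jx z * (v Jv z)\<^sup>2))" for z
  define F2 where "F2 z = g (fst z) * (-4 * (v Jy z * (f Jx z * v Jx z + f Jy z * v Jy z))
     + 2 * (f Jy z * ((v Jx z)\<^sup>2 + (v Jy z)\<^sup>2)) - 2 * (N z * v Jv z * v Jy z) - 2 * (q z * f Jy z * (v Jv z)\<^sup>2))" for z
  define F3 where "F3 z = g (fst z) * (q z * (v Jv z)\<^sup>2)" for z
  define D1 where "D1 z = g (fst z) * (-4 * (v Jxx z * (f Jx z * v Jx z + f Jy z * v Jy z)
      + v Jx z * (f Jxx z * v Jx z + f Jx z * v Jxx z + f Jxy z * v Jy z + f Jy z * v Jxy z))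
     + 2 * (f Jxx z * ((v Jx z)\<^sup>2 + (v Jy z)\<^sup>2) + f Jx z * (2 * v Jx z * v Jxx z + 2 * v Jy z * v Jxy z))
     - 2 * (Nx z * v Jv z * v Jx z + N z * (v Jx z)\<^sup>2 + N z * v Jv z * v Jxx z)
     - 2 * (qx z * f Jx z * (v Jv z)\<^sup>2 + q z * f Jxx z * (v Jv z)\<^sup>2 + 2 * q z * f Jx z * v Jv z * v Jx z))" for z
  define D2 where "D2 z = g (fst z) * (-4 * (v Jyy z * (f Jx z * v Jx z + f Jy z * v Jy z)
      + v Jy z * (f Jxy z * v Jx z + f Jx z * v Jxy z + f Jyy z * v Jy z + f Jy z * v Jyy z))
     + 2 * (f Jyy z * ((v Jx z)\<^sup>2 + (v Jy z)\<^sup>2) + f Jy z * (2 * v Jx z * v Jxy z + 2 * v Jy z * v Jyy z))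
     - 2 * (Ny z * v Jv z * v Jy z + N z * (v Jy z)\<^sup>2 + N z * v Jv z * v Jyy z)
     - 2 * (qy z * f Jy z * (v Jv z)\<^sup>2 + q z * f Jyy z * (v Jv z)\<^sup>2 + 2 * q z * f Jy z * v Jv z * v Jy z))" for z
  define D3 where "D3 z = g' (fst z) * (q z * (v Jv z)\<^sup>2) + g (fst z) * (qt z * (v Jv z)\<^sup>2 + 2 * q z * v Jv z * v Jt z)" for z
  have c: "continuous_on U F1" "continuous_on U F2" "continuous_on U F3" "continuous_on U D1" "continuous_on U D2" "continuous_on U D3"
    unfolding F1_def[abs_def] F2_def[abs_def] F3_def[abs_def] D1_def[abs_def] D2_def[abs_def] D3_def[abs_def]
    by (intro continuous_intros fd vd cq cg1 N)+
  have D1: "has_pd dX U F1 D1"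
    unfolding has_pd_def F1_def
  proof (intro ballI)
    fix z assume z: "z \<in> U"
    note h = gX(1)[THEN has_pdD, OF z] vd(2)[THEN has_pdD, OF z] vd(4)[THEN has_pdD, OF z] vd(6)[THEN has_pdD, OF z]
      fd(2)[THEN has_pdD, OF z] fd(4)[THEN has_pdD, OF z] fd(6)[THEN has_pdD, OF z] q(1)[THEN has_pdD, OF z] N(1)[THEN has_pdD, OF z]
    show "((\<lambda>s. g (fst (z + s *\<^sub>R dX)) * (-4 * (v Jx (z + s *\<^sub>R dX) * (f Jx (z + s *\<^sub>R dX) * v Jx (z + s *\<^sub>R dX) + f Jy (z + s *\<^sub>R dX) * v Jy (z + s *\<^sub>R dX)))
     + 2 * (f Jx (z + s *\<^sub>R dX) * ((v Jx (z + s *\<^sub>R dX))\<^sup>2 + (v Jy (z + s *\<^sub>R dX))\<^sup>2)) - 2 * (N (z + s *\<^sub>R dX) * v Jv (z + s *\<^sub>R dX) * v Jx (z + s *\<^sub>R dX)) - 2 * (q (z + s *\<^sub>R dX) * f Jx (z + s *\<^sub>R dX) * (v Jv (z + s *\<^sub>R dX))\<^sup>2)))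
       has_real_derivative D1 z) (at 0)"
      by (rule derivative_eq_intros h refl)+ (simp only: scaleR_zero_left add.right_neutral D1_def numeral_2_eq_2 diff_Suc_Suc diff_zero power_Suc power_0 of_nat_Suc of_nat_0, algebra)
  qed
  have D2: "has_pd dY U F2 D2"
    unfolding has_pd_def F2_def
  proof (intro ballI)
    fix z assume z: "z \<in> U"
    note h = gX(2)[THEN has_pdD, OF z] vd(3)[THEN has_pdD, OF z] vd(5)[THEN has_pdD, OF z] vd(7)[THEN has_pdD, OF z]
      fd(3)[THEN has_pdD, OF z] fd(5)[THEN has_pdD, OF z] fd(7)[THEN has_pdD, OF z] q(2)[THEN has_pdD, OF z] N(2)[THEN has_pdD, OF z]
    show "((\<lambda>s. g (fst (z + s *\<^sub>R dY)) * (-4 * (v Jy (z + s *\<^sub>R dY) * (f Jx (z + s *\<^sub>R dY) * v Jx (z + s *\<^sub>R dY) + f Jy (z + s *\<^sub>R dY) * v Jy (z + s *\<^sub>R dY)))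
     + 2 * (f Jy (z + s *\<^sub>R dY) * ((v Jx (z + s *\<^sub>R dY))\<^sup>2 + (v Jy (z + s *\<^sub>R dY))\<^sup>2)) - 2 * (N (z + s *\<^sub>R dY) * v Jv (z + s *\<^sub>R dY) * v Jy (z + s *\<^sub>R dY)) - 2 * (q (z + s *\<^sub>R dY) * f Jy (z + s *\<^sub>R dY) * (v Jv (z + s *\<^sub>R dY))\<^sup>2)))
       has_real_derivative D2 z) (at 0)"
      by (rule derivative_eq_intros h refl)+ (simp only: scaleR_zero_left add.right_neutral D2_def numeral_2_eq_2 diff_Suc_Suc diff_zero power_Suc power_0 of_nat_Suc of_nat_0, algebra)
  qed
  have D3: "has_pd dT U F3 D3"
    unfolding has_pd_def F3_def
  proof (intro ballI)
    fix z assume z: "z \<in> U"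
    note h = gT[THEN has_pdD, OF z] vd(1)[THEN has_pdD, OF z] q(3)[THEN has_pdD, OF z]
    show "((\<lambda>s. g (fst (z + s *\<^sub>R dT)) * (q (z + s *\<^sub>R dT) * (v Jv (z + s *\<^sub>R dT))\<^sup>2)) has_real_derivative D3 z) (at 0)"
      by (rule derivative_eq_intros h refl)+ (simp only: scaleR_zero_left add.right_neutral D3_def numeral_2_eq_2 diff_Suc_Suc diff_zero power_Suc power_0 of_nat_Suc of_nat_0, algebra)
  qed
  have cK: "closed K" using K(1) by (rule compact_imp_closed)
  have v0: "v i z = 0" if "z \<in> U - K" for i z using C12_zero_off[OF U cK v(1) v(2) that] by blast
  have I: "lint K D1 = 0" "lint K D2 = 0" "lint K D3 = 0"
    using lint_pd[OF U K D1 c(1,4)] lint_pd[OF U K D2 c(2,5)] lint_pd[OF U K D3 c(3,6)] v0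
    by (simp_all add: F1_def F2_def F3_def)
  have J: "lint K (\<lambda>z. g' (fst z) * (v Jx z)\<^sup>2) \<le> lint K (\<lambda>z. 2 * g (fst z) * v Jxx z * v Jt z)"
    by (rule lint_time_space[OF U K vd(2) vd(4) vd(1) _ g(1,2,3) vd(8) vd(8) vd(8) vd(8) v(2)]) auto
  have J': "lint K (\<lambda>z. g' (fst z) * (v Jy z)\<^sup>2) \<le> lint K (\<lambda>z. 2 * g (fst z) * v Jyy z * v Jt z)"
    by (rule lint_time_space[OF U K vd(3) vd(7) vd(1) _ g(1,2,3) vd(8) vd(8) vd(8) vd(8) v(2)]) auto
  have J0: "0 \<le> lint K (\<lambda>z. 2 * g (fst z) * v Jxx z * v Jt z)" "0 \<le> lint K (\<lambda>z. 2 * g (fst z) * v Jyy z * v Jt z)"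
    using J J' lint_nonneg[of K "\<lambda>z. g' (fst z) * (v Jx z)\<^sup>2"] lint_nonneg[of K "\<lambda>z. g' (fst z) * (v Jy z)\<^sup>2"] g(4)
    by (auto simp: zero_le_mult_iff)
  note cU = continuous_on_subset[OF _ K(2)]
  have cQ: "continuous_on K ?Q" by (rule cU) (intro continuous_intros fd vd cq cm cg1 N cf)
  have cL: "continuous_on K ?L" by (rule cU) (intro continuous_intros fd vd cq cg1)
  have cG: "continuous_on K ?G" by (rule cU) (intro continuous_intros vd cq cg1)
  have cA: "continuous_on K (\<lambda>z. 2 * g (fst z) * v Jxx z * v Jt z)" "continuous_on K (\<lambda>z. 2 * g (fst z) * v Jyy z * v Jt z)"
    by (rule cU, intro continuous_intros vd cg1)+
  note cD = cU[OF c(4)] cU[OF c(5)] cU[OF c(6)]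
  have pw: "(2 * g (fst z) * v Jxx z * v Jt z + 2 * g (fst z) * v Jyy z * v Jt z) + (?Q z + ((D1 z + D2 z) + D3 z)) \<le> ?L z + ?G z" for z
  proof -
    define S where "S = v Jxx z + v Jyy z + q z * v Jv z"
    define A where "A = v Jt z - 2 * (f Jx z * v Jx z + f Jy z * v Jy z) - (f Jxx z + f Jyy z) * v Jv z"
    have id: "2 * S * (A - m z * v Jv z) - (m z)\<^sup>2 * (v Jv z)\<^sup>2 = 2 * v Jxx z * v Jt z + 2 * v Jyy z * v Jt z
    + (4 * (f Jxx z * (v Jx z)\<^sup>2 + 2 * f Jxy z * v Jx z * v Jy z + f Jyy z * (v Jy z)\<^sup>2)
       + 2 * m z * ((v Jx z)\<^sup>2 + (v Jy z)\<^sup>2) + 2 * v Jv z * (Nx z * v Jx z + Ny z * v Jy z)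
       + (v Jv z)\<^sup>2 * (ftt z - 4 * (f Jx z * ftx z + f Jy z * fty z)
          + 4 * (f Jxx z * (f Jx z)\<^sup>2 + 2 * f Jxy z * f Jx z * f Jy z + f Jyy z * (f Jy z)\<^sup>2)
          - 2 * m z * q z - (m z)\<^sup>2))
    + (-4 * (v Jxx z * (f Jx z * v Jx z + f Jy z * v Jy z)
      + v Jx z * (f Jxx z * v Jx z + f Jx z * v Jxx z + f Jxy z * v Jy z + f Jy z * v Jxy z))
     + 2 * (f Jxx z * ((v Jx z)\<^sup>2 + (v Jy z)\<^sup>2) + f Jx z * (2 * v Jx z * v Jxx z + 2 * v Jy z * v Jxy z))
     - 2 * (Nx z * v Jv z * v Jx z + N z * (v Jx z)\<^sup>2 + N z * v Jv z * v Jxx z)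
     - 2 * (qx z * f Jx z * (v Jv z)\<^sup>2 + q z * f Jxx z * (v Jv z)\<^sup>2 + 2 * q z * f Jx z * v Jv z * v Jx z))
    + (-4 * (v Jyy z * (f Jx z * v Jx z + f Jy z * v Jy z)
      + v Jy z * (f Jxy z * v Jx z + f Jx z * v Jxy z + f Jyy z * v Jy z + f Jy z * v Jyy z))
     + 2 * (f Jyy z * ((v Jx z)\<^sup>2 + (v Jy z)\<^sup>2) + f Jy z * (2 * v Jx z * v Jxy z + 2 * v Jy z * v Jyy z))
     - 2 * (Ny z * v Jv z * v Jy z + N z * (v Jy z)\<^sup>2 + N z * v Jv z * v Jyy z)
     - 2 * (qy z * f Jy z * (v Jv z)\<^sup>2 + q z * f Jyy z * (v Jv z)\<^sup>2 + 2 * q z * f Jy z * v Jv z * v Jy z))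
    + (qt z * (v Jv z)\<^sup>2 + 2 * q z * v Jv z * v Jt z)"
      unfolding S_def A_def q_def m_def qx_def qy_def qt_def by (rule commutator_identity)
    \<comment> \<open>This sum of squares is exactly the difference between \<open>(S + A)^2\<close>
      and the left-hand side of \<open>id\<close>.\<close>
    have "0 \<le> (S + m z * v Jv z)\<^sup>2 + A\<^sup>2" by simp
    then have "2 * S * (A - m z * v Jv z) - (m z)\<^sup>2 * (v Jv z)\<^sup>2 \<le> (S + A)\<^sup>2"
      by (simp add: power2_eq_square algebra_simps)
    then have "g (fst z) * (2 * S * (A - m z * v Jv z) - (m z)\<^sup>2 * (v Jv z)\<^sup>2) \<le> g (fst z) * (S + A)\<^sup>2"
      using g(3) by (rule mult_left_mono)
    moreover have "g (fst z) * (S + A)\<^sup>2 = ?L z" by (simp add: S_def A_def algebra_simps)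
    ultimately show ?thesis unfolding id D1_def D2_def D3_def by (simp only: distrib_left mult.assoc mult.left_commute)
  qed
  have "lint K (\<lambda>z. 2 * g (fst z) * v Jxx z * v Jt z) + lint K (\<lambda>z. 2 * g (fst z) * v Jyy z * v Jt z)
      + (lint K ?Q + ((lint K D1 + lint K D2) + lint K D3)) \<le> lint K ?L + lint K ?G"
    by (rule lint_mono_sum[OF K(1) cA cQ cD cL cG pw])
  then show ?thesis using I J0 by linarith
qed

section \<open>A twice continuously differentiable step function\<close>

lemma DERIV_pos_part_power:
  "((\<lambda>s::real. (max 0 s) ^ Suc (Suc n)) has_real_derivative real (Suc (Suc n)) * (max 0 s) ^ Suc n) (at s)"
proof (cases "s = 0")
  case True
  have "((\<lambda>h::real. \<bar>h\<bar> ^ Suc n) \<longlongrightarrow> \<bar>0\<bar> ^ Suc n) (at 0)" by (intro tendsto_intros)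
  then have "((\<lambda>h::real. \<bar>h\<bar> ^ Suc n) \<longlongrightarrow> 0) (at 0)" by simp
  then have "((\<lambda>h::real. (max 0 h) ^ Suc (Suc n) / h) \<longlongrightarrow> 0) (at 0)"
    by (rule Lim_null_comparison[rotated]) (intro always_eventually allI, simp add: max_def abs_mult power_abs mult_nonpos_nonneg)
  then show ?thesis using True by (simp add: DERIV_def)
next
  case False
  then consider "s > 0" | "s < 0" by linarith
  then show ?thesis
  proof cases
    case 1
    have "((\<lambda>s::real. s ^ Suc (Suc n)) has_real_derivative real (Suc (Suc n)) * (max 0 s) ^ Suc n) (at s)"
      using DERIV_pow[of "Suc (Suc n)" s] 1 by simp
    then show ?thesis
      by (rule has_field_derivative_transform_within_open[of _ _ _ "{0<..}"]) (use 1 in \<open>auto simp: max_def\<close>)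
  next
    case 2
    have "((\<lambda>s::real. 0) has_real_derivative real (Suc (Suc n)) * (max 0 s) ^ Suc n) (at s)"
      using 2 by (simp add: max_def)
    then show ?thesis
      by (rule has_field_derivative_transform_within_open[of _ _ _ "{..<0}"]) (use 2 in \<open>auto simp: max_def\<close>)
  qed
qed

text \<open>The quintic p(s) = 10 s^3 - 15 s^4 + 6 s^5 rises from 0 to 1 on [0, 1], with vanishing
  first and second derivatives at both ends. It is written in truncated powers to avoid a case
  distinction: by the symmetry p(1 - r) = 1 - p(r), the polynomial exceeds 1 beyond s = 1 by 10 r^3
  + 15 r^4 + 6 r^5 with r = s - 1, and this excess is subtracted.\<close>

definition sstep :: "real \<Rightarrow> real" where
  "sstep s = 10 * (max 0 s)^3 - 15 * (max 0 s)^4 + 6 * (max 0 s)^5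
     - 10 * (max 0 (s - 1))^3 - 15 * (max 0 (s - 1))^4 - 6 * (max 0 (s - 1))^5"

definition sstep1 :: "real \<Rightarrow> real" where
  "sstep1 s = 30 * (max 0 s)^2 - 60 * (max 0 s)^3 + 30 * (max 0 s)^4
     - 30 * (max 0 (s - 1))^2 - 60 * (max 0 (s - 1))^3 - 30 * (max 0 (s - 1))^4"

definition sstep2 :: "real \<Rightarrow> real" where
  "sstep2 s = 60 * max 0 s - 180 * (max 0 s)^2 + 120 * (max 0 s)^3
     - 60 * max 0 (s - 1) - 180 * (max 0 (s - 1))^2 - 120 * (max 0 (s - 1))^3"

lemma DERIV_pos_part_power_shift:
  "((\<lambda>s::real. (max 0 (s - 1)) ^ Suc (Suc n)) has_real_derivative real (Suc (Suc n)) * (max 0 (s - 1)) ^ Suc n) (at s)"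
  using DERIV_shift[of "\<lambda>s. (max 0 s) ^ Suc (Suc n)" "real (Suc (Suc n)) * (max 0 (s - 1)) ^ Suc n" s "-1"]
    DERIV_pos_part_power[of n "s - 1"] by simp

lemma DERIV_pos_part_numeral:
  fixes s :: real assumes "2 \<le> n"
  shows "((\<lambda>s. (max 0 s) ^ n) has_real_derivative real n * (max 0 s) ^ (n - 1)) (at s)"
    "((\<lambda>s. (max 0 (s - 1)) ^ n) has_real_derivative real n * (max 0 (s - 1)) ^ (n - 1)) (at s)"
proof -
  obtain k where "n = 2 + k" using le_Suc_ex[OF assms] by blast
  then have "n = Suc (Suc k)" by simp
  then show "((\<lambda>s. (max 0 s) ^ n) has_real_derivative real n * (max 0 s) ^ (n - 1)) (at s)"
    "((\<lambda>s. (max 0 (s - 1)) ^ n) has_real_derivative real n * (max 0 (s - 1)) ^ (n - 1)) (at s)"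
    using DERIV_pos_part_power[of k s] DERIV_pos_part_power_shift[of k s] by simp_all
qed

lemma DERIV_sstep: "(sstep has_real_derivative sstep1 s) (at s)"
proof -
  have "(sstep has_real_derivative 10 * (real 3 * (max 0 s)^(3-1)) - 15 * (real 4 * (max 0 s)^(4-1)) + 6 * (real 5 * (max 0 s)^(5-1))
     - 10 * (real 3 * (max 0 (s - 1))^(3-1)) - 15 * (real 4 * (max 0 (s - 1))^(4-1)) - 6 * (real 5 * (max 0 (s - 1))^(5-1))) (at s)"
    unfolding sstep_def[abs_def] by (intro DERIV_diff DERIV_add DERIV_cmult DERIV_pos_part_numeral) simp_all
  then show ?thesis by (simp add: sstep1_def)
qed

lemma DERIV_sstep1: "(sstep1 has_real_derivative sstep2 s) (at s)"
proof -
  have "(sstep1 has_real_derivative 30 * (real 2 * (max 0 s)^(2-1)) - 60 * (real 3 * (max 0 s)^(3-1)) + 30 * (real 4 * (max 0 s)^(4-1))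
     - 30 * (real 2 * (max 0 (s - 1))^(2-1)) - 60 * (real 3 * (max 0 (s - 1))^(3-1)) - 30 * (real 4 * (max 0 (s - 1))^(4-1))) (at s)"
    unfolding sstep1_def[abs_def] by (intro DERIV_diff DERIV_add DERIV_cmult DERIV_pos_part_numeral) simp_all
  then show ?thesis by (simp add: sstep2_def)
qed

lemma continuous_sstep: "continuous_on A sstep" "continuous_on A sstep1" "continuous_on A sstep2"
  unfolding sstep_def[abs_def] sstep1_def[abs_def] sstep2_def[abs_def] by (intro continuous_intros)+

lemma sstep_le0: "s \<le> 0 \<Longrightarrow> sstep s = 0" "s \<le> 0 \<Longrightarrow> sstep1 s = 0" "s \<le> 0 \<Longrightarrow> sstep2 s = 0"
  by (simp_all add: sstep_def sstep1_def sstep2_def max_def)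

lemma sstep_ge1: assumes "1 \<le> s" shows "sstep s = 1" "sstep1 s = 0" "sstep2 s = 0"
proof -
  have m: "max 0 s = s" "max 0 (s - 1) = s - 1" using assms by auto
  show "sstep s = 1" unfolding sstep_def m power_zero_numeral by algebra
  show "sstep1 s = 0" unfolding sstep1_def m power_zero_numeral by algebra
  show "sstep2 s = 0" unfolding sstep2_def m power_zero_numeral by algebra
qed

lemma sstep_mid: assumes "0 \<le> s" "s \<le> 1"
  shows "sstep s = s^3 * (6 * s^2 - 15 * s + 10)" "1 - sstep s = (1-s)^3 * (6 * (1-s)^2 - 15 * (1-s) + 10)"
    "sstep1 s = 30 * (s * (1 - s))^2" "sstep2 s = 60 * (s * (1 - s)) * (1 - 2 * s)"
proof -
  have m: "max 0 s = s" "max 0 (s - 1) = 0" using assms by auto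
  show "sstep s = s^3 * (6 * s^2 - 15 * s + 10)" unfolding sstep_def m power_zero_numeral by algebra
  show "1 - sstep s = (1-s)^3 * (6 * (1-s)^2 - 15 * (1-s) + 10)" unfolding sstep_def m power_zero_numeral by algebra
  show "sstep1 s = 30 * (s * (1 - s))^2" unfolding sstep1_def m power_zero_numeral by algebra
  show "sstep2 s = 60 * (s * (1 - s)) * (1 - 2 * s)" unfolding sstep2_def m power_zero_numeral by algebra
qed

lemma sstep_quadratic_pos: "0 < 6 * s^2 - 15 * s + (10::real)"
proof -
  have "6 * s^2 - 15 * s + 10 = 6 * (s - 5/4)^2 + 5/8" by (simp add: power2_eq_square algebra_simps)
  then show ?thesis by (simp add: add_nonneg_pos)
qed

lemma sstep_bounds: "0 \<le> sstep s" "sstep s \<le> 1" "0 \<le> sstep1 s" "sstep1 s \<le> 60" "\<bar>sstep2 s\<bar> \<le> 60"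
proof -
  consider "s \<le> 0" | "1 \<le> s" | "0 \<le> s" "s \<le> 1" by linarith
  then have "0 \<le> sstep s \<and> sstep s \<le> 1 \<and> 0 \<le> sstep1 s \<and> sstep1 s \<le> 60 \<and> \<bar>sstep2 s\<bar> \<le> 60"
  proof cases
    case 3
    have p: "0 \<le> s * (1 - s)" "s * (1 - s) \<le> 1" using 3 by (auto simp: mult_le_one)
    have "0 \<le> 1 - sstep s" unfolding sstep_mid(2)[OF 3] using 3 sstep_quadratic_pos[of "1 - s"] by (intro mult_nonneg_nonneg) auto
    moreover have "0 \<le> sstep s" unfolding sstep_mid(1)[OF 3] using 3 sstep_quadratic_pos[of s] by (intro mult_nonneg_nonneg) auto
    moreover have "(s * (1 - s))^2 \<le> 1" using p by (simp add: power_le_one)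
    moreover have "\<bar>s * (1 - s)\<bar> * \<bar>1 - 2 * s\<bar> \<le> 1 * 1" using p 3 by (intro mult_mono) auto
    ultimately show ?thesis unfolding sstep_mid(3,4)[OF 3] by (auto simp: abs_mult)
  qed (auto simp: sstep_le0 sstep_ge1)
  then show "0 \<le> sstep s" "sstep s \<le> 1" "0 \<le> sstep1 s" "sstep1 s \<le> 60" "\<bar>sstep2 s\<bar> \<le> 60" by auto
qed

section \<open>Leibniz and chain rules for families of derivatives\<close>

definition jmul :: "(ix \<Rightarrow> pt \<Rightarrow> real) \<Rightarrow> (ix \<Rightarrow> pt \<Rightarrow> real) \<Rightarrow> ix \<Rightarrow> pt \<Rightarrow> real" where
  "jmul a b i z = (case i of Jv \<Rightarrow> a Jv z * b Jv z
     | Jt \<Rightarrow> a Jt z * b Jv z + a Jv z * b Jt z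
     | Jx \<Rightarrow> a Jx z * b Jv z + a Jv z * b Jx z
     | Jy \<Rightarrow> a Jy z * b Jv z + a Jv z * b Jy z
     | Jxx \<Rightarrow> a Jxx z * b Jv z + 2 * (a Jx z * b Jx z) + a Jv z * b Jxx z
     | Jxy \<Rightarrow> a Jxy z * b Jv z + a Jx z * b Jy z + a Jy z * b Jx z + a Jv z * b Jxy z
     | Jyy \<Rightarrow> a Jyy z * b Jv z + 2 * (a Jy z * b Jy z) + a Jv z * b Jyy z)"

lemma jmul_simps:
  "jmul a b Jv z = a Jv z * b Jv z"
  "jmul a b Jt z = a Jt z * b Jv z + a Jv z * b Jt z"
  "jmul a b Jx z = a Jx z * b Jv z + a Jv z * b Jx z"
  "jmul a b Jy z = a Jy z * b Jv z + a Jv z * b Jy z"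
  "jmul a b Jxx z = a Jxx z * b Jv z + 2 * (a Jx z * b Jx z) + a Jv z * b Jxx z"
  "jmul a b Jxy z = a Jxy z * b Jv z + a Jx z * b Jy z + a Jy z * b Jx z + a Jv z * b Jxy z"
  "jmul a b Jyy z = a Jyy z * b Jv z + 2 * (a Jy z * b Jy z) + a Jv z * b Jyy z"
  by (simp_all add: jmul_def)

definition jcomp :: "(real \<Rightarrow> real) \<Rightarrow> (real \<Rightarrow> real) \<Rightarrow> (real \<Rightarrow> real) \<Rightarrow> (ix \<Rightarrow> pt \<Rightarrow> real) \<Rightarrow> ix \<Rightarrow> pt \<Rightarrow> real" where
  "jcomp F F1 F2 a i z = (case i of Jv \<Rightarrow> F (a Jv z)
     | Jt \<Rightarrow> F1 (a Jv z) * a Jt z | Jx \<Rightarrow> F1 (a Jv z) * a Jx z | Jy \<Rightarrow> F1 (a Jv z) * a Jy z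
     | Jxx \<Rightarrow> F2 (a Jv z) * (a Jx z)\<^sup>2 + F1 (a Jv z) * a Jxx z
     | Jxy \<Rightarrow> F2 (a Jv z) * (a Jx z * a Jy z) + F1 (a Jv z) * a Jxy z
     | Jyy \<Rightarrow> F2 (a Jv z) * (a Jy z)\<^sup>2 + F1 (a Jv z) * a Jyy z)"

lemma jcomp_simps:
  "jcomp F F1 F2 a Jv z = F (a Jv z)"
  "jcomp F F1 F2 a Jt z = F1 (a Jv z) * a Jt z"
  "jcomp F F1 F2 a Jx z = F1 (a Jv z) * a Jx z"
  "jcomp F F1 F2 a Jy z = F1 (a Jv z) * a Jy z"
  "jcomp F F1 F2 a Jxx z = F2 (a Jv z) * (a Jx z)\<^sup>2 + F1 (a Jv z) * a Jxx z"
  "jcomp F F1 F2 a Jxy z = F2 (a Jv z) * (a Jx z * a Jy z) + F1 (a Jv z) * a Jxy z"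
  "jcomp F F1 F2 a Jyy z = F2 (a Jv z) * (a Jy z)\<^sup>2 + F1 (a Jv z) * a Jyy z"
  by (simp_all add: jcomp_def)

lemma has_pd_eqI: "has_pd e U f f' \<Longrightarrow> (\<And>z. f' z = g' z) \<Longrightarrow> has_pd e U f g'"
  by (simp add: has_pd_def)

lemma C12_jmul:
  assumes "C12 U a" "C12 U b" shows "C12 U (jmul a b)"
proof -
  note d = C12D[OF assms(1)] C12D[OF assms(2)]
  have c: "continuous_on U (jmul a b i)" for i
    by (cases i; simp only: jmul_simps[abs_def]; intro continuous_intros d)
  have e: "jmul a b Jv = (\<lambda>z. a Jv z * b Jv z)" "jmul a b Jx = (\<lambda>z. a Jx z * b Jv z + a Jv z * b Jx z)"
    "jmul a b Jy = (\<lambda>z. a Jy z * b Jv z + a Jv z * b Jy z)"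
    by (auto simp: jmul_simps)
  show ?thesis unfolding C12_def
    by (intro conjI allI c; unfold e; rule has_pd_eqI, (rule has_pd_add has_pd_mult d)+, simp add: jmul_simps)
qed

lemma C12_jcomp:
  assumes F: "\<And>r. (F has_real_derivative F1 r) (at r)" "\<And>r. (F1 has_real_derivative F2 r) (at r)" "continuous_on UNIV F2"
    and "C12 U a" shows "C12 U (jcomp F F1 F2 a)"
proof -
  note d = C12D[OF assms(4)]
  have c0: "continuous_on UNIV F" "continuous_on UNIV F1" using F by (auto intro!: DERIV_continuous_on)
  have cc: "continuous_on U (\<lambda>z. G (a Jv z))" if "continuous_on UNIV G" for G :: "real \<Rightarrow> real"
    by (rule continuous_on_compose2[OF that d(8)]) auto
  have c: "continuous_on U (jcomp F F1 F2 a i)" for i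
    by (cases i; simp only: jcomp_simps[abs_def]; intro continuous_intros d cc c0 F)
  have e: "jcomp F F1 F2 a Jv = (\<lambda>z. F (a Jv z))" "jcomp F F1 F2 a Jx = (\<lambda>z. F1 (a Jv z) * a Jx z)"
    "jcomp F F1 F2 a Jy = (\<lambda>z. F1 (a Jv z) * a Jy z)"
    by (auto simp: jcomp_simps)
  show ?thesis unfolding C12_def
    by (intro conjI allI c; unfold e; rule has_pd_eqI, (rule has_pd_mult has_pd_comp d F)+, simp add: jcomp_simps power2_eq_square)
qed

section \<open>Cut-offs and the differential inequality\<close>

definition heat :: "(ix \<Rightarrow> pt \<Rightarrow> real) \<Rightarrow> pt \<Rightarrow> real" where "heat j z = j Jt z + j Jxx z + j Jyy z"
definition gsq :: "(ix \<Rightarrow> pt \<Rightarrow> real) \<Rightarrow> pt \<Rightarrow> real" where "gsq j z = (j Jx z)\<^sup>2 + (j Jy z)\<^sup>2"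

lemma gsq_nonneg [simp]: "0 \<le> gsq j z" by (simp add: gsq_def)

lemma continuous_gsq: "C12 U j \<Longrightarrow> continuous_on U (gsq j)"
  unfolding gsq_def[abs_def] by (intro continuous_intros) (auto dest: C12D)

lemma continuous_heat: "C12 U j \<Longrightarrow> continuous_on U (heat j)"
  unfolding heat_def[abs_def] by (intro continuous_intros) (auto dest: C12D)

text \<open>A bound for what a cut-off \<open>X\<close> adds to the differential inequality:
  \<open>u\<close> times the heat operator of \<open>X\<close>, the cross term 2 \<nabla>u \<cdot>
  \<nabla>X, and the contribution of \<open>C\<close> that appears when X \<nabla>u is replaced by
  \<nabla>(u X). It vanishes wherever \<open>X\<close> is locally constant.\<close>

definition cuterr :: "real \<Rightarrow> (ix \<Rightarrow> pt \<Rightarrow> real) \<Rightarrow> (ix \<Rightarrow> pt \<Rightarrow> real) \<Rightarrow> pt \<Rightarrow> real" where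
  "cuterr C u X z = \<bar>u Jv z\<bar> * (\<bar>heat X z\<bar> + C * (\<bar>X Jx z\<bar> + \<bar>X Jy z\<bar>)) + 2 * (\<bar>X Jx z\<bar> + \<bar>X Jy z\<bar>) * sqrt (gsq u z)"

lemma C12_exp: "C12 U f \<Longrightarrow> C12 U (jcomp exp exp exp f)"
  by (intro C12_jcomp) (auto intro: DERIV_exp continuous_intros)

lemma sq_sum3_le: "(a + b + c)\<^sup>2 \<le> 3 * (a\<^sup>2 + b\<^sup>2 + c\<^sup>2)" for a b c :: real
proof -
  have "0 \<le> (a - b)\<^sup>2 + (b - c)\<^sup>2 + (a - c)\<^sup>2" by simp
  then show ?thesis by (simp add: power2_eq_square algebra_simps)
qed

lemma sq_sum2_le: "(a + b)\<^sup>2 \<le> 2 * (a\<^sup>2 + b\<^sup>2)" for a b :: real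
proof -
  have "0 \<le> (a - b)\<^sup>2" by simp
  then show ?thesis by (simp add: power2_eq_square algebra_simps)
qed

lemma abs_dot2_le: "\<bar>a * c + b * d\<bar> \<le> (\<bar>a\<bar> + \<bar>b\<bar>) * sqrt (c\<^sup>2 + d\<^sup>2)" for a b c d :: real
proof -
  have "\<bar>c\<bar> \<le> sqrt (c\<^sup>2 + d\<^sup>2)" "\<bar>d\<bar> \<le> sqrt (c\<^sup>2 + d\<^sup>2)"
    by (auto intro: real_le_rsqrt)
  then have "\<bar>a\<bar> * \<bar>c\<bar> + \<bar>b\<bar> * \<bar>d\<bar> \<le> \<bar>a\<bar> * sqrt (c\<^sup>2 + d\<^sup>2) + \<bar>b\<bar> * sqrt (c\<^sup>2 + d\<^sup>2)"
    by (intro add_mono mult_left_mono) auto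
  then show ?thesis using abs_triangle_ineq[of "a * c" "b * d"] by (simp add: abs_mult algebra_simps)
qed

lemma sqrt_triangle2: "sqrt ((a + c)\<^sup>2 + (b + d)\<^sup>2) \<le> sqrt (a\<^sup>2 + b\<^sup>2) + sqrt (c\<^sup>2 + d\<^sup>2)" for a b c d :: real
  by (rule real_sqrt_sum_squares_triangle_ineq)

lemma sqrt_sum_sq_le: "sqrt (a\<^sup>2 + b\<^sup>2) \<le> \<bar>a\<bar> + \<bar>b\<bar>" for a b :: real
  by (rule sqrt_sum_squares_le_sum_abs)

lemma heat_cutoff_le:
  assumes eq: "\<bar>heat u z\<bar> \<le> C * (\<bar>u Jv z\<bar> + sqrt (gsq u z))" and C: "0 \<le> C"
  shows "\<bar>heat (jmul u X) z\<bar> \<le> C * (\<bar>jmul u X Jv z\<bar> + sqrt (gsq (jmul u X) z)) + cuterr C u X z"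
proof -
  have abs3: "\<bar>a + 2 * b + c\<bar> \<le> \<bar>a\<bar> + 2 * \<bar>b\<bar> + \<bar>c\<bar>" for a b c :: real by linarith
  define s where "s = \<bar>X Jx z\<bar> + \<bar>X Jy z\<bar>"
  define G where "G = sqrt (gsq (jmul u X) z)"
  have "\<bar>X Jv z\<bar> * sqrt (gsq u z) = sqrt ((X Jv z * u Jx z)\<^sup>2 + (X Jv z * u Jy z)\<^sup>2)"
    by (simp add: gsq_def power_mult_distrib distrib_left[symmetric] real_sqrt_mult)
  also have "\<dots> = sqrt ((jmul u X Jx z + (- u Jv z * X Jx z))\<^sup>2 + (jmul u X Jy z + (- u Jv z * X Jy z))\<^sup>2)"
    by (simp add: jmul_simps mult.commute)
  also have "\<dots> \<le> G + sqrt ((- u Jv z * X Jx z)\<^sup>2 + (- u Jv z * X Jy z)\<^sup>2)"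
    unfolding G_def gsq_def by (rule sqrt_triangle2)
  also have "sqrt ((- u Jv z * X Jx z)\<^sup>2 + (- u Jv z * X Jy z)\<^sup>2) \<le> \<bar>u Jv z\<bar> * s"
    using sqrt_sum_sq_le[of "- u Jv z * X Jx z" "- u Jv z * X Jy z"] by (simp add: s_def abs_mult distrib_left)
  finally have 1: "\<bar>X Jv z\<bar> * sqrt (gsq u z) \<le> G + \<bar>u Jv z\<bar> * s" by simp
  have 2: "\<bar>u Jx z * X Jx z + u Jy z * X Jy z\<bar> \<le> s * sqrt (gsq u z)"
    using abs_dot2_le[of "X Jx z" "u Jx z" "X Jy z" "u Jy z"] by (simp add: s_def gsq_def mult.commute)
  have "heat (jmul u X) z = X Jv z * heat u z + 2 * (u Jx z * X Jx z + u Jy z * X Jy z) + u Jv z * heat X z"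
    unfolding heat_def jmul_simps by algebra
  then have "\<bar>heat (jmul u X) z\<bar> \<le> \<bar>X Jv z\<bar> * \<bar>heat u z\<bar> + 2 * \<bar>u Jx z * X Jx z + u Jy z * X Jy z\<bar> + \<bar>u Jv z\<bar> * \<bar>heat X z\<bar>"
    using abs3[of "X Jv z * heat u z" "u Jx z * X Jx z + u Jy z * X Jy z" "u Jv z * heat X z"] by (simp add: abs_mult)
  also have "\<dots> \<le> \<bar>X Jv z\<bar> * (C * (\<bar>u Jv z\<bar> + sqrt (gsq u z))) + 2 * (s * sqrt (gsq u z)) + \<bar>u Jv z\<bar> * \<bar>heat X z\<bar>"
    using eq 2 by (intro add_mono mult_left_mono) auto
  also have "\<bar>X Jv z\<bar> * (C * (\<bar>u Jv z\<bar> + sqrt (gsq u z))) = C * (\<bar>jmul u X Jv z\<bar> + \<bar>X Jv z\<bar> * sqrt (gsq u z))"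
    by (simp add: jmul_simps abs_mult algebra_simps)
  also have "\<dots> \<le> C * (\<bar>jmul u X Jv z\<bar> + (G + \<bar>u Jv z\<bar> * s))"
    using 1 C by (intro mult_left_mono add_left_mono) auto
  finally show ?thesis by (simp add: cuterr_def G_def s_def algebra_simps)
qed

text \<open>The Carleman inequality is applied to v = e^f u X. The coefficient
  \<open>6 * C\<^sup>2\<close> is the cost of the differential inequality: a factor 2 for splitting
  off the cut-off error and a factor 3 for the sum |v| + |\<nabla>v| + |\<nabla>f| |v|. The
  additional 1 is what is left after absorption, and one more factor 2 is lost in passing from v
  back to u X.\<close>

lemma carleman_cutoff:
  fixes u X f :: "ix \<Rightarrow> pt \<Rightarrow> real" and ftt ftx fty N Nx Ny :: "pt \<Rightarrow> real" and g g' :: "real \<Rightarrow> real"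
  assumes U: "open U" and K: "compact K" "K \<subseteq> U"
    and u: "C12 U u" and X: "C12 U X" "\<And>z. z \<in> U - K \<Longrightarrow> X Jv z = 0" and f: "C12 U f"
    and ft: "has_pd dT U (f Jt) ftt" "has_pd dX U (f Jt) ftx" "has_pd dY U (f Jt) fty"
      "has_pd dT U (f Jx) ftx" "has_pd dT U (f Jy) fty"
    and cf: "continuous_on U ftt" "continuous_on U ftx" "continuous_on U fty"
    and N: "has_pd dX U N Nx" "has_pd dY U N Ny" "continuous_on U N" "continuous_on U Nx" "continuous_on U Ny"
    and g: "\<And>t. (g has_real_derivative g' t) (at t)" "continuous_on UNIV g'" "\<And>t. 0 \<le> g t" "\<And>t. 0 \<le> g' t"
    and eq: "\<And>z. z \<in> K \<Longrightarrow> \<bar>heat u z\<bar> \<le> C * (\<bar>u Jv z\<bar> + sqrt (gsq u z))" and C: "0 \<le> C"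
    and pos: "\<And>z a b c. z \<in> K \<Longrightarrow> (6 * C\<^sup>2 + 1) * (a\<^sup>2 + b\<^sup>2 + (1 + gsq f z) * c\<^sup>2)
      \<le> 4 * (f Jxx z * a\<^sup>2 + 2 * f Jxy z * a * b + f Jyy z * b\<^sup>2)
        + 2 * (N z - (f Jxx z + f Jyy z)) * (a\<^sup>2 + b\<^sup>2) + 2 * c * (Nx z * a + Ny z * b)
        + c\<^sup>2 * (ftt z - 4 * (f Jx z * ftx z + f Jy z * fty z)
          + 4 * (f Jxx z * (f Jx z)\<^sup>2 + 2 * f Jxy z * f Jx z * f Jy z + f Jyy z * (f Jy z)\<^sup>2)
          - 2 * (N z - (f Jxx z + f Jyy z)) * (gsq f z - f Jt z) - (N z - (f Jxx z + f Jyy z))\<^sup>2)"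
  shows "lint K (\<lambda>z. g (fst z) * (exp (2 * f Jv z) * ((jmul u X Jv z)\<^sup>2 + gsq (jmul u X) z)))
    \<le> 4 * lint K (\<lambda>z. g (fst z) * (exp (2 * f Jv z) * (cuterr C u X z)\<^sup>2))
      + 2 * lint K (\<lambda>z. g' (fst z) * (\<bar>gsq f z - f Jt z\<bar> * (exp (2 * f Jv z) * (jmul u X Jv z)\<^sup>2)))"
    (is "lint K ?W \<le> 4 * lint K ?E + 2 * lint K ?G")
proof -
  define w where "w = jmul u X"
  define v where "v = jmul (jcomp exp exp exp f) w"
  have wC: "C12 U w" unfolding w_def by (intro C12_jmul u X)
  have vC: "C12 U v" unfolding v_def by (intro C12_jmul C12_exp f wC)
  have v0: "v Jv z = 0" if "z \<in> U - K" for z using X(2)[OF that] by (simp add: v_def w_def jmul_simps)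
  define q where "q z = (f Jx z)\<^sup>2 + (f Jy z)\<^sup>2 - f Jt z" for z
  have qg: "gsq f z - f Jt z = q z" for z by (simp add: q_def gsq_def)
  define Q where "Q z = g (fst z) *
      (4 * (f Jxx z * (v Jx z)\<^sup>2 + 2 * f Jxy z * v Jx z * v Jy z + f Jyy z * (v Jy z)\<^sup>2)
       + 2 * (N z - (f Jxx z + f Jyy z)) * ((v Jx z)\<^sup>2 + (v Jy z)\<^sup>2) + 2 * v Jv z * (Nx z * v Jx z + Ny z * v Jy z)
       + (v Jv z)\<^sup>2 * (ftt z - 4 * (f Jx z * ftx z + f Jy z * fty z)
          + 4 * (f Jxx z * (f Jx z)\<^sup>2 + 2 * f Jxy z * f Jx z * f Jy z + f Jyy z * (f Jy z)\<^sup>2)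
          - 2 * (N z - (f Jxx z + f Jyy z)) * q z - (N z - (f Jxx z + f Jyy z))\<^sup>2))" for z
  define L where "L z = g (fst z) * (v Jt z + v Jxx z + v Jyy z - 2 * (f Jx z * v Jx z + f Jy z * v Jy z)
          + (q z - (f Jxx z + f Jyy z)) * v Jv z)\<^sup>2" for z
  define Gq where "Gq z = g' (fst z) * (q z * (v Jv z)\<^sup>2)" for z
  define R where "R z = (v Jx z)\<^sup>2 + (v Jy z)\<^sup>2 + (1 + gsq f z) * (v Jv z)\<^sup>2" for z
  define gR where "gR z = g (fst z) * R z" for z
  have main: "lint K Q \<le> lint K L + lint K Gq"
    unfolding Q_def[abs_def] L_def[abs_def] Gq_def[abs_def] q_def
    by (rule carleman[OF U K vC v0 f ft cf N g])
  note vd = C12D[OF vC] and fd = C12D[OF f] and wd = C12D[OF wC] and ud = C12D[OF u] and Xd = C12D[OF X(1)]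
  have cg: "continuous_on UNIV g" using g(1) by (intro DERIV_continuous_on) auto
  have cg1: "continuous_on V (\<lambda>z::pt. g (fst z))" "continuous_on V (\<lambda>z::pt. g' (fst z))" for V
    by (rule continuous_on_compose2[OF cg] continuous_on_compose2[OF g(2)]; auto intro!: continuous_intros)+
  have cq: "continuous_on U q" unfolding q_def[abs_def] by (intro continuous_intros fd)
  note cU = continuous_on_subset[OF _ K(2)]
  have cQ: "continuous_on K Q" unfolding Q_def[abs_def] by (rule cU) (intro continuous_intros fd vd cq cg1 N cf)
  have cL: "continuous_on K L" unfolding L_def[abs_def] by (rule cU) (intro continuous_intros fd vd cq cg1)
  have cG: "continuous_on K Gq" unfolding Gq_def[abs_def] by (rule cU) (intro continuous_intros vd cq cg1)
  have cR: "continuous_on K gR" unfolding gR_def[abs_def] R_def[abs_def] by (rule cU) (intro continuous_intros vd fd cg1 continuous_gsq f)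
  have cE: "continuous_on K ?E" unfolding cuterr_def by (rule cU) (intro continuous_intros vd fd cg1 continuous_gsq continuous_heat f u X ud Xd)
  have cW: "continuous_on K ?W" unfolding w_def[symmetric] by (rule cU) (intro continuous_intros wd fd cg1 continuous_gsq wC)
  have cG2: "continuous_on K ?G" unfolding w_def[symmetric] qg by (rule cU) (intro continuous_intros wd fd cg1 cq)
  define B where "B = 6 * C\<^sup>2 + 1"
  have 1: "B * lint K gR \<le> lint K Q"
    unfolding lint_cmult[symmetric]
  proof (rule lint_mono[OF K(1) _ cQ])
    show "continuous_on K (\<lambda>z. B * gR z)" by (intro continuous_intros cR)
    fix z assume z: "z \<in> K"
    have "g (fst z) * (B * R z) \<le> Q z" unfolding Q_def R_def B_def
      by (rule mult_left_mono[OF _ g(3)]) (use pos[OF z, of "v Jx z" "v Jy z" "v Jv z"] in \<open>simp add: qg\<close>)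
    then show "B * gR z \<le> Q z" by (simp add: gR_def mult.left_commute)
  qed
  have vw: "v Jv z = exp (f Jv z) * w Jv z" "v Jx z = exp (f Jv z) * (w Jx z + f Jx z * w Jv z)"
    "v Jy z = exp (f Jv z) * (w Jy z + f Jy z * w Jv z)" for z
    by (simp_all add: v_def jmul_simps[where a="jcomp exp exp exp f"] jcomp_simps algebra_simps)
  have expsq: "exp (2 * r) = (exp r)\<^sup>2" for r :: real by (simp add: exp_double)
  have grad: "exp (f Jv z) * sqrt (gsq w z) \<le> sqrt ((v Jx z)\<^sup>2 + (v Jy z)\<^sup>2) + sqrt (gsq f z) * \<bar>v Jv z\<bar>" for z
  proof -
    have "exp (f Jv z) * sqrt (gsq w z) = sqrt ((v Jx z + (- f Jx z * v Jv z))\<^sup>2 + (v Jy z + (- f Jy z * v Jv z))\<^sup>2)"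
      unfolding vw gsq_def
      by (rule real_sqrt_unique[symmetric]) (auto simp: power_mult_distrib algebra_simps power2_eq_square)
    also have "\<dots> \<le> sqrt ((v Jx z)\<^sup>2 + (v Jy z)\<^sup>2) + sqrt ((- f Jx z * v Jv z)\<^sup>2 + (- f Jy z * v Jv z)\<^sup>2)"
      by (rule sqrt_triangle2)
    also have "sqrt ((- f Jx z * v Jv z)\<^sup>2 + (- f Jy z * v Jv z)\<^sup>2) = sqrt (gsq f z) * \<bar>v Jv z\<bar>"
      by (simp add: gsq_def power_mult_distrib distrib_right[symmetric] real_sqrt_mult)
    finally show ?thesis .
  qed
  have gradsq: "exp (2 * f Jv z) * ((w Jv z)\<^sup>2 + gsq w z) \<le> 2 * R z" for z
  proof -
    have "(exp (f Jv z) * sqrt (gsq w z))\<^sup>2 \<le> (sqrt ((v Jx z)\<^sup>2 + (v Jy z)\<^sup>2) + sqrt (gsq f z) * \<bar>v Jv z\<bar>)\<^sup>2"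
      by (rule power_mono[OF grad]) auto
    also have "\<dots> \<le> 2 * ((sqrt ((v Jx z)\<^sup>2 + (v Jy z)\<^sup>2))\<^sup>2 + (sqrt (gsq f z) * \<bar>v Jv z\<bar>)\<^sup>2)" by (rule sq_sum2_le)
    finally have "exp (2 * f Jv z) * gsq w z \<le> 2 * ((v Jx z)\<^sup>2 + (v Jy z)\<^sup>2) + 2 * gsq f z * (v Jv z)\<^sup>2"
      by (simp add: power_mult_distrib expsq)
    moreover have "exp (2 * f Jv z) * (w Jv z)\<^sup>2 = (v Jv z)\<^sup>2" by (simp add: vw expsq power_mult_distrib)
    moreover have "0 \<le> (v Jv z)\<^sup>2" by simp
    ultimately show ?thesis unfolding R_def distrib_left distrib_right mult_1_left mult.assoc by linarith
  qed
  have 2: "lint K L \<le> lint K (\<lambda>z. 6 * C\<^sup>2 * gR z + 2 * ?E z)"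
  proof (rule lint_mono[OF K(1) cL])
    show "continuous_on K (\<lambda>z. 6 * C\<^sup>2 * gR z + 2 * ?E z)" by (intro continuous_on_add continuous_on_mult continuous_on_const cR cE)
    fix z assume z: "z \<in> K"
    \<comment> \<open>The conjugation is undone: the operator acting on v = e^f w is e^f times the
      heat operator of \<open>w\<close>.\<close>
    have id: "v Jt z + v Jxx z + v Jyy z - 2 * (f Jx z * v Jx z + f Jy z * v Jy z)
          + (q z - (f Jxx z + f Jyy z)) * v Jv z = exp (f Jv z) * heat w z"
      by (simp only: v_def jmul_simps[where a="jcomp exp exp exp f"] jcomp_simps q_def heat_def) algebra
    have "\<bar>exp (f Jv z) * heat w z\<bar> \<le> exp (f Jv z) * (C * (\<bar>w Jv z\<bar> + sqrt (gsq w z)) + cuterr C u X z)"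
      using heat_cutoff_le[OF eq[OF z] C, of X] unfolding w_def by (simp add: abs_mult)
    also have "\<dots> = C * (\<bar>v Jv z\<bar> + exp (f Jv z) * sqrt (gsq w z)) + exp (f Jv z) * cuterr C u X z"
      by (simp add: vw abs_mult algebra_simps)
    also have "\<dots> \<le> C * (\<bar>v Jv z\<bar> + (sqrt ((v Jx z)\<^sup>2 + (v Jy z)\<^sup>2) + sqrt (gsq f z) * \<bar>v Jv z\<bar>)) + exp (f Jv z) * cuterr C u X z"
      using C grad[of z] by (intro add_right_mono mult_left_mono add_left_mono) auto
    finally have "\<bar>exp (f Jv z) * heat w z\<bar>\<^sup>2 \<le> (C * (\<bar>v Jv z\<bar> + sqrt ((v Jx z)\<^sup>2 + (v Jy z)\<^sup>2) + sqrt (gsq f z) * \<bar>v Jv z\<bar>) + exp (f Jv z) * cuterr C u X z)\<^sup>2"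
      by (intro power_mono) (auto simp: add.assoc)
    also have "\<dots> \<le> 2 * ((C * (\<bar>v Jv z\<bar> + sqrt ((v Jx z)\<^sup>2 + (v Jy z)\<^sup>2) + sqrt (gsq f z) * \<bar>v Jv z\<bar>))\<^sup>2 + (exp (f Jv z) * cuterr C u X z)\<^sup>2)"
      by (rule sq_sum2_le)
    also have "(C * (\<bar>v Jv z\<bar> + sqrt ((v Jx z)\<^sup>2 + (v Jy z)\<^sup>2) + sqrt (gsq f z) * \<bar>v Jv z\<bar>))\<^sup>2
       \<le> C\<^sup>2 * (3 * (\<bar>v Jv z\<bar>\<^sup>2 + (sqrt ((v Jx z)\<^sup>2 + (v Jy z)\<^sup>2))\<^sup>2 + (sqrt (gsq f z) * \<bar>v Jv z\<bar>)\<^sup>2))"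
      unfolding power_mult_distrib[of C] by (intro mult_left_mono sq_sum3_le) auto
    also have "\<bar>v Jv z\<bar>\<^sup>2 + (sqrt ((v Jx z)\<^sup>2 + (v Jy z)\<^sup>2))\<^sup>2 + (sqrt (gsq f z) * \<bar>v Jv z\<bar>)\<^sup>2 = R z"
      by (simp add: R_def power_mult_distrib algebra_simps)
    finally have "\<bar>exp (f Jv z) * heat w z\<bar>\<^sup>2 \<le> 6 * C\<^sup>2 * R z + 2 * (exp (2 * f Jv z) * (cuterr C u X z)\<^sup>2)"
      by (simp add: power_mult_distrib expsq)
    then have "g (fst z) * \<bar>exp (f Jv z) * heat w z\<bar>\<^sup>2 \<le> g (fst z) * (6 * C\<^sup>2 * R z + 2 * (exp (2 * f Jv z) * (cuterr C u X z)\<^sup>2))"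
      using g(3) by (rule mult_left_mono)
    then show "L z \<le> 6 * C\<^sup>2 * gR z + 2 * ?E z" unfolding L_def id gR_def
      by (simp only: power2_abs distrib_left mult.assoc mult.left_commute)
  qed
  have 3: "lint K (\<lambda>z. 6 * C\<^sup>2 * gR z + 2 * ?E z) = 6 * C\<^sup>2 * lint K gR + 2 * lint K ?E"
    by (subst lint_add[OF K(1)]) (intro continuous_on_mult continuous_on_const cR cE lint_cmult | simp only: lint_cmult)+
  have 4: "lint K Gq \<le> lint K ?G"
  proof (rule lint_mono[OF K(1) cG cG2])
    fix z
    have "exp (2 * f Jv z) * (w Jv z)\<^sup>2 = (v Jv z)\<^sup>2" by (simp add: vw expsq power_mult_distrib)
    then show "Gq z \<le> ?G z" unfolding Gq_def qg w_def[symmetric] using g(4)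
      by (auto intro!: mult_left_mono mult_right_mono)
  qed
  have "lint K ?W \<le> 2 * lint K gR"
    unfolding lint_cmult[symmetric]
  proof (rule lint_mono[OF K(1) cW])
    show "continuous_on K (\<lambda>z. 2 * gR z)" by (intro continuous_intros cR)
    show "?W z \<le> 2 * gR z" for z
      using mult_left_mono[OF gradsq[of z] g(3)[of "fst z"]] unfolding w_def[symmetric] gR_def by (simp add: mult.left_commute)
  qed
  moreover have "lint K gR \<le> 2 * lint K ?E + lint K ?G"
    using main 1 2 4 unfolding 3 B_def by (simp add: distrib_right)
  ultimately show ?thesis by linarith
qed

section \<open>Time cut-offs and the initial layer\<close>

definition jtime :: "(real \<Rightarrow> real) \<Rightarrow> (real \<Rightarrow> real) \<Rightarrow> ix \<Rightarrow> pt \<Rightarrow> real" where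
  "jtime g g' i z = (case i of Jv \<Rightarrow> g (fst z) | Jt \<Rightarrow> g' (fst z) | _ \<Rightarrow> 0)"

lemma jtime_simps: "jtime g g' Jv z = g (fst z)" "jtime g g' Jt z = g' (fst z)" "jtime g g' Jx z = 0" "jtime g g' Jy z = 0"
   "jtime g g' Jxx z = 0" "jtime g g' Jxy z = 0" "jtime g g' Jyy z = 0"
  by (simp_all add: jtime_def)

lemma has_pd_time:
  assumes "\<And>t. t \<in> fst ` U \<Longrightarrow> (g has_real_derivative g' t) (at t)"
  shows "has_pd dT U (\<lambda>z. g (fst z)) (\<lambda>z. g' (fst z))"
  unfolding has_pd_def
proof
  fix z :: pt assume "z \<in> U"
  then have "((\<lambda>s. g (s + fst z)) has_real_derivative g' (fst z)) (at 0)"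
    using assms[of "fst z"] DERIV_shift[of g "g' (fst z)" 0 "fst z"] by simp
  then show "((\<lambda>s. g (fst (z + s *\<^sub>R dT))) has_real_derivative g' (fst z)) (at 0)"
    by (simp add: add.commute)
qed

lemma C12_jtime:
  assumes g: "\<And>t. (g has_real_derivative g' t) (at t)" "continuous_on UNIV g'"
  shows "C12 U (jtime g g')"
proof -
  have cg: "continuous_on UNIV g" using g(1) by (intro DERIV_continuous_on) auto
  have c: "continuous_on U (jtime g g' i)" for i
    by (cases i; simp only: jtime_simps[abs_def]; (intro continuous_on_const)?;
      (rule continuous_on_compose2[OF cg] continuous_on_compose2[OF g(2)])?; auto intro!: continuous_intros)
  have e: "jtime g g' Jv = (\<lambda>z. g (fst z))" "jtime g g' Jx = (\<lambda>z. 0)" "jtime g g' Jy = (\<lambda>z. 0)"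
    by (auto simp: jtime_simps)
  show ?thesis unfolding C12_def
    by (intro conjI allI c; unfold e; (rule has_pd_eqI[OF has_pd_time[where g'=g']], use g in \<open>simp add: jtime_simps\<close>, simp add: jtime_simps)?;
      (rule has_pd_eqI[OF has_pd_const], simp add: jtime_simps)?; simp add: has_pd_def jtime_simps)
qed

definition ramp :: "real \<Rightarrow> real \<Rightarrow> real \<Rightarrow> real" where "ramp a d t = sstep ((t - a) / d)"
definition ramp1 :: "real \<Rightarrow> real \<Rightarrow> real \<Rightarrow> real" where "ramp1 a d t = sstep1 ((t - a) / d) / d"

lemma DERIV_ramp: "(ramp a d has_real_derivative ramp1 a d t) (at t)"
proof -
  have "((\<lambda>t. (t - a) / d) has_real_derivative 1 / d) (at t)"
    by (rule DERIV_cdivide) (auto intro!: derivative_eq_intros)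
  from DERIV_chain2[OF DERIV_sstep this] show ?thesis by (simp add: ramp_def[abs_def] ramp1_def)
qed

lemma continuous_ramp1: "continuous_on A (ramp1 a d)"
proof -
  have "continuous_on A (\<lambda>t. sstep1 ((t - a) * inverse d) * inverse d)"
    by (intro continuous_intros continuous_on_compose2[OF continuous_sstep(2)[of UNIV]]) auto
  then show ?thesis by (simp add: ramp1_def[abs_def] divide_inverse)
qed

lemma ramp_bounds:
  assumes "0 < d"
  shows "0 \<le> ramp a d t" "ramp a d t \<le> 1" "0 \<le> ramp1 a d t" "ramp1 a d t \<le> 60 / d"
  using assms sstep_bounds by (auto simp: ramp_def ramp1_def divide_right_mono)

lemma ramp_eq: assumes "0 < d"
  shows "t \<le> a \<Longrightarrow> ramp a d t = 0" "t \<le> a \<Longrightarrow> ramp1 a d t = 0"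
    "a + d \<le> t \<Longrightarrow> ramp a d t = 1" "a + d \<le> t \<Longrightarrow> ramp1 a d t = 0"
  using assms sstep_le0[of "(t - a) / d"] sstep_ge1[of "(t - a) / d"]
  by (simp_all add: ramp_def ramp1_def divide_nonpos_pos le_divide_eq)

text \<open>\<open>K\<close> may approach time 0, where \<open>u\<close> tends to 0 without a rate
  and its derivatives are not controlled. A time cut-off inside \<open>X\<close> would enter
  squared, as 1/r^2 on a layer of thickness r, which cannot be compensated without a rate. The
  factor \<open>g\<close> enters linearly, and 1/r times r stays bounded. Hence \<open>X\<close> is
  multiplied by a ramp \<open>th\<close> on [r/2, r], which merely produces compact support, while
  \<open>g\<close> vanishes up to time r and rises on [r, 2 r], where \<open>th\<close> is already
  1. In the limit the initial time leaves no contribution.\<close>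

lemma carleman_initial:
  fixes u X f :: "ix \<Rightarrow> pt \<Rightarrow> real" and ftt ftx fty N Nx Ny :: "pt \<Rightarrow> real"
  assumes U: "open U" and K: "\<And>e. 0 < e \<Longrightarrow> compact (K \<inter> {z. e \<le> fst z})" "K \<subseteq> U" "\<And>z. z \<in> K \<Longrightarrow> 0 < fst z"
      "\<And>z. z \<in> K \<Longrightarrow> snd z \<in> cbox c1 c2"
    and u: "C12 U u" and X: "C12 U X" "\<And>z. z \<in> U - K \<Longrightarrow> X Jv z = 0" "\<And>z. z \<in> U \<Longrightarrow> \<bar>X Jv z\<bar> \<le> 1" and f: "C12 U f"
    and ft: "has_pd dT U (f Jt) ftt" "has_pd dX U (f Jt) ftx" "has_pd dY U (f Jt) fty"
      "has_pd dT U (f Jx) ftx" "has_pd dT U (f Jy) fty"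
    and cf: "continuous_on U ftt" "continuous_on U ftx" "continuous_on U fty"
    and N: "has_pd dX U N Nx" "has_pd dY U N Ny" "continuous_on U N" "continuous_on U Nx" "continuous_on U Ny"
    and eq: "\<And>z. z \<in> K \<Longrightarrow> \<bar>heat u z\<bar> \<le> C * (\<bar>u Jv z\<bar> + sqrt (gsq u z))" and C: "0 \<le> C"
    and pos: "\<And>z a b c. z \<in> K \<Longrightarrow> (6 * C\<^sup>2 + 1) * (a\<^sup>2 + b\<^sup>2 + (1 + gsq f z) * c\<^sup>2)
      \<le> 4 * (f Jxx z * a\<^sup>2 + 2 * f Jxy z * a * b + f Jyy z * b\<^sup>2)
        + 2 * (N z - (f Jxx z + f Jyy z)) * (a\<^sup>2 + b\<^sup>2) + 2 * c * (Nx z * a + Ny z * b)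
        + c\<^sup>2 * (ftt z - 4 * (f Jx z * ftx z + f Jy z * fty z)
          + 4 * (f Jxx z * (f Jx z)\<^sup>2 + 2 * f Jxy z * f Jx z * f Jy z + f Jyy z * (f Jy z)\<^sup>2)
          - 2 * (N z - (f Jxx z + f Jyy z)) * (gsq f z - f Jt z) - (N z - (f Jxx z + f Jyy z))\<^sup>2)"
    and q: "\<And>z. z \<in> K \<Longrightarrow> \<bar>gsq f z - f Jt z\<bar> * exp (2 * f Jv z) \<le> Bq"
    and u0: "\<And>e. 0 < e \<Longrightarrow> \<exists>d>0. \<forall>z\<in>K. fst z < d \<longrightarrow> \<bar>u Jv z\<bar> \<le> e"
    and Err: "\<And>e. 0 < e \<Longrightarrow> lint (K \<inter> {z. e \<le> fst z}) (\<lambda>z. exp (2 * f Jv z) * (cuterr C u X z)\<^sup>2) \<le> Err"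
    and e0: "0 < e0"
  shows "lint (K \<inter> {z. e0 \<le> fst z}) (\<lambda>z. exp (2 * f Jv z) * ((jmul u X Jv z)\<^sup>2 + gsq (jmul u X) z)) \<le> 4 * Err"
proof (rule field_le_epsilon)
  fix eta :: real assume eta: "0 < eta"
  define V where "V = measure lborel (cbox c1 c2)"
  define Bq' where "Bq' = max Bq 0"
  \<comment> \<open>In the initial layer \<open>60 / r\<close> bounds \<open>g'\<close>,
    \<open>Bq'\<close> bounds the weight factor, and \<open>r * V\<close> is the volume, so that r
    cancels. With |u| \<le> \<open>e\<close> for the \<open>e\<close> chosen below, the layer
    contributes at most \<open>eta / 2\<close>.\<close>
  define M where "M = 120 * Bq' * V + 1"
  have M: "0 < M" by (simp add: M_def V_def Bq'_def add_nonneg_pos)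
  define e where "e = sqrt (eta / M)"
  have e: "0 < e" "e\<^sup>2 = eta / M" using eta M by (auto simp: e_def)
  obtain d where d: "0 < d" "\<And>z. z \<in> K \<Longrightarrow> fst z < d \<Longrightarrow> \<bar>u Jv z\<bar> \<le> e" using u0[OF e(1)] by blast
  \<comment> \<open>The layer [r, 2 r] has to lie in the time span on which |u| \<le>
    \<open>e\<close>, and must end before \<open>e0\<close>, from where on \<open>g\<close> is to be
    1.\<close>
  define r where "r = min e0 d / 3"
  have r: "0 < r" "2 * r < d" "2 * r \<le> e0" using d e0 by (auto simp: r_def min_def)
  define th where "th = jtime (ramp (r/2) (r/2)) (ramp1 (r/2) (r/2))"
  define X' where "X' = jmul X th"
  define g where "g = ramp r r"
  define g' where "g' = ramp1 r r"
  define K' where "K' = K \<inter> {z. r/2 \<le> fst z}"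
  have cK': "compact K'" using K(1)[of "r/2"] r by (simp add: K'_def)
  have K'U: "K' \<subseteq> U" using K(2) by (auto simp: K'_def)
  have th: "C12 U th" unfolding th_def by (intro C12_jtime DERIV_ramp continuous_ramp1)
  have X'C: "C12 U X'" unfolding X'_def by (intro C12_jmul X th)
  have X'0: "X' Jv z = 0" if "z \<in> U - K'" for z
  proof (cases "z \<in> K")
    case True
    then have "fst z \<le> r/2" using that by (auto simp: K'_def)
    then show ?thesis using ramp_eq(1)[of "r/2" "fst z" "r/2"] r by (simp add: X'_def th_def jmul_simps jtime_simps)
  qed (use that X(2) in \<open>simp add: X'_def jmul_simps\<close>)
  have th1: "X' i z = X i z" if "r \<le> fst z" for i z
    using ramp_eq(3,4)[of "r/2" "r/2" "fst z"] that r
    by (cases i) (simp_all add: X'_def th_def jmul_simps jtime_simps)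
  have gb: "0 \<le> g t" "g t \<le> 1" "0 \<le> g' t" "g' t \<le> 60 / r" for t using ramp_bounds[OF r(1)] by (auto simp: g_def g'_def)
  have g: "(g has_real_derivative g' t) (at t)" "continuous_on UNIV g'" for t
    unfolding g_def g'_def by (rule DERIV_ramp continuous_ramp1)+
  have cg: "continuous_on UNIV g" using g(1) by (intro DERIV_continuous_on) auto
  have cg1: "continuous_on S (\<lambda>z::pt. g (fst z))" "continuous_on S (\<lambda>z::pt. g' (fst z))" for S
    by (rule continuous_on_compose2[OF cg] continuous_on_compose2[OF g(2)]; auto intro!: continuous_intros)+
  note wC = C12_jmul[OF u X(1)] and wC' = C12_jmul[OF u X'C]
  note wd = C12D[OF wC] and wd' = C12D[OF wC'] and fd = C12D[OF f] and ud = C12D[OF u] and Xd = C12D[OF X(1)] and Xd' = C12D[OF X'C]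
  note cU = continuous_on_subset[OF _ K'U]
  have main: "lint K' (\<lambda>z. g (fst z) * (exp (2 * f Jv z) * ((jmul u X' Jv z)\<^sup>2 + gsq (jmul u X') z)))
    \<le> 4 * lint K' (\<lambda>z. g (fst z) * (exp (2 * f Jv z) * (cuterr C u X' z)\<^sup>2))
      + 2 * lint K' (\<lambda>z. g' (fst z) * (\<bar>gsq f z - f Jt z\<bar> * (exp (2 * f Jv z) * (jmul u X' Jv z)\<^sup>2)))"
    (is "lint K' ?W \<le> 4 * lint K' ?E + 2 * lint K' ?G")
    by (rule carleman_cutoff[OF U cK' K'U u X'C X'0 f ft cf N g gb(1,3) eq C pos]) (auto simp: K'_def)
  have cW: "continuous_on K' ?W" by (rule cU) (intro continuous_intros wd' fd cg1 continuous_gsq wC')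
  have cE: "continuous_on K' ?E" unfolding cuterr_def by (rule cU) (intro continuous_intros fd cg1 continuous_gsq continuous_heat f u X'C ud Xd')
  have cG: "continuous_on K' ?G" by (rule cU) (intro continuous_intros wd' fd cg1 continuous_gsq f)
  have cE1: "continuous_on K' (\<lambda>z. exp (2 * f Jv z) * (cuterr C u X z)\<^sup>2)"
    unfolding cuterr_def by (rule cU) (intro continuous_intros fd cg1 continuous_gsq continuous_heat f u X ud Xd)
  have Ke0: "K \<inter> {z. e0 \<le> fst z} \<subseteq> K'" using r by (auto simp: K'_def)
  have W: "lint (K \<inter> {z. e0 \<le> fst z}) (\<lambda>z. exp (2 * f Jv z) * ((jmul u X Jv z)\<^sup>2 + gsq (jmul u X) z)) \<le> lint K' ?W"
  proof (rule lint_mono_sets[OF K(1)[OF e0] _ cK' cW])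
    show "continuous_on (K \<inter> {z. e0 \<le> fst z}) (\<lambda>z. exp (2 * f Jv z) * ((jmul u X Jv z)\<^sup>2 + gsq (jmul u X) z))"
      by (rule continuous_on_subset[of U]) (use K(2) in \<open>auto intro!: continuous_intros wd fd continuous_gsq wC\<close>)
    show "z \<in> K' \<and> exp (2 * f Jv z) * ((jmul u X Jv z)\<^sup>2 + gsq (jmul u X) z) \<le> ?W z" if "z \<in> K \<inter> {z. e0 \<le> fst z}" for z
    proof -
      have z: "2 * r \<le> fst z" "z \<in> K'" using that r Ke0 by auto
      have "jmul u X' i z = jmul u X i z" for i using z r by (cases i) (simp_all add: jmul_simps th1)
      moreover have "g (fst z) = 1" using ramp_eq(3)[of r r "fst z"] z r by (simp add: g_def)
      ultimately show ?thesis using z by (simp add: gsq_def)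
    qed
  qed (use gb in auto)
  have E: "lint K' ?E \<le> Err"
  proof -
    have "lint K' ?E \<le> lint K' (\<lambda>z. exp (2 * f Jv z) * (cuterr C u X z)\<^sup>2)"
    proof (rule lint_mono[OF cK' cE cE1])
      show "?E z \<le> exp (2 * f Jv z) * (cuterr C u X z)\<^sup>2" for z
      proof (cases "r \<le> fst z")
        case True
        then have "cuterr C u X' z = cuterr C u X z" by (simp add: cuterr_def heat_def th1)
        then show ?thesis using gb[of "fst z"] mult_right_mono[of "g (fst z)" 1 "exp (2 * f Jv z) * (cuterr C u X z)\<^sup>2"] by simp
      next
        case False
        then have "g (fst z) = 0" using ramp_eq(1)[of r "fst z" r] r by (simp add: g_def)
        then show ?thesis by simp
      qed
    qed
    also have "\<dots> \<le> Err" using Err[of "r/2"] r by (simp add: K'_def)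
    finally show ?thesis .
  qed
  have G: "lint K' ?G \<le> eta / 2"
  proof -
    define Q where "Q = cbox (r, c1) (2 * r, c2)"
    have "lint K' ?G \<le> lint Q (\<lambda>z. 60 / r * (Bq' * e\<^sup>2))"
      unfolding lint_def
    proof (rule integral_mono)
      show "integrable lborel (cut K' ?G)" by (rule integrable_cut[OF cK' cG])
      show "integrable lborel (cut Q (\<lambda>z. 60 / r * (Bq' * e\<^sup>2)))" by (rule integrable_cut) (auto simp: Q_def)
      fix z
      have nn: "0 \<le> 60 / r * (Bq' * e\<^sup>2)" using r by (simp add: Bq'_def)
      show "cut K' ?G z \<le> cut Q (\<lambda>z. 60 / r * (Bq' * e\<^sup>2)) z"
      proof (cases "z \<in> K' \<and> r < fst z \<and> fst z < 2 * r")
        case True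
        then have z: "z \<in> K" "z \<in> Q" "fst z < d" using K(4)[of z] r
          by (cases z; auto simp: K'_def Q_def cbox_Pair_eq)+
        have "\<bar>jmul u X' Jv z\<bar> \<le> e"
        proof -
          have "\<bar>u Jv z\<bar> \<le> e" using d(2) z by blast
          moreover have "\<bar>X Jv z\<bar> \<le> 1" using X(3) z K(2) by blast
          ultimately have "\<bar>u Jv z\<bar> * \<bar>X Jv z\<bar> \<le> e * 1" by (intro mult_mono) auto
          then show ?thesis using th1[of z Jv] True by (simp add: jmul_simps abs_mult)
        qed
        then have "(jmul u X' Jv z)\<^sup>2 \<le> e\<^sup>2" using power_mono[of "\<bar>jmul u X' Jv z\<bar>" e 2] by simp
        moreover have "\<bar>gsq f z - f Jt z\<bar> * exp (2 * f Jv z) \<le> Bq'" using q[OF z(1)] by (simp add: Bq'_def)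
        ultimately have "(\<bar>gsq f z - f Jt z\<bar> * exp (2 * f Jv z)) * (jmul u X' Jv z)\<^sup>2 \<le> Bq' * e\<^sup>2"
          by (intro mult_mono) (auto simp: Bq'_def)
        then have "g' (fst z) * ((\<bar>gsq f z - f Jt z\<bar> * exp (2 * f Jv z)) * (jmul u X' Jv z)\<^sup>2) \<le> 60 / r * (Bq' * e\<^sup>2)"
          using gb[of "fst z"] r by - (rule mult_mono, auto simp: Bq'_def)
        then show ?thesis using True z by (simp add: cut_def mult.assoc)
      next
        case False
        then have "z \<notin> K' \<or> g' (fst z) = 0"
          using ramp_eq(2,4)[of r "fst z" r] ramp_eq(4)[of r r "fst z"] r by (auto simp: g'_def not_less)
        then show ?thesis using nn by (auto simp: cut_def)
      qed
    qed
    also have "\<dots> = 60 / r * (Bq' * e\<^sup>2) * measure lborel Q" unfolding Q_def by (subst lint_const) auto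
    also have "measure lborel Q = r * V" using r by (simp add: Q_def V_def content_Pair content_real)
    also have "60 / r * (Bq' * e\<^sup>2) * (r * V) = (60 * Bq' * V) * e\<^sup>2" using r by simp
    also have "\<dots> \<le> (M / 2) * e\<^sup>2" by (intro mult_right_mono) (auto simp: M_def)
    also have "\<dots> = eta / 2" using e M by simp
    finally show ?thesis .
  qed
  show "lint (K \<inter> {z. e0 \<le> fst z}) (\<lambda>z. exp (2 * f Jv z) * ((jmul u X Jv z)\<^sup>2 + gsq (jmul u X) z)) \<le> 4 * Err + eta"
    using W main E G by linarith
qed

section \<open>The local energy estimate\<close>

lemma young_quarter: "\<bar>a * b\<bar> \<le> a\<^sup>2 / 4 + b\<^sup>2" for a b :: real
proof -
  have "0 \<le> (\<bar>a\<bar> / 2 - \<bar>b\<bar>)\<^sup>2" by simp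
  then show ?thesis by (simp add: power2_eq_square abs_mult algebra_simps)
qed

text \<open>The equation is tested with X^2 u. As it is a backward equation, the term with the time
  derivative of \<open>X\<close> has a good sign where the cut-off increases. Therefore
  \<open>G\<close> bounds - X X_t from above only, and a cut-off that rises after time 0 is free of
  charge.\<close>

lemma caccioppoli:
  assumes U: "open U" and K: "compact K" "K \<subseteq> U"
    and u: "C12 U u" and X: "C12 U X" "\<And>z. z \<in> U - K \<Longrightarrow> X Jv z = 0" "\<And>z. z \<in> K \<Longrightarrow> \<bar>X Jv z\<bar> \<le> 1"
    and eq: "\<And>z. z \<in> K \<Longrightarrow> \<bar>heat u z\<bar> \<le> C * (\<bar>u Jv z\<bar> + sqrt (gsq u z))" and C: "0 \<le> C"
    and G: "\<And>z. z \<in> K \<Longrightarrow> - (X Jv z * X Jt z) \<le> G" and G2: "\<And>z. z \<in> K \<Longrightarrow> (\<bar>X Jx z\<bar> + \<bar>X Jy z\<bar>)\<^sup>2 \<le> G2"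
  shows "lint K (\<lambda>z. (X Jv z)\<^sup>2 * gsq u z) \<le> 2 * (C + C\<^sup>2 + 4 * G2 + G) * lint K (\<lambda>z. (u Jv z)\<^sup>2)"
proof -
  note ud = C12D[OF u] and Xd = C12D[OF X(1)]
  define F1 where "F1 z = (X Jv z)\<^sup>2 * (u Jv z * u Jx z)" for z
  define F2 where "F2 z = (X Jv z)\<^sup>2 * (u Jv z * u Jy z)" for z
  define F3 where "F3 z = (X Jv z)\<^sup>2 * (u Jv z)\<^sup>2" for z
  define D1 where "D1 z = 2 * X Jv z * X Jx z * (u Jv z * u Jx z) + (X Jv z)\<^sup>2 * (u Jx z * u Jx z + u Jv z * u Jxx z)" for z
  define D2 where "D2 z = 2 * X Jv z * X Jy z * (u Jv z * u Jy z) + (X Jv z)\<^sup>2 * (u Jy z * u Jy z + u Jv z * u Jyy z)" for z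
  define D3 where "D3 z = 2 * X Jv z * X Jt z * (u Jv z)\<^sup>2 + (X Jv z)\<^sup>2 * (2 * u Jv z * u Jt z)" for z
  have sq: "has_pd e V (\<lambda>z. (h z)\<^sup>2) (\<lambda>z. 2 * h z * h' z)" if "has_pd e V h h'" for e V h h'
    using has_pd_mult[OF that that] by (simp add: power2_eq_square algebra_simps has_pd_def)
  have pd: "has_pd dX U F1 D1" "has_pd dY U F2 D2" "has_pd dT U F3 D3"
    unfolding F1_def[abs_def] F2_def[abs_def] F3_def[abs_def] D1_def[abs_def] D2_def[abs_def] D3_def[abs_def]
    by (intro has_pd_mult sq ud Xd)+
  have c: "continuous_on U F1" "continuous_on U F2" "continuous_on U F3" "continuous_on U D1" "continuous_on U D2" "continuous_on U D3"
    unfolding F1_def[abs_def] F2_def[abs_def] F3_def[abs_def] D1_def[abs_def] D2_def[abs_def] D3_def[abs_def]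
    by (intro continuous_intros ud Xd)+
  have I: "lint K D1 = 0" "lint K D2 = 0" "lint K D3 = 0"
    using lint_pd[OF U K pd(1) c(1,4)] lint_pd[OF U K pd(2) c(2,5)] lint_pd[OF U K pd(3) c(3,6)] X(2)
    by (simp_all add: F1_def F2_def F3_def)
  note cU = continuous_on_subset[OF _ K(2)]
  define A where "A = C + C\<^sup>2 + 4 * G2 + G"
  have cu: "continuous_on K (\<lambda>z. (u Jv z)\<^sup>2)" by (rule cU) (intro continuous_intros ud)
  have cg: "continuous_on K (\<lambda>z. (X Jv z)\<^sup>2 * gsq u z)" by (rule cU) (intro continuous_intros Xd continuous_gsq u)
  have pw: "(X Jv z)\<^sup>2 * gsq u z \<le> 2 * A * (u Jv z)\<^sup>2 + (2 * D1 z + (2 * D2 z + D3 z))" if z: "z \<in> K" for z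
  proof -
    define x where "x = X Jv z" define s where "s = sqrt (gsq u z)"
    define p where "p = \<bar>X Jx z\<bar> + \<bar>X Jy z\<bar>" define a where "a = \<bar>u Jv z\<bar>"
    have s2: "s\<^sup>2 = gsq u z" by (simp add: s_def)
    have x1: "x\<^sup>2 \<le> 1" using power_mono[OF X(3)[OF z], of 2] by (simp add: x_def)
    have id: "2 * D1 z + (2 * D2 z + D3 z) = 2 * (x\<^sup>2 * gsq u z) + 2 * (x\<^sup>2 * (u Jv z * heat u z))
       + 4 * (x * (u Jv z * (X Jx z * u Jx z + X Jy z * u Jy z))) + 2 * (x * X Jt z * a\<^sup>2)"
      unfolding D1_def D2_def D3_def heat_def gsq_def x_def a_def power2_abs by algebra
    \<comment> \<open>With the weight 1/4 in this estimate and in the next one, the absorbed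
      gradient terms amount to exactly one half of the gradient term in \<open>id\<close>.\<close>
    have 1: "\<bar>x\<^sup>2 * (u Jv z * heat u z)\<bar> \<le> C * a\<^sup>2 + (x\<^sup>2 * s\<^sup>2 / 4 + C\<^sup>2 * a\<^sup>2)"
    proof -
      have "\<bar>x\<^sup>2 * (u Jv z * heat u z)\<bar> \<le> x\<^sup>2 * (a * (C * (a + s)))"
        using eq[OF z] by (simp add: abs_mult a_def s_def mult_left_mono)
      also have "\<dots> = x\<^sup>2 * (C * a\<^sup>2 + s * (C * a))" by (simp add: power2_eq_square algebra_simps)
      also have "\<dots> \<le> x\<^sup>2 * (C * a\<^sup>2 + (s\<^sup>2 / 4 + (C * a)\<^sup>2))"
        using young_quarter[of s "C * a"] by (intro mult_left_mono add_left_mono) auto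
      also have "\<dots> = x\<^sup>2 * s\<^sup>2 / 4 + x\<^sup>2 * (C * a\<^sup>2 + C\<^sup>2 * a\<^sup>2)" by (simp add: algebra_simps power_mult_distrib)
      also have "x\<^sup>2 * (C * a\<^sup>2 + C\<^sup>2 * a\<^sup>2) \<le> 1 * (C * a\<^sup>2 + C\<^sup>2 * a\<^sup>2)"
        using x1 C by (intro mult_right_mono) auto
      finally show ?thesis by simp
    qed
    have 2: "\<bar>2 * (x * (u Jv z * (X Jx z * u Jx z + X Jy z * u Jy z)))\<bar> \<le> x\<^sup>2 * s\<^sup>2 / 4 + 4 * (G2 * a\<^sup>2)"
    proof -
      have "\<bar>2 * (x * (u Jv z * (X Jx z * u Jx z + X Jy z * u Jy z)))\<bar> \<le> 2 * (\<bar>x\<bar> * (a * (p * s)))"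
        using abs_dot2_le[of "X Jx z" "u Jx z" "X Jy z" "u Jy z"]
        by (simp add: abs_mult a_def p_def s_def gsq_def mult_left_mono)
      also have "\<dots> \<le> (x * s)\<^sup>2 / 4 + (2 * (p * a))\<^sup>2"
        using young_quarter[of "\<bar>x\<bar> * s" "2 * (p * a)"] by (simp add: power_mult_distrib algebra_simps)
      also have "(2 * (p * a))\<^sup>2 = 4 * (p\<^sup>2 * a\<^sup>2)" by (simp add: power_mult_distrib)
      also have "p\<^sup>2 * a\<^sup>2 \<le> G2 * a\<^sup>2" using G2[OF z] by (intro mult_right_mono) (auto simp: p_def)
      finally show ?thesis by (simp add: power_mult_distrib)
    qed
    have 3: "- (x * X Jt z * a\<^sup>2) \<le> G * a\<^sup>2"
      using mult_right_mono[OF G[OF z], of "a\<^sup>2"] by (simp add: x_def)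
    have "a\<^sup>2 = (u Jv z)\<^sup>2" by (simp add: a_def)
    then show ?thesis using 1 2 3 unfolding id s2[symmetric] A_def x_def[symmetric] by (simp add: algebra_simps abs_le_iff)
  qed
  have "lint K (\<lambda>z. (X Jv z)\<^sup>2 * gsq u z) \<le> lint K (\<lambda>z. 2 * A * (u Jv z)\<^sup>2 + (2 * D1 z + (2 * D2 z + D3 z)))"
    by (rule lint_mono[OF K(1) cg _ pw]) (intro continuous_on_add continuous_on_mult continuous_on_const cu cU c)
  also have "\<dots> = 2 * A * lint K (\<lambda>z. (u Jv z)\<^sup>2) + (2 * lint K D1 + (2 * lint K D2 + lint K D3))"
    by (simp only: lint_cmult[symmetric], subst lint_add[OF K(1)], (intro continuous_on_add continuous_on_mult continuous_on_const cu cU c)+,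
        subst lint_add[OF K(1)], (intro continuous_on_add continuous_on_mult continuous_on_const cu cU c)+,
        subst lint_add[OF K(1)], (intro continuous_on_add continuous_on_mult continuous_on_const cu cU c)+, rule refl)
  finally show ?thesis using I by (simp add: A_def)
qed

section \<open>Cut-offs in balls\<close>

definition jrho :: "real^2 \<Rightarrow> ix \<Rightarrow> pt \<Rightarrow> real" where
  "jrho c i z = (case i of Jv \<Rightarrow> (norm (snd z - c))\<^sup>2 | Jt \<Rightarrow> 0 | Jx \<Rightarrow> 2 * (snd z $ 1 - c $ 1) | Jy \<Rightarrow> 2 * (snd z $ 2 - c $ 2)
     | Jxx \<Rightarrow> 2 | Jxy \<Rightarrow> 0 | Jyy \<Rightarrow> 2)"

lemma jrho_simps: "jrho c Jv z = (norm (snd z - c))\<^sup>2" "jrho c Jt z = 0" "jrho c Jx z = 2 * (snd z $ 1 - c $ 1)"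
  "jrho c Jy z = 2 * (snd z $ 2 - c $ 2)" "jrho c Jxx z = 2" "jrho c Jxy z = 0" "jrho c Jyy z = 2"
  by (simp_all add: jrho_def)

lemma norm2_sq: "(norm (x :: real^2))\<^sup>2 = (x $ 1)\<^sup>2 + (x $ 2)\<^sup>2"
  by (simp add: norm_vec_def L2_set_def sum_2)

lemma axis_12 [simp]: "(axis 1 1 :: real^2) $ 1 = 1" "(axis 1 1 :: real^2) $ 2 = 0"
    "(axis 2 1 :: real^2) $ 1 = 0" "(axis 2 1 :: real^2) $ 2 = 1"
  by (simp_all add: axis_def)

lemma C12_jrho: "C12 U (jrho c)"
proof -
  have c: "continuous_on U (jrho c i)" for i
    by (cases i; simp only: jrho_simps[abs_def]; intro continuous_intros)
  have e: "jrho c Jv = (\<lambda>z. (snd z $ 1 - c $ 1)\<^sup>2 + (snd z $ 2 - c $ 2)\<^sup>2)" "jrho c Jx = (\<lambda>z. 2 * (snd z $ 1 - c $ 1))"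
    "jrho c Jy = (\<lambda>z. 2 * (snd z $ 2 - c $ 2))"
    by (auto simp: jrho_simps norm2_sq)
  show ?thesis unfolding C12_def
    by (intro conjI allI c; unfold e; simp add: has_pd_def jrho_simps;
       intro allI impI ballI; (rule derivative_eq_intros refl | simp)+)
qed

definition ramp2 :: "real \<Rightarrow> real \<Rightarrow> real \<Rightarrow> real" where "ramp2 a d t = sstep2 ((t - a) / d) / d\<^sup>2"

lemma DERIV_ramp1: "(ramp1 a d has_real_derivative ramp2 a d t) (at t)"
proof -
  have "((\<lambda>t. (t - a) / d) has_real_derivative 1 / d) (at t)"
    by (rule DERIV_cdivide) (auto intro!: derivative_eq_intros)
  from DERIV_cdivide[OF DERIV_chain2[OF DERIV_sstep1 this], of d] show ?thesis
    by (simp add: ramp1_def[abs_def] ramp2_def power2_eq_square)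
qed

lemma continuous_ramp2: "continuous_on A (ramp2 a d)"
proof -
  have "continuous_on A (\<lambda>t. sstep2 ((t - a) * inverse d) * inverse (d\<^sup>2))"
    by (intro continuous_intros continuous_on_compose2[OF continuous_sstep(3)[of UNIV]]) auto
  then show ?thesis by (simp add: ramp2_def[abs_def] divide_inverse)
qed

lemma ramp2_bound: "\<bar>ramp2 a d t\<bar> \<le> 60 / d\<^sup>2"
  using sstep_bounds(5) by (auto simp: ramp2_def divide_right_mono abs_divide)

lemma ramp2_eq: assumes "0 < d" shows "t \<le> a \<Longrightarrow> ramp2 a d t = 0" "a + d \<le> t \<Longrightarrow> ramp2 a d t = 0"
  using assms sstep_le0[of "(t - a) / d"] sstep_ge1[of "(t - a) / d"]
  by (simp_all add: ramp2_def divide_nonpos_pos le_divide_eq)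

definition jup :: "real \<Rightarrow> real \<Rightarrow> (ix \<Rightarrow> pt \<Rightarrow> real) \<Rightarrow> ix \<Rightarrow> pt \<Rightarrow> real" where
  "jup a d = jcomp (ramp a d) (ramp1 a d) (ramp2 a d)"

definition jdown :: "real \<Rightarrow> real \<Rightarrow> (ix \<Rightarrow> pt \<Rightarrow> real) \<Rightarrow> ix \<Rightarrow> pt \<Rightarrow> real" where
  "jdown a d = jcomp (\<lambda>t. 1 - ramp a d t) (\<lambda>t. - ramp1 a d t) (\<lambda>t. - ramp2 a d t)"

lemma C12_jup: "C12 U j \<Longrightarrow> C12 U (jup a d j)"
  unfolding jup_def by (intro C12_jcomp DERIV_ramp DERIV_ramp1 continuous_ramp2)

lemma C12_jdown: "C12 U j \<Longrightarrow> C12 U (jdown a d j)"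
  unfolding jdown_def
  by (intro C12_jcomp DERIV_minus DERIV_ramp1 continuous_intros continuous_ramp2)
    (use DERIV_diff[OF DERIV_const DERIV_ramp] in simp)

definition jt :: "ix \<Rightarrow> pt \<Rightarrow> real" where "jt = jtime (\<lambda>t. t) (\<lambda>t. 1)"

lemma C12_jt: "C12 U jt" unfolding jt_def by (rule C12_jtime) auto

lemma jt_simps: "jt Jv z = fst z" "jt Jt z = 1" "jt Jx z = 0" "jt Jy z = 0" "jt Jxx z = 0" "jt Jxy z = 0" "jt Jyy z = 0"
  by (simp_all add: jt_def jtime_simps)

lemma cball_in_box: "x \<in> cball c r \<Longrightarrow> x \<in> cbox (\<chi> i. c $ i - r) (\<chi> i. c $ i + r)" for x c :: "real^2"
proof -
  assume "x \<in> cball c r"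
  then have "\<bar>(x - c) $ i\<bar> \<le> r" for i
    using component_le_norm_cart[of "x - c" i] by (simp add: dist_norm norm_minus_commute)
  then show ?thesis by (simp add: mem_box_cart abs_le_iff)
    (smt (verit) vector_minus_component)
qed

lemma measure_box:
  assumes "0 \<le> r" "a \<le> b"
  shows "measure lborel (cbox (a, \<chi> i. c $ i - r) (b, (\<chi> i. c $ i + r) :: real^2)) = (b - a) * (4 * r\<^sup>2)"
proof -
  have "cbox (\<chi> i. c $ i - r) ((\<chi> i. c $ i + r) :: real^2) \<noteq> {}"
    using cball_in_box[of c c r] assms by force
  then have "measure lborel (cbox (\<chi> i. c $ i - r) ((\<chi> i. c $ i + r) :: real^2)) = 4 * r\<^sup>2"
    by (simp add: content_cbox_cart UNIV_2 power2_eq_square)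
  then show ?thesis using assms by (simp add: content_Pair)
qed

lemma lint_le_const:
  assumes K: "compact K" "K \<subseteq> {a..b} \<times> cball c r" and f: "continuous_on K f" "\<And>z. z \<in> K \<Longrightarrow> f z \<le> B"
    and nn: "0 \<le> B" "0 \<le> r" "a \<le> b"
  shows "lint K f \<le> B * ((b - a) * (4 * r\<^sup>2))"
proof -
  define L where "L = cbox (a, \<chi> i. c $ i - r) (b, (\<chi> i. c $ i + r) :: real^2)"
  have "lint K f \<le> lint L (\<lambda>z. B)"
  proof (rule lint_mono_sets[OF K(1) f(1)])
    show "z \<in> L \<and> f z \<le> B" if "z \<in> K" for z
      using that K(2) f(2)[OF that] cball_in_box[of "snd z" c r]
      by (cases z) (force simp: L_def cbox_Pair_eq)
  qed (use nn in \<open>auto simp: L_def\<close>)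
  also have "\<dots> = B * measure lborel L" by (rule lint_const) (simp add: L_def)
  finally show ?thesis using measure_box[OF nn(2,3)] by (simp add: L_def)
qed

section \<open>Gaussian decay at small times\<close>

definition solves :: "real \<Rightarrow> pt set \<Rightarrow> (ix \<Rightarrow> pt \<Rightarrow> real) \<Rightarrow> bool" where
  "solves C U u \<longleftrightarrow> C12 U u \<and> (\<forall>z\<in>U. \<bar>heat u z\<bar> \<le> C * (\<bar>u Jv z\<bar> + sqrt (gsq u z)))"

lemma abs_coord_le: "\<bar>(x :: real^2) $ i - c $ i\<bar> \<le> norm (x - c)"
  using component_le_norm_cart[of "x - c" i] by simp

text \<open>The cut-off is a function of the squared distance, so the centre is not singular. A ramp
  of length \<open>d * R^2\<close> in this variable has a gradient of order 1/R and a Laplacian of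
  order 1/R^2.\<close>

lemma ball_cut_bounds:
  assumes R: "0 < R" and z: "norm (snd z - c) \<le> R" and d: "0 < d"
  shows "\<bar>jdown a (d * R\<^sup>2) (jrho c) Jx z\<bar> + \<bar>jdown a (d * R\<^sup>2) (jrho c) Jy z\<bar> \<le> 240 / (d * R)"
    and "\<bar>jdown a (d * R\<^sup>2) (jrho c) Jxx z + jdown a (d * R\<^sup>2) (jrho c) Jyy z\<bar> \<le> 240 / (d\<^sup>2 * R\<^sup>2) + 240 / (d * R\<^sup>2)"
proof -
  define r where "r = (norm (snd z - c))\<^sup>2"
  have dR: "0 < d * R\<^sup>2" using d R by simp
  have s1: "0 \<le> ramp1 a (d * R\<^sup>2) r" "ramp1 a (d * R\<^sup>2) r \<le> 60 / (d * R\<^sup>2)" using ramp_bounds[OF dR] by auto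
  have ab: "\<bar>2 * s - 2 * t\<bar> = 2 * \<bar>s - t\<bar>" for s t :: real by (simp add: abs_if)
  have co: "\<bar>snd z $ i - c $ i\<bar> \<le> R" for i using abs_coord_le[of "snd z" i c] z by linarith
  have "\<bar>jdown a (d * R\<^sup>2) (jrho c) Jx z\<bar> + \<bar>jdown a (d * R\<^sup>2) (jrho c) Jy z\<bar>
     = ramp1 a (d * R\<^sup>2) r * (2 * \<bar>snd z $ 1 - c $ 1\<bar> + 2 * \<bar>snd z $ 2 - c $ 2\<bar>)"
    using s1 by (simp add: jdown_def jcomp_simps jrho_simps r_def abs_mult distrib_left ab)
  also have "\<dots> \<le> 60 / (d * R\<^sup>2) * (4 * R)"
    using s1 co[of 1] co[of 2] dR by (intro mult_mono) auto
  also have "\<dots> = 240 / (d * R)" using R d by (simp add: power2_eq_square field_simps)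
  finally show "\<bar>jdown a (d * R\<^sup>2) (jrho c) Jx z\<bar> + \<bar>jdown a (d * R\<^sup>2) (jrho c) Jy z\<bar> \<le> 240 / (d * R)" .
  have lap_id: "- A * (2 * p)\<^sup>2 + - B * 2 + (- A * (2 * q)\<^sup>2 + - B * 2) = - (A * (4 * s)) - B * 4"
    if "s = p\<^sup>2 + q\<^sup>2" for A B p q s :: real
    using that by (simp add: power_mult_distrib algebra_simps)
  have lap_abs: "\<bar>- (A * (4 * s)) - B * 4\<bar> \<le> \<bar>A\<bar> * (4 * s) + B * 4" if "0 \<le> s" "0 \<le> B" for A B s :: real
    using that abs_triangle_ineq4[of "- (A * (4 * s))" "B * 4"] by (simp add: abs_mult)
  have r_eq: "r = (snd z $ 1 - c $ 1)\<^sup>2 + (snd z $ 2 - c $ 2)\<^sup>2" by (simp add: r_def norm2_sq)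
  have rR: "0 \<le> r" "r \<le> R\<^sup>2" using power_mono[OF z, of 2] by (auto simp: r_def)
  have "jdown a (d * R\<^sup>2) (jrho c) Jxx z + jdown a (d * R\<^sup>2) (jrho c) Jyy z = - (ramp2 a (d * R\<^sup>2) r * (4 * r)) - ramp1 a (d * R\<^sup>2) r * 4"
    unfolding jdown_def jcomp_simps jrho_simps r_def[symmetric] by (rule lap_id[OF r_eq])
  then have "\<bar>jdown a (d * R\<^sup>2) (jrho c) Jxx z + jdown a (d * R\<^sup>2) (jrho c) Jyy z\<bar> \<le> \<bar>ramp2 a (d * R\<^sup>2) r\<bar> * (4 * r) + ramp1 a (d * R\<^sup>2) r * 4"
    using lap_abs[OF rR(1) s1(1)] by metis
  also have "\<dots> \<le> 60 / (d * R\<^sup>2)\<^sup>2 * (4 * R\<^sup>2) + 60 / (d * R\<^sup>2) * 4"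
    using ramp2_bound[of a "d * R\<^sup>2" r] s1 rR dR by (intro add_mono mult_mono) auto
  also have "\<dots> = 240 / (d\<^sup>2 * R\<^sup>2) + 240 / (d * R\<^sup>2)" using R d by (simp add: power2_eq_square field_simps)
  finally show "\<bar>jdown a (d * R\<^sup>2) (jrho c) Jxx z + jdown a (d * R\<^sup>2) (jrho c) Jyy z\<bar> \<le> 240 / (d\<^sup>2 * R\<^sup>2) + 240 / (d * R\<^sup>2)" .
qed

text \<open>The time cut-off rises on [e/2, e] and falls on [T1, 2 T1]. Only its fall costs
  something in \<open>caccioppoli\<close>, so the bound does not depend on \<open>e\<close>: the
  gradient is square integrable down to time 0, although nothing is assumed about it there.\<close>

lemma local_energy:
  assumes R: "0 < \<rho>" "\<rho> \<le> R" and T1: "0 < T1" "2 * T1 < T" and C: "0 \<le> C"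
    and u: "solves C ({0<..<T} \<times> ball c R) u" "\<And>z. z \<in> {0<..<T} \<times> ball c R \<Longrightarrow> \<bar>u Jv z\<bar> \<le> M" and e: "0 < e"
  shows "lint ({e..T1} \<times> cball c (3/4 * R)) (gsq u) \<le> 2 * (C + C\<^sup>2 + 4 * (1200 / \<rho>)\<^sup>2 + 60 / T1) * (M\<^sup>2 * (8 * T1)) * R\<^sup>2"
proof (cases "e \<le> T1")
  case False
  then have "lint ({e..T1} \<times> cball c (3/4 * R)) (gsq u) = 0" by (simp add: lint_def cut_def)
  then show ?thesis using assms by simp
next
  case True
  define U where "U = {0<..<T} \<times> ball c R"
  define K where "K = {e/2..2 * T1} \<times> cball c (7/8 * R)"
  have U: "open U" by (simp add: U_def open_Times)
  have R0: "0 < R" using R by linarith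
  have K: "compact K" "K \<subseteq> U" using e T1 R0 by (auto simp: K_def U_def compact_Times)
  note uC = u(1)[unfolded solves_def U_def[symmetric]]
  define tt where "tt = jmul (jup (e/2) (e/2) jt) (jdown T1 T1 jt)"
  \<comment> \<open>Equal to 1 for |x - c| \<le> 3/4 R and to 0 beyond 7/8 R, because 9/16 + 13/64 =
    (7/8)^2. The number 1200 below is 240 / (13/64) rounded up.\<close>
  define b where "b = jdown (9/16 * R\<^sup>2) (13/64 * R\<^sup>2) (jrho c)"
  define X where "X = jmul tt b"
  have X: "C12 U X" unfolding X_def tt_def b_def by (intro C12_jmul C12_jup C12_jdown C12_jt C12_jrho)
  have dd: "0 < 13/64 * R\<^sup>2" "0 < e/2" using R0 e by auto
  have b01: "0 \<le> b Jv z" "b Jv z \<le> 1" for z using ramp_bounds[OF dd(1)] by (auto simp: b_def jdown_def jcomp_simps)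
  have t01: "0 \<le> tt Jv z" "tt Jv z \<le> 1" for z
    using ramp_bounds[OF dd(2)] ramp_bounds[OF T1(1)]
    by (auto simp: tt_def jup_def jdown_def jmul_simps jcomp_simps intro!: mult_nonneg_nonneg mult_le_one)
  have tv: "tt Jx z = 0" "tt Jy z = 0" "b Jt z = 0" for z
    by (simp_all add: tt_def b_def jup_def jdown_def jmul_simps jcomp_simps jt_simps jrho_simps)
  have tt: "- (60 / T1) \<le> tt Jt z" for z
  proof -
    have "tt Jt z = ramp1 (e/2) (e/2) (fst z) * (1 - ramp T1 T1 (fst z)) - ramp (e/2) (e/2) (fst z) * ramp1 T1 T1 (fst z)"
      by (simp add: tt_def jup_def jdown_def jmul_simps jcomp_simps jt_simps)
    moreover have "0 \<le> ramp1 (e/2) (e/2) (fst z) * (1 - ramp T1 T1 (fst z))"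
      using ramp_bounds[OF dd(2)] ramp_bounds[OF T1(1)] by simp
    moreover have "ramp (e/2) (e/2) (fst z) * ramp1 T1 T1 (fst z) \<le> 1 * (60 / T1)"
      using ramp_bounds[OF dd(2)] ramp_bounds[OF T1(1)] T1(1) by (intro mult_mono) auto
    ultimately show ?thesis by linarith
  qed
  have X0: "X Jv z = 0" if "z \<in> U - K" for z
  proof -
    have "fst z \<le> e/2 \<or> 2 * T1 \<le> fst z \<or> 7/8 * R \<le> norm (snd z - c)"
      using that by (cases z) (auto simp: K_def dist_norm norm_minus_commute)
    then consider "fst z \<le> e/2" | "2 * T1 \<le> fst z" | "(7/8 * R)\<^sup>2 \<le> (norm (snd z - c))\<^sup>2"
      using R0 by (auto intro: power_mono)
    then show ?thesis
    proof cases
      case 1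
      then show ?thesis using ramp_eq(1)[OF dd(2)] by (simp add: X_def tt_def jup_def jmul_simps jcomp_simps jt_simps)
    next
      case 2
      then show ?thesis using ramp_eq(3)[OF T1(1)] by (simp add: X_def tt_def jdown_def jmul_simps jcomp_simps jt_simps)
    next
      case 3
      then have "9/16 * R\<^sup>2 + 13/64 * R\<^sup>2 \<le> (norm (snd z - c))\<^sup>2" by (simp add: power_mult_distrib power2_eq_square)
      then show ?thesis using ramp_eq(3)[OF dd(1)] by (simp add: X_def b_def jdown_def jmul_simps jcomp_simps jrho_simps)
    qed
  qed
  have main: "lint K (\<lambda>z. (X Jv z)\<^sup>2 * gsq u z) \<le> 2 * (C + C\<^sup>2 + 4 * (1200 / \<rho>)\<^sup>2 + 60 / T1) * lint K (\<lambda>z. (u Jv z)\<^sup>2)"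
  proof (rule caccioppoli[OF U K _ X X0 _ _ C])
    show "C12 U u" using uC by simp
    show "\<bar>X Jv z\<bar> \<le> 1" for z using t01 b01 by (simp add: X_def jmul_simps abs_mult mult_le_one)
    show "\<bar>heat u z\<bar> \<le> C * (\<bar>u Jv z\<bar> + sqrt (gsq u z))" if "z \<in> K" for z using uC K that by auto
    show "- (X Jv z * X Jt z) \<le> 60 / T1" if "z \<in> K" for z
    proof -
      have "(tt Jv z * (b Jv z)\<^sup>2) * (- tt Jt z) \<le> 1 * (60 / T1)"
      proof (cases "- tt Jt z \<le> 0")
        case True
        then have "(tt Jv z * (b Jv z)\<^sup>2) * (- tt Jt z) \<le> 0" using t01[of z] by (intro mult_nonneg_nonpos) auto
        moreover have "0 \<le> 60 / T1" using T1 by simp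
        ultimately show ?thesis by linarith
      next
        case False
        then show ?thesis using t01[of z] b01[of z] tt[of z] by (intro mult_mono mult_le_one) (auto simp: power_le_one)
      qed
      then show ?thesis by (simp add: X_def jmul_simps tv power2_eq_square mult_ac)
    qed
    show "(\<bar>X Jx z\<bar> + \<bar>X Jy z\<bar>)\<^sup>2 \<le> (1200 / \<rho>)\<^sup>2" if z: "z \<in> K" for z
    proof (rule power_mono)
      have "norm (snd z - c) \<le> R" using z R0 by (cases z) (auto simp: K_def dist_norm norm_minus_commute)
      then have b1: "\<bar>b Jx z\<bar> + \<bar>b Jy z\<bar> \<le> 240 / (13/64 * R)" unfolding b_def using R0 by (intro ball_cut_bounds) auto
      have "\<bar>X Jx z\<bar> + \<bar>X Jy z\<bar> = tt Jv z * (\<bar>b Jx z\<bar> + \<bar>b Jy z\<bar>)"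
        using t01[of z] by (simp add: X_def jmul_simps tv abs_mult distrib_left)
      also have "\<dots> \<le> 1 * (240 / (13/64 * R))" using t01[of z] b1 by (intro mult_mono) auto
      also have "\<dots> \<le> 1200 / \<rho>" using R R0 by (simp add: field_simps)
      finally show "\<bar>X Jx z\<bar> + \<bar>X Jy z\<bar> \<le> 1200 / \<rho>" .
    qed simp
  qed
  have cu: "continuous_on K (\<lambda>z. (u Jv z)\<^sup>2)" using uC by (intro continuous_on_subset[OF _ K(2)] continuous_intros C12D) auto
  have M0: "(u Jv z)\<^sup>2 \<le> M\<^sup>2" if "z \<in> K" for z
    using power_mono[OF u(2)[of z], of 2] that K by (auto simp: U_def)
  have "lint K (\<lambda>z. (u Jv z)\<^sup>2) \<le> M\<^sup>2 * ((2 * T1 - 0) * (4 * R\<^sup>2))"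
    by (rule lint_le_const[where c=c, OF K(1) _ cu M0]) (use e R0 T1 in \<open>auto simp: K_def\<close>)
  then have "lint K (\<lambda>z. (u Jv z)\<^sup>2) \<le> (M\<^sup>2 * (8 * T1)) * R\<^sup>2" by (simp add: algebra_simps)
  moreover have "lint ({e..T1} \<times> cball c (3/4 * R)) (gsq u) \<le> lint K (\<lambda>z. (X Jv z)\<^sup>2 * gsq u z)"
  proof (rule lint_mono_sets)
    show "continuous_on ({e..T1} \<times> cball c (3/4 * R)) (gsq u)"
      by (rule continuous_on_subset[OF continuous_gsq, of U]) (use uC e T1 R0 in \<open>auto simp: U_def\<close>)
    show "continuous_on K (\<lambda>z. (X Jv z)\<^sup>2 * gsq u z)"
      by (rule continuous_on_subset[OF _ K(2)]) (use uC in \<open>intro continuous_intros continuous_gsq C12D[OF X], simp\<close>)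
    show "z \<in> K \<and> gsq u z \<le> (X Jv z)\<^sup>2 * gsq u z" if z: "z \<in> {e..T1} \<times> cball c (3/4 * R)" for z
    proof -
      have t: "e \<le> fst z" "fst z \<le> T1" "norm (snd z - c) \<le> 3/4 * R"
        using z by (cases z; auto simp: dist_norm norm_minus_commute)+
      have "(norm (snd z - c))\<^sup>2 \<le> 9/16 * R\<^sup>2" using power_mono[OF t(3), of 2] by (simp add: power_mult_distrib power2_eq_square)
      then have "X Jv z = 1"
        using t ramp_eq(3)[OF dd(2), of "e/2" "fst z"] ramp_eq(1)[OF T1(1)] ramp_eq(1)[OF dd(1)]
        by (simp add: X_def tt_def b_def jup_def jdown_def jmul_simps jcomp_simps jt_simps jrho_simps)
      moreover have "z \<in> K" using t e T1 R0 by (cases z) (auto simp: K_def dist_norm norm_minus_commute)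
      ultimately show ?thesis by simp
    qed
  qed (use K in \<open>auto simp: compact_Times\<close>)
  moreover have "0 \<le> 2 * (C + C\<^sup>2 + 4 * (1200 / \<rho>)\<^sup>2 + 60 / T1)" using C T1 by simp
  ultimately show ?thesis using main by (smt (verit) mult.assoc mult_left_mono)
qed

lemma C12_lin:
  assumes "C12 U a" "C12 U b" shows "C12 U (\<lambda>i z. p * a i z + q * b i z)"
proof -
  note d = C12D[OF assms(1)] C12D[OF assms(2)]
  have m: "has_pd e U (\<lambda>z. k * h z) (\<lambda>z. k * h' z)" if "has_pd e U h h'" for e k h h'
    using has_pd_mult[OF has_pd_const that] by simp
  show ?thesis unfolding C12_def by (intro conjI allI has_pd_add m d continuous_intros)
qed

text \<open>The weight is \<open>R\<^sup>2 e\<^bsup>-\<lambda>t\<^esup> - \<bar>x - c\<bar>\<^sup>2 / 2\<close>: the convexity in time compensates the concavity in space.\<close>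
lemma gaussian_decay_large:
  assumes C: "0 \<le> C" and lam: "16 + 4 * (6 * C\<^sup>2 + 1) \<le> lam" and T: "0 < T" "4 \<le> lam * T"
    and R: "1 \<le> R" and u: "solves C ({0<..<T} \<times> ball c R) u"
    and Z: "\<And>e. 0 < e \<Longrightarrow> lint ({e..1/lam} \<times> cball c (3/4 * R)) (\<lambda>z. (u Jv z)\<^sup>2 + gsq u z) \<le> Z"
    and u0: "\<And>e. 0 < e \<Longrightarrow> \<exists>d>0. \<forall>z\<in>{0<..<T} \<times> ball c R. fst z < d \<longrightarrow> \<bar>u Jv z\<bar> \<le> e"
    and e: "0 < e"
  shows "lint ({e..1/(20 * lam)} \<times> cball c (R/10)) (\<lambda>z. (u Jv z)\<^sup>2 + gsq u z)
    \<le> 8 * (120 * lam + 5000 + 768 * C)\<^sup>2 * Z * exp (- (R\<^sup>2 / 10))"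
proof -
  define B where "B = 6 * C\<^sup>2 + 1"
  \<comment> \<open>The Hessian of the weight is minus the identity, so the gradient part of the
    form has the coefficient \<open>2 * m - 4 = B + 4\<close>. Since \<open>4 * m \<le> lam\<close>,
    the second time derivative of the weight dominates the terms with v^2.\<close>
  define m where "m = 4 + B / 2"
  define T1 where "T1 = 1 / lam"
  have B1: "1 \<le> B" by (simp add: B_def)
  have lam': "16 + 4 * B \<le> lam" using lam by (simp add: B_def)
  have lam0: "0 < lam" "4 * m \<le> lam" using lam' B1 by (auto simp: m_def)
  have T1: "0 < T1" "4 * T1 \<le> T" using lam0 T by (auto simp: T1_def divide_le_eq mult.commute)
  have R0: "0 < R" "1 \<le> R\<^sup>2" using R by (auto simp: one_le_power)
  define U where "U = {0<..<T} \<times> ball c R"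
  define K where "K = {0<..T1} \<times> cball c (3/4 * R)"
  have U: "open U" by (simp add: U_def open_Times)
  have KU: "K \<subseteq> U" using T1 R0 by (auto simp: K_def U_def)
  have Ke: "K \<inter> {z. e \<le> fst z} = {e..T1} \<times> cball c (3/4 * R)" if "0 < e" for e
    using that by (auto simp: K_def)
  note uC = u[unfolded solves_def U_def[symmetric]]
  define h where "h t = exp (- (lam * t))" for t
  define f where "f = (\<lambda>i z. R\<^sup>2 * jtime h (\<lambda>t. - (lam * h t)) i z + (- 1/2) * jrho c i z)"
  have hd: "(h has_real_derivative - (lam * h t)) (at t)" for t
    unfolding h_def by (auto intro!: derivative_eq_intros)
  have ch: "continuous_on A h" for A unfolding h_def[abs_def] by (intro continuous_intros)
  have chz: "continuous_on A (\<lambda>z::pt. h (fst z))" for A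
    by (rule continuous_on_compose2[OF ch[of UNIV]]) (auto intro!: continuous_intros)
  have f: "C12 U f" unfolding f_def by (intro C12_lin C12_jtime C12_jrho hd continuous_intros ch)
  have fv: "f Jv z = R\<^sup>2 * h (fst z) - (norm (snd z - c))\<^sup>2 / 2" "f Jt z = - (R\<^sup>2 * (lam * h (fst z)))"
     "f Jx z = - (snd z $ 1 - c $ 1)" "f Jy z = - (snd z $ 2 - c $ 2)" "f Jxx z = -1" "f Jxy z = 0" "f Jyy z = -1" for z
    by (simp_all add: f_def jtime_simps jrho_simps field_simps)
  have fg: "gsq f z = (norm (snd z - c))\<^sup>2" for z by (simp add: gsq_def fv norm2_sq power2_commute)
  have ab: "fst (z + s *\<^sub>R dX) = fst z" "fst (z + s *\<^sub>R dY) = fst z" "snd (z + s *\<^sub>R dT) = snd z" for z :: pt and s by simp_all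
  have ft: "has_pd dT U (f Jt) (\<lambda>z. R\<^sup>2 * (lam * (lam * h (fst z))))"
      "has_pd dX U (f Jt) (\<lambda>z. 0)" "has_pd dY U (f Jt) (\<lambda>z. 0)"
      "has_pd dT U (f Jx) (\<lambda>z. 0)" "has_pd dT U (f Jy) (\<lambda>z. 0)"
  proof -
    have "has_pd dT U (\<lambda>z. (- (R\<^sup>2 * lam)) * h (fst z)) (\<lambda>z. 0 * h (fst z) + (- (R\<^sup>2 * lam)) * (- (lam * h (fst z))))"
      by (intro has_pd_mult has_pd_const has_pd_time hd)
    then show "has_pd dT U (f Jt) (\<lambda>z. R\<^sup>2 * (lam * (lam * h (fst z))))" by (simp add: has_pd_def fv algebra_simps)
  qed (simp_all add: has_pd_def fv ab)
  \<comment> \<open>\<open>tt\<close> is 1 up to \<open>T1 / 2\<close> and 0 from \<open>T1\<close>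
    on; \<open>b\<close> is 1 up to distance R/2 and 0 from 3/4 R on. There is no cut-off at time 0,
    which is left to \<open>carleman_initial\<close>.\<close>
  define tt where "tt = jdown (T1/2) (T1/2) jt"
  define b where "b = jdown (1/4 * R\<^sup>2) (5/16 * R\<^sup>2) (jrho c)"
  define X where "X = jmul tt b"
  have X: "C12 U X" unfolding X_def tt_def b_def by (intro C12_jmul C12_jup C12_jdown C12_jt C12_jrho)
  have dd: "0 < 5/16 * R\<^sup>2" "0 < T1/2" using R0 T1 by auto
  have b01: "0 \<le> b Jv z" "b Jv z \<le> 1" for z using ramp_bounds[OF dd(1)] by (auto simp: b_def jdown_def jcomp_simps)
  have t01: "0 \<le> tt Jv z" "tt Jv z \<le> 1" for z using ramp_bounds[OF dd(2)] by (auto simp: tt_def jdown_def jcomp_simps jt_simps)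
  have tv: "tt Jx z = 0" "tt Jy z = 0" "tt Jxx z = 0" "tt Jyy z = 0" "b Jt z = 0" for z
    by (simp_all add: tt_def b_def jup_def jdown_def jmul_simps jcomp_simps jt_simps jrho_simps)
  have ttt: "\<bar>tt Jt z\<bar> \<le> 120 * lam" for z
  proof -
    have "tt Jt z = - ramp1 (T1/2) (T1/2) (fst z)" by (simp add: tt_def jdown_def jcomp_simps jt_simps)
    moreover have "60 / (T1 / 2) = 120 * lam" by (simp add: T1_def)
    ultimately show ?thesis using ramp_bounds[OF dd(2), of "T1/2" "fst z"] by simp
  qed
  have X0: "X Jv z = 0" if "z \<in> U - K" for z
  proof -
    have "T1 \<le> fst z \<or> 3/4 * R \<le> norm (snd z - c)"
      using that by (cases z) (auto simp: K_def U_def dist_norm norm_minus_commute)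
    then consider "T1 \<le> fst z" | "(3/4 * R)\<^sup>2 \<le> (norm (snd z - c))\<^sup>2"
      using R0 by (auto intro: power_mono)
    then show ?thesis
    proof cases
      case 1
      then show ?thesis using ramp_eq(3)[OF dd(2), of "T1/2" "fst z"] by (simp add: X_def tt_def jdown_def jmul_simps jcomp_simps jt_simps)
    next
      case 2
      then have "1/4 * R\<^sup>2 + 5/16 * R\<^sup>2 \<le> (norm (snd z - c))\<^sup>2" by (simp add: power_mult_distrib power2_eq_square)
      then show ?thesis using ramp_eq(3)[OF dd(1)] by (simp add: X_def b_def jdown_def jmul_simps jcomp_simps jrho_simps)
    qed
  qed
  define H where "H = 120 * lam + 5000 + 768 * C"
  have H0: "0 \<le> H" using lam0 C by (simp add: H_def)
  have Kz: "0 < fst z" "fst z \<le> T1" "norm (snd z - c) \<le> R" "(norm (snd z - c))\<^sup>2 \<le> R\<^sup>2" if "z \<in> K" for z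
  proof -
    show 1: "0 < fst z" "fst z \<le> T1" "norm (snd z - c) \<le> R"
      using that R0 by (cases z; auto simp: K_def dist_norm norm_minus_commute)+
    show "(norm (snd z - c))\<^sup>2 \<le> R\<^sup>2" using 1(3) by (intro power_mono) auto
  qed
  have cut: "cuterr C u X z \<le> H * (\<bar>u Jv z\<bar> + sqrt (gsq u z))" if z: "z \<in> K" for z
  proof -
    have 1: "\<bar>b Jx z\<bar> + \<bar>b Jy z\<bar> \<le> 768"
    proof -
      have "\<bar>b Jx z\<bar> + \<bar>b Jy z\<bar> \<le> 240 / (5/16 * R)" unfolding b_def using R0 Kz[OF z] by (intro ball_cut_bounds) auto
      also have "\<dots> \<le> 768" using R by (simp add: field_simps)
      finally show ?thesis .
    qed
    have 2: "\<bar>b Jxx z + b Jyy z\<bar> \<le> 5000"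
    proof -
      have "\<bar>b Jxx z + b Jyy z\<bar> \<le> 240 / ((5/16)\<^sup>2 * R\<^sup>2) + 240 / (5/16 * R\<^sup>2)"
        unfolding b_def using R0 Kz[OF z] by (intro ball_cut_bounds) auto
      also have "\<dots> \<le> 240 / ((5/16)\<^sup>2 * 1) + 240 / (5/16 * 1)"
        using R0 by (intro add_mono divide_left_mono mult_left_mono) (auto simp: power2_eq_square)
      also have "\<dots> \<le> 5000" by (simp add: power2_eq_square)
      finally show ?thesis .
    qed
    have 3: "\<bar>X Jx z\<bar> + \<bar>X Jy z\<bar> \<le> 768"
    proof -
      have "\<bar>X Jx z\<bar> + \<bar>X Jy z\<bar> = tt Jv z * (\<bar>b Jx z\<bar> + \<bar>b Jy z\<bar>)"
        using t01[of z] by (simp add: X_def jmul_simps tv abs_mult distrib_left)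
      also have "\<dots> \<le> 1 * 768" using t01[of z] 1 by (intro mult_mono) auto
      finally show ?thesis by simp
    qed
    have 4: "\<bar>heat X z\<bar> \<le> 120 * lam + 5000"
    proof -
      have "heat X z = tt Jt z * b Jv z + tt Jv z * (b Jxx z + b Jyy z)"
        by (simp add: heat_def X_def jmul_simps tv distrib_left)
      then have "\<bar>heat X z\<bar> \<le> \<bar>tt Jt z\<bar> * b Jv z + tt Jv z * \<bar>b Jxx z + b Jyy z\<bar>"
        using abs_triangle_ineq[of "tt Jt z * b Jv z" "tt Jv z * (b Jxx z + b Jyy z)"] t01[of z] b01[of z] by (simp add: abs_mult)
      also have "\<dots> \<le> (120 * lam) * 1 + 1 * 5000"
        using ttt[of z] t01[of z] b01[of z] 2 lam0 by (intro add_mono mult_mono) auto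
      finally show ?thesis by simp
    qed
    have "cuterr C u X z \<le> \<bar>u Jv z\<bar> * ((120 * lam + 5000) + C * 768) + 2 * 768 * sqrt (gsq u z)"
      unfolding cuterr_def using 3 4 C by (intro add_mono mult_left_mono mult_right_mono) auto
    also have "\<dots> \<le> \<bar>u Jv z\<bar> * H + H * sqrt (gsq u z)"
      using lam0 C by (intro add_mono mult_left_mono mult_right_mono) (auto simp: H_def)
    finally show ?thesis by (simp add: algebra_simps)
  qed
  have cutnn: "0 \<le> cuterr C u X z" for z using C by (simp add: cuterr_def)
  have cut2: "(cuterr C u X z)\<^sup>2 \<le> 2 * H\<^sup>2 * ((u Jv z)\<^sup>2 + gsq u z)" if z: "z \<in> K" for z
  proof -
    have "(cuterr C u X z)\<^sup>2 \<le> (H * (\<bar>u Jv z\<bar> + sqrt (gsq u z)))\<^sup>2" using cut[OF z] cutnn by (rule power_mono)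
    also have "\<dots> \<le> H\<^sup>2 * (2 * (\<bar>u Jv z\<bar>\<^sup>2 + (sqrt (gsq u z))\<^sup>2))"
      unfolding power_mult_distrib by (intro mult_left_mono sq_sum2_le) auto
    finally show ?thesis by (simp add: algebra_simps)
  qed
  have h_le1: "h t \<le> 1" if "0 < t" for t using that lam0 by (simp add: h_def)
  have cut0: "exp (2 * f Jv z) * (cuterr C u X z)\<^sup>2 \<le> exp (7/4 * R\<^sup>2) * (2 * H\<^sup>2 * ((u Jv z)\<^sup>2 + gsq u z))" if z: "z \<in> K" for z
  proof (cases "fst z \<le> T1/2 \<and> (norm (snd z - c))\<^sup>2 \<le> 1/4 * R\<^sup>2")
    case True
    then have "tt Jt z = 0" "b Jx z = 0" "b Jy z = 0" "b Jxx z = 0" "b Jyy z = 0"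
      using ramp_eq(2)[OF dd(2), of "fst z" "T1/2"] ramp_eq(2)[OF dd(1)] ramp2_eq(1)[OF dd(1)]
      by (simp_all add: tt_def b_def jdown_def jcomp_simps jt_simps jrho_simps)
    then have "cuterr C u X z = 0" by (simp add: cuterr_def heat_def X_def jmul_simps tv)
    then show ?thesis by simp
  next
    case False
    \<comment> \<open>Where the cut-off varies, either |x - c|^2 > R^2 / 4, and then 2 f \<le> 2 R^2
      - R^2 / 4, or t > \<open>T1 / 2\<close>, and then e^(-1/2) \<le> 2/3 gives 2 f \<le> 4/3 R^2.
      Both are at most 7/4 R^2.\<close>
    have "2 * f Jv z \<le> 7/4 * R\<^sup>2"
    proof (cases "fst z \<le> T1/2")
      case True
      then have "1/4 * R\<^sup>2 < (norm (snd z - c))\<^sup>2" using False by auto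
      moreover have "R\<^sup>2 * h (fst z) \<le> R\<^sup>2 * 1" using h_le1[of "fst z"] Kz[OF z] by (intro mult_left_mono) auto
      ultimately show ?thesis by (simp add: fv)
    next
      case F: False
      have "1/2 \<le> lam * fst z" using F lam0 by (simp add: T1_def field_simps)
      then have "3/2 \<le> exp (lam * fst z)" using exp_ge_add_one_self[of "lam * fst z"] by linarith
      then have "h (fst z) \<le> 2/3" unfolding h_def exp_minus using le_imp_inverse_le[of "3/2" "exp (lam * fst z)"] by simp
      then have "R\<^sup>2 * h (fst z) \<le> R\<^sup>2 * (2/3)" by (intro mult_left_mono) auto
      moreover have "2 * (a - n / 2) \<le> 7/4 * r" if "a \<le> r * (2/3)" "0 \<le> r" "0 \<le> n" for a n r :: real
        using that by (simp add: field_simps)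
      ultimately show ?thesis unfolding fv by (meson zero_le_power2)
    qed
    then show ?thesis using cut2[OF z] by (intro mult_mono) auto
  qed
  have cu: "continuous_on U (\<lambda>z. (u Jv z)\<^sup>2 + gsq u z)" using uC by (intro continuous_intros continuous_gsq C12D) auto
  note fd = C12D[OF f] and Xd = C12D[OF X] and ud = C12D[OF conjunct1[OF uC]]
  have Err: "lint (K \<inter> {z. e \<le> fst z}) (\<lambda>z. exp (2 * f Jv z) * (cuterr C u X z)\<^sup>2) \<le> exp (7/4 * R\<^sup>2) * (2 * H\<^sup>2) * Z" if e: "0 < e" for e
  proof -
    have cK: "compact (K \<inter> {z. e \<le> fst z})" unfolding Ke[OF e] by (intro compact_Times) auto
    have sub: "K \<inter> {z. e \<le> fst z} \<subseteq> U" using KU by auto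
    have "lint (K \<inter> {z. e \<le> fst z}) (\<lambda>z. exp (2 * f Jv z) * (cuterr C u X z)\<^sup>2)
       \<le> lint (K \<inter> {z. e \<le> fst z}) (\<lambda>z. exp (7/4 * R\<^sup>2) * (2 * H\<^sup>2) * ((u Jv z)\<^sup>2 + gsq u z))"
    proof (rule lint_mono[OF cK])
      show "continuous_on (K \<inter> {z. e \<le> fst z}) (\<lambda>z. exp (2 * f Jv z) * (cuterr C u X z)\<^sup>2)"
        unfolding cuterr_def by (rule continuous_on_subset[OF _ sub]) (use uC in \<open>intro continuous_intros fd Xd ud continuous_gsq continuous_heat X, auto\<close>)
      show "continuous_on (K \<inter> {z. e \<le> fst z}) (\<lambda>z. exp (7/4 * R\<^sup>2) * (2 * H\<^sup>2) * ((u Jv z)\<^sup>2 + gsq u z))"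
        by (intro continuous_on_mult continuous_on_const continuous_on_subset[OF cu sub])
    qed (use cut0 in \<open>simp add: mult.assoc\<close>)
    also have "\<dots> = exp (7/4 * R\<^sup>2) * (2 * H\<^sup>2) * lint (K \<inter> {z. e \<le> fst z}) (\<lambda>z. (u Jv z)\<^sup>2 + gsq u z)" by (rule lint_cmult)
    also have "\<dots> \<le> exp (7/4 * R\<^sup>2) * (2 * H\<^sup>2) * Z"
      using Z[OF e] unfolding Ke[OF e] T1_def by (intro mult_left_mono) auto
    finally show ?thesis .
  qed
  have pos: "(6 * C\<^sup>2 + 1) * (a\<^sup>2 + b\<^sup>2 + (1 + gsq f z) * c'\<^sup>2)
      \<le> 4 * (f Jxx z * a\<^sup>2 + 2 * f Jxy z * a * b + f Jyy z * b\<^sup>2)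
        + 2 * ((m - 2) - (f Jxx z + f Jyy z)) * (a\<^sup>2 + b\<^sup>2) + 2 * c' * (0 * a + 0 * b)
        + c'\<^sup>2 * (R\<^sup>2 * (lam * (lam * h (fst z))) - 4 * (f Jx z * 0 + f Jy z * 0)
          + 4 * (f Jxx z * (f Jx z)\<^sup>2 + 2 * f Jxy z * f Jx z * f Jy z + f Jyy z * (f Jy z)\<^sup>2)
          - 2 * ((m - 2) - (f Jxx z + f Jyy z)) * (gsq f z - f Jt z) - ((m - 2) - (f Jxx z + f Jyy z))\<^sup>2)"
    if z: "z \<in> K" for z a b c'
  proof -
    define r where "r = (norm (snd z - c))\<^sup>2"
    define y where "y = h (fst z)"
    have r: "0 \<le> r" "r \<le> R\<^sup>2" using Kz[OF z] by (auto simp: r_def)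
    have y: "1/3 \<le> y"
    proof -
      have "lam * fst z \<le> 1" using Kz(2)[OF z] lam0 by (simp add: T1_def field_simps)
      then have "exp (lam * fst z) \<le> exp 1" by simp
      then have "exp (lam * fst z) \<le> 3" using exp_le by linarith
      then have "1 / 3 \<le> 1 / exp (lam * fst z)" by (intro divide_left_mono) auto
      then show ?thesis by (simp add: y_def h_def exp_minus inverse_eq_divide)
    qed
    \<comment> \<open>The coefficient of v^2. Since \<open>R^2 \<ge> 1\<close> and
      \<open>r \<le> R^2\<close>, every term can be compared with R^2, and R drops out of the
      condition on \<open>lam\<close>.\<close>
    have key: "B * (1 + r) \<le> R\<^sup>2 * (lam * (lam * y)) - 4 * r - 2 * m * (r + R\<^sup>2 * (lam * y)) - m\<^sup>2"
    proof -
      have "B * (1 + r) + 4 * r + 2 * m * r + m\<^sup>2 \<le> R\<^sup>2 * (2 * B + 4 + 2 * m + m\<^sup>2)"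
      proof -
        have "B * (1 + r) \<le> B * (R\<^sup>2 + R\<^sup>2)" using r R0 B1 by (intro mult_left_mono) auto
        moreover have "m * r \<le> m * R\<^sup>2" using r B1 by (intro mult_left_mono) (auto simp: m_def)
        moreover have "m\<^sup>2 * 1 \<le> m\<^sup>2 * R\<^sup>2" using R0 by (intro mult_left_mono) auto
        moreover have "4 * r \<le> 4 * R\<^sup>2" using r by simp
        ultimately show ?thesis by (simp add: algebra_simps)
      qed
      moreover have "2 * B + 4 + 2 * m + m\<^sup>2 \<le> lam * (lam * y) - 2 * m * (lam * y)"
      proof -
        have Bm: "B = 2 * m - 8" by (simp add: m_def)
        have "0 \<le> 5/3 * (m - 9/5)\<^sup>2 + (12 - 27/5)" by simp
        then have "2 * B + 4 + 2 * m + m\<^sup>2 \<le> 8/3 * m\<^sup>2" unfolding Bm by (simp add: power2_eq_square algebra_simps)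
        also have "\<dots> = (4 * m) * (2 * m) * (1/3)" by (simp add: power2_eq_square)
        also have "\<dots> \<le> lam * (lam - 2 * m) * y"
          using lam0 y B1 by (intro mult_mono) (auto simp: m_def)
        finally show ?thesis by (simp add: algebra_simps)
      qed
      then have "R\<^sup>2 * (2 * B + 4 + 2 * m + m\<^sup>2) \<le> R\<^sup>2 * (lam * (lam * y) - 2 * m * (lam * y))"
        by (intro mult_left_mono) auto
      ultimately show ?thesis by (simp add: algebra_simps)
    qed
    have fs: "(f Jx z)\<^sup>2 + (f Jy z)\<^sup>2 = r" using fg[of z] by (simp add: gsq_def r_def)
    have "B * (a\<^sup>2 + b\<^sup>2) \<le> (2 * m - 4) * (a\<^sup>2 + b\<^sup>2)"
      by (intro mult_right_mono) (auto simp: m_def)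
    moreover have "B * (1 + r) * c'\<^sup>2 \<le> (R\<^sup>2 * (lam * (lam * y)) - 4 * r - 2 * m * (r + R\<^sup>2 * (lam * y)) - m\<^sup>2) * c'\<^sup>2"
      using key by (intro mult_right_mono) auto
    ultimately show ?thesis
      unfolding fg r_def[symmetric] B_def[symmetric] fv(2) y_def[symmetric] fs[symmetric]
      by (simp add: fv(5-7) algebra_simps)
  qed
  have main: "lint (K \<inter> {z. e \<le> fst z}) (\<lambda>z. exp (2 * f Jv z) * ((jmul u X Jv z)\<^sup>2 + gsq (jmul u X) z))
     \<le> 4 * (exp (7/4 * R\<^sup>2) * (2 * H\<^sup>2) * Z)"
  proof (rule carleman_initial[where U=U and K=K and f=f and N="\<lambda>z. m - 2" and Nx="\<lambda>z. 0" and Ny="\<lambda>z. 0" and C=C and u=u and X=X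
        and ftt="\<lambda>z. R\<^sup>2 * (lam * (lam * h (fst z)))" and ftx="\<lambda>z. 0" and fty="\<lambda>z. 0"
        and ?c1.0="\<chi> i. c $ i - R" and ?c2.0="\<chi> i. c $ i + R" and Bq="(R\<^sup>2 + R\<^sup>2 * lam) * exp (2 * R\<^sup>2)"])
    show "compact (K \<inter> {z. e \<le> fst z})" if "0 < e" for e unfolding Ke[OF that] by (intro compact_Times) auto
    show "snd z \<in> cbox (\<chi> i. c $ i - R) (\<chi> i. c $ i + R)" if "z \<in> K" for z
      using Kz(3)[OF that] by (intro cball_in_box) (simp add: dist_norm norm_minus_commute)
    show "\<bar>X Jv z\<bar> \<le> 1" for z using t01 b01 by (simp add: X_def jmul_simps abs_mult mult_le_one)
    show "\<bar>gsq f z - f Jt z\<bar> * exp (2 * f Jv z) \<le> (R\<^sup>2 + R\<^sup>2 * lam) * exp (2 * R\<^sup>2)" if z: "z \<in> K" for z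
    proof (rule mult_mono)
      have hh: "0 \<le> h (fst z)" "h (fst z) \<le> 1" using h_le1 Kz[OF z] by (auto simp: h_def)
      have "lam * h (fst z) \<le> lam * 1" using hh lam0 by (intro mult_left_mono) auto
      then have 1: "R\<^sup>2 * (lam * h (fst z)) \<le> R\<^sup>2 * lam" "0 \<le> R\<^sup>2 * (lam * h (fst z))"
        using hh lam0 by (auto intro!: mult_left_mono)
      then show "\<bar>gsq f z - f Jt z\<bar> \<le> R\<^sup>2 + R\<^sup>2 * lam" using Kz(4)[OF z] by (simp add: fg fv)
      have "R\<^sup>2 * h (fst z) \<le> R\<^sup>2 * 1" using hh by (intro mult_left_mono) auto
      moreover have "a - n / 2 \<le> r" if "a \<le> r * 1" "0 \<le> n" for a n r :: real using that by simp
      ultimately have "f Jv z \<le> R\<^sup>2" unfolding fv by (meson zero_le_power2)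
      then show "exp (2 * f Jv z) \<le> exp (2 * R\<^sup>2)" by simp
    qed (use lam0 in auto)
    show "\<exists>d>0. \<forall>z\<in>K. fst z < d \<longrightarrow> \<bar>u Jv z\<bar> \<le> e" if "0 < e" for e
      using u0[OF that] KU unfolding U_def by blast
    show "has_pd dX U (\<lambda>z. m - 2) (\<lambda>z. 0)" "has_pd dY U (\<lambda>z. m - 2) (\<lambda>z. 0)" by (rule has_pd_const)+
  qed (use U KU Kz uC X X0 f ft C Err e pos in \<open>auto intro!: continuous_intros chz\<close>)
  define L where "L = {e..1/(20 * lam)} \<times> cball c (R/10)"
  have T20: "1 / (20 * lam) \<le> T1/2" using lam0 by (simp add: T1_def field_simps)
  have sub: "L \<subseteq> K \<inter> {z. e \<le> fst z}" using e R0 T20 T1 by (auto simp: L_def K_def)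
  have LU: "L \<subseteq> U" using sub KU by auto
  have cL: "compact L" by (auto simp: L_def compact_Times)
  have wC: "C12 U (jmul u X)" using uC by (intro C12_jmul X) auto
  have "exp (189/100 * R\<^sup>2) * lint L (\<lambda>z. (u Jv z)\<^sup>2 + gsq u z)
     \<le> lint (K \<inter> {z. e \<le> fst z}) (\<lambda>z. exp (2 * f Jv z) * ((jmul u X Jv z)\<^sup>2 + gsq (jmul u X) z))"
    unfolding lint_cmult[symmetric]
  proof (rule lint_mono_sets[OF cL])
    show "continuous_on L (\<lambda>z. exp (189/100 * R\<^sup>2) * ((u Jv z)\<^sup>2 + gsq u z))"
      by (intro continuous_on_mult continuous_on_const continuous_on_subset[OF cu LU])
    show "compact (K \<inter> {z. e \<le> fst z})" unfolding Ke[OF e] by (intro compact_Times) auto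
    show "continuous_on (K \<inter> {z. e \<le> fst z}) (\<lambda>z. exp (2 * f Jv z) * ((jmul u X Jv z)\<^sup>2 + gsq (jmul u X) z))"
      by (rule continuous_on_subset[of U]) (use KU in \<open>auto intro!: continuous_intros fd C12D[OF wC] continuous_gsq wC\<close>)
    show "z \<in> K \<inter> {z. e \<le> fst z} \<and> exp (189/100 * R\<^sup>2) * ((u Jv z)\<^sup>2 + gsq u z) \<le> exp (2 * f Jv z) * ((jmul u X Jv z)\<^sup>2 + gsq (jmul u X) z)"
      if z: "z \<in> L" for z
    proof -
      have zt: "fst z \<le> 1/(20 * lam)" "norm (snd z - c) \<le> R/10"
        using z by (cases z; auto simp: L_def dist_norm norm_minus_commute)+
      then have n2: "(norm (snd z - c))\<^sup>2 \<le> R\<^sup>2 / 100" using power_mono[OF zt(2), of 2] by (simp add: power_divide)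
      have n4: "(norm (snd z - c))\<^sup>2 \<le> 1/4 * R\<^sup>2" using n2 R0(2) by simp
      have "tt Jv z = 1" "b Jv z = 1" "b Jx z = 0" "b Jy z = 0"
        using zt T20 ramp_eq(1)[OF dd(2), of "fst z" "T1/2"] ramp_eq(1,2)[OF dd(1) n4]
        by (simp_all add: tt_def b_def jdown_def jcomp_simps jt_simps jrho_simps)
      then have w: "jmul u X Jv z = u Jv z" "gsq (jmul u X) z = gsq u z" by (simp_all add: X_def jmul_simps gsq_def tv)
      \<comment> \<open>On the smaller set 2 f \<ge> 2 (19/20) R^2 - R^2 / 100 = 1.89 R^2. The
        excess over the value 1.75 R^2 where the cut-off varies is the source of the Gaussian
        factor.\<close>
      have "lam * fst z \<le> 1/20" using zt(1) lam0 by (simp add: field_simps)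
      then have "19/20 \<le> h (fst z)" using exp_ge_add_one_self[of "- (lam * fst z)"] by (simp add: h_def)
      then have "R\<^sup>2 * (19/20) \<le> R\<^sup>2 * h (fst z)" by (intro mult_left_mono) auto
      moreover have "189/100 * r \<le> 2 * (a - n / 2)" if "r * (19/20) \<le> a" "n \<le> r / 100" for a n r :: real
        using that by (simp add: field_simps)
      ultimately have "189/100 * R\<^sup>2 \<le> 2 * f Jv z" unfolding fv using n2 by blast
      then show ?thesis using z sub unfolding w by (auto intro!: mult_right_mono)
    qed
  qed auto
  also note main
  finally have "exp (189/100 * R\<^sup>2) * lint L (\<lambda>z. (u Jv z)\<^sup>2 + gsq u z) \<le> 8 * H\<^sup>2 * Z * exp (7/4 * R\<^sup>2)" by (simp add: mult_ac)
  then have "exp (- (189/100 * R\<^sup>2)) * (exp (189/100 * R\<^sup>2) * lint L (\<lambda>z. (u Jv z)\<^sup>2 + gsq u z))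
      \<le> exp (- (189/100 * R\<^sup>2)) * (8 * H\<^sup>2 * Z * exp (7/4 * R\<^sup>2))" by (intro mult_left_mono) auto
  moreover have "exp (- (189/100 * R\<^sup>2)) * (exp (189/100 * R\<^sup>2) * I) = I" for I
    unfolding mult.assoc[symmetric] exp_add[symmetric] by simp
  ultimately have "lint L (\<lambda>z. (u Jv z)\<^sup>2 + gsq u z) \<le> 8 * H\<^sup>2 * Z * (exp (- (189/100 * R\<^sup>2)) * exp (7/4 * R\<^sup>2))"
    by (simp only: mult.commute mult.left_commute)
  also have "\<dots> \<le> 8 * H\<^sup>2 * Z * exp (- (R\<^sup>2 / 10))"
  proof (rule mult_left_mono)
    have "exp (- (189/100 * R\<^sup>2)) * exp (7/4 * R\<^sup>2) = exp (- (14/100 * R\<^sup>2))" unfolding exp_add[symmetric] by simp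
    then show "exp (- (189/100 * R\<^sup>2)) * exp (7/4 * R\<^sup>2) \<le> exp (- (R\<^sup>2 / 10))" by simp
    have "0 \<le> Z" using Z[of 1] lint_nonneg[of "{1..1/lam} \<times> cball c (3/4 * R)" "\<lambda>z. (u Jv z)\<^sup>2 + gsq u z"] by simp
    then show "0 \<le> 8 * H\<^sup>2 * Z" by simp
  qed
  finally show ?thesis by (simp add: L_def H_def)
qed

text \<open>The constant is fixed before \<open>u\<close>, the centre and the radius. The total mass
  is at most \<open>A0 * R^2\<close> by \<open>local_energy\<close>. For R \<ge> 1 the Carleman
  argument applies; for R < 1 the factor e^(-R^2/10) is bounded below, so the mass bound already has
  the required form.\<close>

lemma gaussian_decay:
  fixes C lam T M \<rho> :: real
  assumes C: "0 \<le> C" and lam: "16 + 4 * (6 * C\<^sup>2 + 1) \<le> lam" and T: "0 < T" "4 \<le> lam * T" and rho: "0 < \<rho>"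
  obtains A where "0 \<le> A" "\<And>u c R e. \<rho> \<le> R \<Longrightarrow> solves C ({0<..<T} \<times> ball c R) u \<Longrightarrow>
    (\<And>z. z \<in> {0<..<T} \<times> ball c R \<Longrightarrow> \<bar>u Jv z\<bar> \<le> M) \<Longrightarrow>
    (\<And>e. 0 < e \<Longrightarrow> \<exists>d>0. \<forall>z\<in>{0<..<T} \<times> ball c R. fst z < d \<longrightarrow> \<bar>u Jv z\<bar> \<le> e) \<Longrightarrow> 0 < e \<Longrightarrow>
    lint ({e..1/(20 * lam)} \<times> cball c (R/10)) (\<lambda>z. (u Jv z)\<^sup>2 + gsq u z) \<le> A * R\<^sup>2 * exp (- (R\<^sup>2 / 10))"
proof -
  define T1 where "T1 = 1 / lam"
  have lam0: "0 < lam" using lam by (smt (verit) zero_le_power2)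
  have T1: "0 < T1" "2 * T1 < T" using lam0 T by (auto simp: T1_def field_simps)
  define A0 where "A0 = M\<^sup>2 * (4 * T1) + 2 * (C + C\<^sup>2 + 4 * (1200 / \<rho>)\<^sup>2 + 60 / T1) * (M\<^sup>2 * (8 * T1))"
  have A0: "0 \<le> A0" using C T1 by (simp add: A0_def)
  define H where "H = 8 * (120 * lam + 5000 + 768 * C)\<^sup>2"
  have H: "0 \<le> H" by (simp add: H_def)
  show thesis
  proof (rule that[of "(H + 2) * A0"])
    show "0 \<le> (H + 2) * A0" using A0 H by simp
    fix u c R and e :: real
    assume R: "\<rho> \<le> R" and u: "solves C ({0<..<T} \<times> ball c R) u" and M: "\<And>z. z \<in> {0<..<T} \<times> ball c R \<Longrightarrow> \<bar>u Jv z\<bar> \<le> M"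
      and u0: "\<And>e. 0 < e \<Longrightarrow> \<exists>d>0. \<forall>z\<in>{0<..<T} \<times> ball c R. fst z < d \<longrightarrow> \<bar>u Jv z\<bar> \<le> e" and e: "0 < e"
    have R0: "0 < R" using R rho by linarith
    define U where "U = {0<..<T} \<times> ball c R"
    have uC: "C12 U u" using u by (simp add: solves_def U_def)
    have Z: "lint ({e..T1} \<times> cball c (3/4 * R)) (\<lambda>z. (u Jv z)\<^sup>2 + gsq u z) \<le> A0 * R\<^sup>2" if e: "0 < e" for e
    proof (cases "e \<le> T1")
      case True
      define K where "K = {e..T1} \<times> cball c (3/4 * R)"
      have K: "compact K" "K \<subseteq> U" using e T1 R0 by (auto simp: K_def U_def compact_Times)
      note cU = continuous_on_subset[OF _ K(2)]
      have c1: "continuous_on K (\<lambda>z. (u Jv z)\<^sup>2)" by (rule cU) (intro continuous_intros C12D[OF uC])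
      have c2: "continuous_on K (gsq u)" by (rule cU) (intro continuous_gsq uC)
      have "lint K (\<lambda>z. (u Jv z)\<^sup>2) \<le> M\<^sup>2 * ((T1 - 0) * (4 * R\<^sup>2))"
      proof (rule lint_le_const[where c=c, OF K(1) _ c1])
        show "(u Jv z)\<^sup>2 \<le> M\<^sup>2" if "z \<in> K" for z using power_mono[OF M[of z], of 2] that K by (auto simp: U_def)
      qed (use e R0 T1 in \<open>auto simp: K_def\<close>)
      moreover have "lint K (gsq u) \<le> 2 * (C + C\<^sup>2 + 4 * (1200 / \<rho>)\<^sup>2 + 60 / T1) * (M\<^sup>2 * (8 * T1)) * R\<^sup>2"
        unfolding K_def by (rule local_energy[OF rho R T1 C u M e])
      ultimately have "lint K (\<lambda>z. (u Jv z)\<^sup>2 + gsq u z) \<le> A0 * R\<^sup>2"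
        unfolding lint_add[OF K(1) c1 c2] A0_def distrib_right by (simp add: mult_ac)
      then show ?thesis by (simp add: K_def)
    qed (use A0 in \<open>simp add: lint_def cut_def\<close>)
    have ex0: "0 \<le> A0 * R\<^sup>2 * exp (- (R\<^sup>2 / 10))" using A0 by simp
    show "lint ({e..1/(20 * lam)} \<times> cball c (R/10)) (\<lambda>z. (u Jv z)\<^sup>2 + gsq u z) \<le> (H + 2) * A0 * R\<^sup>2 * exp (- (R\<^sup>2 / 10))"
    proof (cases "1 \<le> R")
      case True
      have "lint ({e..1/(20 * lam)} \<times> cball c (R/10)) (\<lambda>z. (u Jv z)\<^sup>2 + gsq u z)
         \<le> 8 * (120 * lam + 5000 + 768 * C)\<^sup>2 * (A0 * R\<^sup>2) * exp (- (R\<^sup>2 / 10))"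
        by (rule gaussian_decay_large[OF C lam T True u Z[unfolded T1_def] u0 e])
      also have "\<dots> = H * (A0 * R\<^sup>2 * exp (- (R\<^sup>2 / 10)))" by (simp add: H_def)
      also have "\<dots> \<le> (H + 2) * (A0 * R\<^sup>2 * exp (- (R\<^sup>2 / 10)))" using ex0 by (intro mult_right_mono) auto
      finally show ?thesis by (simp add: mult.assoc)
    next
      case False
      then have "R\<^sup>2 \<le> 1" using R0 by (simp add: power_le_one)
      then have ex: "1 \<le> 2 * exp (- (R\<^sup>2 / 10))" using exp_ge_add_one_self[of "- (R\<^sup>2 / 10)"] by simp
      have "lint ({e..1/(20 * lam)} \<times> cball c (R/10)) (\<lambda>z. (u Jv z)\<^sup>2 + gsq u z)
         \<le> lint ({e..T1} \<times> cball c (3/4 * R)) (\<lambda>z. (u Jv z)\<^sup>2 + gsq u z)"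
      proof (rule lint_mono_sets)
        have "1 / (20 * lam) \<le> T1" using lam0 by (simp add: T1_def field_simps)
        then show "z \<in> {e..T1} \<times> cball c (3/4 * R) \<and> (u Jv z)\<^sup>2 + gsq u z \<le> (u Jv z)\<^sup>2 + gsq u z"
          if "z \<in> {e..1/(20 * lam)} \<times> cball c (R/10)" for z using that R0 by auto
        have c: "continuous_on U (\<lambda>z. (u Jv z)\<^sup>2 + gsq u z)" by (intro continuous_intros C12D[OF uC] continuous_gsq uC)
        show "continuous_on ({e..1/(20 * lam)} \<times> cball c (R/10)) (\<lambda>z. (u Jv z)\<^sup>2 + gsq u z)"
          by (rule continuous_on_subset[OF c]) (use e R0 T1 \<open>1 / (20 * lam) \<le> T1\<close> in \<open>auto simp: U_def\<close>)
        show "continuous_on ({e..T1} \<times> cball c (3/4 * R)) (\<lambda>z. (u Jv z)\<^sup>2 + gsq u z)"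
          by (rule continuous_on_subset[OF c]) (use e R0 T1 in \<open>auto simp: U_def\<close>)
      qed (auto simp: compact_Times)
      also have "\<dots> \<le> A0 * R\<^sup>2 * 1" using Z[OF e] by simp
      also have "\<dots> \<le> A0 * R\<^sup>2 * (2 * exp (- (R\<^sup>2 / 10)))" using A0 ex by (intro mult_left_mono) auto
      also have "\<dots> = 2 * (A0 * R\<^sup>2 * exp (- (R\<^sup>2 / 10)))" by simp
      also have "\<dots> \<le> (H + 2) * (A0 * R\<^sup>2 * exp (- (R\<^sup>2 / 10)))" using ex0 H by (intro mult_right_mono) auto
      finally show ?thesis by (simp add: mult.assoc)
    qed
  qed
qed

section \<open>The profile of the conical weight\<close>

primrec peval :: "int list \<Rightarrow> real \<Rightarrow> real" where
  "peval [] x = 0"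
| "peval (a # as) x = of_int a + x * peval as x"

fun padd :: "int list \<Rightarrow> int list \<Rightarrow> int list" where
  "padd [] bs = bs"
| "padd (a # as) [] = a # as"
| "padd (a # as) (b # bs) = (a + b) # padd as bs"

definition psmul :: "int \<Rightarrow> int list \<Rightarrow> int list" where "psmul c as = map ((*) c) as"

primrec pmul :: "int list \<Rightarrow> int list \<Rightarrow> int list" where
  "pmul [] bs = []"
| "pmul (a # as) bs = padd (psmul a bs) (0 # pmul as bs)"

primrec pder_from :: "int \<Rightarrow> int list \<Rightarrow> int list" where
  "pder_from k [] = []"
| "pder_from k (a # as) = k * a # pder_from (k + 1) as"

definition pder :: "int list \<Rightarrow> int list" where "pder as = pder_from 1 (tl as)"

lemma peval_padd [simp]: "peval (padd as bs) x = peval as x + peval bs x"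
  by (induction as bs rule: padd.induct) (simp_all add: algebra_simps)

lemma peval_psmul [simp]: "peval (psmul c as) x = of_int c * peval as x"
  by (induction as) (simp_all add: psmul_def algebra_simps)

lemma peval_pmul [simp]: "peval (pmul as bs) x = peval as x * peval bs x"
  by (induction as) (simp_all add: algebra_simps)

lemma DERIV_peval: "(peval as has_real_derivative peval (pder as) x) (at x)"
proof -
  have nil: "peval [] = (\<lambda>x. 0)" by (rule ext) simp
  have *: "((\<lambda>x. peval as x) has_real_derivative peval (pder as) x) (at x)
     \<and> peval (pder_from (k + 1) as) x = of_int (k + 1) * peval as x + x * peval (pder as) x" for k
  proof (induction as arbitrary: k)
    case (Cons a as)
    have e: "peval (pder_from (k + 1) as) x = of_int (k + 1) * peval as x + x * peval (pder as) x" for k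
      using Cons.IH by blast
    have "((\<lambda>x. of_int a + x * peval as x) has_real_derivative 0 + (1 * peval as x + peval (pder as) x * x)) (at x)"
      using Cons.IH by (intro DERIV_add DERIV_const DERIV_mult DERIV_ident) auto
    moreover have "peval (pder (a # as)) x = peval as x + x * peval (pder as) x"
      using e[of 0] by (simp add: pder_def)
    ultimately show ?case using e[of "k + 1"] by (simp add: algebra_simps)
  qed (simp_all add: pder_def nil)
  then show ?thesis by blast
qed

lemma continuous_on_peval: "continuous_on S (peval as)"
  using DERIV_peval by (intro DERIV_continuous_on) (auto intro: has_field_derivative_at_within)

text \<open>The coefficients of \<open>(d (1 + w))\<^sup>n p ((a + b w) / (d (1 + w)))\<close>, paired with those of \<open>(d (1 + w))\<^sup>n\<close>;
  if they are positive, then so is \<open>p\<close> on \<open>[a / d, b / d)\<close>.\<close>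
primrec moebius :: "int \<Rightarrow> int \<Rightarrow> int \<Rightarrow> int list \<Rightarrow> int list \<times> int list" where
  "moebius a b d [] = ([], [1])"
| "moebius a b d (c # cs) = (let (q, w) = moebius a b d cs; w' = pmul [d, d] w in (padd (psmul c w') (pmul [a, b] q), w'))"

lemma moebius:
  assumes "0 < d" "0 \<le> w" "u * (of_int d * (1 + w)) = of_int a + of_int b * w"
  shows "0 < peval (snd (moebius a b d cs)) w \<and> peval (fst (moebius a b d cs)) w = peval (snd (moebius a b d cs)) w * peval cs u"
proof (induction cs)
  case (Cons c cs)
  obtain q v where qv: "moebius a b d cs = (q, v)" by fastforce
  have d: "0 < of_int d * (1 + w)" using assms by simp
  have IH: "0 < peval v w" "peval q w = peval v w * peval cs u" using Cons.IH qv by auto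
  have s: "peval (snd (moebius a b d (c # cs))) w = (of_int d * (1 + w)) * peval v w"
    by (simp add: qv Let_def algebra_simps)
  have "peval (fst (moebius a b d (c # cs))) w = of_int c * ((of_int d * (1 + w)) * peval v w) + (of_int a + of_int b * w) * peval q w"
    by (simp add: qv Let_def algebra_simps)
  also have "\<dots> = ((of_int d * (1 + w)) * peval v w) * (of_int c + u * peval cs u)"
    unfolding assms(3)[symmetric] IH(2) by (simp add: algebra_simps)
  finally show ?case using s IH(1) d by simp
qed auto

lemma peval_pos: "list_all (\<lambda>c. 0 < c) cs \<Longrightarrow> cs \<noteq> [] \<Longrightarrow> 0 \<le> w \<Longrightarrow> 0 < peval cs w"
proof (induction cs)
  case (Cons c cs)
  then have "0 \<le> peval cs w" by (cases "cs = []") (auto intro: less_imp_le)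
  then show ?case using Cons.prems by (auto intro!: add_pos_nonneg)
qed simp

definition pos_cert :: "int \<Rightarrow> int \<Rightarrow> int \<Rightarrow> int list \<Rightarrow> bool" where
  "pos_cert a b d cs \<longleftrightarrow> (let q = fst (moebius a b d cs) in q \<noteq> [] \<and> list_all (\<lambda>c. 0 < c) q)"

lemma pos_cert:
  assumes "pos_cert a b d cs" "0 < d" "of_int a / of_int d \<le> u" "u < of_int b / of_int d"
  shows "0 < peval cs u"
proof -
  \<comment> \<open>The inverse of the substitution u = (a + b w) / (d (1 + w)); it maps [a/d, b/d)
    onto [0, \<infinity>).\<close>
  define w where "w = (of_int d * u - of_int a) / (of_int b - of_int d * u)"
  have d: "0 < real_of_int d" using assms(2) by simp
  have p: "0 \<le> of_int d * u - of_int a" "0 < of_int b - of_int d * u"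
    using assms d by (auto simp: field_simps)
  then have w: "0 \<le> w" by (simp add: w_def)
  have "u * (of_int d * (1 + w)) = of_int a + of_int b * w"
    using p by (simp add: w_def field_simps)
  note m = moebius[OF assms(2) w this, of cs]
  have "0 < peval (fst (moebius a b d cs)) w"
    using assms(1) w by (intro peval_pos) (auto simp: pos_cert_def Let_def)
  then show ?thesis using m zero_less_mult_pos by fastforce
qed

definition cP :: "int list" where "cP = [1000, -992, 290, -347, 370, -263, 106, -18]"
definition cM :: "int list" where "cM = [3980, -6947, 21047, -42108, 48640, -29252, 7067]"
definition cP1 :: "int list" where "cP1 = pder cP"
definition cP2 :: "int list" where "cP2 = pder cP1"

text \<open>\<open>cP\<close> and \<open>cM\<close> are \<open>1000 P\<close> and \<open>1000 \<mu>\<close> in the variable \<open>u = s\<^sup>2\<close>, fitted numerically to the extremal weight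
  (the solution of \<open>\<lambda>\<^sub>m\<^sub>i\<^sub>n (H) + H (W, W) / \<bar>W\<bar>\<^sup>2 = 0\<close>). The following lists carry the factors \<open>10\<^sup>1\<^sup>1\<close> for \<open>H\<close> and \<open>\<mu>\<close>
  and \<open>10\<^sup>7\<close> for \<open>W\<close>; the exponent is \<open>\<kappa> = 19999 / 10000\<close>.\<close>
definition cH22 :: "int list" where "cH22 = psmul 100000000 (padd (psmul 2 cP1) (0 # psmul 4 cP2))"
definition cH11 :: "int list" where "cH11 = padd (padd (psmul (19999 * 9999) cP) (0 # psmul (-4 * 10000 * 9999) cP1)) (0 # cH22)"
definition ch12 :: "int list" where "ch12 = padd (psmul (2 * 9999 * 10000) cP1) (psmul (-1) cH22)"
definition cW1 :: "int list" where "cW1 = padd (psmul 19999 cP) (0 # psmul (-20000) cP1)"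
definition cw2 :: "int list" where "cw2 = psmul 20000 cP1"
definition cm :: "int list" where "cm = psmul 100000000 cM"
definition cWW :: "int list" where "cWW = padd (pmul cW1 cW1) (0 # pmul cw2 cw2)"
definition certA :: "int list" where
  "certA = padd (psmul 2 (padd (pmul cH11 (pmul cW1 cW1)) (padd (0 # psmul 2 (pmul ch12 (pmul cW1 cw2))) (0 # pmul cH22 (pmul cw2 cw2)))))
     (psmul (-1) (pmul cm cWW))"
definition certD :: "int list" where "certD = padd (psmul 2 cH11) cm"
definition certB :: "int list" where "certB = padd (pmul certD (padd (psmul 2 cH22) cm)) (0 # psmul (-4) (pmul ch12 ch12))"
definition certC :: "int list" where "certC = padd (psmul 2 cWW) (psmul (-100000000) (pmul cM cP))"

text \<open>The interval [0, 6/5) contains the square of every slope up to \<open>sig\<close>, since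
  \<open>sig^2\<close> is about 1.1901. Positivity of all coefficients is a sufficient condition
  that becomes weaker on shorter intervals; hence the subdivision at 1/5 and 2/5 for
  \<open>certA\<close> and at 1 for \<open>certB\<close>.\<close>

lemma cert_list:
  shows "pos_cert 0 1 5 certA" "pos_cert 1 2 5 certA" "pos_cert 2 6 5 certA"
    "pos_cert 0 5 5 certB" "pos_cert 5 6 5 certB" "pos_cert 0 6 5 certC" "pos_cert 0 6 5 certD"
  by code_simp+

lemma pos_cert_6_5:
  assumes "0 \<le> u" "u < 6/5"
  shows "0 < peval certA u" "0 < peval certB u" "0 < peval certC u" "0 < peval certD u"
proof -
  have "u < 1/5 \<or> (1/5 \<le> u \<and> u < 2/5) \<or> 2/5 \<le> u" by linarith
  then show "0 < peval certA u"
    using assms pos_cert[OF cert_list(1), of u] pos_cert[OF cert_list(2), of u] pos_cert[OF cert_list(3), of u] by auto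
  have "u < 1 \<or> 1 \<le> u" by linarith
  then show "0 < peval certB u"
    using assms pos_cert[OF cert_list(4), of u] pos_cert[OF cert_list(5), of u] by auto
  show "0 < peval certC u" "0 < peval certD u"
    using assms pos_cert[OF cert_list(6), of u] pos_cert[OF cert_list(7), of u] by auto
qed

section \<open>The profile and the four inequalities\<close>

definition kap :: real where "kap = 19999/10000"
text \<open>A rational slope slightly below tan 47.5\<degree> = 1.0913... . The slope 1.091, used
  for the sectors inside the domain, lies strictly in between and leaves room around the closed
  sector of slope \<open>sig\<close>.\<close>

definition sig :: real where "sig = 10909/10000"
definition prP :: "real \<Rightarrow> real" where "prP s = peval cP (s\<^sup>2) / 1000"
definition prP1 :: "real \<Rightarrow> real" where "prP1 s = 2 * s * peval cP1 (s\<^sup>2) / 1000"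
definition prP2 :: "real \<Rightarrow> real" where "prP2 s = (2 * peval cP1 (s\<^sup>2) + 4 * s\<^sup>2 * peval cP2 (s\<^sup>2)) / 1000"
definition prmu :: "real \<Rightarrow> real" where "prmu s = peval cM (s\<^sup>2) / 1000"
text \<open>\<open>H11\<close>, \<open>H12\<close>, \<open>H22\<close> and \<open>W1\<close>,
  \<open>W2\<close> are the Hessian and the gradient of x1^\<kappa> P(x2 / x1), after division by
  x1^(\<kappa> - 2) and by x1^(\<kappa> - 1).\<close>

definition H11 :: "real \<Rightarrow> real" where "H11 s = kap * (kap - 1) * prP s - 2 * (kap - 1) * s * prP1 s + s\<^sup>2 * prP2 s"
definition H12 :: "real \<Rightarrow> real" where "H12 s = (kap - 1) * prP1 s - s * prP2 s"
definition H22 :: "real \<Rightarrow> real" where "H22 s = prP2 s"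
definition W1 :: "real \<Rightarrow> real" where "W1 s = kap * prP s - s * prP1 s"
definition W2 :: "real \<Rightarrow> real" where "W2 s = prP1 s"
definition cN :: "int list" where "cN = padd (padd cH11 cH22) cm"
text \<open>The trace of the Hessian plus \<open>prmu\<close>. This is the profile of m + \<Delta>f,
  the function whose gradient occurs in the Carleman inequality.\<close>

definition nu :: "real \<Rightarrow> real" where "nu s = peval cN (s\<^sup>2) / 10^11"
definition nu1 :: "real \<Rightarrow> real" where "nu1 s = 2 * s * peval (pder cN) (s\<^sup>2) / 10^11"

lemma kap_bounds: "1 < kap" "kap < 2" by (simp_all add: kap_def)
lemma sig_bounds: "0 < sig" "sig < 1091/1000" by (simp_all add: sig_def)

lemma DERIV_peval_sq: "((\<lambda>s. peval c (s\<^sup>2)) has_real_derivative 2 * s * peval (pder c) (s\<^sup>2)) (at s)"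
proof -
  have "((\<lambda>s. s\<^sup>2) has_real_derivative 2 * s) (at s)" by (auto intro!: derivative_eq_intros)
  from DERIV_chain2[OF DERIV_peval this] show ?thesis by (simp add: mult_ac)
qed

lemma DERIV_prP: "(prP has_real_derivative prP1 s) (at s)"
  unfolding prP_def[abs_def] prP1_def cP1_def by (intro DERIV_cdivide DERIV_peval_sq)

lemma DERIV_prP1: "(prP1 has_real_derivative prP2 s) (at s)"
proof -
  have "((\<lambda>s. (2 * s) * peval cP1 (s\<^sup>2)) has_real_derivative (2 * 1) * peval cP1 (s\<^sup>2) + (2 * s * peval cP2 (s\<^sup>2)) * (2 * s)) (at s)"
    unfolding cP2_def by (intro DERIV_mult DERIV_cmult DERIV_ident DERIV_peval_sq)
  from DERIV_cdivide[OF this, of 1000] show ?thesis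
    unfolding prP1_def[abs_def] prP2_def by (simp add: algebra_simps power2_eq_square)
qed

lemma DERIV_nu: "(nu has_real_derivative nu1 s) (at s)"
  unfolding nu_def[abs_def] nu1_def by (intro DERIV_cdivide DERIV_peval_sq)

lemma continuous_peval_sq: "continuous_on S (\<lambda>s. peval c (s\<^sup>2))"
  by (rule continuous_on_compose2[OF continuous_on_peval[of UNIV]]) (auto intro!: continuous_intros)

lemma continuous_profile:
  "continuous_on S prP" "continuous_on S prP1" "continuous_on S prP2" "continuous_on S prmu" "continuous_on S nu" "continuous_on S nu1"
  unfolding prP_def[abs_def] prP1_def[abs_def] prP2_def[abs_def] prmu_def[abs_def] nu_def[abs_def] nu1_def[abs_def]
  by (intro continuous_intros continuous_peval_sq; simp)+

lemma continuous_HW: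
  "continuous_on S H11" "continuous_on S H12" "continuous_on S H22" "continuous_on S W1" "continuous_on S W2"
  unfolding H11_def[abs_def] H12_def[abs_def] H22_def[abs_def] W1_def[abs_def] W2_def[abs_def]
  by (intro continuous_intros continuous_profile)+

lemma prP_0: "0 < prP 0" by (simp add: prP_def cP_def)

lemma prP_sig: "prP sig \<le> 0" "prP (- sig) \<le> 0"
  by (simp_all add: prP_def cP_def sig_def power_divide)

lemma H_scaled:
  "H11 s = peval cH11 (s\<^sup>2) / 10^11" "H12 s = s * peval ch12 (s\<^sup>2) / 10^11" "H22 s = peval cH22 (s\<^sup>2) / 10^11"
  "W1 s = peval cW1 (s\<^sup>2) / 10^7" "W2 s = s * peval cw2 (s\<^sup>2) / 10^7" "prmu s = peval cm (s\<^sup>2) / 10^11"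
  by (simp_all add: H11_def H12_def H22_def W1_def W2_def prmu_def cH11_def ch12_def cH22_def cW1_def cw2_def cm_def
      prP_def prP1_def prP2_def kap_def field_simps power2_eq_square)

lemma nu_eq: "nu s = H11 s + H22 s + prmu s"
  by (simp add: nu_def cN_def H_scaled add_divide_distrib)

text \<open>The first inequality says \<mu> < 2 H(W, W) / |W|^2. The next two say that 2 H + \<mu>
  is positive definite, that is, \<mu> > -2 \<lambda>_min(H). A suitable \<mu> exists only where
  \<lambda>_min(H) + H(W, W) / |W|^2 > 0, whose limiting case defines the extremal weight. The
  fourth inequality is for the terms produced by the time derivative of the weight.\<close>

lemma profile_pos:
  assumes "\<bar>s\<bar> \<le> sig"
  shows "0 < 4 * (H11 s * (W1 s)\<^sup>2 + 2 * H12 s * W1 s * W2 s + H22 s * (W2 s)\<^sup>2) - 2 * prmu s * ((W1 s)\<^sup>2 + (W2 s)\<^sup>2)" (is "0 < ?a")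
    "0 < (4 * H11 s + 2 * prmu s) * (4 * H22 s + 2 * prmu s) - (4 * H12 s)\<^sup>2" (is "0 < ?b")
    "0 < 4 * H11 s + 2 * prmu s" (is "0 < ?d")
    "0 < 4 * ((W1 s)\<^sup>2 + (W2 s)\<^sup>2) - 2 * prmu s * prP s" (is "0 < ?c")
proof -
  define u where "u = s\<^sup>2"
  have "u \<le> sig\<^sup>2" using power_mono[OF assms, of 2] by (simp add: u_def)
  then have u: "0 \<le> u" "u < 6/5" by (auto simp: sig_def u_def power2_eq_square)
  note pc = pos_cert_6_5[OF u]
  have s2: "s * s = u" by (simp add: u_def power2_eq_square)
  have a: "?a = 2 * (peval certA u / 10^25)"
    unfolding H_scaled u_def[symmetric] certA_def cWW_def
    by (simp add: field_simps power2_eq_square) (simp add: s2[symmetric] algebra_simps)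
  have b: "?b = 4 * (peval certB u / 10^22)"
    unfolding H_scaled u_def[symmetric] certB_def certD_def
    by (simp add: field_simps power2_eq_square) (simp add: s2[symmetric] algebra_simps)
  have c: "?c = 2 * (peval certC u / 10^14)"
    unfolding H_scaled(1-5) prP_def prmu_def u_def[symmetric] certC_def cWW_def
    by (simp add: field_simps power2_eq_square) (simp add: s2[symmetric] algebra_simps)
  have d: "?d = 2 * (peval certD u / 10^11)"
    unfolding H_scaled u_def[symmetric] certD_def by simp
  show "0 < ?a" unfolding a using pc(1) by simp
  show "0 < ?b" unfolding b using pc(2) by simp
  show "0 < ?c" unfolding c using pc(3) by simp
  show "0 < ?d" unfolding d using pc(4) by simp
qed

text \<open>By Cayley-Hamilton, (tr M) M - (det M) I = M^2 for a symmetric 2 x 2 matrix M; with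
  positive trace and determinant this bounds the quadratic form below by det M / tr M. In
  coordinates this is \<open>id\<close>.\<close>

lemma pos_def_2:
  fixes a b c d x y :: real
  assumes "a + c \<le> t" "0 < t" "d \<le> a * c - b\<^sup>2" "0 < a + c" "0 \<le> d"
  shows "d / t * (x\<^sup>2 + y\<^sup>2) \<le> a * x\<^sup>2 + 2 * b * x * y + c * y\<^sup>2"
proof -
  define Q where "Q = a * x\<^sup>2 + 2 * b * x * y + c * y\<^sup>2"
  have id: "(a + c) * Q - (a * c - b\<^sup>2) * (x\<^sup>2 + y\<^sup>2) = (a * x + b * y)\<^sup>2 + (b * x + c * y)\<^sup>2"
    unfolding Q_def by algebra
  have "d * (x\<^sup>2 + y\<^sup>2) \<le> (a * c - b\<^sup>2) * (x\<^sup>2 + y\<^sup>2)" using assms by (intro mult_right_mono) auto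
  also have "\<dots> \<le> (a + c) * Q" using id sum_power2_ge_zero[of "a * x + b * y" "b * x + c * y"] by linarith
  finally have 1: "d * (x\<^sup>2 + y\<^sup>2) \<le> (a + c) * Q" .
  have "0 \<le> (a + c) * Q" by (rule order_trans[OF _ 1]) (use assms in simp)
  then have "0 \<le> Q" using assms by (simp add: zero_le_mult_iff)
  then have "(a + c) * Q \<le> t * Q" using assms by (intro mult_right_mono)
  then have "d * (x\<^sup>2 + y\<^sup>2) \<le> t * Q" using 1 by linarith
  then show ?thesis using assms(2) by (simp add: Q_def field_simps)
qed

lemma pos_lower_bound:
  fixes f :: "real \<Rightarrow> real"
  assumes "continuous_on UNIV f" "\<And>s. \<bar>s\<bar> \<le> sig \<Longrightarrow> 0 < f s"
  obtains e where "0 < e" "\<And>s. \<bar>s\<bar> \<le> sig \<Longrightarrow> e \<le> f s"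
proof -
  have "\<exists>x\<in>{-sig..sig}. \<forall>y\<in>{-sig..sig}. f x \<le> f y"
    by (rule continuous_attains_inf) (use sig_bounds in \<open>auto intro: continuous_on_subset[OF assms(1)]\<close>)
  then obtain x where x: "x \<in> {-sig..sig}" "\<forall>y\<in>{-sig..sig}. f x \<le> f y" by blast
  have mem: "\<bar>s\<bar> \<le> sig \<longleftrightarrow> s \<in> {-sig..sig}" for s by auto
  show ?thesis by (rule that[of "f x"]) (use x assms(2) mem in auto)
qed

lemma profile_bound:
  fixes f :: "real \<Rightarrow> real"
  assumes "continuous_on UNIV f"
  obtains b where "0 \<le> b" "\<And>s. \<bar>s\<bar> \<le> sig \<Longrightarrow> \<bar>f s\<bar> \<le> b"
proof -
  have "compact (f ` {-sig..sig})" by (intro compact_continuous_image continuous_on_subset[OF assms]) auto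
  then have "bounded (f ` {-sig..sig})" by (rule compact_imp_bounded)
  then obtain b where b: "\<forall>x\<in>f ` {-sig..sig}. norm x \<le> b" unfolding bounded_iff by blast
  have mem: "\<bar>s\<bar> \<le> sig \<longleftrightarrow> s \<in> {-sig..sig}" for s by auto
  have "\<bar>f s\<bar> \<le> max b 0" if "\<bar>s\<bar> \<le> sig" for s using b that unfolding mem by (force simp: le_max_iff_disj)
  then show ?thesis by (intro that[of "max b 0"]) auto
qed

text \<open>The strict inequalities of \<open>profile_pos\<close> hold on a compact interval of
  slopes and therefore with a common margin. For the gradient the margin is stated as
  \<open>2 * \<delta>\<close>, because one half of it will absorb the cross terms with the gradient
  of \<open>N\<close>.\<close>

lemma profile_constants:
  obtains \<delta> b where "0 < \<delta>" "1 \<le> b"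
    "\<And>s. \<bar>s\<bar> \<le> sig \<Longrightarrow> \<delta> \<le> 4 * (H11 s * (W1 s)\<^sup>2 + 2 * H12 s * W1 s * W2 s + H22 s * (W2 s)\<^sup>2) - 2 * prmu s * ((W1 s)\<^sup>2 + (W2 s)\<^sup>2)"
    "\<And>s. \<bar>s\<bar> \<le> sig \<Longrightarrow> \<delta> \<le> 4 * ((W1 s)\<^sup>2 + (W2 s)\<^sup>2) - 2 * prmu s * prP s"
    "\<And>s x y. \<bar>s\<bar> \<le> sig \<Longrightarrow> 2 * \<delta> * (x\<^sup>2 + y\<^sup>2) \<le> 4 * (H11 s * x\<^sup>2 + 2 * H12 s * x * y + H22 s * y\<^sup>2) + 2 * prmu s * (x\<^sup>2 + y\<^sup>2)"
    "\<And>s. \<bar>s\<bar> \<le> sig \<Longrightarrow> \<bar>prP s\<bar> \<le> b" "\<And>s. \<bar>s\<bar> \<le> sig \<Longrightarrow> \<bar>prmu s\<bar> \<le> b"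
    "\<And>s. \<bar>s\<bar> \<le> sig \<Longrightarrow> \<bar>W1 s\<bar> \<le> b" "\<And>s. \<bar>s\<bar> \<le> sig \<Longrightarrow> \<bar>W2 s\<bar> \<le> b"
    "\<And>s. \<bar>s\<bar> \<le> sig \<Longrightarrow> \<bar>nu s\<bar> \<le> b" "\<And>s. \<bar>s\<bar> \<le> sig \<Longrightarrow> \<bar>nu1 s\<bar> \<le> b"
    "\<And>s. \<bar>s\<bar> \<le> sig \<Longrightarrow> \<bar>H11 s\<bar> \<le> b" "\<And>s. \<bar>s\<bar> \<le> sig \<Longrightarrow> \<bar>H22 s\<bar> \<le> b"
proof -
  note cc = continuous_HW continuous_profile
  have c1: "continuous_on UNIV (\<lambda>s. 4 * (H11 s * (W1 s)\<^sup>2 + 2 * H12 s * W1 s * W2 s + H22 s * (W2 s)\<^sup>2) - 2 * prmu s * ((W1 s)\<^sup>2 + (W2 s)\<^sup>2))" by (intro continuous_intros cc)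
  have c4: "continuous_on UNIV (\<lambda>s. 4 * ((W1 s)\<^sup>2 + (W2 s)\<^sup>2) - 2 * prmu s * prP s)" by (intro continuous_intros cc)
  have c2: "continuous_on UNIV (\<lambda>s. (4 * H11 s + 2 * prmu s) * (4 * H22 s + 2 * prmu s) - (4 * H12 s)\<^sup>2)" by (intro continuous_intros cc)
  have ct: "continuous_on UNIV (\<lambda>s. (4 * H11 s + 2 * prmu s) + (4 * H22 s + 2 * prmu s))" by (intro continuous_intros cc)
  obtain d1 where d1: "0 < d1" "\<And>s. \<bar>s\<bar> \<le> sig \<Longrightarrow> d1 \<le> 4 * (H11 s * (W1 s)\<^sup>2 + 2 * H12 s * W1 s * W2 s + H22 s * (W2 s)\<^sup>2) - 2 * prmu s * ((W1 s)\<^sup>2 + (W2 s)\<^sup>2)"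
    by (rule pos_lower_bound[OF c1 profile_pos(1)]) (assumption | rule that)+
  obtain d2 where d2: "0 < d2" "\<And>s. \<bar>s\<bar> \<le> sig \<Longrightarrow> d2 \<le> 4 * ((W1 s)\<^sup>2 + (W2 s)\<^sup>2) - 2 * prmu s * prP s"
    by (rule pos_lower_bound[OF c4 profile_pos(4)]) (assumption | rule that)+
  obtain d3 where d3: "0 < d3" "\<And>s. \<bar>s\<bar> \<le> sig \<Longrightarrow> d3 \<le> (4 * H11 s + 2 * prmu s) * (4 * H22 s + 2 * prmu s) - (4 * H12 s)\<^sup>2"
    by (rule pos_lower_bound[OF c2 profile_pos(2)]) (assumption | rule that)+
  obtain t where t: "0 \<le> t" "\<And>s. \<bar>s\<bar> \<le> sig \<Longrightarrow> \<bar>(4 * H11 s + 2 * prmu s) + (4 * H22 s + 2 * prmu s)\<bar> \<le> t"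
    by (rule profile_bound[OF ct]) blast
  obtain b1 where b1: "0 \<le> b1" "\<And>s. \<bar>s\<bar> \<le> sig \<Longrightarrow> \<bar>prP s\<bar> \<le> b1" using profile_bound[OF cc(6)] by blast
  obtain b2 where b2: "0 \<le> b2" "\<And>s. \<bar>s\<bar> \<le> sig \<Longrightarrow> \<bar>prmu s\<bar> \<le> b2" using profile_bound[OF cc(9)] by blast
  obtain b3 where b3: "0 \<le> b3" "\<And>s. \<bar>s\<bar> \<le> sig \<Longrightarrow> \<bar>W1 s\<bar> \<le> b3" using profile_bound[OF cc(4)] by blast
  obtain b4 where b4: "0 \<le> b4" "\<And>s. \<bar>s\<bar> \<le> sig \<Longrightarrow> \<bar>W2 s\<bar> \<le> b4" using profile_bound[OF cc(5)] by blast
  obtain b5 where b5: "0 \<le> b5" "\<And>s. \<bar>s\<bar> \<le> sig \<Longrightarrow> \<bar>nu s\<bar> \<le> b5" using profile_bound[OF cc(10)] by blast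
  obtain b6 where b6: "0 \<le> b6" "\<And>s. \<bar>s\<bar> \<le> sig \<Longrightarrow> \<bar>nu1 s\<bar> \<le> b6" using profile_bound[OF cc(11)] by blast
  obtain b7 where b7: "0 \<le> b7" "\<And>s. \<bar>s\<bar> \<le> sig \<Longrightarrow> \<bar>H11 s\<bar> \<le> b7" using profile_bound[OF cc(1)] by blast
  obtain b8 where b8: "0 \<le> b8" "\<And>s. \<bar>s\<bar> \<le> sig \<Longrightarrow> \<bar>H22 s\<bar> \<le> b8" using profile_bound[OF cc(3)] by blast
  define b where "b = 1 + b1 + b2 + b3 + b4 + b5 + b6 + b7 + b8"
  define \<delta> where "\<delta> = min (min d1 d2) (d3 / (t + 1) / 2)"
  show thesis
  proof (rule that[of \<delta> b])
    show "0 < \<delta>" using d1 d2 d3 t by (simp add: \<delta>_def)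
    show "1 \<le> b" using b1 b2 b3 b4 b5 b6 b7 b8 by (simp add: b_def)
    fix s assume s: "\<bar>s\<bar> \<le> sig"
    show "\<delta> \<le> 4 * (H11 s * (W1 s)\<^sup>2 + 2 * H12 s * W1 s * W2 s + H22 s * (W2 s)\<^sup>2) - 2 * prmu s * ((W1 s)\<^sup>2 + (W2 s)\<^sup>2)"
      using d1(2)[OF s] by (simp add: \<delta>_def)
    show "\<delta> \<le> 4 * ((W1 s)\<^sup>2 + (W2 s)\<^sup>2) - 2 * prmu s * prP s" using d2(2)[OF s] by (simp add: \<delta>_def)
    show "\<bar>prP s\<bar> \<le> b" "\<bar>prmu s\<bar> \<le> b" "\<bar>W1 s\<bar> \<le> b" "\<bar>W2 s\<bar> \<le> b" "\<bar>nu s\<bar> \<le> b" "\<bar>nu1 s\<bar> \<le> b" "\<bar>H11 s\<bar> \<le> b" "\<bar>H22 s\<bar> \<le> b"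
      using b1(1) b2(1) b3(1) b4(1) b5(1) b6(1) b7(1) b8(1)
        b1(2)[OF s] b2(2)[OF s] b3(2)[OF s] b4(2)[OF s] b5(2)[OF s] b6(2)[OF s] b7(2)[OF s] b8(2)[OF s] by (simp_all add: b_def)
    show "2 * \<delta> * (x\<^sup>2 + y\<^sup>2) \<le> 4 * (H11 s * x\<^sup>2 + 2 * H12 s * x * y + H22 s * y\<^sup>2) + 2 * prmu s * (x\<^sup>2 + y\<^sup>2)" for x y
    proof -
      have det: "0 < (4 * H11 s + 2 * prmu s) * (4 * H22 s + 2 * prmu s)"
        using profile_pos(2)[OF s] zero_le_power2[of "4 * H12 s"] by linarith
      then have "0 < 4 * H22 s + 2 * prmu s" using profile_pos(3)[OF s] zero_less_mult_pos by blast
      then have "d3 / (t + 1) * (x\<^sup>2 + y\<^sup>2) \<le> (4 * H11 s + 2 * prmu s) * x\<^sup>2 + 2 * (4 * H12 s) * x * y + (4 * H22 s + 2 * prmu s) * y\<^sup>2"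
        using d3(1) d3(2)[OF s] t(1) t(2)[OF s] profile_pos(3)[OF s] by (intro pos_def_2) auto
      moreover have "2 * \<delta> * (x\<^sup>2 + y\<^sup>2) \<le> d3 / (t + 1) * (x\<^sup>2 + y\<^sup>2)"
      proof (rule mult_right_mono)
        have "\<delta> \<le> d3 / (t + 1) / 2" unfolding \<delta>_def by (rule min.cobounded2)
        moreover have "2 * x \<le> y" if "x \<le> y / 2" for x y :: real using that by simp
        ultimately show "2 * \<delta> \<le> d3 / (t + 1)" by blast
      qed simp
      ultimately show ?thesis by (simp add: algebra_simps)
    qed
  qed
qed

section \<open>The conical weight\<close>

definition xpos :: "pt set" where "xpos = {z. 0 < snd z $ 1}"

definition slope :: "pt \<Rightarrow> real" where "slope z = snd z $ 2 / snd z $ 1"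

text \<open>A function homogeneous of degree \<open>r\<close> on the half-plane x1 > 0 is recorded
  by its profile in the slope. A space derivative lowers the degree by one and acts on the profile
  through ordinary derivatives.\<close>

definition hom :: "real \<Rightarrow> (real \<Rightarrow> real) \<Rightarrow> pt \<Rightarrow> real" where
  "hom r F z = (snd z $ 1) powr r * F (slope z)"

lemma continuous_slope: "continuous_on xpos slope"
  unfolding slope_def[abs_def] xpos_def by (intro continuous_intros) auto

lemma continuous_hom: "continuous_on UNIV F \<Longrightarrow> continuous_on xpos (hom r F)"
  unfolding hom_def[abs_def]
  by (intro continuous_intros continuous_on_compose2[OF _ continuous_slope, of UNIV]) (auto simp: xpos_def)

lemma has_pd_hom_x:
  assumes "\<And>s. (F has_real_derivative F' s) (at s)"
  shows "has_pd dX xpos (hom r F) (hom (r - 1) (\<lambda>s. r * F s - s * F' s))"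
  unfolding has_pd_def
proof
  fix z assume "z \<in> xpos"
  then have x: "0 < snd z $ 1" by (simp add: xpos_def)
  define x y where "x = snd z $ 1" and "y = snd z $ 2"
  have x0: "0 < x" using x by (simp add: x_def)
  have q: "((\<lambda>s. y / (x + s)) has_real_derivative - y / x\<^sup>2) (at 0)"
    using x0 by (auto intro!: derivative_eq_intros simp: power2_eq_square)
  have p: "((\<lambda>s. (x + s) powr r) has_real_derivative r * x powr (r - 1)) (at 0)"
    using x0 by (auto intro!: derivative_eq_intros)
  have "((\<lambda>s. F (y / (x + s))) has_real_derivative F' (y / (x + 0)) * (- y / x\<^sup>2)) (at 0)"
    by (rule DERIV_chain2[OF assms q])
  from DERIV_mult[OF p this] have "((\<lambda>s. (x + s) powr r * F (y / (x + s))) has_real_derivative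
     r * x powr (r - 1) * F (y / x) + (F' (y / x) * (- y / x\<^sup>2)) * x powr r) (at 0)" by simp
  moreover have "r * x powr (r - 1) * F (y / x) + (F' (y / x) * (- y / x\<^sup>2)) * x powr r = hom (r - 1) (\<lambda>s. r * F s - s * F' s) z"
    using x0 by (simp add: hom_def slope_def x_def[symmetric] y_def[symmetric] powr_diff power2_eq_square field_simps)
  ultimately show "((\<lambda>s. hom r F (z + s *\<^sub>R dX)) has_real_derivative hom (r - 1) (\<lambda>s. r * F s - s * F' s) z) (at 0)"
    by (simp add: hom_def slope_def x_def y_def)
qed

lemma has_pd_hom_y:
  assumes "\<And>s. (F has_real_derivative F' s) (at s)"
  shows "has_pd dY xpos (hom r F) (hom (r - 1) F')"
  unfolding has_pd_def
proof
  fix z assume "z \<in> xpos"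
  then have x: "0 < snd z $ 1" by (simp add: xpos_def)
  define x y where "x = snd z $ 1" and "y = snd z $ 2"
  have x0: "0 < x" using x by (simp add: x_def)
  have q: "((\<lambda>s. (y + s) / x) has_real_derivative 1 / x) (at 0)"
    by (rule DERIV_cdivide) (auto intro!: derivative_eq_intros)
  have "((\<lambda>s. F ((y + s) / x)) has_real_derivative F' ((y + 0) / x) * (1 / x)) (at 0)"
    by (rule DERIV_chain2[OF assms q])
  from DERIV_cmult[OF this, of "x powr r"] have "((\<lambda>s. x powr r * F ((y + s) / x)) has_real_derivative x powr r * (F' (y / x) * (1 / x))) (at 0)" by simp
  moreover have "x powr r * (F' (y / x) * (1 / x)) = hom (r - 1) F' z"
    using x0 by (simp add: hom_def slope_def x_def[symmetric] y_def[symmetric] powr_diff)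
  ultimately show "((\<lambda>s. hom r F (z + s *\<^sub>R dY)) has_real_derivative hom (r - 1) F' z) (at 0)"
    by (simp add: hom_def slope_def x_def y_def)
qed

lemma has_pd_hom_t: "has_pd dT V (hom r F) (\<lambda>z. 0)"
  by (simp add: has_pd_def hom_def slope_def)

definition jPsi :: "ix \<Rightarrow> pt \<Rightarrow> real" where
  "jPsi i = (case i of Jv \<Rightarrow> hom kap prP | Jt \<Rightarrow> (\<lambda>z. 0) | Jx \<Rightarrow> hom (kap - 1) W1 | Jy \<Rightarrow> hom (kap - 1) W2
     | Jxx \<Rightarrow> hom (kap - 2) H11 | Jxy \<Rightarrow> hom (kap - 2) H12 | Jyy \<Rightarrow> hom (kap - 2) H22)"

lemma jPsi_simps: "jPsi Jv = hom kap prP" "jPsi Jt = (\<lambda>z. 0)" "jPsi Jx = hom (kap - 1) W1" "jPsi Jy = hom (kap - 1) W2"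
   "jPsi Jxx = hom (kap - 2) H11" "jPsi Jxy = hom (kap - 2) H12" "jPsi Jyy = hom (kap - 2) H22"
  by (simp_all add: jPsi_def)

lemma DERIV_W1: "(W1 has_real_derivative H12 s) (at s)"
proof -
  have "(W1 has_real_derivative kap * prP1 s - (1 * prP1 s + prP2 s * s)) (at s)"
    unfolding W1_def[abs_def] by (intro DERIV_diff DERIV_cmult DERIV_mult DERIV_ident DERIV_prP DERIV_prP1)
  then show ?thesis by (simp add: H12_def algebra_simps)
qed

lemma DERIV_W2: "(W2 has_real_derivative H22 s) (at s)"
  using DERIV_prP1 by (simp add: W2_def[abs_def] H22_def)

lemma C12_jPsi: "C12 xpos jPsi"
proof -
  have c: "continuous_on xpos (jPsi i)" for i
    by (cases i; simp only: jPsi_simps; intro continuous_hom continuous_HW continuous_profile continuous_on_const)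
  have 1: "(\<lambda>s. kap * prP s - s * W2 s) = W1" by (auto simp: W1_def W2_def)
  have 2: "(\<lambda>s. (kap - 1) * W1 s - s * H12 s) = H11" by (auto simp: W1_def H11_def H12_def algebra_simps power2_eq_square)
  have 3: "(\<lambda>s. (kap - 1) * W2 s - s * H22 s) = H12" by (auto simp: W2_def H12_def H22_def)
  have 4: "prP1 = W2" by (auto simp: W2_def)
  have k: "kap - 1 - 1 = kap - 2" by simp
  show ?thesis unfolding C12_def jPsi_simps
    using has_pd_hom_t has_pd_hom_x[OF DERIV_prP, of kap] has_pd_hom_y[OF DERIV_prP, of kap]
      has_pd_hom_x[OF DERIV_W1, of "kap - 1"] has_pd_hom_y[OF DERIV_W1, of "kap - 1"]
      has_pd_hom_x[OF DERIV_W2, of "kap - 1"] has_pd_hom_y[OF DERIV_W2, of "kap - 1"] c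
    unfolding 4 k 1 2 3 by blast
qed

text \<open>Two squares are completed: the part \<open>\<delta> * A\<close> of the gradient form is
  spent, and a multiple of c^2 with \<delta> in the denominator is left to be dominated.\<close>

lemma cross_term:
  fixes \<delta> A X z1 z2 a b c :: real
  assumes "0 < \<delta>" "0 < A" "0 < X" "z1\<^sup>2 + z2\<^sup>2 \<le> Z"
  shows "- (\<delta> * A * (a\<^sup>2 + b\<^sup>2)) - A * Z / (\<delta> * X\<^sup>2) * c\<^sup>2 \<le> 2 * c * (A / X * z1 * a + A / X * z2 * b)"
proof -
  have "0 \<le> (\<delta> * X * a + c * z1)\<^sup>2 + (\<delta> * X * b + c * z2)\<^sup>2" by simp
  also have "\<dots> = \<delta>\<^sup>2 * X\<^sup>2 * (a\<^sup>2 + b\<^sup>2) + 2 * \<delta> * X * c * (z1 * a + z2 * b) + c\<^sup>2 * (z1\<^sup>2 + z2\<^sup>2)" by algebra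
  also have "\<dots> \<le> \<delta>\<^sup>2 * X\<^sup>2 * (a\<^sup>2 + b\<^sup>2) + 2 * \<delta> * X * c * (z1 * a + z2 * b) + c\<^sup>2 * Z"
    using assms(4) by (intro add_left_mono mult_left_mono) auto
  finally have "0 \<le> A / (\<delta> * X\<^sup>2) * (\<delta>\<^sup>2 * X\<^sup>2 * (a\<^sup>2 + b\<^sup>2) + 2 * \<delta> * X * c * (z1 * a + z2 * b) + c\<^sup>2 * Z)"
    using assms by (intro mult_nonneg_nonneg) auto
  also have "\<dots> = \<delta> * A * (a\<^sup>2 + b\<^sup>2) + 2 * c * (A / X * z1 * a + A / X * z2 * b) + A * Z / (\<delta> * X\<^sup>2) * c\<^sup>2"
    using assms by (simp add: power2_eq_square field_simps)
  finally show ?thesis by linarith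
qed

text \<open>Here \<open>A = a \<eta> x\<^sup>\<kappa>\<^sup>-\<^sup>2\<close> and \<open>\<beta> = -\<eta>' / \<eta>\<close>; then \<open>Y\<close> is the weight itself.\<close>
lemma cone_quad_pos:
  fixes \<delta> bd A X \<beta> \<Lambda> B h11 h12 h22 w1 w2 mu p z1 z2 a b c Y k :: real
  assumes d: "0 < \<delta>" "1 \<le> bd" "1 \<le> B"
    and pa: "\<delta> \<le> 4 * (h11 * w1\<^sup>2 + 2 * h12 * w1 * w2 + h22 * w2\<^sup>2) - 2 * mu * (w1\<^sup>2 + w2\<^sup>2)"
    and pc: "\<delta> \<le> 4 * (w1\<^sup>2 + w2\<^sup>2) - 2 * mu * p"
    and pb: "2 * \<delta> * (a\<^sup>2 + b\<^sup>2) \<le> 4 * (h11 * a\<^sup>2 + 2 * h12 * a * b + h22 * b\<^sup>2) + 2 * mu * (a\<^sup>2 + b\<^sup>2)"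
    and bnd: "\<bar>mu\<bar> \<le> bd" "\<bar>w1\<bar> \<le> bd" "\<bar>w2\<bar> \<le> bd" "0 < p" "p \<le> bd" "z1\<^sup>2 + z2\<^sup>2 \<le> Z" "0 \<le> Z"
    and pos: "0 < A" "0 < X" and Y: "Y = A * X\<^sup>2 * p" "k \<le> Y"
    and L: "\<Lambda> \<le> \<beta>" "4 * B * bd\<^sup>2 \<le> \<Lambda> * \<delta>" "2 * B \<le> \<Lambda>"
    and k: "1 \<le> k" "4 * bd^3 \<le> \<delta> * k" "bd * (2 * Z + 1) \<le> \<delta> * k"
  shows "B * (a\<^sup>2 + b\<^sup>2 + (1 + A\<^sup>2 * X\<^sup>2 * (w1\<^sup>2 + w2\<^sup>2)) * c\<^sup>2)
    \<le> 4 * (A * h11 * a\<^sup>2 + 2 * (A * h12) * a * b + A * h22 * b\<^sup>2)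
      + 2 * (A * mu + B / 2) * (a\<^sup>2 + b\<^sup>2) + 2 * c * (A / X * z1 * a + A / X * z2 * b)
      + c\<^sup>2 * (\<Lambda> * \<beta> * Y + 4 * \<beta> * A\<^sup>2 * X\<^sup>2 * (w1\<^sup>2 + w2\<^sup>2)
          + 4 * A^3 * X\<^sup>2 * (h11 * w1\<^sup>2 + 2 * h12 * w1 * w2 + h22 * w2\<^sup>2)
          - 2 * (A * mu + B / 2) * (A\<^sup>2 * X\<^sup>2 * (w1\<^sup>2 + w2\<^sup>2) + \<beta> * Y) - (A * mu + B / 2)\<^sup>2)"
proof -
  define G where "G = A\<^sup>2 * X\<^sup>2"
  define w where "w = w1\<^sup>2 + w2\<^sup>2"
  have G: "0 < G" using pos by (simp add: G_def)
  have w: "0 \<le> w" "w \<le> 2 * bd\<^sup>2"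
    using power_mono[OF bnd(2), of 2] power_mono[OF bnd(3), of 2] by (auto simp: w_def)
  have Lp: "0 < \<Lambda>" "0 < \<beta>" using L d by linarith+
  have Y1: "1 \<le> Y" using k Y by linarith
  \<comment> \<open>The weight is \<open>Y = V * p\<close> with \<open>p \<le> bd\<close>. A lower
    bound \<open>k\<close> for the weight thus makes \<open>V\<close> large, which is the source of
    \<open>V1\<close> and \<open>V2\<close>.\<close>
  define V where "V = A * X\<^sup>2"
  have V0: "0 < V" using pos by (simp add: V_def)
  have "k \<le> V * bd"
  proof -
    have "V * p \<le> V * bd" using V0 bnd by (intro mult_left_mono) auto
    then show ?thesis using Y by (simp add: V_def)
  qed
  then have dk: "\<delta> * k \<le> \<delta> * (V * bd)" using d by (intro mult_left_mono) auto
  have V1: "4 * bd\<^sup>2 \<le> \<delta> * V"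
  proof -
    have "bd * (4 * bd\<^sup>2) \<le> bd * (\<delta> * V)" using order_trans[OF k(2) dk] by (simp add: power3_eq_cube power2_eq_square algebra_simps)
    then show ?thesis using d by simp
  qed
  have V2: "2 * Z + 1 \<le> \<delta> * V"
  proof -
    have "bd * (2 * Z + 1) \<le> bd * (\<delta> * V)" using order_trans[OF k(3) dk] by (simp add: algebra_simps)
    then show ?thesis using d by simp
  qed
  have t1: "4 * (A\<^sup>2 * bd\<^sup>2) \<le> G * A * \<delta>"
  proof -
    have "A\<^sup>2 * (4 * bd\<^sup>2) \<le> A\<^sup>2 * (\<delta> * V)" using V1 by (intro mult_left_mono) auto
    then show ?thesis by (simp add: G_def V_def power2_eq_square algebra_simps)
  qed
  have t2: "2 * (A * Z / (\<delta> * X\<^sup>2)) \<le> G * A * \<delta>"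
  proof -
    have "2 * Z \<le> (2 * Z + 1)\<^sup>2" using bnd(7) by (simp add: power2_eq_square algebra_simps)
    also have "\<dots> \<le> (\<delta> * V)\<^sup>2" using V2 bnd(7) by (intro power_mono) auto
    finally have "A / (\<delta> * X\<^sup>2) * (2 * Z) \<le> A / (\<delta> * X\<^sup>2) * (\<delta> * V)\<^sup>2"
      using pos d by (intro mult_left_mono) auto
    also have "\<dots> = G * A * \<delta>" using pos d by (simp add: G_def V_def power2_eq_square field_simps)
    finally show ?thesis by (simp add: mult.left_commute)
  qed
  have t3: "2 * (B * G * w) \<le> \<beta> * G * \<delta>"
  proof -
    have "2 * B * w \<le> 2 * B * (2 * bd\<^sup>2)" using w d by (intro mult_left_mono) auto
    also have "\<dots> \<le> \<Lambda> * \<delta>" using L by simp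
    also have "\<dots> \<le> \<beta> * \<delta>" using L d by (intro mult_right_mono) auto
    finally have "G * (2 * B * w) \<le> G * (\<beta> * \<delta>)" using G by (intro mult_left_mono) auto
    then show ?thesis by (simp add: algebra_simps)
  qed
  have t4: "B * \<beta> * Y + (B\<^sup>2 / 2 + B) \<le> \<Lambda> * \<beta> * Y"
  proof -
    have bY: "2 * B \<le> \<beta> * Y"
    proof -
      have "2 * B * 1 \<le> \<beta> * Y" using L d Y1 by (intro mult_mono) auto
      then show ?thesis by simp
    qed
    have half: "x / 2 + y \<le> 2 * x" if "y \<le> x" "0 \<le> y" for x y :: real using that by simp
    have "B * B / 2 + B \<le> 2 * (B * B)" by (rule half) (use d in auto)
    then have "B\<^sup>2 / 2 + B \<le> B * (2 * B)" by (simp add: power2_eq_square)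
    also have "\<dots> \<le> B * (\<beta> * Y)" using bY d by (intro mult_left_mono) auto
    finally have "B * \<beta> * Y + (B\<^sup>2 / 2 + B) \<le> 2 * B * (\<beta> * Y)" by (simp add: algebra_simps)
    also have "\<dots> \<le> \<Lambda> * (\<beta> * Y)" using L(3) bY d by (intro mult_right_mono) auto
    finally show ?thesis by (simp add: algebra_simps)
  qed
  have t5: "(A * mu + B / 2)\<^sup>2 \<le> 2 * (A\<^sup>2 * bd\<^sup>2) + B\<^sup>2 / 2"
  proof -
    have "(A * mu + B / 2)\<^sup>2 \<le> 2 * ((A * mu)\<^sup>2 + (B / 2)\<^sup>2)" by (rule sq_sum2_le)
    moreover have "(A * mu)\<^sup>2 \<le> A\<^sup>2 * bd\<^sup>2"
      using power_mono[OF bnd(1), of 2] by (simp add: power_mult_distrib mult_left_mono)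
    ultimately show ?thesis by (simp add: power_divide)
  qed
  define T where "T = \<Lambda> * \<beta> * Y + 4 * \<beta> * A\<^sup>2 * X\<^sup>2 * w
          + 4 * A^3 * X\<^sup>2 * (h11 * w1\<^sup>2 + 2 * h12 * w1 * w2 + h22 * w2\<^sup>2)
          - 2 * (A * mu + B / 2) * (A\<^sup>2 * X\<^sup>2 * w + \<beta> * Y) - (A * mu + B / 2)\<^sup>2"
  have T1: "T = G * A * (4 * (h11 * w1\<^sup>2 + 2 * h12 * w1 * w2 + h22 * w2\<^sup>2) - 2 * mu * w)
      + \<beta> * G * (4 * w - 2 * mu * p) + \<Lambda> * \<beta> * Y - B * G * w - B * \<beta> * Y - (A * mu + B / 2)\<^sup>2"
    unfolding T_def G_def Y by (simp add: power2_eq_square power3_eq_cube algebra_simps)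
  have T2: "G * A * \<delta> \<le> G * A * (4 * (h11 * w1\<^sup>2 + 2 * h12 * w1 * w2 + h22 * w2\<^sup>2) - 2 * mu * w)"
    using pa G pos by (intro mult_left_mono) (auto simp: w_def)
  have T3: "\<beta> * G * \<delta> \<le> \<beta> * G * (4 * w - 2 * mu * p)"
    using pc G Lp by (intro mult_left_mono) (auto simp: w_def)
  \<comment> \<open>The budget. \<open>G * A * \<delta>\<close> pays in two halves for the square of
    \<open>A * mu\<close> and for the remainder of the cross term.
    \<open>\<beta> * G * \<delta>\<close> pays twice for \<open>B * G * w\<close>, which is demanded
    by the conclusion and also arises from the summand \<open>B / 2\<close> of m.
    \<open>\<Lambda> * \<beta> * Y\<close> pays for \<open>B * \<beta> * Y\<close> and the
    constants.\<close>
  have lin: "B' + e + x2 \<le> T'" if "T' = ga + bg + y - e - by' - q'" "ga' \<le> ga" "bg' \<le> bg" "4 * x1 \<le> ga'" "2 * x2 \<le> ga'"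
     "2 * e \<le> bg'" "by' + (B2 / 2 + B') \<le> y" "q' \<le> 2 * x1 + B2 / 2" for B' e x1 x2 T' ga bg y by' q' ga' bg' B2 :: real
    using that by linarith
  have "B + B * G * w + A * Z / (\<delta> * X\<^sup>2) \<le> T"
    by (rule lin[OF T1 T2 T3 t1 t2 t3 t4 t5])
  then have T: "B * (1 + G * w) + A * Z / (\<delta> * X\<^sup>2) \<le> T" by (simp add: algebra_simps)
  have cr: "- (\<delta> * A * (a\<^sup>2 + b\<^sup>2)) - A * Z / (\<delta> * X\<^sup>2) * c\<^sup>2 \<le> 2 * c * (A / X * z1 * a + A / X * z2 * b)"
    by (rule cross_term[OF d(1) pos bnd(6)])
  have gr: "\<delta> * A * (a\<^sup>2 + b\<^sup>2) + B * (a\<^sup>2 + b\<^sup>2) \<le> 4 * (A * h11 * a\<^sup>2 + 2 * (A * h12) * a * b + A * h22 * b\<^sup>2) + 2 * (A * mu + B / 2) * (a\<^sup>2 + b\<^sup>2)"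
  proof -
    have "A * (2 * \<delta> * (a\<^sup>2 + b\<^sup>2)) \<le> A * (4 * (h11 * a\<^sup>2 + 2 * h12 * a * b + h22 * b\<^sup>2) + 2 * mu * (a\<^sup>2 + b\<^sup>2))"
      using pb pos by (intro mult_left_mono) auto
    moreover have "0 \<le> \<delta> * A * (a\<^sup>2 + b\<^sup>2)" using pos d by simp
    moreover have "A * (4 * (h11 * a\<^sup>2 + 2 * h12 * a * b + h22 * b\<^sup>2) + 2 * mu * (a\<^sup>2 + b\<^sup>2)) + B * (a\<^sup>2 + b\<^sup>2)
      = 4 * (A * h11 * a\<^sup>2 + 2 * (A * h12) * a * b + A * h22 * b\<^sup>2) + 2 * (A * mu + B / 2) * (a\<^sup>2 + b\<^sup>2)"
      by (simp add: algebra_simps)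
    moreover have "A * (2 * \<delta> * (a\<^sup>2 + b\<^sup>2)) = \<delta> * A * (a\<^sup>2 + b\<^sup>2) + \<delta> * A * (a\<^sup>2 + b\<^sup>2)" by (simp add: algebra_simps)
    ultimately show ?thesis by linarith
  qed
  have "c\<^sup>2 * (B * (1 + G * w) + A * Z / (\<delta> * X\<^sup>2)) \<le> c\<^sup>2 * T" using T by (intro mult_left_mono) auto
  then have "B * (1 + G * w) * c\<^sup>2 + A * Z / (\<delta> * X\<^sup>2) * c\<^sup>2 \<le> c\<^sup>2 * T" by (simp add: algebra_simps)
  moreover have "B * (a\<^sup>2 + b\<^sup>2 + (1 + G * w) * c\<^sup>2) = B * (a\<^sup>2 + b\<^sup>2) + B * (1 + G * w) * c\<^sup>2" by (simp add: algebra_simps)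
  ultimately show ?thesis unfolding w_def[symmetric] G_def[symmetric] T_def[unfolded G_def[symmetric], symmetric]
    using cr gr T_def G_def by (simp only: )
qed

section \<open>Decay on dyadic shells of the sector\<close>

lemma lint_cover:
  assumes I: "finite I" and K: "compact K" "continuous_on K h" and A: "\<And>i. i \<in> I \<Longrightarrow> compact (A i)" "\<And>i. i \<in> I \<Longrightarrow> continuous_on (A i) (g i)"
    and cov: "\<And>z. z \<in> K \<Longrightarrow> \<exists>i\<in>I. z \<in> A i \<and> h z \<le> g i z" and nn: "\<And>i z. i \<in> I \<Longrightarrow> z \<in> A i \<Longrightarrow> 0 \<le> g i z"
  shows "lint K h \<le> (\<Sum>i\<in>I. lint (A i) (g i))"
proof -
  have "lint K h \<le> (LINT z|lborel. (\<Sum>i\<in>I. cut (A i) (g i) z))"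
    unfolding lint_def
  proof (rule integral_mono)
    show "integrable lborel (cut K h)" by (rule integrable_cut[OF K])
    show "integrable lborel (\<lambda>z. \<Sum>i\<in>I. cut (A i) (g i) z)"
      by (intro Bochner_Integration.integrable_sum integrable_cut A)
    fix z
    have n: "0 \<le> cut (A i) (g i) z" if "i \<in> I" for i using nn[OF that] by (simp add: cut_def)
    show "cut K h z \<le> (\<Sum>i\<in>I. cut (A i) (g i) z)"
    proof (cases "z \<in> K")
      case True
      then obtain i where i: "i \<in> I" "z \<in> A i" "h z \<le> g i z" using cov by blast
      then have "cut K h z \<le> cut (A i) (g i) z" using True by (simp add: cut_def)
      also have "\<dots> \<le> (\<Sum>i\<in>I. cut (A i) (g i) z)" using i(1) I n by (intro member_le_sum) auto
      finally show ?thesis .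
    qed (use n in \<open>simp add: cut_def sum_nonneg\<close>)
  qed
  also have "\<dots> = (\<Sum>i\<in>I. lint (A i) (g i))"
    unfolding lint_def by (intro Bochner_Integration.integral_sum integrable_cut A)
  finally show ?thesis .
qed

definition open_sector :: "real \<Rightarrow> (real^2) set" where "open_sector m = {x. \<bar>x $ 2\<bar> < m * x $ 1}"

lemma open_sector_open: "open (open_sector m)"
  unfolding open_sector_def by (intro open_Collect_less continuous_intros)

definition annulus :: "real \<Rightarrow> (real^2) set" where
  "annulus r = {x. \<bar>x $ 2\<bar> \<le> sig * x $ 1 \<and> r \<le> norm x \<and> norm x \<le> 2 * r}"

lemma compact_annulus: "compact (annulus r)"
proof -
  have "closed {x::real^2. \<bar>x $ 2\<bar> \<le> sig * x $ 1}" "closed {x::real^2. r \<le> norm x}"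
    by (intro closed_Collect_le continuous_intros)+
  moreover have "annulus r = ({x. \<bar>x $ 2\<bar> \<le> sig * x $ 1} \<inter> {x. r \<le> norm x}) \<inter> cball 0 (2 * r)"
    by (auto simp: annulus_def)
  ultimately show ?thesis by (simp add: closed_Int_compact closed_Int)
qed

text \<open>Relative radius of the balls in which the Gaussian decay is applied. The slopes 1.0909
  and 1.091 differ by 1/10000, and |x| \<le> 2.1 x1 in the sector, so a ball of radius
  \<open>wid * |x|\<close> about a point of slope at most \<open>sig\<close> stays within slope
  1.091.\<close>

definition wid :: real where "wid = 1/100000"

lemma norm_le_open_sector: "\<bar>x $ 2\<bar> \<le> sig * x $ 1 \<Longrightarrow> norm x \<le> (21/10) * x $ 1" for x :: "real^2"
  using norm_le_l1_cart[of x] by (simp add: sum_2 sig_def)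

lemma ball_subset_open_sector:
  assumes c: "\<bar>c $ 2\<bar> \<le> sig * c $ 1" and r: "r \<le> norm c" "0 < r"
  shows "ball c (wid * r) \<subseteq> open_sector (1091/1000)"
proof
  fix x assume "x \<in> ball c (wid * r)"
  then have n: "norm (x - c) < wid * r" by (simp add: dist_norm norm_minus_commute)
  have w: "wid * r \<le> wid * ((21/10) * c $ 1)" using r norm_le_open_sector[OF c] by (simp add: wid_def)
  have "\<bar>x $ 1 - c $ 1\<bar> < wid * r" "\<bar>x $ 2 - c $ 2\<bar> < wid * r" using abs_coord_le[of x _ c] n by (meson le_less_trans)+
  then have "c $ 1 - wid * r < x $ 1" "\<bar>x $ 2\<bar> < \<bar>c $ 2\<bar> + wid * r" by linarith+
  moreover have "b < 1091/1000 * a" if "c1 - h < a" "b < c2 + h" "h \<le> 1/100000 * ((21/10) * c1)" "c2 \<le> 10909/10000 * c1" "0 < c1" for a b c1 c2 h :: real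
    using that by linarith
  moreover have "0 < c $ 1" using norm_le_open_sector[OF c] r by linarith
  ultimately show "x \<in> open_sector (1091/1000)" using w c unfolding open_sector_def wid_def sig_def by blast
qed

lemma solves_mono: "solves C U u \<Longrightarrow> V \<subseteq> U \<Longrightarrow> solves C V u"
  unfolding solves_def C12_def by (auto intro: has_pd_subset continuous_on_subset)

text \<open>The shell of size 1 is covered once by finitely many balls of radius
  \<open>wid / 10\<close>, and the cover is then scaled by \<open>r\<close>. The number of balls
  does not depend on \<open>r\<close>, so the decay on balls gives the decay on every shell with one
  constant.\<close>

lemma annulus_decay:
  fixes C lam T M rho :: real
  assumes C: "0 \<le> C" and lam: "16 + 4 * (6 * C\<^sup>2 + 1) \<le> lam" and T: "0 < T" "4 \<le> lam * T" and rho: "0 < rho"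
  obtains A where "0 \<le> A" "\<And>u r e. rho \<le> r \<Longrightarrow> solves C ({0<..<T} \<times> open_sector (1091/1000)) u \<Longrightarrow>
    (\<And>z. z \<in> {0<..<T} \<times> open_sector (1091/1000) \<Longrightarrow> \<bar>u Jv z\<bar> \<le> M) \<Longrightarrow>
    (\<And>k e. 0 < e \<Longrightarrow> \<exists>d>0. \<forall>z\<in>{0<..<T} \<times> (open_sector (1091/1000) \<inter> cball 0 k). fst z < d \<longrightarrow> \<bar>u Jv z\<bar> \<le> e) \<Longrightarrow> 0 < e \<Longrightarrow>
    lint ({e..1/(20 * lam)} \<times> annulus r) (\<lambda>z. (u Jv z)\<^sup>2 + gsq u z) \<le> A * (r\<^sup>2 * exp (- (wid\<^sup>2 / 10 * r\<^sup>2)))"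
proof -
  have w0: "0 < wid" by (simp add: wid_def)
  obtain A where A: "0 \<le> A" "\<And>u c R e. wid * rho \<le> R \<Longrightarrow> solves C ({0<..<T} \<times> ball c R) u \<Longrightarrow>
    (\<And>z. z \<in> {0<..<T} \<times> ball c R \<Longrightarrow> \<bar>u Jv z\<bar> \<le> M) \<Longrightarrow>
    (\<And>e. 0 < e \<Longrightarrow> \<exists>d>0. \<forall>z\<in>{0<..<T} \<times> ball c R. fst z < d \<longrightarrow> \<bar>u Jv z\<bar> \<le> e) \<Longrightarrow> 0 < e \<Longrightarrow>
    lint ({e..1/(20 * lam)} \<times> cball c (R/10)) (\<lambda>z. (u Jv z)\<^sup>2 + gsq u z) \<le> A * R\<^sup>2 * exp (- (R\<^sup>2 / 10))"
    using gaussian_decay[OF C lam T mult_pos_pos[OF w0 rho], of M] by blast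
  have "\<exists>F\<subseteq>annulus 1. finite F \<and> annulus 1 \<subseteq> (\<Union>c\<in>F. ball c (wid/10))"
    by (rule compactE_image[OF compact_annulus[of 1], of "annulus 1" "\<lambda>c. ball c (wid/10)"])
      (use w0 in \<open>auto intro: exI\<close>)
  then obtain F where F: "F \<subseteq> annulus 1" "finite F" "annulus 1 \<subseteq> (\<Union>c\<in>F. ball c (wid/10))" by blast
  show thesis
  proof (rule that[of "real (card F) * (A * wid\<^sup>2)"])
    show "0 \<le> real (card F) * (A * wid\<^sup>2)" using A by simp
    fix u r and e :: real
    assume r: "rho \<le> r" and u: "solves C ({0<..<T} \<times> open_sector (1091/1000)) u"
      and M: "\<And>z. z \<in> {0<..<T} \<times> open_sector (1091/1000) \<Longrightarrow> \<bar>u Jv z\<bar> \<le> M"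
      and u0: "\<And>k e. 0 < e \<Longrightarrow> \<exists>d>0. \<forall>z\<in>{0<..<T} \<times> (open_sector (1091/1000) \<inter> cball 0 k). fst z < d \<longrightarrow> \<bar>u Jv z\<bar> \<le> e"
      and e: "0 < e"
    have r0: "0 < r" using r rho by linarith
    have lam0: "0 < lam" using lam by (smt (verit) zero_le_power2)
    have lT: "1/(20 * lam) < T" using lam0 T by (simp add: field_simps)
    define v where "v z = (u Jv z)\<^sup>2 + gsq u z" for z
    have uC: "C12 ({0<..<T} \<times> open_sector (1091/1000)) u" using u by (simp add: solves_def)
    have cv: "continuous_on ({0<..<T} \<times> open_sector (1091/1000)) v"
      unfolding v_def[abs_def] by (intro continuous_intros continuous_gsq uC C12D[OF uC])
    have v0: "0 \<le> v z" for z by (simp add: v_def)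
    have sub: "ball (r *\<^sub>R c) (wid * r) \<subseteq> open_sector (1091/1000)" if "c \<in> F" for c
    proof (rule ball_subset_open_sector)
      have c: "\<bar>c $ 2\<bar> \<le> sig * c $ 1" "1 \<le> norm c" using F(1) that by (auto simp: annulus_def)
      have "r * \<bar>c $ 2\<bar> \<le> r * (sig * c $ 1)" using c r0 by (intro mult_left_mono) auto
      then show "\<bar>(r *\<^sub>R c) $ 2\<bar> \<le> sig * (r *\<^sub>R c) $ 1" using r0 by (simp add: abs_mult mult.left_commute)
      show "r \<le> norm (r *\<^sub>R c)" using c r0 by simp
    qed (rule r0)
    have ann: "x \<in> open_sector (1091/1000)" if "x \<in> annulus r" for x
    proof -
      have "\<bar>x $ 2\<bar> \<le> sig * x $ 1" "r \<le> norm x" using that by (auto simp: annulus_def)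
      moreover from this have "x \<in> ball x (wid * r)" using r0 w0 by simp
      ultimately show ?thesis using ball_subset_open_sector r0 by blast
    qed
    have "lint ({e..1/(20 * lam)} \<times> annulus r) v \<le> (\<Sum>c\<in>F. lint ({e..1/(20 * lam)} \<times> cball (r *\<^sub>R c) (wid * r / 10)) v)"
    proof (rule lint_cover[OF F(2)])
      show "compact ({e..1/(20 * lam)} \<times> annulus r)" by (intro compact_Times compact_annulus) auto
      show "continuous_on ({e..1/(20 * lam)} \<times> annulus r) v"
        by (rule continuous_on_subset[OF cv]) (use e lT ann in auto)
      fix c assume c: "c \<in> F"
      show "compact ({e..1/(20 * lam)} \<times> cball (r *\<^sub>R c) (wid * r / 10))" by (intro compact_Times) auto
      have "cball (r *\<^sub>R c) (wid * r / 10) \<subseteq> ball (r *\<^sub>R c) (wid * r)" using mult_pos_pos[OF w0 r0] by auto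
      then show "continuous_on ({e..1/(20 * lam)} \<times> cball (r *\<^sub>R c) (wid * r / 10)) v"
        by (intro continuous_on_subset[OF cv]) (use e lT sub[OF c] in auto)
    next
      fix z assume z: "z \<in> {e..1/(20 * lam)} \<times> annulus r"
      define x where "x = (1/r) *\<^sub>R snd z"
      have sx: "snd z = r *\<^sub>R x" using r0 by (simp add: x_def)
      have "\<bar>snd z $ 2\<bar> \<le> sig * snd z $ 1" "r \<le> norm (snd z)" "norm (snd z) \<le> 2 * r" using z by (auto simp: annulus_def)
      then have "x \<in> annulus 1" using r0 by (simp add: annulus_def sx abs_mult mult.left_commute)
      then obtain c where c: "c \<in> F" "dist c x < wid/10" using F(3) by auto
      have "dist (r *\<^sub>R c) (snd z) = r * dist c x" using r0 by (simp add: sx dist_norm scaleR_diff_right[symmetric])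
      also have "\<dots> \<le> r * (wid/10)" using c r0 by (intro mult_left_mono) auto
      finally show "\<exists>c\<in>F. z \<in> {e..1/(20 * lam)} \<times> cball (r *\<^sub>R c) (wid * r / 10) \<and> v z \<le> v z"
        using c z by (intro bexI[of _ c]) (auto simp: mult.commute mem_Times_iff)
    qed (rule v0)
    also have "\<dots> \<le> (\<Sum>c\<in>F. A * (wid * r)\<^sup>2 * exp (- ((wid * r)\<^sup>2 / 10)))"
    proof (rule sum_mono)
      fix c assume c: "c \<in> F"
      have s: "{0<..<T} \<times> ball (r *\<^sub>R c) (wid * r) \<subseteq> {0<..<T} \<times> open_sector (1091/1000)" using sub[OF c] by blast
      show "lint ({e..1/(20 * lam)} \<times> cball (r *\<^sub>R c) (wid * r / 10)) v \<le> A * (wid * r)\<^sup>2 * exp (- ((wid * r)\<^sup>2 / 10))"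
        unfolding v_def[abs_def]
      proof (rule A(2)[OF _ solves_mono[OF u s] _ _ e])
        show "wid * rho \<le> wid * r" using r w0 by simp
        show "\<bar>u Jv z\<bar> \<le> M" if "z \<in> {0<..<T} \<times> ball (r *\<^sub>R c) (wid * r)" for z using M s that by blast
        fix e' :: real assume "0 < e'"
        then obtain d where d: "0 < d" "\<forall>z\<in>{0<..<T} \<times> (open_sector (1091/1000) \<inter> cball 0 (norm (r *\<^sub>R c) + wid * r)). fst z < d \<longrightarrow> \<bar>u Jv z\<bar> \<le> e'"
          using u0 by blast
        have "ball (r *\<^sub>R c) (wid * r) \<subseteq> cball 0 (norm (r *\<^sub>R c) + wid * r)"
        proof
          fix x assume "x \<in> ball (r *\<^sub>R c) (wid * r)"
          then have "norm (x - r *\<^sub>R c) < wid * r" by (simp add: dist_norm norm_minus_commute)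
          then show "x \<in> cball 0 (norm (r *\<^sub>R c) + wid * r)" using norm_triangle_sub[of x "r *\<^sub>R c"] by simp
        qed
        then show "\<exists>d>0. \<forall>z\<in>{0<..<T} \<times> ball (r *\<^sub>R c) (wid * r). fst z < d \<longrightarrow> \<bar>u Jv z\<bar> \<le> e'"
          using d sub[OF c] by (intro exI[of _ d]) blast
      qed
    qed
    also have "\<dots> = real (card F) * (A * wid\<^sup>2) * (r\<^sup>2 * exp (- (wid\<^sup>2 / 10 * r\<^sup>2)))"
      by (simp add: power_mult_distrib)
    finally show "lint ({e..1/(20 * lam)} \<times> annulus r) (\<lambda>z. (u Jv z)\<^sup>2 + gsq u z) \<le> real (card F) * (A * wid\<^sup>2) * (r\<^sup>2 * exp (- (wid\<^sup>2 / 10 * r\<^sup>2)))"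
      by (simp add: v_def[abs_def])
  qed
qed

text \<open>Up to constants, what the shell y \<le> |x| \<le> 2 y contributes to the error of
  cutting off. The first factor bounds the exponential of the weight, the fourth power comes from
  the squared derivatives of the cut-off, and the rest is the decay of \<open>u\<close> on the
  shell.\<close>

definition gterm :: "real \<Rightarrow> real \<Rightarrow> real \<Rightarrow> real" where
  "gterm E c y = exp (E * (2 * y) powr kap) * ((1 + 2 * y)^4 * (y\<^sup>2 * exp (- (c * y\<^sup>2))))"

text \<open>This is where \<kappa> < 2 is decisive: y^(\<kappa> - 2) tends to 0, so for any
  \<open>E\<close> the exponent E (2 y)^\<kappa> is eventually at most half of c y^2, however small
  \<open>c\<close> is.\<close>

lemma gterm_le:
  assumes c: "0 < c" and E: "0 \<le> E"
  obtains K Y where "0 \<le> K" "1 \<le> Y" "\<And>y. Y \<le> y \<Longrightarrow> gterm E c y \<le> K / y\<^sup>2"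
proof -
  have "((\<lambda>y. y powr (kap - 2)) \<longlongrightarrow> 0) at_top"
    by (rule tendsto_neg_powr) (auto simp: kap_def filterlim_ident)
  moreover have "0 < c / (2 * (E * 4 + 1))" using c E by simp
  ultimately have "eventually (\<lambda>y. y powr (kap - 2) < c / (2 * (E * 4 + 1))) at_top"
    by (rule order_tendstoD(2))
  then obtain Y0 where Y0: "\<And>y. Y0 \<le> y \<Longrightarrow> y powr (kap - 2) < c / (2 * (E * 4 + 1))"
    by (auto simp: eventually_at_top_linorder)
  \<comment> \<open>81 = 3^4 comes from 1 + 2 y \<le> 3 y, and 256 = 4^4 from e^w \<ge> (w / 4)^4
    with w = c y^2 / 2.\<close>
  define K where "K = 81 * 256 * (2 / c)^4"
  show thesis
  proof (rule that[of K "max 1 Y0"])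
    show "0 \<le> K" using c by (simp add: K_def)
    fix y assume y: "max 1 Y0 \<le> y"
    then have y1: "1 \<le> y" "0 < y" by auto
    have "(2 * y) powr kap = 2 powr kap * (y powr (kap - 2) * y\<^sup>2)"
      using y1 by (simp add: powr_mult powr_diff powr_numeral)
    also have "\<dots> \<le> 4 * (c / (2 * (E * 4 + 1)) * y\<^sup>2)"
    proof (intro mult_mono)
      have "2 powr kap \<le> 2 powr (2::real)" by (rule powr_mono) (auto simp: kap_def)
      then show "2 powr kap \<le> (4::real)" by (simp add: powr_numeral)
      show "y powr (kap - 2) \<le> c / (2 * (E * 4 + 1))" using Y0[of y] y by simp
    qed (use c E in auto)
    finally have "E * (2 * y) powr kap \<le> E * (4 * (c / (2 * (E * 4 + 1)) * y\<^sup>2))" using E by (rule mult_left_mono)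
    also have "\<dots> = (4 * E / (4 * E + 1)) * (c / 2 * y\<^sup>2)" using E by (simp add: field_simps)
    also have "\<dots> \<le> 1 * (c / 2 * y\<^sup>2)" using c E by (intro mult_right_mono) auto
    finally have e1: "E * (2 * y) powr kap \<le> c / 2 * y\<^sup>2" by simp
    define w where "w = c / 2 * y\<^sup>2"
    have w: "0 < w" using c y1 by (simp add: w_def)
    have "(w / 4)^4 \<le> (1 + w / real 4)^4" using w by (intro power_mono) auto
    also have "\<dots> \<le> exp w" by (rule exp_ge_one_plus_x_over_n_power_n) (use w in auto)
    finally have "w^4 / 256 \<le> exp w" by (simp add: power_divide)
    then have "inverse (exp w) \<le> inverse (w^4 / 256)" using w by (intro le_imp_inverse_le) auto
    then have e2: "exp (- w) \<le> 256 / w^4" by (simp add: exp_minus)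
    have "gterm E c y = (1 + 2 * y)^4 * y\<^sup>2 * exp (E * (2 * y) powr kap - c * y\<^sup>2)"
      by (simp add: gterm_def exp_diff exp_minus field_simps)
    also have "\<dots> \<le> (3 * y)^4 * y\<^sup>2 * exp (- w)"
      using y1 e1 by (intro mult_mono power_mono) (auto simp: w_def)
    also have "\<dots> \<le> (3 * y)^4 * y\<^sup>2 * (256 / w^4)" using e2 y1 by (intro mult_left_mono) auto
    also have "\<dots> = K / y\<^sup>2" using c y1 by (simp add: w_def K_def power_mult_distrib power_divide field_simps eval_nat_numeral)
    finally show "gterm E c y \<le> K / y\<^sup>2" .
  qed simp
qed

lemma gterm_dyadic_le:
  assumes c: "0 < c" and E: "0 \<le> E" and x: "0 < x"
  obtains K where "0 \<le> K" "eventually (\<lambda>n. gterm E c (x * 2^n) \<le> K * (1/4)^n) sequentially"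
proof -
  obtain K Y where K: "0 \<le> K" "1 \<le> Y" "\<And>y. Y \<le> y \<Longrightarrow> gterm E c y \<le> K / y\<^sup>2" using gterm_le[OF c E] by blast
  obtain n0 where n0: "Y / x < 2^n0" using real_arch_pow[of 2 "Y / x"] by auto
  show thesis
  proof (rule that[of "K / x\<^sup>2"])
    show "0 \<le> K / x\<^sup>2" using K by simp
    show "eventually (\<lambda>n. gterm E c (x * 2^n) \<le> K / x\<^sup>2 * (1/4)^n) sequentially"
    proof (rule eventually_sequentiallyI[of n0])
      fix n assume "n0 \<le> n"
      then have "(2::real)^n0 \<le> 2^n" by (rule power_increasing) simp
      then have "x * 2^n0 \<le> x * 2^n" using x by (intro mult_left_mono) auto
      moreover have "Y < x * 2^n0" using n0 x by (simp add: field_simps)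
      ultimately have "Y \<le> x * 2^n" by linarith
      from K(3)[OF this] have "gterm E c (x * 2^n) \<le> K / (x * 2^n)\<^sup>2" .
      also have "\<dots> = K / x\<^sup>2 * (1/4)^n"
      proof -
        have "((2::real)^n)\<^sup>2 = 4^n" by (simp add: power2_eq_square power_mult_distrib[symmetric])
        then show ?thesis by (simp add: power_mult_distrib power_divide)
      qed
      finally show "gterm E c (x * 2^n) \<le> K / x\<^sup>2 * (1/4)^n" .
    qed
  qed
qed

lemma gterm_nonneg: "0 \<le> y \<Longrightarrow> 0 \<le> gterm E c y"
  by (simp add: gterm_def)

lemma gterm_summable:
  assumes "0 < c" "0 < x" shows "summable (\<lambda>n. gterm 0 c (x * 2^n))"
proof -
  obtain K where K: "0 \<le> K" "eventually (\<lambda>n. gterm 0 c (x * 2^n) \<le> K * (1/4)^n) sequentially"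
    using gterm_dyadic_le[OF assms(1) order_refl assms(2)] by blast
  show ?thesis
  proof (rule summable_comparison_test_ev)
    show "eventually (\<lambda>n. norm (gterm 0 c (x * 2^n)) \<le> K * (1/4)^n) sequentially"
      using K(2) by eventually_elim (use gterm_nonneg assms in auto)
    show "summable (\<lambda>n. K * (1/4)^n)" by (intro summable_mult summable_geometric) auto
  qed
qed

text \<open>For the outermost shell, the only one on which the weight is not bounded by its level:
  for a fixed parameter of the weight its contribution disappears as the cut-off radius grows. The
  inner shells are summed with \<open>E = 0\<close> by \<open>gterm_summable\<close>.\<close>

lemma gterm_tendsto:
  assumes "0 < c" "0 < x" "0 \<le> E" shows "(\<lambda>n. gterm E c (x * 2^n)) \<longlonglongrightarrow> 0"
proof -
  obtain K where K: "0 \<le> K" "eventually (\<lambda>n. gterm E c (x * 2^n) \<le> K * (1/4)^n) sequentially"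
    using gterm_dyadic_le[OF assms(1,3,2)] by blast
  have "(\<lambda>n. K * (1/4)^n) \<longlonglongrightarrow> K * 0" by (intro tendsto_mult tendsto_const LIMSEQ_power_zero) auto
  then have lim: "(\<lambda>n. K * (1/4)^n) \<longlonglongrightarrow> 0" by simp
  show ?thesis
    by (rule tendsto_sandwich[OF _ K(2) tendsto_const lim]) (use gterm_nonneg assms in auto)
qed

text \<open>\<open>\<delta>\<close> and \<open>b\<close> are margin and bound of the profile,
  \<open>B\<close> is the coefficient to be reached in the Carleman inequality,
  \<open>\<Lambda>\<close> the decay rate in time, \<open>\<tau>\<close> the time at which the
  weight vanishes, and \<open>K1\<close> the level at which it is cut off. The factor a of the
  weight is not among them, as it tends to infinity at the end.\<close>

locale cone_weight =
  fixes \<delta> b \<Lambda> \<tau> K1 B :: real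
  assumes dl: "0 < \<delta>" and b1: "1 \<le> b"
    and prA: "\<And>s. \<bar>s\<bar> \<le> sig \<Longrightarrow> \<delta> \<le> 4 * (H11 s * (W1 s)\<^sup>2 + 2 * H12 s * W1 s * W2 s + H22 s * (W2 s)\<^sup>2) - 2 * prmu s * ((W1 s)\<^sup>2 + (W2 s)\<^sup>2)"
    and prC: "\<And>s. \<bar>s\<bar> \<le> sig \<Longrightarrow> \<delta> \<le> 4 * ((W1 s)\<^sup>2 + (W2 s)\<^sup>2) - 2 * prmu s * prP s"
    and prB: "\<And>s x y. \<bar>s\<bar> \<le> sig \<Longrightarrow> 2 * \<delta> * (x\<^sup>2 + y\<^sup>2) \<le> 4 * (H11 s * x\<^sup>2 + 2 * H12 s * x * y + H22 s * y\<^sup>2) + 2 * prmu s * (x\<^sup>2 + y\<^sup>2)"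
    and bnd: "\<And>s. \<bar>s\<bar> \<le> sig \<Longrightarrow> \<bar>prP s\<bar> \<le> b" "\<And>s. \<bar>s\<bar> \<le> sig \<Longrightarrow> \<bar>prmu s\<bar> \<le> b"
    "\<And>s. \<bar>s\<bar> \<le> sig \<Longrightarrow> \<bar>W1 s\<bar> \<le> b" "\<And>s. \<bar>s\<bar> \<le> sig \<Longrightarrow> \<bar>W2 s\<bar> \<le> b"
    "\<And>s. \<bar>s\<bar> \<le> sig \<Longrightarrow> \<bar>nu s\<bar> \<le> b" "\<And>s. \<bar>s\<bar> \<le> sig \<Longrightarrow> \<bar>nu1 s\<bar> \<le> b"
    "\<And>s. \<bar>s\<bar> \<le> sig \<Longrightarrow> \<bar>H11 s\<bar> \<le> b" "\<And>s. \<bar>s\<bar> \<le> sig \<Longrightarrow> \<bar>H22 s\<bar> \<le> b"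
    and B1: "1 \<le> B" and Lam: "4 * B * b\<^sup>2 \<le> \<Lambda> * \<delta>" "2 * B \<le> \<Lambda>" and tau: "0 < \<tau>" and K1: "0 < K1"
begin

text \<open>Vanishing at \<open>\<tau>\<close> closes the superlevel sets of the weight before that
  time, so no cut-off in time is required at the upper end. Moreover \<eta>'' = -\<Lambda> \<eta>',
  and -\<eta>' / \<eta> \<ge> \<Lambda> before \<open>\<tau>\<close>; these two relations make the
  time derivatives helpful.\<close>

definition eta :: "real \<Rightarrow> real" where "eta t = exp (- (\<Lambda> * t)) - exp (- (\<Lambda> * \<tau>))"
definition eta1 :: "real \<Rightarrow> real" where "eta1 t = - (\<Lambda> * exp (- (\<Lambda> * t)))"
definition eta2 :: "real \<Rightarrow> real" where "eta2 t = \<Lambda> * (\<Lambda> * exp (- (\<Lambda> * t)))"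

lemma Lam0: "0 < \<Lambda>" using Lam B1 by linarith

lemma DERIV_eta: "(eta has_real_derivative eta1 t) (at t)" "(eta1 has_real_derivative eta2 t) (at t)"
  unfolding eta_def[abs_def] eta1_def[abs_def] eta2_def by (auto intro!: derivative_eq_intros)

lemma continuous_eta: "continuous_on S eta" "continuous_on S eta1" "continuous_on S eta2"
  unfolding eta_def[abs_def] eta1_def[abs_def] eta2_def[abs_def] by (intro continuous_intros)+

lemma continuous_eta_fst: "continuous_on S (\<lambda>z::pt. eta (fst z))" "continuous_on S (\<lambda>z::pt. eta1 (fst z))" "continuous_on S (\<lambda>z::pt. eta2 (fst z))"
  by (rule continuous_on_compose2[OF continuous_eta(1)[of UNIV]] continuous_on_compose2[OF continuous_eta(2)[of UNIV]]
    continuous_on_compose2[OF continuous_eta(3)[of UNIV]]; auto intro!: continuous_intros)+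

lemma eta_le: "0 \<le> t \<Longrightarrow> eta t \<le> 1" "0 \<le> t \<Longrightarrow> \<bar>eta1 t\<bar> \<le> \<Lambda>"
  using Lam0 by (auto simp: eta_def eta1_def abs_mult mult_left_le intro: order_trans[of _ "exp (- (\<Lambda> * t))"])

lemma eta_pos: "t < \<tau> \<Longrightarrow> 0 < eta t" using Lam0 by (simp add: eta_def)
lemma eta_nonneg: "t \<le> \<tau> \<Longrightarrow> 0 \<le> eta t" using Lam0 by (simp add: eta_def)

definition jPhi :: "ix \<Rightarrow> pt \<Rightarrow> real" where "jPhi = jmul (jtime eta eta1) jPsi"

lemma C12_jPhi: "C12 xpos jPhi"
  unfolding jPhi_def by (intro C12_jmul C12_jtime DERIV_eta continuous_eta C12_jPsi)

lemma jPhi_simps: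
  "jPhi Jv z = eta (fst z) * hom kap prP z" "jPhi Jt z = eta1 (fst z) * hom kap prP z"
  "jPhi Jx z = eta (fst z) * hom (kap - 1) W1 z" "jPhi Jy z = eta (fst z) * hom (kap - 1) W2 z"
  "jPhi Jxx z = eta (fst z) * hom (kap - 2) H11 z" "jPhi Jxy z = eta (fst z) * hom (kap - 2) H12 z"
  "jPhi Jyy z = eta (fst z) * hom (kap - 2) H22 z"
  by (simp_all add: jPhi_def jmul_simps jtime_simps jPsi_simps)

text \<open>A lower bound for x1 where the weight is at least \<open>K1\<close>: there K1 \<le> b
  x1^\<kappa>, and x1^\<kappa> \<le> x1 if x1 < 1. It keeps the negative power x1^(\<kappa> - 2) of
  the second derivatives bounded.\<close>

definition x0 :: real where "x0 = min 1 (K1 / b)"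

lemma x0: "0 < x0" "x0 \<le> 1" "x0 * b \<le> K1"
  using K1 b1 by (auto simp: x0_def min_def field_simps)

definition region :: "pt set" where
  "region = {z. 0 < fst z \<and> fst z \<le> \<tau> \<and> 0 < snd z $ 1 \<and> \<bar>snd z $ 2\<bar> \<le> sig * snd z $ 1 \<and> K1 \<le> jPhi Jv z}"

lemma slope_le: "0 < snd z $ 1 \<Longrightarrow> \<bar>snd z $ 2\<bar> \<le> sig * snd z $ 1 \<Longrightarrow> \<bar>slope z\<bar> \<le> sig"
  by (simp add: slope_def abs_divide divide_le_eq)

lemma hom_le: "0 < snd z $ 1 \<Longrightarrow> \<bar>snd z $ 2\<bar> \<le> sig * snd z $ 1 \<Longrightarrow> hom kap prP z \<le> b * (snd z $ 1) powr kap"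
  using bnd(1)[OF slope_le, of z] unfolding hom_def by (simp add: mult.commute mult_left_mono abs_le_iff)

text \<open>At time \<open>\<tau>\<close> and on the two rays of slope \<open>sig\<close> the weight
  is at most 0, because \<eta> vanishes and P is not positive there. A weight of at least
  \<open>K1\<close> therefore turns the closed conditions into strict ones, so the superlevel set
  lies inside the open sector without any boundary condition.\<close>

lemma region_pre:
  assumes "0 \<le> fst z" "fst z \<le> \<tau>" "0 < snd z $ 1" "\<bar>snd z $ 2\<bar> \<le> sig * snd z $ 1" "K1 \<le> jPhi Jv z"
  shows "fst z < \<tau>" "\<bar>snd z $ 2\<bar> < sig * snd z $ 1" "x0 \<le> snd z $ 1" "0 < prP (slope z)"
proof -
  define x where "x = snd z $ 1"
  have x: "0 < x" using assms by (simp add: x_def)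
  have P: "0 < eta (fst z) * (x powr kap * prP (slope z))"
    using assms(5) K1 by (simp add: jPhi_simps hom_def x_def)
  have e: "0 \<le> eta (fst z)" using eta_nonneg assms by simp
  have e0: "eta (fst z) \<noteq> 0" using P by auto
  then show "fst z < \<tau>" using assms(2) by (auto simp: eta_def order_le_less)
  have "0 < eta (fst z)" using e e0 by simp
  then have "0 < x powr kap * prP (slope z)" using P by (simp add: zero_less_mult_iff)
  then show p: "0 < prP (slope z)" using x by (simp add: zero_less_mult_iff)
  show "\<bar>snd z $ 2\<bar> < sig * snd z $ 1"
  proof (rule ccontr)
    assume "\<not> \<bar>snd z $ 2\<bar> < sig * snd z $ 1"
    then have "\<bar>snd z $ 2\<bar> = sig * x" using assms(4) by (simp add: x_def)
    then have "slope z = sig \<or> slope z = - sig" using x by (auto simp: slope_def x_def[symmetric] abs_if field_simps split: if_splits)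
    then show False using p prP_sig by auto
  qed
  have "jPhi Jv z \<le> 1 * (b * x powr kap)"
    unfolding jPhi_simps using e eta_le[OF assms(1)] hom_le[OF assms(3,4)] p b1 x by (intro mult_mono) (auto simp: hom_def x_def)
  then have 1: "K1 \<le> b * x powr kap" using assms(5) by simp
  show "x0 \<le> snd z $ 1"
  proof (cases "1 \<le> x")
    case False
    then have "x powr kap \<le> x powr 1" using x kap_bounds by (intro powr_mono') auto
    then have le: "x powr kap \<le> x" using x by simp
    have "b * x powr kap \<le> b * x" by (rule mult_left_mono[OF le]) (use b1 in simp)
    with 1 have "K1 \<le> b * x" by (rule order_trans)
    then have "K1 / b \<le> x" using b1 by (simp add: field_simps)
    then show ?thesis by (simp add: x0_def x_def)
  qed (use x0(2) in \<open>simp add: x_def\<close>)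
qed

lemma regionD:
  assumes "z \<in> region"
  shows "0 < fst z" "fst z < \<tau>" "0 < snd z $ 1" "\<bar>snd z $ 2\<bar> < sig * snd z $ 1" "x0 \<le> snd z $ 1" "0 < prP (slope z)"
    "\<bar>slope z\<bar> \<le> sig" "K1 \<le> jPhi Jv z" "z \<in> xpos" "0 < eta (fst z)" "snd z $ 1 \<le> norm (snd z)"
proof -
  have z: "0 < fst z" "fst z \<le> \<tau>" "0 < snd z $ 1" "\<bar>snd z $ 2\<bar> \<le> sig * snd z $ 1" "K1 \<le> jPhi Jv z"
    using assms by (auto simp: region_def)
  note p = region_pre[OF less_imp_le[OF z(1)] z(2-5)]
  show "0 < fst z" "fst z < \<tau>" "0 < snd z $ 1" "\<bar>snd z $ 2\<bar> < sig * snd z $ 1" "x0 \<le> snd z $ 1" "0 < prP (slope z)"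
    "\<bar>slope z\<bar> \<le> sig" "K1 \<le> jPhi Jv z" "z \<in> xpos" "0 < eta (fst z)"
    using z p slope_le[of z] eta_pos by (auto simp: xpos_def)
  show "snd z $ 1 \<le> norm (snd z)" using component_le_norm_cart[of "snd z" 1] by simp
qed

definition truncated_sector :: "real \<Rightarrow> real \<Rightarrow> pt set" where
  "truncated_sector e R = {e..\<tau>} \<times> {x. x0 \<le> x $ 1 \<and> \<bar>x $ 2\<bar> \<le> sig * x $ 1 \<and> norm x \<le> 2 * R}"

lemma compact_truncated_sector: "compact (truncated_sector e R)"
proof -
  have "closed {x::real^2. x0 \<le> x $ 1 \<and> \<bar>x $ 2\<bar> \<le> sig * x $ 1}"
    by (intro closed_Collect_conj closed_Collect_le continuous_intros)
  moreover have "{x::real^2. x0 \<le> x $ 1 \<and> \<bar>x $ 2\<bar> \<le> sig * x $ 1 \<and> norm x \<le> 2 * R}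
      = {x. x0 \<le> x $ 1 \<and> \<bar>x $ 2\<bar> \<le> sig * x $ 1} \<inter> cball 0 (2 * R)" by auto
  ultimately show ?thesis unfolding truncated_sector_def by (simp add: compact_Times closed_Int_compact)
qed

lemma truncated_sector_xpos: "truncated_sector e R \<subseteq> xpos"
  using x0 by (auto simp: truncated_sector_def xpos_def)

definition Kset :: "real \<Rightarrow> pt set" where "Kset R = region \<inter> {z. norm (snd z) \<le> 2 * R}"

lemma Kset_truncated_sector: "Kset R \<subseteq> truncated_sector 0 R"
proof
  fix z assume z: "z \<in> Kset R"
  then have "z \<in> region" "norm (snd z) \<le> 2 * R" by (auto simp: Kset_def)
  with regionD[OF this(1)] show "z \<in> truncated_sector 0 R" by (cases z) (auto simp: truncated_sector_def)
qed

lemma compact_Kset: assumes "0 < e" shows "compact (Kset R \<inter> {z. e \<le> fst z})"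
proof -
  have c: "continuous_on (truncated_sector e R) (jPhi Jv)"
    by (rule continuous_on_subset[OF C12D(8)[OF C12_jPhi] truncated_sector_xpos])
  have "Kset R \<inter> {z. e \<le> fst z} = {z \<in> truncated_sector e R. K1 \<le> jPhi Jv z}"
  proof (intro set_eqI iffI)
    fix z assume z: "z \<in> Kset R \<inter> {z. e \<le> fst z}"
    then have "z \<in> region" "norm (snd z) \<le> 2 * R" "e \<le> fst z" by (auto simp: Kset_def)
    with regionD[OF this(1)] show "z \<in> {z \<in> truncated_sector e R. K1 \<le> jPhi Jv z}" by (cases z) (auto simp: truncated_sector_def)
  next
    fix z assume "z \<in> {z \<in> truncated_sector e R. K1 \<le> jPhi Jv z}"
    then show "z \<in> Kset R \<inter> {z. e \<le> fst z}" using assms x0 by (cases z) (auto simp: truncated_sector_def Kset_def region_def)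
  qed
  moreover have "compact {z \<in> truncated_sector e R. K1 \<le> jPhi Jv z}"
  proof -
    have "{z \<in> truncated_sector e R. K1 \<le> jPhi Jv z} = truncated_sector e R \<inter> jPhi Jv -` {K1..}" by auto
    moreover have "closed (truncated_sector e R \<inter> jPhi Jv -` {K1..})"
      by (rule continuous_closed_preimage[OF c compact_imp_closed[OF compact_truncated_sector]]) auto
    ultimately have cl: "closed {z \<in> truncated_sector e R. K1 \<le> jPhi Jv z}" by simp
    have "{z \<in> truncated_sector e R. K1 \<le> jPhi Jv z} \<inter> truncated_sector e R = {z \<in> truncated_sector e R. K1 \<le> jPhi Jv z}" by auto
    then show ?thesis using closed_Int_compact[OF cl compact_truncated_sector[of e R]] by simp
  qed
  ultimately show ?thesis by simp
qed

text \<open>Size of the weight from which on \<open>cone_quad_pos\<close> applies. The number 10 b^2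
  bounds the squared gradient of the profile of \<open>N\<close>: its components are at most 3 b and
  b.\<close>

definition k0 :: real where "k0 = 1 + 4 * b^3 / \<delta> + b * (20 * b\<^sup>2 + 1) / \<delta>"

lemma k0: "1 \<le> k0" "4 * b^3 \<le> \<delta> * k0" "b * (2 * (10 * b\<^sup>2) + 1) \<le> \<delta> * k0"
proof -
  have e: "\<delta> * k0 = \<delta> + 4 * b^3 + b * (20 * b\<^sup>2 + 1)" using dl by (simp add: k0_def field_simps)
  show "1 \<le> k0" using dl b1 by (simp add: k0_def)
  show "4 * b^3 \<le> \<delta> * k0" "b * (2 * (10 * b\<^sup>2) + 1) \<le> \<delta> * k0" unfolding e using dl b1 by simp_all
qed

text \<open>This is m + \<Delta>f for m = A \<mu> + B / 2 with A = a \<eta> x1^(\<kappa> - 2). The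
  summand B / 2 supplies precisely the coefficient \<open>B\<close> demanded for the
  gradient.\<close>

definition wN :: "real \<Rightarrow> pt \<Rightarrow> real" where "wN a z = a * (eta (fst z) * hom (kap - 2) nu z) + B / 2"
definition wNx :: "real \<Rightarrow> pt \<Rightarrow> real" where "wNx a z = a * (eta (fst z) * hom (kap - 3) (\<lambda>s. (kap - 2) * nu s - s * nu1 s) z)"
definition wNy :: "real \<Rightarrow> pt \<Rightarrow> real" where "wNy a z = a * (eta (fst z) * hom (kap - 3) nu1 z)"
definition ftt :: "real \<Rightarrow> pt \<Rightarrow> real" where "ftt a z = a * (eta2 (fst z) * hom kap prP z)"
definition ftx :: "real \<Rightarrow> pt \<Rightarrow> real" where "ftx a z = a * (eta1 (fst z) * hom (kap - 1) W1 z)"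
definition fty :: "real \<Rightarrow> pt \<Rightarrow> real" where "fty a z = a * (eta1 (fst z) * hom (kap - 1) W2 z)"
definition wf :: "real \<Rightarrow> ix \<Rightarrow> pt \<Rightarrow> real" where "wf a i z = a * jPhi i z"

lemma C12_wf: "C12 xpos (wf a)"
proof -
  have "C12 xpos (\<lambda>i z. a * jPhi i z + 0 * jPhi i z)" by (intro C12_lin C12_jPhi)
  then show ?thesis by (simp add: wf_def[abs_def])
qed

lemma has_pd_cm: "has_pd e U f f' \<Longrightarrow> has_pd e U (\<lambda>z. c * f z) (\<lambda>z. c * f' z)"
  using has_pd_mult[OF has_pd_const, of e U f f' c] by simp

lemma has_pd_sp: "has_pd dX U (\<lambda>z. h (fst z)) (\<lambda>z. 0)" "has_pd dY U (\<lambda>z. h (fst z)) (\<lambda>z. 0)"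
  by (simp_all add: has_pd_def)

lemma weight_pd:
  "has_pd dT xpos (wf a Jt) (ftt a)" "has_pd dX xpos (wf a Jt) (ftx a)" "has_pd dY xpos (wf a Jt) (fty a)"
  "has_pd dT xpos (wf a Jx) (ftx a)" "has_pd dT xpos (wf a Jy) (fty a)"
  "has_pd dX xpos (wN a) (wNx a)" "has_pd dY xpos (wN a) (wNy a)"
proof -
  have k3: "kap - 2 - 1 = kap - 3" by simp
  have w4: "prP1 = W2" by (auto simp: W2_def)
  have w1: "(\<lambda>s. kap * prP s - s * W2 s) = W1" by (auto simp: W1_def W2_def)
  note hx = has_pd_hom_x[OF DERIV_prP, of kap, unfolded w4 w1] and hy = has_pd_hom_y[OF DERIV_prP, of kap, unfolded w4]
  show "has_pd dT xpos (wf a Jt) (ftt a)"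
    unfolding wf_def[abs_def] jPhi_simps ftt_def[abs_def]
    by (rule has_pd_eqI[OF has_pd_cm[OF has_pd_mult[OF has_pd_time has_pd_hom_t]]]) (rule DERIV_eta, simp)
  show "has_pd dX xpos (wf a Jt) (ftx a)"
    unfolding wf_def[abs_def] jPhi_simps ftx_def[abs_def]
    by (rule has_pd_eqI[OF has_pd_cm[OF has_pd_mult[OF has_pd_sp(1) hx]]]) simp
  show "has_pd dY xpos (wf a Jt) (fty a)"
    unfolding wf_def[abs_def] jPhi_simps fty_def[abs_def]
    by (rule has_pd_eqI[OF has_pd_cm[OF has_pd_mult[OF has_pd_sp(2) hy]]]) simp
  show "has_pd dT xpos (wf a Jx) (ftx a)"
    unfolding wf_def[abs_def] jPhi_simps ftx_def[abs_def]
    by (rule has_pd_eqI[OF has_pd_cm[OF has_pd_mult[OF has_pd_time has_pd_hom_t]]]) (rule DERIV_eta, simp)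
  show "has_pd dT xpos (wf a Jy) (fty a)"
    unfolding wf_def[abs_def] jPhi_simps fty_def[abs_def]
    by (rule has_pd_eqI[OF has_pd_cm[OF has_pd_mult[OF has_pd_time has_pd_hom_t]]]) (rule DERIV_eta, simp)
  show "has_pd dX xpos (wN a) (wNx a)"
    unfolding wN_def[abs_def] wNx_def[abs_def]
    by (rule has_pd_eqI[OF has_pd_add[OF has_pd_cm[OF has_pd_mult[OF has_pd_sp(1) has_pd_hom_x[OF DERIV_nu]]] has_pd_const]]) (simp add: k3)
  show "has_pd dY xpos (wN a) (wNy a)"
    unfolding wN_def[abs_def] wNy_def[abs_def]
    by (rule has_pd_eqI[OF has_pd_add[OF has_pd_cm[OF has_pd_mult[OF has_pd_sp(2) has_pd_hom_y[OF DERIV_nu]]] has_pd_const]]) (simp add: k3)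
qed

lemma weight_cont:
  "continuous_on xpos (ftt a)" "continuous_on xpos (ftx a)" "continuous_on xpos (fty a)"
  "continuous_on xpos (wN a)" "continuous_on xpos (wNx a)" "continuous_on xpos (wNy a)"
  unfolding ftt_def[abs_def] ftx_def[abs_def] fty_def[abs_def] wN_def[abs_def] wNx_def[abs_def] wNy_def[abs_def]
  by (intro continuous_intros continuous_eta_fst continuous_hom continuous_HW continuous_profile)+

text \<open>A rewriting into the variables of \<open>cone_quad_pos\<close>. The weight there is
  \<open>Y = a * jPhi Jv z\<close>, which is at least \<open>k0\<close> because
  \<open>K1 \<le> jPhi Jv z\<close> in the region and \<open>k0 \<le> a * K1\<close>.\<close>

lemma weight_pos:
  assumes z: "z \<in> region" and a: "0 < a" "k0 \<le> a * K1"
  shows "B * (p\<^sup>2 + q\<^sup>2 + (1 + gsq (wf a) z) * r\<^sup>2)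
      \<le> 4 * (wf a Jxx z * p\<^sup>2 + 2 * wf a Jxy z * p * q + wf a Jyy z * q\<^sup>2)
        + 2 * (wN a z - (wf a Jxx z + wf a Jyy z)) * (p\<^sup>2 + q\<^sup>2) + 2 * r * (wNx a z * p + wNy a z * q)
        + r\<^sup>2 * (ftt a z - 4 * (wf a Jx z * ftx a z + wf a Jy z * fty a z)
          + 4 * (wf a Jxx z * (wf a Jx z)\<^sup>2 + 2 * wf a Jxy z * wf a Jx z * wf a Jy z + wf a Jyy z * (wf a Jy z)\<^sup>2)
          - 2 * (wN a z - (wf a Jxx z + wf a Jyy z)) * (gsq (wf a) z - wf a Jt z) - (wN a z - (wf a Jxx z + wf a Jyy z))\<^sup>2)"
proof -
  note rd = regionD[OF z]
  define X where "X = snd z $ 1"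
  define s where "s = slope z"
  define A where "A = a * (eta (fst z) * X powr (kap - 2))"
  define \<beta> where "\<beta> = \<Lambda> * exp (- (\<Lambda> * fst z)) / eta (fst z)"
  define Y where "Y = A * X\<^sup>2 * prP s"
  define z1 where "z1 = (kap - 2) * nu s - s * nu1 s"
  have X: "0 < X" using rd by (simp add: X_def)
  have s: "\<bar>s\<bar> \<le> sig" using rd by (simp add: s_def)
  have et: "0 < eta (fst z)" using rd by simp
  have A: "0 < A" using a et X by (simp add: A_def)
  have AX: "A * X = a * (eta (fst z) * X powr (kap - 1))" "A * X\<^sup>2 = a * (eta (fst z) * X powr kap)"
    "A / X = a * (eta (fst z) * X powr (kap - 3))"
    using X by (simp_all add: A_def powr_diff power2_eq_square powr_numeral field_simps eval_nat_numeral)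
  have be: "eta (fst z) * \<beta> = \<Lambda> * exp (- (\<Lambda> * fst z))" using et by (simp add: \<beta>_def)
  have e1: "eta1 (fst z) = - (eta (fst z) * \<beta>)" "eta2 (fst z) = \<Lambda> * (eta (fst z) * \<beta>)"
    unfolding be by (simp_all add: eta1_def eta2_def)
  have ho: "hom r F z = X powr r * F s" for r F by (simp add: hom_def X_def s_def)
  have j: "wf a Jx z = A * X * W1 s" "wf a Jy z = A * X * W2 s" "wf a Jxx z = A * H11 s" "wf a Jxy z = A * H12 s" "wf a Jyy z = A * H22 s"
    "wf a Jt z = - (\<beta> * Y)" "ftt a z = \<Lambda> * \<beta> * Y" "ftx a z = - (\<beta> * (A * X * W1 s))" "fty a z = - (\<beta> * (A * X * W2 s))"
    "wNx a z = A / X * z1" "wNy a z = A / X * nu1 s"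
    unfolding wf_def jPhi_simps ftt_def ftx_def fty_def wNx_def wNy_def ho e1 Y_def AX
    by (simp_all add: A_def z1_def)
  have N: "wN a z - (wf a Jxx z + wf a Jyy z) = A * prmu s + B / 2"
    unfolding j wN_def ho nu_eq by (simp add: A_def algebra_simps)
  have Yk: "k0 \<le> Y"
  proof -
    have "Y = a * jPhi Jv z" unfolding Y_def AX jPhi_simps ho by simp
    moreover have "a * K1 \<le> a * jPhi Jv z" using rd a by (intro mult_left_mono) auto
    ultimately show ?thesis using a by linarith
  qed
  have bL: "\<Lambda> \<le> \<beta>"
  proof -
    have "eta (fst z) \<le> exp (- (\<Lambda> * fst z))" by (simp add: eta_def)
    then have "\<Lambda> * eta (fst z) \<le> \<Lambda> * exp (- (\<Lambda> * fst z))" using Lam0 by (intro mult_left_mono) auto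
    then show ?thesis using et by (simp add: \<beta>_def le_divide_eq)
  qed
  have zz: "z1\<^sup>2 + (nu1 s)\<^sup>2 \<le> 10 * b\<^sup>2"
  proof -
    have "\<bar>z1\<bar> \<le> \<bar>(kap - 2) * nu s\<bar> + \<bar>s * nu1 s\<bar>" unfolding z1_def by (rule abs_triangle_ineq4)
    also have "\<dots> \<le> 1 * b + 2 * b"
      unfolding abs_mult using bnd(5,6)[OF s] s kap_bounds sig_bounds b1 by (intro add_mono mult_mono) auto
    finally have "\<bar>z1\<bar>\<^sup>2 \<le> (3 * b)\<^sup>2" by (intro power_mono) auto
    moreover have "\<bar>nu1 s\<bar>\<^sup>2 \<le> b\<^sup>2" using bnd(6)[OF s] by (intro power_mono) auto
    ultimately show ?thesis by (simp add: power_mult_distrib)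
  qed
  have g: "gsq (wf a) z = A\<^sup>2 * X\<^sup>2 * ((W1 s)\<^sup>2 + (W2 s)\<^sup>2)"
    unfolding gsq_def j by (simp add: power_mult_distrib algebra_simps)
  have P: "prP s \<le> b" "0 < prP s" using bnd(1)[OF s] rd(6) by (auto simp: s_def)
  have Z0: "0 \<le> 10 * b\<^sup>2" by simp
  have "B * (p\<^sup>2 + q\<^sup>2 + (1 + A\<^sup>2 * X\<^sup>2 * ((W1 s)\<^sup>2 + (W2 s)\<^sup>2)) * r\<^sup>2)
    \<le> 4 * (A * H11 s * p\<^sup>2 + 2 * (A * H12 s) * p * q + A * H22 s * q\<^sup>2)
      + 2 * (A * prmu s + B / 2) * (p\<^sup>2 + q\<^sup>2) + 2 * r * (A / X * z1 * p + A / X * nu1 s * q)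
      + r\<^sup>2 * (\<Lambda> * \<beta> * Y + 4 * \<beta> * A\<^sup>2 * X\<^sup>2 * ((W1 s)\<^sup>2 + (W2 s)\<^sup>2)
          + 4 * A^3 * X\<^sup>2 * (H11 s * (W1 s)\<^sup>2 + 2 * H12 s * W1 s * W2 s + H22 s * (W2 s)\<^sup>2)
          - 2 * (A * prmu s + B / 2) * (A\<^sup>2 * X\<^sup>2 * ((W1 s)\<^sup>2 + (W2 s)\<^sup>2) + \<beta> * Y) - (A * prmu s + B / 2)\<^sup>2)"
    by (rule cone_quad_pos[OF dl b1 B1 prA[OF s] prC[OF s] prB[OF s] bnd(2)[OF s] bnd(3)[OF s] bnd(4)[OF s] P(2,1) zz Z0 A X Y_def Yk bL Lam k0])
  moreover have "\<Lambda> * \<beta> * Y + 4 * \<beta> * A\<^sup>2 * X\<^sup>2 * ((W1 s)\<^sup>2 + (W2 s)\<^sup>2)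
          + 4 * A^3 * X\<^sup>2 * (H11 s * (W1 s)\<^sup>2 + 2 * H12 s * W1 s * W2 s + H22 s * (W2 s)\<^sup>2)
      = ftt a z - 4 * (wf a Jx z * ftx a z + wf a Jy z * fty a z)
          + 4 * (wf a Jxx z * (wf a Jx z)\<^sup>2 + 2 * wf a Jxy z * wf a Jx z * wf a Jy z + wf a Jyy z * (wf a Jy z)\<^sup>2)"
    unfolding j by algebra
  ultimately show ?thesis unfolding N g by (simp only: j(3-6,10,11) diff_minus_eq_add)
qed

end

context cone_weight
begin

text \<open>Two cut-offs: one along the values of the weight, rising between the levels
  \<open>K1\<close> and \<open>2 * K1\<close>, and one at infinity, falling between |x| = R and 2 R,
  since R^2 + 3/4 (2 R)^2 = (2 R)^2.\<close>

definition jcutoff :: "real \<Rightarrow> ix \<Rightarrow> pt \<Rightarrow> real" where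
  "jcutoff R = jmul (jup K1 K1 jPhi) (jdown (R\<^sup>2) (3/4 * (2 * R)\<^sup>2) (jrho 0))"

lemma C12_jcutoff: "C12 xpos (jcutoff R)"
  unfolding jcutoff_def by (intro C12_jmul C12_jup C12_jdown C12_jPhi C12_jrho)

lemma jcutoff_bound: "0 < R \<Longrightarrow> \<bar>jcutoff R Jv z\<bar> \<le> 1"
  using ramp_bounds(1,2)[OF K1] ramp_bounds(1,2)[of "3/4 * (2 * R)\<^sup>2"]
  by (simp add: jcutoff_def jmul_simps jup_def jdown_def jcomp_simps abs_mult mult_le_one)

lemma jcutoff_zero:
  assumes R: "0 < R" and z: "jPhi Jv z \<le> K1 \<or> 2 * R \<le> norm (snd z)" shows "jcutoff R Jv z = 0"
  using z
proof
  assume "jPhi Jv z \<le> K1"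
  then show ?thesis using ramp_eq(1)[OF K1] by (simp add: jcutoff_def jmul_simps jup_def jcomp_simps)
next
  assume "2 * R \<le> norm (snd z)"
  then have "(2 * R)\<^sup>2 \<le> (norm (snd z))\<^sup>2" using R by (intro power_mono) auto
  then have "R\<^sup>2 + 3/4 * (2 * R)\<^sup>2 \<le> (norm (snd z - 0))\<^sup>2" by (simp add: power_mult_distrib)
  moreover have "0 < 3/4 * (2 * R)\<^sup>2" using R by simp
  ultimately have "ramp (R\<^sup>2) (3/4 * (2 * R)\<^sup>2) ((norm (snd z - 0))\<^sup>2) = 1" by (intro ramp_eq(3))
  then show ?thesis by (simp add: jcutoff_def jmul_simps jdown_def jcomp_simps jrho_simps)
qed

lemma jcutoff_flat:
  assumes R: "0 < R" and z: "2 * K1 \<le> jPhi Jv z" "norm (snd z) \<le> R"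
  shows "jcutoff R Jv z = 1" "jcutoff R Jt z = 0" "jcutoff R Jx z = 0" "jcutoff R Jy z = 0" "jcutoff R Jxx z = 0" "jcutoff R Jyy z = 0"
proof -
  have d: "0 < 3/4 * (2 * R)\<^sup>2" using R by simp
  have n: "(norm (snd z - 0))\<^sup>2 \<le> R\<^sup>2" using z(2) by (intro power_mono) auto
  have p: "K1 + K1 \<le> jPhi Jv z" using z by simp
  note f = ramp_eq(3,4)[OF K1 p] ramp2_eq(2)[OF K1 p] ramp_eq(1,2)[OF d n] ramp2_eq(1)[OF d n]
  show "jcutoff R Jv z = 1" "jcutoff R Jt z = 0" "jcutoff R Jx z = 0" "jcutoff R Jy z = 0" "jcutoff R Jxx z = 0" "jcutoff R Jyy z = 0"
    unfolding jcutoff_def jmul_simps jup_def jdown_def jcomp_simps jrho_simps f by simp_all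
qed

text \<open>The constant does not depend on \<open>R\<close>. First derivatives of the weight grow
  at most linearly and its time derivative at most quadratically as \<kappa> < 2, and its second
  space derivatives are bounded because x1 \<ge> \<open>x0\<close>; the cut-off at infinity has
  bounded derivatives for R \<ge> 1.\<close>

lemma cut_bound:
  assumes C: "0 \<le> C"
  obtains c3 where "0 \<le> c3" "\<And>R u z. 1 \<le> R \<Longrightarrow> z \<in> Kset R \<Longrightarrow>
     cuterr C u (jcutoff R) z \<le> c3 * (1 + norm (snd z))\<^sup>2 * (\<bar>u Jv z\<bar> + sqrt (gsq u z))"
proof -
  define q0 where "q0 = x0 powr (kap - 2)"
  have q0: "0 \<le> q0" by (simp add: q0_def)
  define ha where "ha = 120 * b / K1 + 160"
  define c1 where "c1 = 60 / K1\<^sup>2 * (2 * b\<^sup>2) + 60 / K1 * (\<Lambda> * b + 2 * (b * q0))"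
  define c2 where "c2 = c1 + 2 * (120 * b / K1 * 160) + 200"
  define c3 where "c3 = c2 + C * ha + 2 * ha"
  have nn: "0 \<le> ha" "0 \<le> c1" "0 \<le> c2" using b1 K1 q0 Lam0 by (auto simp: ha_def c1_def c2_def)
  show thesis
  proof (rule that[of c3])
    show "0 \<le> c3" using nn C by (simp add: c3_def)
    fix R :: real and u z assume R: "1 \<le> R" and z: "z \<in> Kset R"
    have R0: "0 < R" using R by simp
    have zr: "z \<in> region" and zn: "norm (snd z) \<le> 2 * R" using z by (auto simp: Kset_def)
    note rd = regionD[OF zr]
    define X where "X = snd z $ 1" define s where "s = slope z" define \<rho> where "\<rho> = 1 + norm (snd z)"
    have X: "0 < X" "X \<le> \<rho>" using rd by (auto simp: X_def \<rho>_def)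
    have r1: "1 \<le> \<rho>" by (simp add: \<rho>_def)
    have r12: "\<rho> \<le> \<rho>\<^sup>2" "1 \<le> \<rho>\<^sup>2" using r1 by (auto simp: power2_eq_square mult_le_cancel_left1 one_le_power intro: order_trans)
    have s: "\<bar>s\<bar> \<le> sig" using rd by (simp add: s_def)
    have e: "0 \<le> eta (fst z)" "eta (fst z) \<le> 1" "\<bar>eta1 (fst z)\<bar> \<le> \<Lambda>" using rd eta_le[of "fst z"] by auto
    have pw: "X powr kap \<le> \<rho>\<^sup>2" "X powr (kap - 1) \<le> \<rho>" "X powr (kap - 2) \<le> q0"
    proof -
      have "X powr kap \<le> \<rho> powr kap" using X kap_bounds by (intro powr_mono2) auto
      also have "\<dots> \<le> \<rho> powr 2" using r1 kap_bounds by (intro powr_mono) auto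
      finally show "X powr kap \<le> \<rho>\<^sup>2" using r1 by (simp add: powr_numeral)
      have "X powr (kap - 1) \<le> \<rho> powr (kap - 1)" using X kap_bounds by (intro powr_mono2) auto
      also have "\<dots> \<le> \<rho> powr 1" using r1 kap_bounds by (intro powr_mono) auto
      finally show "X powr (kap - 1) \<le> \<rho>" using r1 by simp
      show "X powr (kap - 2) \<le> q0" unfolding q0_def using x0 rd kap_bounds by (intro powr_mono2') (auto simp: X_def)
    qed
    have ho: "hom r F z = X powr r * F s" for r F by (simp add: hom_def X_def s_def)
    have hb: "\<bar>h * hom r F z\<bar> \<le> l * (m * b)" if "\<bar>h\<bar> \<le> l" "X powr r \<le> m" "\<bar>F s\<bar> \<le> b" for h r F l m
    proof -
      have "\<bar>h\<bar> * (X powr r * \<bar>F s\<bar>) \<le> l * (m * b)"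
        using that by (intro mult_mono mult_nonneg_nonneg) (auto intro: order_trans[OF _ that(1)] order_trans[OF _ that(2)])
      then show ?thesis by (simp add: ho abs_mult)
    qed
    have e': "\<bar>eta (fst z)\<bar> \<le> 1" using e by simp
    have P: "\<bar>jPhi Jt z\<bar> \<le> \<Lambda> * (\<rho>\<^sup>2 * b)" "\<bar>jPhi Jx z\<bar> \<le> 1 * (\<rho> * b)" "\<bar>jPhi Jy z\<bar> \<le> 1 * (\<rho> * b)"
       "\<bar>jPhi Jxx z\<bar> \<le> 1 * (q0 * b)" "\<bar>jPhi Jyy z\<bar> \<le> 1 * (q0 * b)"
      unfolding jPhi_simps
      by (rule hb, rule e(3) e', rule pw, rule bnd[OF s])+
    define v where "v = jPhi Jv z"
    define up where "up = jup K1 K1 jPhi"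
    define dn where "dn = jdown (R\<^sup>2) (3/4 * (2 * R)\<^sup>2) (jrho 0)"
    have rr: "\<bar>ramp1 K1 K1 v\<bar> \<le> 60 / K1" "\<bar>ramp2 K1 K1 v\<bar> \<le> 60 / K1\<^sup>2" using ramp_bounds[OF K1] ramp2_bound by auto
    have u1: "0 \<le> up Jv z" "up Jv z \<le> 1" using ramp_bounds[OF K1] by (auto simp: up_def jup_def jcomp_simps)
    have d0: "0 < 3/4 * (2 * R)\<^sup>2" using R0 by simp
    have d1: "0 \<le> dn Jv z" "dn Jv z \<le> 1" using ramp_bounds[OF d0] by (auto simp: dn_def jdown_def jcomp_simps)
    have dt: "dn Jt z = 0" by (simp add: dn_def jdown_def jcomp_simps jrho_simps)
    have dg: "\<bar>dn Jx z\<bar> + \<bar>dn Jy z\<bar> \<le> 160"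
    proof -
      have "\<bar>dn Jx z\<bar> + \<bar>dn Jy z\<bar> \<le> 240 / (3/4 * (2 * R))" unfolding dn_def using R0 zn by (intro ball_cut_bounds) auto
      also have "\<dots> \<le> 160" using R by (simp add: field_simps)
      finally show ?thesis .
    qed
    have dl: "\<bar>dn Jxx z + dn Jyy z\<bar> \<le> 200"
    proof -
      have "\<bar>dn Jxx z + dn Jyy z\<bar> \<le> 240 / ((3/4)\<^sup>2 * (2 * R)\<^sup>2) + 240 / (3/4 * (2 * R)\<^sup>2)"
        unfolding dn_def using R0 zn by (intro ball_cut_bounds) auto
      also have "\<dots> \<le> 240 / ((3/4)\<^sup>2 * 4) + 240 / (3/4 * 4)"
      proof -
        have "4 \<le> (2 * R)\<^sup>2" using power_mono[of 2 "2 * R" 2] R by simp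
        then show ?thesis using R0 by (intro add_mono divide_left_mono mult_left_mono) auto
      qed
      also have "\<dots> \<le> 200" by (simp add: power2_eq_square)
      finally show ?thesis .
    qed
    have K60: "0 \<le> 60 / K1" using K1 by simp
    have ux: "\<bar>up Jx z\<bar> \<le> 60 / K1 * (\<rho> * b)" "\<bar>up Jy z\<bar> \<le> 60 / K1 * (\<rho> * b)"
      unfolding up_def jup_def jcomp_simps v_def[symmetric] abs_mult
      using mult_mono[OF rr(1) P(2) K60 abs_ge_zero] mult_mono[OF rr(1) P(3) K60 abs_ge_zero] by (simp_all only: mult_1_left)
    have ugr: "\<bar>up Jx z\<bar> + \<bar>up Jy z\<bar> \<le> 120 * b / K1 * \<rho>\<^sup>2"
    proof -
      have "60 / K1 * (\<rho> * b) + 60 / K1 * (\<rho> * b) = 120 * b / K1 * \<rho>" by (simp add: field_simps)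
      then have "\<bar>up Jx z\<bar> + \<bar>up Jy z\<bar> \<le> 120 * b / K1 * \<rho>" using ux by linarith
      also have "\<dots> \<le> 120 * b / K1 * \<rho>\<^sup>2" using r12 b1 K1 by (intro mult_left_mono) auto
      finally show ?thesis .
    qed
    have uh: "\<bar>heat up z\<bar> \<le> c1 * \<rho>\<^sup>2"
    proof -
      have sq: "(jPhi Jx z)\<^sup>2 + (jPhi Jy z)\<^sup>2 \<le> 2 * b\<^sup>2 * \<rho>\<^sup>2"
        using power_mono[OF P(2), of 2] power_mono[OF P(3), of 2] by (simp add: power_mult_distrib mult.commute[of "\<rho>\<^sup>2"])
      have li: "\<bar>jPhi Jt z + jPhi Jxx z + jPhi Jyy z\<bar> \<le> (\<Lambda> * b + 2 * (b * q0)) * \<rho>\<^sup>2"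
      proof -
        have "\<bar>jPhi Jt z + jPhi Jxx z + jPhi Jyy z\<bar> \<le> \<Lambda> * (\<rho>\<^sup>2 * b) + 2 * (b * q0)" using P by (simp add: mult.commute)
        also have "\<dots> \<le> \<Lambda> * (\<rho>\<^sup>2 * b) + 2 * (b * q0) * \<rho>\<^sup>2"
          using mult_left_mono[OF r12(2), of "2 * (b * q0)"] b1 q0 by simp
        finally show ?thesis by (simp add: algebra_simps)
      qed
      have "heat up z = ramp2 K1 K1 v * ((jPhi Jx z)\<^sup>2 + (jPhi Jy z)\<^sup>2) + ramp1 K1 K1 v * (jPhi Jt z + jPhi Jxx z + jPhi Jyy z)"
        by (simp add: heat_def up_def jup_def jcomp_simps v_def algebra_simps)
      then have "\<bar>heat up z\<bar> \<le> \<bar>ramp2 K1 K1 v\<bar> * ((jPhi Jx z)\<^sup>2 + (jPhi Jy z)\<^sup>2) + \<bar>ramp1 K1 K1 v\<bar> * \<bar>jPhi Jt z + jPhi Jxx z + jPhi Jyy z\<bar>"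
        using abs_triangle_ineq[of "ramp2 K1 K1 v * ((jPhi Jx z)\<^sup>2 + (jPhi Jy z)\<^sup>2)" "ramp1 K1 K1 v * (jPhi Jt z + jPhi Jxx z + jPhi Jyy z)"]
        by (simp add: abs_mult)
      also have "\<dots> \<le> 60 / K1\<^sup>2 * (2 * b\<^sup>2 * \<rho>\<^sup>2) + 60 / K1 * ((\<Lambda> * b + 2 * (b * q0)) * \<rho>\<^sup>2)"
        using rr sq li K1 by (intro add_mono mult_mono) auto
      finally show ?thesis by (simp add: c1_def algebra_simps)
    qed
    have tri: "\<bar>h\<bar> \<le> \<bar>p\<bar> + 2 * (\<bar>q\<bar> + \<bar>r\<bar>) + \<bar>s\<bar>" if "h = p + 2 * (q + r) + s" for h p q r s :: real
      using that unfolding distrib_left by linarith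
    have tri2: "\<bar>p + q\<bar> + \<bar>r + s\<bar> \<le> (\<bar>p\<bar> + \<bar>q\<bar>) + (\<bar>r\<bar> + \<bar>s\<bar>)" for p q r s :: real by linarith
    have Xe: "jcutoff R = jmul up dn" by (simp add: jcutoff_def up_def dn_def)
    have "heat (jcutoff R) z = heat up z * dn Jv z + 2 * (up Jx z * dn Jx z + up Jy z * dn Jy z) + up Jv z * (dn Jxx z + dn Jyy z)"
      unfolding Xe heat_def jmul_simps dt by algebra
    then have "\<bar>heat (jcutoff R) z\<bar> \<le> \<bar>heat up z\<bar> * \<bar>dn Jv z\<bar> + 2 * (\<bar>up Jx z\<bar> * \<bar>dn Jx z\<bar> + \<bar>up Jy z\<bar> * \<bar>dn Jy z\<bar>) + \<bar>up Jv z\<bar> * \<bar>dn Jxx z + dn Jyy z\<bar>"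
      unfolding abs_mult[symmetric] by (rule tri)
    also have "\<dots> \<le> (c1 * \<rho>\<^sup>2) * 1 + 2 * (120 * b / K1 * \<rho>\<^sup>2 * 160) + 1 * 200"
    proof (intro add_mono)
      show "\<bar>heat up z\<bar> * \<bar>dn Jv z\<bar> \<le> (c1 * \<rho>\<^sup>2) * 1" using uh d1 nn by (intro mult_mono) auto
      have "\<bar>up Jx z\<bar> * \<bar>dn Jx z\<bar> + \<bar>up Jy z\<bar> * \<bar>dn Jy z\<bar> \<le> (\<bar>up Jx z\<bar> + \<bar>up Jy z\<bar>) * (\<bar>dn Jx z\<bar> + \<bar>dn Jy z\<bar>)"
        by (simp add: distrib_left distrib_right)
      also have "\<dots> \<le> 120 * b / K1 * \<rho>\<^sup>2 * 160" using ugr dg b1 K1 by (intro mult_mono) auto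
      finally show "2 * (\<bar>up Jx z\<bar> * \<bar>dn Jx z\<bar> + \<bar>up Jy z\<bar> * \<bar>dn Jy z\<bar>) \<le> 2 * (120 * b / K1 * \<rho>\<^sup>2 * 160)" by simp
      show "\<bar>up Jv z\<bar> * \<bar>dn Jxx z + dn Jyy z\<bar> \<le> 1 * 200" using u1 dl by (intro mult_mono) auto
    qed
    also have "\<dots> \<le> c2 * \<rho>\<^sup>2" using r12 by (simp add: c2_def algebra_simps)
    finally have hX: "\<bar>heat (jcutoff R) z\<bar> \<le> c2 * \<rho>\<^sup>2" .
    have gX: "\<bar>jcutoff R Jx z\<bar> + \<bar>jcutoff R Jy z\<bar> \<le> ha * \<rho>\<^sup>2"
    proof -
      have "\<bar>jcutoff R Jx z\<bar> + \<bar>jcutoff R Jy z\<bar> \<le> (\<bar>up Jx z\<bar> * \<bar>dn Jv z\<bar> + \<bar>up Jv z\<bar> * \<bar>dn Jx z\<bar>) + (\<bar>up Jy z\<bar> * \<bar>dn Jv z\<bar> + \<bar>up Jv z\<bar> * \<bar>dn Jy z\<bar>)"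
        unfolding Xe jmul_simps abs_mult[symmetric] by (rule tri2)
      also have "\<dots> = (\<bar>up Jx z\<bar> + \<bar>up Jy z\<bar>) * \<bar>dn Jv z\<bar> + \<bar>up Jv z\<bar> * (\<bar>dn Jx z\<bar> + \<bar>dn Jy z\<bar>)" by (simp add: algebra_simps)
      also have "\<dots> \<le> (120 * b / K1 * \<rho>\<^sup>2) * 1 + 1 * 160"
        using ugr dg u1 d1 b1 K1 by (intro add_mono mult_mono) auto
      also have "\<dots> \<le> ha * \<rho>\<^sup>2" using r12 by (simp add: ha_def algebra_simps)
      finally show ?thesis .
    qed
    have "cuterr C u (jcutoff R) z \<le> \<bar>u Jv z\<bar> * (c2 * \<rho>\<^sup>2 + C * (ha * \<rho>\<^sup>2)) + 2 * (ha * \<rho>\<^sup>2) * sqrt (gsq u z)"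
      unfolding cuterr_def using hX gX C by (intro add_mono mult_left_mono mult_right_mono) auto
    also have "\<dots> \<le> \<bar>u Jv z\<bar> * (c3 * \<rho>\<^sup>2) + (c3 * \<rho>\<^sup>2) * sqrt (gsq u z)"
    proof (intro add_mono mult_left_mono mult_right_mono)
      show "c2 * \<rho>\<^sup>2 + C * (ha * \<rho>\<^sup>2) \<le> c3 * \<rho>\<^sup>2" using nn by (simp add: c3_def algebra_simps)
      have "2 * ha \<le> c3" using nn C by (simp add: c3_def)
      then have "2 * ha * \<rho>\<^sup>2 \<le> c3 * \<rho>\<^sup>2" by (intro mult_right_mono) auto
      then show "2 * (ha * \<rho>\<^sup>2) \<le> c3 * \<rho>\<^sup>2" by (simp add: mult.assoc)
    qed auto
    also have "\<dots> = c3 * (1 + norm (snd z))\<^sup>2 * (\<bar>u Jv z\<bar> + sqrt (gsq u z))" by (simp add: \<rho>_def algebra_simps)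
    finally show "cuterr C u (jcutoff R) z \<le> c3 * (1 + norm (snd z))\<^sup>2 * (\<bar>u Jv z\<bar> + sqrt (gsq u z))" .
  qed
qed

section \<open>Vanishing on the axis\<close>

lemma dyadic_exists:
  fixes x r :: real
  assumes "0 < x" shows "x \<le> r \<Longrightarrow> r \<le> x * 2 ^ Suc m \<Longrightarrow> \<exists>n\<le>m. x * 2^n \<le> r \<and> r \<le> 2 * (x * 2^n)"
proof (induction m)
  case (Suc m)
  show ?case
  proof (cases "r \<le> x * 2 ^ Suc m")
    case True
    then show ?thesis using Suc le_SucI by blast
  next
    case False
    then show ?thesis using Suc.prems by (intro exI[of _ "Suc m"]) (auto simp: mult_ac)
  qed
qed auto

end

context cone_weight
begin

text \<open>Exponents are compared. Near \<open>p\<close> the weight exceeds \<open>3 * K1\<close>,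
  which yields the factor e^(6 a K1) on the left. The cut-off along the level is felt only where the
  weight is below \<open>2 * K1\<close>, which costs e^(4 a K1). The cut-off at infinity disappears
  as R \<rightarrow> \<infinity> for fixed a. Letting a \<rightarrow> \<infinity> afterwards
  contradicts \<open>u Jv p \<noteq> 0\<close>.\<close>

lemma vanish_point:
  fixes C lam T M :: real
  assumes C: "0 \<le> C" and BC: "B = 6 * C\<^sup>2 + 1" and lam: "16 + 4 * (6 * C\<^sup>2 + 1) \<le> lam" and T: "0 < T" "4 \<le> lam * T"
    and tl: "\<tau> = 1/(20 * lam)"
    and u: "solves C ({0<..<T} \<times> open_sector (1091/1000)) u"
    and M: "\<And>z. z \<in> {0<..<T} \<times> open_sector (1091/1000) \<Longrightarrow> \<bar>u Jv z\<bar> \<le> M"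
    and u0: "\<And>k e. 0 < e \<Longrightarrow> \<exists>d>0. \<forall>z\<in>{0<..<T} \<times> (open_sector (1091/1000) \<inter> cball 0 k). fst z < d \<longrightarrow> \<bar>u Jv z\<bar> \<le> e"
    and p: "p \<in> {0<..<\<tau>} \<times> open_sector sig" "3 * K1 < jPhi Jv p"
  shows "u Jv p = 0"
proof (rule ccontr)
  assume up: "u Jv p \<noteq> 0"
  have lam0: "0 < lam" using lam by (smt (verit) zero_le_power2)
  have tT: "\<tau> < T" unfolding tl using lam0 T by (simp add: field_simps)
  define U where "U = {0<..<\<tau>} \<times> open_sector sig"
  have U: "open U" unfolding U_def by (intro open_Times open_sector_open) auto
  have xp: "0 < x $ 1" if "x \<in> open_sector sig" for x
    using that sig_bounds unfolding open_sector_def by (smt (verit) mem_Collect_eq zero_less_mult_pos)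
  have Ux: "U \<subseteq> xpos" using xp by (auto simp: U_def xpos_def)
  have sc: "open_sector sig \<subseteq> open_sector (1091/1000)"
  proof
    fix x assume x: "x \<in> open_sector sig"
    have "sig * x $ 1 \<le> 1091/1000 * x $ 1" using xp[OF x] sig_bounds by (intro mult_right_mono) auto
    then show "x \<in> open_sector (1091/1000)" using x by (simp add: open_sector_def)
  qed
  have UV: "U \<subseteq> {0<..<T} \<times> open_sector (1091/1000)" using tT sc by (auto simp: U_def)
  have uU: "solves C U u" by (rule solves_mono[OF u UV])
  have uC: "C12 U u" using uU by (simp add: solves_def)
  define v where "v z = (u Jv z)\<^sup>2 + gsq u z" for z
  have v0: "0 \<le> v z" for z by (simp add: v_def)
  have cv: "continuous_on U v" unfolding v_def[abs_def] by (intro continuous_intros continuous_gsq uC C12D[OF uC])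
  obtain A where A: "0 \<le> A" "\<And>r e. x0 \<le> r \<Longrightarrow> 0 < e \<Longrightarrow> lint ({e..\<tau>} \<times> annulus r) v \<le> A * (r\<^sup>2 * exp (- (wid\<^sup>2 / 10 * r\<^sup>2)))"
  proof -
    obtain A where A: "0 \<le> A" "\<And>u r e. x0 \<le> r \<Longrightarrow> solves C ({0<..<T} \<times> open_sector (1091/1000)) u \<Longrightarrow>
      (\<And>z. z \<in> {0<..<T} \<times> open_sector (1091/1000) \<Longrightarrow> \<bar>u Jv z\<bar> \<le> M) \<Longrightarrow>
      (\<And>k e. 0 < e \<Longrightarrow> \<exists>d>0. \<forall>z\<in>{0<..<T} \<times> (open_sector (1091/1000) \<inter> cball 0 k). fst z < d \<longrightarrow> \<bar>u Jv z\<bar> \<le> e) \<Longrightarrow> 0 < e \<Longrightarrow>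
      lint ({e..1/(20 * lam)} \<times> annulus r) (\<lambda>z. (u Jv z)\<^sup>2 + gsq u z) \<le> A * (r\<^sup>2 * exp (- (wid\<^sup>2 / 10 * r\<^sup>2)))"
      using annulus_decay[OF C lam T x0(1), of M] by blast
    show thesis
    proof (rule that[OF A(1)])
      show "lint ({e..\<tau>} \<times> annulus r) v \<le> A * (r\<^sup>2 * exp (- (wid\<^sup>2 / 10 * r\<^sup>2)))" if "x0 \<le> r" "0 < e" for r e
        unfolding v_def[abs_def] tl by (rule A(2)[OF that(1) u M u0 that(2)])
    qed
  qed
  obtain c3 where c3: "0 \<le> c3" "\<And>R u z. 1 \<le> R \<Longrightarrow> z \<in> Kset R \<Longrightarrow>
     cuterr C u (jcutoff R) z \<le> c3 * (1 + norm (snd z))\<^sup>2 * (\<bar>u Jv z\<bar> + sqrt (gsq u z))" using cut_bound[OF C] by blast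
  define c where "c = wid\<^sup>2 / 10"
  have c: "0 < c" by (simp add: c_def wid_def)
  define S where "S = (\<Sum>n. gterm 0 c (x0 * 2^n))"
  define D where "D = 2 * c3\<^sup>2"
  have D: "0 \<le> D" by (simp add: D_def)
  \<comment> \<open>A closed ball about \<open>p\<close> on which the strict inequalities persist.
    The bound \<open>r \<le> fst p / 2\<close> keeps it away from time 0.\<close>
  obtain r where r: "0 < r" "r \<le> fst p / 2" "\<And>z. z \<in> cball p r \<Longrightarrow> z \<in> U \<and> 3 * K1 < jPhi Jv z \<and> \<bar>u Jv p\<bar> / 2 < \<bar>u Jv z\<bar>"
  proof -
    have c1: "continuous_on U (jPhi Jv)" by (rule continuous_on_subset[OF C12D(8)[OF C12_jPhi] Ux])
    have c2: "continuous_on U (\<lambda>z. \<bar>u Jv z\<bar>)" by (intro continuous_intros C12D[OF uC])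
    have "open (U \<inter> jPhi Jv -` {3 * K1<..})" by (rule continuous_open_preimage[OF c1 U]) auto
    moreover have "open (U \<inter> (\<lambda>z. \<bar>u Jv z\<bar>) -` {\<bar>u Jv p\<bar> / 2<..})" by (rule continuous_open_preimage[OF c2 U]) auto
    ultimately have o: "open ((U \<inter> jPhi Jv -` {3 * K1<..}) \<inter> (U \<inter> (\<lambda>z. \<bar>u Jv z\<bar>) -` {\<bar>u Jv p\<bar> / 2<..}))" by (rule open_Int)
    have "p \<in> (U \<inter> jPhi Jv -` {3 * K1<..}) \<inter> (U \<inter> (\<lambda>z. \<bar>u Jv z\<bar>) -` {\<bar>u Jv p\<bar> / 2<..})"
      using p up by (auto simp: U_def)
    then obtain r where r: "0 < r" "cball p r \<subseteq> (U \<inter> jPhi Jv -` {3 * K1<..}) \<inter> (U \<inter> (\<lambda>z. \<bar>u Jv z\<bar>) -` {\<bar>u Jv p\<bar> / 2<..})"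
      using o open_contains_cball by blast
    have fp: "0 < fst p" using p by auto
    show thesis
      by (rule that[of "min r (fst p / 2)"]) (use r fp in auto)
  qed
  define L where "L = cball p r"
  define \<mu> where "\<mu> = measure lborel L"
  have mu: "0 < \<mu>" using r(1) by (simp add: \<mu>_def L_def content_cball_pos)
  define q where "q = \<bar>u Jv p\<bar>\<^sup>2 / 4"
  have q: "0 < q" using up by (simp add: q_def)
  define e0 where "e0 = fst p / 2"
  have e0: "0 < e0" using p by (auto simp: e0_def)
  have LF: "e0 \<le> fst z" "norm (snd z) \<le> norm (snd p) + r" if "z \<in> L" for z
  proof -
    have d: "dist p z \<le> r" using that by (simp add: L_def)
    have "\<bar>fst p - fst z\<bar> \<le> dist p z" using dist_fst_le[of p z] by (simp add: dist_real_def)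
    then show "e0 \<le> fst z" using d r(2) by (simp add: e0_def)
    have "dist (snd p) (snd z) \<le> dist p z" by (rule dist_snd_le)
    then show "norm (snd z) \<le> norm (snd p) + r" using d norm_triangle_sub[of "snd z" "snd p"] by (simp add: dist_norm norm_minus_commute)
  qed
  define aa where "aa = k0 / K1"
  have aa: "0 < aa" "k0 \<le> aa * K1" using k0 K1 by (auto simp: aa_def)
  have main: "exp (6 * a * K1) * (q * \<mu>) \<le> 4 * (D * A * (exp (4 * a * K1) * S + gterm (2 * a * b) c (x0 * 2 ^ Suc m)))"
    if a: "aa \<le> a" and R1: "1 \<le> x0 * 2 ^ Suc m" and RL: "norm (snd p) + r \<le> x0 * 2 ^ Suc m" for a m
  proof -
    have a0: "0 < a" "k0 \<le> a * K1" using a aa K1 mult_right_mono[of aa a K1] by linarith+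
    define R where "R = x0 * 2 ^ Suc m"
    have R: "1 \<le> R" "0 < R" using R1 by (auto simp: R_def)
    define E where "E = 2 * a * b"
    \<comment> \<open>Bounds for the factor multiplying u^2 + |\<nabla>u|^2 on the n-th shell. Up to
      n = m the shells lie within |x| \<le> R, where the error occurs only below the level
      \<open>2 * K1\<close>; the shell n = m + 1 is R \<le> |x| \<le> 2 R, where the weight is
      estimated by its growth.\<close>
    define co where "co n = (if n \<le> m then exp (4 * a * K1) else exp (E * (2 * (x0 * 2^n)) powr kap)) * (D * (1 + 2 * (x0 * 2^n))^4)" for n
    have co0: "0 \<le> co n" for n using D by (simp add: co_def)
    define Err where "Err = D * A * (exp (4 * a * K1) * S + gterm E c R)"
    have ann: "x \<in> open_sector (1091/1000)" if "x \<in> annulus y" "0 < y" for x y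
    proof -
      have "\<bar>x $ 2\<bar> \<le> sig * x $ 1" "y \<le> norm x" using that by (auto simp: annulus_def)
      moreover from this have "x \<in> ball x (wid * y)" using that by (simp add: wid_def)
      ultimately show ?thesis using ball_subset_open_sector that by blast
    qed
    have ES: "(\<Sum>n\<le>Suc m. co n * (A * ((x0 * 2^n)\<^sup>2 * exp (- (wid\<^sup>2 / 10 * (x0 * 2^n)\<^sup>2))))) \<le> Err"
    proof -
      have "(\<Sum>n\<le>m. co n * (A * ((x0 * 2^n)\<^sup>2 * exp (- (wid\<^sup>2 / 10 * (x0 * 2^n)\<^sup>2))))) = (\<Sum>n\<le>m. (D * A * exp (4 * a * K1)) * gterm 0 c (x0 * 2^n))"
        by (rule sum.cong) (auto simp: co_def gterm_def c_def mult_ac)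
      also have "\<dots> = (D * A * exp (4 * a * K1)) * (\<Sum>n\<le>m. gterm 0 c (x0 * 2^n))" by (rule sum_distrib_left[symmetric])
      also have "\<dots> \<le> (D * A * exp (4 * a * K1)) * S"
        unfolding S_def using gterm_summable[OF c x0(1)] gterm_nonneg x0 D A
        by (intro mult_left_mono sum_le_suminf) auto
      finally have 1: "(\<Sum>n\<le>m. co n * (A * ((x0 * 2^n)\<^sup>2 * exp (- (wid\<^sup>2 / 10 * (x0 * 2^n)\<^sup>2))))) \<le> D * A * (exp (4 * a * K1) * S)" by (simp add: mult.assoc)
      have 2: "co (Suc m) * (A * ((x0 * 2^Suc m)\<^sup>2 * exp (- (wid\<^sup>2 / 10 * (x0 * 2^Suc m)\<^sup>2)))) = D * A * gterm E c R"
        unfolding co_def gterm_def c_def R_def by (simp add: mult_ac)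
      show ?thesis unfolding sum.atMost_Suc 2 Err_def distrib_left using 1 by simp
    qed
    have KU: "Kset R \<subseteq> U"
    proof
      fix z assume "z \<in> Kset R"
      then have "z \<in> region" by (simp add: Kset_def)
      from regionD[OF this] show "z \<in> U" by (cases z) (auto simp: U_def open_sector_def)
    qed
    have wfU: "C12 U (wf a)" "C12 U (jcutoff R)" using C12_wf C12_jcutoff Ux unfolding C12_def by (blast intro: has_pd_subset continuous_on_subset)+
    have ErrB: "lint (Kset R \<inter> {z. e \<le> fst z}) (\<lambda>z. exp (2 * wf a Jv z) * (cuterr C u (jcutoff R) z)\<^sup>2) \<le> Err" if e: "0 < e" for e
    proof -
      have "lint (Kset R \<inter> {z. e \<le> fst z}) (\<lambda>z. exp (2 * wf a Jv z) * (cuterr C u (jcutoff R) z)\<^sup>2)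
         \<le> (\<Sum>n\<in>{..Suc m}. lint ({e..\<tau>} \<times> annulus (x0 * 2^n)) (\<lambda>z. co n * v z))"
      proof (rule lint_cover)
        show "compact (Kset R \<inter> {z. e \<le> fst z})" by (rule compact_Kset[OF e])
        show "continuous_on (Kset R \<inter> {z. e \<le> fst z}) (\<lambda>z. exp (2 * wf a Jv z) * (cuterr C u (jcutoff R) z)\<^sup>2)"
          unfolding cuterr_def
          by (rule continuous_on_subset[of U]) (use KU in \<open>auto intro!: continuous_intros C12D[OF uC] C12D[OF wfU(1)] C12D[OF wfU(2)] continuous_gsq continuous_heat uC wfU\<close>)
        show "compact ({e..\<tau>} \<times> annulus (x0 * 2 ^ n))" for n by (intro compact_Times compact_annulus) auto
        have c1: "continuous_on ({0<..<T} \<times> open_sector (1091/1000)) v"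
          unfolding v_def[abs_def] using u by (intro continuous_intros continuous_gsq C12D) (auto simp: solves_def)
        show "continuous_on ({e..\<tau>} \<times> annulus (x0 * 2 ^ n)) (\<lambda>z. co n * v z)" for n
          by (intro continuous_on_mult continuous_on_const continuous_on_subset[OF c1]) (use e tT ann[of _ "x0 * 2^n"] x0 in auto)
        show "0 \<le> co n * v z" for n z using co0 v0 by simp
        fix z assume z: "z \<in> Kset R \<inter> {z. e \<le> fst z}"
        then have zR: "z \<in> region" "norm (snd z) \<le> 2 * R" "e \<le> fst z" "z \<in> Kset R" by (auto simp: Kset_def)
        note rd = regionD[OF zR(1)]
        define \<rho> where "\<rho> = norm (snd z)"
        have r0: "x0 \<le> \<rho>" using rd by (simp add: \<rho>_def)
        have cn: "0 \<le> cuterr C u (jcutoff R) z" using C by (simp add: cuterr_def)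
        have cb: "(cuterr C u (jcutoff R) z)\<^sup>2 \<le> D * (1 + \<rho>)^4 * v z"
        proof -
          have "(cuterr C u (jcutoff R) z)\<^sup>2 \<le> (c3 * (1 + \<rho>)\<^sup>2 * (\<bar>u Jv z\<bar> + sqrt (gsq u z)))\<^sup>2"
            unfolding \<rho>_def by (rule power_mono[OF c3(2)[OF R(1) zR(4)] cn])
          also have "\<dots> \<le> (c3 * (1 + \<rho>)\<^sup>2)\<^sup>2 * (2 * (\<bar>u Jv z\<bar>\<^sup>2 + (sqrt (gsq u z))\<^sup>2))"
            unfolding power_mult_distrib[of "c3 * (1 + \<rho>)\<^sup>2"] by (intro mult_left_mono sq_sum2_le) auto
          also have "\<dots> = D * ((1 + \<rho>)\<^sup>2)\<^sup>2 * v z" by (simp add: D_def v_def power_mult_distrib)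
          also have "((1 + \<rho>)\<^sup>2)\<^sup>2 = (1 + \<rho>)^4" by (simp add: power_mult[symmetric])
          finally show ?thesis .
        qed
        have fin: "exp (2 * wf a Jv z) * (cuterr C u (jcutoff R) z)\<^sup>2 \<le> e1 * (D * (1 + 2 * y)^4) * v z"
          if "\<rho> \<le> 2 * y" "0 \<le> y" "exp (2 * wf a Jv z) \<le> e1 \<or> cuterr C u (jcutoff R) z = 0" "0 \<le> e1" for y e1
        proof (cases "cuterr C u (jcutoff R) z = 0")
          case True
          then show ?thesis using that D v0 by simp
        next
          case False
          have "(1 + \<rho>)^4 \<le> (1 + 2 * y)^4" using that r0 x0 by (intro power_mono) auto
          then have "D * (1 + \<rho>)^4 * v z \<le> D * (1 + 2 * y)^4 * v z" using D v0 by (intro mult_right_mono mult_left_mono) auto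
          with cb have "(cuterr C u (jcutoff R) z)\<^sup>2 \<le> D * (1 + 2 * y)^4 * v z" by (rule order_trans)
          then have "exp (2 * wf a Jv z) * (cuterr C u (jcutoff R) z)\<^sup>2 \<le> e1 * (D * (1 + 2 * y)^4 * v z)"
            using that False by (intro mult_mono) auto
          then show ?thesis by (simp add: mult.assoc)
        qed
        have zann: "z \<in> {e..\<tau>} \<times> annulus y" if "y \<le> \<rho>" "\<rho> \<le> 2 * y" for y
          using rd zR that by (cases z) (auto simp: annulus_def \<rho>_def)
        show "\<exists>n\<in>{..Suc m}. z \<in> {e..\<tau>} \<times> annulus (x0 * 2 ^ n) \<and> exp (2 * wf a Jv z) * (cuterr C u (jcutoff R) z)\<^sup>2 \<le> co n * v z"
        proof (cases "\<rho> \<le> R")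
          case True
          obtain n where n: "n \<le> m" "x0 * 2^n \<le> \<rho>" "\<rho> \<le> 2 * (x0 * 2^n)"
            using dyadic_exists[OF x0(1) r0, of m] True by (auto simp: R_def)
          \<comment> \<open>Inside |x| \<le> R the cut-off is constant above the level
            \<open>2 * K1\<close>, so either the error vanishes or the weight is small.\<close>
          have "exp (2 * wf a Jv z) \<le> exp (4 * a * K1) \<or> cuterr C u (jcutoff R) z = 0"
          proof (cases "2 * K1 \<le> jPhi Jv z")
            case True
            note fl = jcutoff_flat[OF R(2) True \<open>\<rho> \<le> R\<close>[unfolded \<rho>_def]]
            show ?thesis by (simp add: cuterr_def heat_def fl)
          next
            case False
            then have "a * jPhi Jv z \<le> a * (2 * K1)" using a0 by (intro mult_left_mono) auto
            then show ?thesis by (simp add: wf_def mult_ac)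
          qed
          from fin[OF n(3) _ this] x0 have "exp (2 * wf a Jv z) * (cuterr C u (jcutoff R) z)\<^sup>2 \<le> co n * v z"
            using n(1) by (simp add: co_def)
          then show ?thesis using n zann[OF n(2,3)] by (intro bexI[of _ n]) auto
        next
          case False
          have hp: "hom kap prP z \<le> b * (snd z $ 1) powr kap" using rd by (intro hom_le) auto
          have "jPhi Jv z \<le> 1 * (b * (snd z $ 1) powr kap)"
            unfolding jPhi_simps using rd eta_le[of "fst z"] hp b1 by (intro mult_mono) (auto simp: hom_def)
          also have "\<dots> \<le> b * (2 * R) powr kap"
            using rd zR(2) b1 kap_bounds by (simp, intro mult_left_mono powr_mono2) auto
          finally have "a * jPhi Jv z \<le> a * (b * (2 * R) powr kap)" using a0 by (intro mult_left_mono) auto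
          then have "exp (2 * wf a Jv z) \<le> exp (E * (2 * (x0 * 2 ^ Suc m)) powr kap)" by (simp add: wf_def E_def R_def)
          then have "exp (2 * wf a Jv z) * (cuterr C u (jcutoff R) z)\<^sup>2 \<le> exp (E * (2 * (x0 * 2 ^ Suc m)) powr kap) * (D * (1 + 2 * (x0 * 2 ^ Suc m))^4) * v z"
            by (intro fin) (use zR(2) x0 in \<open>auto simp: \<rho>_def R_def\<close>)
          then have "exp (2 * wf a Jv z) * (cuterr C u (jcutoff R) z)\<^sup>2 \<le> co (Suc m) * v z" by (simp add: co_def)
          moreover have "z \<in> {e..\<tau>} \<times> annulus (x0 * 2 ^ Suc m)"
            by (rule zann) (use False zR(2) in \<open>auto simp: R_def \<rho>_def\<close>)
          ultimately show ?thesis by blast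
        qed
      qed auto
      also have "\<dots> \<le> (\<Sum>n\<le>Suc m. co n * (A * ((x0 * 2^n)\<^sup>2 * exp (- (wid\<^sup>2 / 10 * (x0 * 2^n)\<^sup>2)))))"
        unfolding lint_cmult using A(2)[OF _ e] x0(1) co0 by (intro sum_mono mult_left_mono) auto
      also note ES
      finally show ?thesis .
    qed
    \<comment> \<open>Any finite bound serves for the initial layer. The weight, unlike
      \<open>u\<close>, is regular up to time 0, so the compact truncated sector that includes time
      0 provides one.\<close>
    obtain Bq where Bq: "\<And>z. z \<in> Kset R \<Longrightarrow> \<bar>gsq (wf a) z - wf a Jt z\<bar> * exp (2 * wf a Jv z) \<le> Bq"
    proof -
      have "continuous_on xpos (\<lambda>z. \<bar>gsq (wf a) z - wf a Jt z\<bar> * exp (2 * wf a Jv z))"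
        by (intro continuous_intros continuous_gsq C12_wf C12D[OF C12_wf])
      then have "compact ((\<lambda>z. \<bar>gsq (wf a) z - wf a Jt z\<bar> * exp (2 * wf a Jv z)) ` truncated_sector 0 R)"
        by (intro compact_continuous_image compact_truncated_sector) (rule continuous_on_subset[OF _ truncated_sector_xpos])
      then have "bounded ((\<lambda>z. \<bar>gsq (wf a) z - wf a Jt z\<bar> * exp (2 * wf a Jv z)) ` truncated_sector 0 R)" by (rule compact_imp_bounded)
      then obtain Bq where "\<forall>x\<in>(\<lambda>z. \<bar>gsq (wf a) z - wf a Jt z\<bar> * exp (2 * wf a Jv z)) ` truncated_sector 0 R. norm x \<le> Bq"
        unfolding bounded_iff by blast
      then show thesis using Kset_truncated_sector[of R] by (intro that[of Bq]) fastforce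
    qed
    have car: "lint (Kset R \<inter> {z. e0 \<le> fst z}) (\<lambda>z. exp (2 * wf a Jv z) * ((jmul u (jcutoff R) Jv z)\<^sup>2 + gsq (jmul u (jcutoff R)) z)) \<le> 4 * Err"
    proof (rule carleman_initial[where U=U and f="wf a" and N="wN a" and Nx="wNx a" and Ny="wNy a" and ftt="ftt a" and ftx="ftx a" and fty="fty a" and C=C and Bq=Bq
         and ?c1.0="\<chi> i. 0 $ i - 2 * R" and ?c2.0="\<chi> i. 0 $ i + 2 * R"])
      show "compact (Kset R \<inter> {z. e \<le> fst z})" if "0 < e" for e by (rule compact_Kset[OF that])
      show "0 < fst z" if "z \<in> Kset R" for z using that regionD by (auto simp: Kset_def)
      show "snd z \<in> cbox (\<chi> i. 0 $ i - 2 * R) (\<chi> i. 0 $ i + 2 * R)" if "z \<in> Kset R" for z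
        by (rule cball_in_box) (use that in \<open>simp add: Kset_def\<close>)
      show "jcutoff R Jv z = 0" if "z \<in> U - Kset R" for z
      proof (rule jcutoff_zero[OF R(2)])
        have "z \<notin> region \<or> 2 * R < norm (snd z)" using that by (auto simp: Kset_def)
        moreover have "z \<in> region \<or> jPhi Jv z < K1" using that xp[of "snd z"] by (cases z) (auto simp: region_def U_def open_sector_def)
        ultimately show "jPhi Jv z \<le> K1 \<or> 2 * R \<le> norm (snd z)" by auto
      qed
      show "\<bar>jcutoff R Jv z\<bar> \<le> 1" for z by (rule jcutoff_bound[OF R(2)])
      show "has_pd dT U (wf a Jt) (ftt a)" "has_pd dX U (wf a Jt) (ftx a)" "has_pd dY U (wf a Jt) (fty a)"
        "has_pd dT U (wf a Jx) (ftx a)" "has_pd dT U (wf a Jy) (fty a)" "has_pd dX U (wN a) (wNx a)" "has_pd dY U (wN a) (wNy a)"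
        by (rule has_pd_subset[OF _ Ux], rule weight_pd)+
      show "continuous_on U (ftt a)" "continuous_on U (ftx a)" "continuous_on U (fty a)" "continuous_on U (wN a)" "continuous_on U (wNx a)" "continuous_on U (wNy a)"
        by (rule continuous_on_subset[OF _ Ux], rule weight_cont)+
      show "\<bar>heat u z\<bar> \<le> C * (\<bar>u Jv z\<bar> + sqrt (gsq u z))" if "z \<in> Kset R" for z using uU KU that by (auto simp: solves_def)
      show "\<exists>d>0. \<forall>z\<in>Kset R. fst z < d \<longrightarrow> \<bar>u Jv z\<bar> \<le> e" if e: "0 < e" for e
      proof -
        obtain d where d: "0 < d" "\<forall>z\<in>{0<..<T} \<times> (open_sector (1091/1000) \<inter> cball 0 (2 * R)). fst z < d \<longrightarrow> \<bar>u Jv z\<bar> \<le> e" using u0[OF e] by blast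
        have "z \<in> {0<..<T} \<times> (open_sector (1091/1000) \<inter> cball 0 (2 * R))" if "z \<in> Kset R" for z
        proof -
          have "z \<in> {0<..<T} \<times> open_sector (1091/1000)" using that KU UV by blast
          moreover have "norm (snd z) \<le> 2 * R" using that by (simp add: Kset_def)
          ultimately show ?thesis by (cases z) auto
        qed
        then show ?thesis using d by blast
      qed
      show "(6 * C\<^sup>2 + 1) * (a'\<^sup>2 + b'\<^sup>2 + (1 + gsq (wf a) z) * c'\<^sup>2)
      \<le> 4 * (wf a Jxx z * a'\<^sup>2 + 2 * wf a Jxy z * a' * b' + wf a Jyy z * b'\<^sup>2)
        + 2 * (wN a z - (wf a Jxx z + wf a Jyy z)) * (a'\<^sup>2 + b'\<^sup>2) + 2 * c' * (wNx a z * a' + wNy a z * b')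
        + c'\<^sup>2 * (ftt a z - 4 * (wf a Jx z * ftx a z + wf a Jy z * fty a z)
          + 4 * (wf a Jxx z * (wf a Jx z)\<^sup>2 + 2 * wf a Jxy z * wf a Jx z * wf a Jy z + wf a Jyy z * (wf a Jy z)\<^sup>2)
          - 2 * (wN a z - (wf a Jxx z + wf a Jyy z)) * (gsq (wf a) z - wf a Jt z) - (wN a z - (wf a Jxx z + wf a Jyy z))\<^sup>2)"
        if "z \<in> Kset R" for z a' b' c'
        unfolding BC[symmetric] by (rule weight_pos[OF _ a0]) (use that in \<open>simp add: Kset_def\<close>)
    qed (use U KU uC wfU C Bq ErrB e0 in auto)
    have LK: "z \<in> Kset R \<inter> {z. e0 \<le> fst z}" if z: "z \<in> L" for z
    proof -
      have zU: "z \<in> U" "3 * K1 < jPhi Jv z" using r(3)[of z] z by (auto simp: L_def)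
      then have "z \<in> region" using xp[of "snd z"] K1 by (cases z) (auto simp: region_def U_def open_sector_def)
      moreover have "norm (snd z) \<le> 2 * R" using LF(2)[OF z] RL R by (simp add: R_def)
      ultimately show ?thesis using LF(1)[OF z] by (simp add: Kset_def)
    qed
    have "lint L (\<lambda>z. exp (6 * a * K1) * q) \<le> lint (Kset R \<inter> {z. e0 \<le> fst z}) (\<lambda>z. exp (2 * wf a Jv z) * ((jmul u (jcutoff R) Jv z)\<^sup>2 + gsq (jmul u (jcutoff R)) z))"
    proof (rule lint_mono_sets)
      have wC: "C12 U (jmul u (jcutoff R))" by (intro C12_jmul uC wfU)
      show "continuous_on (Kset R \<inter> {z. e0 \<le> fst z}) (\<lambda>z. exp (2 * wf a Jv z) * ((jmul u (jcutoff R) Jv z)\<^sup>2 + gsq (jmul u (jcutoff R)) z))"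
        by (rule continuous_on_subset[of U]) (use KU in \<open>auto intro!: continuous_intros C12D[OF wfU(1)] C12D[OF wC] continuous_gsq wC\<close>)
      show "compact (Kset R \<inter> {z. e0 \<le> fst z})" by (rule compact_Kset[OF e0])
      fix z assume z: "z \<in> L"
      have zU: "3 * K1 < jPhi Jv z" "\<bar>u Jv p\<bar> / 2 < \<bar>u Jv z\<bar>" using r(3)[of z] z by (auto simp: L_def)
      have "norm (snd z) \<le> R" using LF(2)[OF z] RL by (simp add: R_def)
      then have fl: "jcutoff R Jv z = 1" using jcutoff_flat(1)[OF R(2)] zU K1 by simp
      have "a * (3 * K1) \<le> a * jPhi Jv z" using zU a0 by (intro mult_left_mono) auto
      then have ex: "exp (6 * a * K1) \<le> exp (2 * wf a Jv z)" by (simp add: wf_def mult_ac)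
      have qq: "q \<le> (jmul u (jcutoff R) Jv z)\<^sup>2 + gsq (jmul u (jcutoff R)) z"
      proof -
        have "(\<bar>u Jv p\<bar> / 2)\<^sup>2 \<le> \<bar>u Jv z\<bar>\<^sup>2" using zU by (intro power_mono) auto
        then have "q \<le> (jmul u (jcutoff R) Jv z)\<^sup>2" by (simp add: q_def jmul_simps fl power_divide)
        then show ?thesis by (simp add: add_increasing2)
      qed
      have "exp (6 * a * K1) * q \<le> exp (2 * wf a Jv z) * ((jmul u (jcutoff R) Jv z)\<^sup>2 + gsq (jmul u (jcutoff R)) z)"
        by (rule mult_mono[OF ex qq]) (use q in auto)
      then show "z \<in> Kset R \<inter> {z. e0 \<le> fst z} \<and> exp (6 * a * K1) * q \<le> exp (2 * wf a Jv z) * ((jmul u (jcutoff R) Jv z)\<^sup>2 + gsq (jmul u (jcutoff R)) z)"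
        using LK[OF z] by blast
    qed (auto simp: L_def)
    also note car
    also have "lint L (\<lambda>z. exp (6 * a * K1) * q) = exp (6 * a * K1) * q * \<mu>" unfolding \<mu>_def by (rule lint_const) (simp add: L_def)
    finally show ?thesis by (simp add: Err_def E_def R_def mult.assoc)
  qed
  \<comment> \<open>The radius tends to infinity while a is fixed; a is enlarged only
    afterwards.\<close>
  have lim: "exp (6 * a * K1) * (q * \<mu>) \<le> 4 * (D * A * (exp (4 * a * K1) * S))" if a: "aa \<le> a" for a
  proof -
    have a0: "0 < a" using a aa by linarith
    have "(\<lambda>m. gterm (2 * a * b) c (x0 * 2 ^ Suc m)) \<longlonglongrightarrow> 0"
      using LIMSEQ_Suc[OF gterm_tendsto[OF c x0(1), of "2 * a * b"]] a0 b1 by simp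
    then have l: "(\<lambda>m. 4 * (D * A * (exp (4 * a * K1) * S + gterm (2 * a * b) c (x0 * 2 ^ Suc m)))) \<longlonglongrightarrow> 4 * (D * A * (exp (4 * a * K1) * S + 0))"
      by (intro tendsto_intros)
    obtain n0 where n0: "(max 1 (norm (snd p) + r)) / x0 < 2^n0" using real_arch_pow[of 2 "(max 1 (norm (snd p) + r)) / x0"] by auto
    have ev: "exp (6 * a * K1) * (q * \<mu>) \<le> 4 * (D * A * (exp (4 * a * K1) * S + gterm (2 * a * b) c (x0 * 2 ^ Suc m)))" if "n0 \<le> m" for m
    proof -
      have "(2::real)^n0 \<le> 2 ^ Suc m" using that by (intro power_increasing) auto
      then have "x0 * 2^n0 \<le> x0 * 2 ^ Suc m" using x0 by (intro mult_left_mono) auto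
      moreover have "max 1 (norm (snd p) + r) < x0 * 2^n0" using n0 x0 by (simp add: field_simps)
      ultimately show ?thesis by (intro main[OF a]) auto
    qed
    have "exp (6 * a * K1) * (q * \<mu>) \<le> 4 * (D * A * (exp (4 * a * K1) * S + 0))"
      by (rule LIMSEQ_le_const[OF l]) (use ev in blast)
    then show ?thesis by simp
  qed
  \<comment> \<open>Chosen so that \<open>2 * a * K1\<close> reaches the ratio by which e^(2 a K1)
    is bounded; the contradiction is then s < e^s.\<close>
  define a where "a = max aa (4 * (D * A * S) / (q * \<mu>) / (2 * K1))"
  have a: "aa \<le> a" "4 * (D * A * S) / (q * \<mu>) \<le> 2 * a * K1"
  proof -
    show "aa \<le> a" by (simp add: a_def)
    have "4 * (D * A * S) / (q * \<mu>) / (2 * K1) \<le> a" by (simp add: a_def)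
    moreover have "w \<le> 2 * a * K1" if "w / (2 * K1) \<le> a" for w using that K1 by (simp add: divide_le_eq mult_ac)
    ultimately show "4 * (D * A * S) / (q * \<mu>) \<le> 2 * a * K1" by blast
  qed
  have e6: "exp (6 * a * K1) = exp (4 * a * K1) * exp (2 * a * K1)" by (simp add: exp_add[symmetric])
  have "exp (4 * a * K1) * (exp (2 * a * K1) * (q * \<mu>)) \<le> exp (4 * a * K1) * (4 * (D * A * S))"
    using lim[OF a(1)] unfolding e6 by (simp add: mult_ac)
  then have "exp (2 * a * K1) * (q * \<mu>) \<le> 4 * (D * A * S)" by simp
  then have "exp (2 * a * K1) \<le> 4 * (D * A * S) / (q * \<mu>)" using q mu by (simp add: le_divide_eq)
  moreover have "2 * a * K1 < exp (2 * a * K1)" using exp_ge_add_one_self[of "2 * a * K1"] by linarith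
  ultimately show False using a(2) by linarith
qed

end

text \<open>The time \<open>\<tau>\<close> depends on \<open>C\<close> and \<open>T\<close> only,
  through \<open>lam\<close>. The weight, in contrast, is adapted to the point: the level
  \<open>K1\<close> is chosen after \<open>p\<close>, and it may be arbitrarily small.\<close>

lemma open_sector_vanish:
  fixes C T :: real
  assumes C: "0 \<le> C" and T: "0 < T"
  obtains \<tau> where "0 < \<tau>" "\<tau> < T" "\<And>u M p. solves C ({0<..<T} \<times> open_sector (1091/1000)) u \<Longrightarrow>
    (\<And>z. z \<in> {0<..<T} \<times> open_sector (1091/1000) \<Longrightarrow> \<bar>u Jv z\<bar> \<le> M) \<Longrightarrow>
    (\<And>k e. 0 < e \<Longrightarrow> \<exists>d>0. \<forall>z\<in>{0<..<T} \<times> (open_sector (1091/1000) \<inter> cball 0 k). fst z < d \<longrightarrow> \<bar>u Jv z\<bar> \<le> e) \<Longrightarrow>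
    0 < fst p \<Longrightarrow> fst p < \<tau> \<Longrightarrow> 0 < snd p $ 1 \<Longrightarrow> snd p $ 2 = 0 \<Longrightarrow> u Jv p = 0"
proof -
  define lam where "lam = max (16 + 4 * (6 * C\<^sup>2 + 1)) (4 / T)"
  have lam: "16 + 4 * (6 * C\<^sup>2 + 1) \<le> lam" "4 / T \<le> lam" by (simp_all add: lam_def)
  have lT: "4 \<le> lam * T" using lam(2) T by (simp add: divide_le_eq)
  have lam0: "0 < lam" using lam(1) by (smt (verit) zero_le_power2)
  define \<tau> where "\<tau> = 1/(20 * lam)"
  have tau: "0 < \<tau>" "\<tau> < T" using lam0 lT T by (auto simp: \<tau>_def field_simps)
  define B where "B = 6 * C\<^sup>2 + 1"
  have B1: "1 \<le> B" by (simp add: B_def)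
  obtain \<delta> b where db: "0 < \<delta>" "1 \<le> b"
    "\<And>s. \<bar>s\<bar> \<le> sig \<Longrightarrow> \<delta> \<le> 4 * (H11 s * (W1 s)\<^sup>2 + 2 * H12 s * W1 s * W2 s + H22 s * (W2 s)\<^sup>2) - 2 * prmu s * ((W1 s)\<^sup>2 + (W2 s)\<^sup>2)"
    "\<And>s. \<bar>s\<bar> \<le> sig \<Longrightarrow> \<delta> \<le> 4 * ((W1 s)\<^sup>2 + (W2 s)\<^sup>2) - 2 * prmu s * prP s"
    "\<And>s x y. \<bar>s\<bar> \<le> sig \<Longrightarrow> 2 * \<delta> * (x\<^sup>2 + y\<^sup>2) \<le> 4 * (H11 s * x\<^sup>2 + 2 * H12 s * x * y + H22 s * y\<^sup>2) + 2 * prmu s * (x\<^sup>2 + y\<^sup>2)"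
    "\<And>s. \<bar>s\<bar> \<le> sig \<Longrightarrow> \<bar>prP s\<bar> \<le> b" "\<And>s. \<bar>s\<bar> \<le> sig \<Longrightarrow> \<bar>prmu s\<bar> \<le> b"
    "\<And>s. \<bar>s\<bar> \<le> sig \<Longrightarrow> \<bar>W1 s\<bar> \<le> b" "\<And>s. \<bar>s\<bar> \<le> sig \<Longrightarrow> \<bar>W2 s\<bar> \<le> b"
    "\<And>s. \<bar>s\<bar> \<le> sig \<Longrightarrow> \<bar>nu s\<bar> \<le> b" "\<And>s. \<bar>s\<bar> \<le> sig \<Longrightarrow> \<bar>nu1 s\<bar> \<le> b"
    "\<And>s. \<bar>s\<bar> \<le> sig \<Longrightarrow> \<bar>H11 s\<bar> \<le> b" "\<And>s. \<bar>s\<bar> \<le> sig \<Longrightarrow> \<bar>H22 s\<bar> \<le> b"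
    using profile_constants by blast
  \<comment> \<open>The sum of the two lower bounds that \<open>cone_quad_pos\<close> imposes on the
    decay rate.\<close>
  define \<Lambda> where "\<Lambda> = 4 * B * b\<^sup>2 / \<delta> + 2 * B"
  have L1: "4 * B * b\<^sup>2 \<le> \<Lambda> * \<delta>"
  proof -
    have "\<Lambda> * \<delta> = 4 * B * b\<^sup>2 + 2 * B * \<delta>" using db(1) by (simp add: \<Lambda>_def distrib_right)
    then show ?thesis using db(1) B1 by simp
  qed
  have L2: "2 * B \<le> \<Lambda>" using db(1) B1 by (simp add: \<Lambda>_def)
  have L0: "0 < \<Lambda>" using L2 B1 by linarith
  show thesis
  proof (rule that[OF tau])
    fix u :: "ix \<Rightarrow> pt \<Rightarrow> real" and M :: real and p :: pt
    assume u: "solves C ({0<..<T} \<times> open_sector (1091/1000)) u"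
      "\<And>z. z \<in> {0<..<T} \<times> open_sector (1091/1000) \<Longrightarrow> \<bar>u Jv z\<bar> \<le> M"
      "\<And>k e. 0 < e \<Longrightarrow> \<exists>d>0. \<forall>z\<in>{0<..<T} \<times> (open_sector (1091/1000) \<inter> cball 0 k). fst z < d \<longrightarrow> \<bar>u Jv z\<bar> \<le> e"
      and p: "0 < fst p" "fst p < \<tau>" "0 < snd p $ 1" "snd p $ 2 = 0"
    \<comment> \<open>One quarter of the value of the weight at \<open>p\<close>, so that
      \<open>p\<close> lies above the level \<open>3 * K1\<close>.\<close>
    define K1 where "K1 = (exp (- (\<Lambda> * fst p)) - exp (- (\<Lambda> * \<tau>))) * ((snd p $ 1) powr kap * prP 0) / 4"
    have K1: "0 < K1" unfolding K1_def using L0 p prP_0 by simp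
    interpret cone_weight \<delta> b \<Lambda> \<tau> K1 B
      by standard (use db B1 L1 L2 tau K1 in blast)+
    have "jPhi Jv p = 4 * K1" by (simp add: jPhi_simps eta_def hom_def slope_def p K1_def)
    then have "3 * K1 < jPhi Jv p" using K1 by simp
    moreover have "p \<in> {0<..<\<tau>} \<times> open_sector sig" using p sig_bounds by (cases p) (auto simp: open_sector_def)
    ultimately show "u Jv p = 0"
      using vanish_point[OF C B_def lam(1) T lT \<tau>_def u] by blast
  qed
qed

section \<open>From the axis to the whole domain\<close>

lemma double_difference:
  fixes f :: "'a::real_normed_vector \<Rightarrow> real"
  assumes pd: "has_pd d U f fd" "has_pd e U fd fde" and h: "0 < h"
    and box: "\<And>s t. 0 \<le> s \<Longrightarrow> s \<le> h \<Longrightarrow> 0 \<le> t \<Longrightarrow> t \<le> h \<Longrightarrow> z + s *\<^sub>R d + t *\<^sub>R e \<in> U"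
  shows "\<exists>s t. 0 \<le> s \<and> s \<le> h \<and> 0 \<le> t \<and> t \<le> h \<and>
    f (z + h *\<^sub>R d + h *\<^sub>R e) - f (z + h *\<^sub>R d) - f (z + h *\<^sub>R e) + f z = h * h * fde (z + s *\<^sub>R d + t *\<^sub>R e)"
proof -
  have D: "((\<lambda>s. f (z + s *\<^sub>R d + h *\<^sub>R e) - f (z + s *\<^sub>R d)) has_real_derivative
      fd (z + s *\<^sub>R d + h *\<^sub>R e) - fd (z + s *\<^sub>R d)) (at s)" if s: "0 \<le> s" "s \<le> h" for s
  proof (rule DERIV_diff)
    have r: "z + r *\<^sub>R d + h *\<^sub>R e = (z + h *\<^sub>R e) + r *\<^sub>R d" for r by (simp only: add_ac)
    have "z + s *\<^sub>R d + h *\<^sub>R e \<in> U" by (rule box) (use s h in auto)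
    from has_pd_line[OF pd(1) this[unfolded r]] show "((\<lambda>s. f (z + s *\<^sub>R d + h *\<^sub>R e)) has_real_derivative fd (z + s *\<^sub>R d + h *\<^sub>R e)) (at s)"
      by (simp only: r)
    show "((\<lambda>s. f (z + s *\<^sub>R d)) has_real_derivative fd (z + s *\<^sub>R d)) (at s)"
      by (rule has_pd_line[OF pd(1)]) (use box[of s 0] s h in simp)
  qed
  obtain s where s: "0 < s" "s < h" "(f (z + h *\<^sub>R d + h *\<^sub>R e) - f (z + h *\<^sub>R d)) - (f (z + 0 *\<^sub>R d + h *\<^sub>R e) - f (z + 0 *\<^sub>R d))
      = (h - 0) * (fd (z + s *\<^sub>R d + h *\<^sub>R e) - fd (z + s *\<^sub>R d))"
    using MVT2[OF h, of "\<lambda>s. f (z + s *\<^sub>R d + h *\<^sub>R e) - f (z + s *\<^sub>R d)", OF D] by auto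
  have D2: "((\<lambda>t. fd (z + s *\<^sub>R d + t *\<^sub>R e)) has_real_derivative fde (z + s *\<^sub>R d + t *\<^sub>R e)) (at t)" if "0 \<le> t" "t \<le> h" for t
    by (rule has_pd_line[OF pd(2)]) (use box[of s t] s that in simp)
  obtain t where t: "0 < t" "t < h" "fd (z + s *\<^sub>R d + h *\<^sub>R e) - fd (z + s *\<^sub>R d + 0 *\<^sub>R e) = (h - 0) * fde (z + s *\<^sub>R d + t *\<^sub>R e)"
    using MVT2[OF h, of "\<lambda>t. fd (z + s *\<^sub>R d + t *\<^sub>R e)", OF D2] by auto
  have "f (z + h *\<^sub>R d + h *\<^sub>R e) - f (z + h *\<^sub>R d) - f (z + h *\<^sub>R e) + f z
      = h * (fd (z + s *\<^sub>R d + h *\<^sub>R e) - fd (z + s *\<^sub>R d))" using s(3) by simp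
  also have "fd (z + s *\<^sub>R d + h *\<^sub>R e) - fd (z + s *\<^sub>R d) = h * fde (z + s *\<^sub>R d + t *\<^sub>R e)" using t(3) by simp
  finally show ?thesis using s(1,2) t(1,2) by (metis less_imp_le mult.assoc)
qed

text \<open>The second difference over a small parallelogram, divided by h^2, is a value of either
  mixed derivative at a point nearby, and continuity of both forces equality at \<open>z\<close>.
  The class \<open>C12_on\<close> provides the two orders separately, while a family has a single
  entry \<open>Jxy\<close>.\<close>

lemma mixed_partials:
  fixes f :: "'a::real_normed_vector \<Rightarrow> real"
  assumes U: "open U" "z \<in> U" and pd: "has_pd d U f fd" "has_pd e U f fe" "has_pd e U fd fde" "has_pd d U fe fed"
    and c: "continuous_on U fde" "continuous_on U fed"
  shows "fde z = fed z"
proof (rule ccontr)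
  assume ne: "fde z \<noteq> fed z"
  define \<epsilon> where "\<epsilon> = \<bar>fde z - fed z\<bar> / 2"
  have eps: "0 < \<epsilon>" using ne by (simp add: \<epsilon>_def)
  obtain d1 where d1: "0 < d1" "\<And>y. y \<in> U \<Longrightarrow> dist y z < d1 \<Longrightarrow> dist (fde y) (fde z) < \<epsilon>"
    using c(1) U(2) eps unfolding continuous_on_iff by blast
  obtain d2 where d2: "0 < d2" "\<And>y. y \<in> U \<Longrightarrow> dist y z < d2 \<Longrightarrow> dist (fed y) (fed z) < \<epsilon>"
    using c(2) U(2) eps unfolding continuous_on_iff by blast
  obtain d3 where d3: "0 < d3" "ball z d3 \<subseteq> U" using U open_contains_ball by blast
  define m where "m = min d1 (min d2 d3)"
  have m: "0 < m" "m \<le> d1" "m \<le> d2" "m \<le> d3" using d1 d2 d3 by (auto simp: m_def)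
  define h where "h = m / (2 * (norm d + norm e + 1))"
  have n0: "0 < 2 * (norm d + norm e + 1)" by (simp add: add_nonneg_pos)
  have h: "0 < h" using m n0 by (simp add: h_def)
  have hm: "h * (norm d + norm e) < m"
  proof -
    have "h * (norm d + norm e) \<le> h * (norm d + norm e + 1)" using h by (intro mult_left_mono) auto
    also have "\<dots> = m / 2" using n0 by (simp add: h_def field_simps)
    finally show ?thesis using m by simp
  qed
  have near: "dist (z + s *\<^sub>R d + t *\<^sub>R e) z < m" if "0 \<le> s" "s \<le> h" "0 \<le> t" "t \<le> h" for s t
  proof -
    have "dist (z + s *\<^sub>R d + t *\<^sub>R e) z = norm (s *\<^sub>R d + t *\<^sub>R e)" by (simp add: dist_norm)
    also have "\<dots> \<le> s * norm d + t * norm e" using norm_triangle_ineq[of "s *\<^sub>R d" "t *\<^sub>R e"] that by simp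
    also have "\<dots> \<le> h * norm d + h * norm e" using that by (intro add_mono mult_right_mono) auto
    finally show ?thesis using hm by (simp add: distrib_left)
  qed
  have box: "z + s *\<^sub>R d + t *\<^sub>R e \<in> U" if "0 \<le> s" "s \<le> h" "0 \<le> t" "t \<le> h" for s t
    using near[OF that] m d3 by (force simp: dist_commute)
  obtain s t where st: "0 \<le> s" "s \<le> h" "0 \<le> t" "t \<le> h"
    "f (z + h *\<^sub>R d + h *\<^sub>R e) - f (z + h *\<^sub>R d) - f (z + h *\<^sub>R e) + f z = h * h * fde (z + s *\<^sub>R d + t *\<^sub>R e)"
    using double_difference[OF pd(1,3) h box] by blast
  have box': "z + s *\<^sub>R e + t *\<^sub>R d \<in> U" if "0 \<le> s" "s \<le> h" "0 \<le> t" "t \<le> h" for s t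
    using box[OF that(3,4,1,2)] by (simp add: add_ac)
  obtain s' t' where st': "0 \<le> s'" "s' \<le> h" "0 \<le> t'" "t' \<le> h"
    "f (z + h *\<^sub>R e + h *\<^sub>R d) - f (z + h *\<^sub>R e) - f (z + h *\<^sub>R d) + f z = h * h * fed (z + s' *\<^sub>R e + t' *\<^sub>R d)"
    using double_difference[OF pd(2,4) h box'] by blast
  have c1: "z + h *\<^sub>R e + h *\<^sub>R d = z + h *\<^sub>R d + h *\<^sub>R e" "z + s' *\<^sub>R e + t' *\<^sub>R d = z + t' *\<^sub>R d + s' *\<^sub>R e" by (simp_all add: add_ac)
  have "h * h * fde (z + s *\<^sub>R d + t *\<^sub>R e) = h * h * fed (z + t' *\<^sub>R d + s' *\<^sub>R e)"
    using st(5) st'(5)[unfolded c1] by linarith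
  then have eq: "fde (z + s *\<^sub>R d + t *\<^sub>R e) = fed (z + t' *\<^sub>R d + s' *\<^sub>R e)" using h by simp
  have "dist (fde (z + s *\<^sub>R d + t *\<^sub>R e)) (fde z) < \<epsilon>"
    by (rule d1(2)[OF box[OF st(1-4)]]) (use near[OF st(1-4)] m in linarith)
  moreover have "dist (fed (z + t' *\<^sub>R d + s' *\<^sub>R e)) (fed z) < \<epsilon>"
    by (rule d2(2)[OF box[OF st'(3,4,1,2)]]) (use near[OF st'(3,4,1,2)] m in linarith)
  ultimately have "\<bar>fde z - fed z\<bar> < \<epsilon> + \<epsilon>" unfolding eq by (simp add: dist_real_def abs_if split: if_splits)
  then show False by (simp add: \<epsilon>_def)
qed

section \<open>The family of derivatives of a solution, and its translates\<close>

lemma partial_line: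
  fixes f :: "real^'n \<Rightarrow> real"
  assumes "f differentiable (at x)"
  shows "((\<lambda>s. f (x + s *\<^sub>R axis i 1)) has_real_derivative partial i f x) (at 0)"
proof -
  have F: "(f has_derivative frechet_derivative f (at x)) (at x)" using assms by (simp add: frechet_derivative_works)
  have l: "linear (frechet_derivative f (at x))" using F by (simp add: has_derivative_linear)
  have g: "((\<lambda>s. x + s *\<^sub>R axis i 1) has_derivative (\<lambda>s. s *\<^sub>R axis i 1)) (at (0::real))"
    by (auto intro!: derivative_eq_intros)
  have "(f has_derivative frechet_derivative f (at x)) (at (x + 0 *\<^sub>R axis i 1))" using F by simp
  from diff_chain_at[OF g this] have "((\<lambda>s. f (x + s *\<^sub>R axis i 1)) has_derivative (\<lambda>s. frechet_derivative f (at x) (s *\<^sub>R axis i 1))) (at 0)"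
    by (simp add: o_def)
  moreover have "(\<lambda>s. frechet_derivative f (at x) (s *\<^sub>R axis i 1)) = (\<lambda>s. s * partial i f x)"
    using linear_scale[OF l] by (simp add: partial_def)
  ultimately show ?thesis by (simp add: has_field_derivative_def mult.commute[of _ "partial i f x"])
qed

definition jet :: "(real \<Rightarrow> real^2 \<Rightarrow> real) \<Rightarrow> ix \<Rightarrow> pt \<Rightarrow> real" where
  "jet u i z = (case i of Jv \<Rightarrow> u (fst z) (snd z) | Jt \<Rightarrow> time_deriv u (fst z) (snd z)
     | Jx \<Rightarrow> partial 1 (u (fst z)) (snd z) | Jy \<Rightarrow> partial 2 (u (fst z)) (snd z)
     | Jxx \<Rightarrow> partial 1 (partial 1 (u (fst z))) (snd z) | Jxy \<Rightarrow> partial 2 (partial 1 (u (fst z))) (snd z)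
     | Jyy \<Rightarrow> partial 2 (partial 2 (u (fst z))) (snd z))"

lemma jet_simps: "jet u Jv = (\<lambda>z. u (fst z) (snd z))" "jet u Jt = (\<lambda>z. time_deriv u (fst z) (snd z))"
  "jet u Jx = (\<lambda>z. partial 1 (u (fst z)) (snd z))" "jet u Jy = (\<lambda>z. partial 2 (u (fst z)) (snd z))"
  "jet u Jxx = (\<lambda>z. partial 1 (partial 1 (u (fst z))) (snd z))" "jet u Jxy = (\<lambda>z. partial 2 (partial 1 (u (fst z))) (snd z))"
  "jet u Jyy = (\<lambda>z. partial 2 (partial 2 (u (fst z))) (snd z))"
  by (auto simp: jet_def)

lemma C12_jet:
  fixes u :: "real \<Rightarrow> real^2 \<Rightarrow> real"
  assumes I: "open I" "open D" and u: "C12_on I D u" and cu: "continuous_on (I \<times> D) (\<lambda>(t, x). u t x)"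
  shows "C12 (I \<times> D) (jet u)"
proof -
  note c = u[unfolded C12_on_def]
  have U: "open (I \<times> D)" by (rule open_Times[OF I])
  have sp: "has_pd (0, axis k 1) (I \<times> D) (\<lambda>z. u (fst z) (snd z)) (\<lambda>z. partial k (u (fst z)) (snd z))" for k :: 2
    unfolding has_pd_def using c by (auto intro!: partial_line)
  have sp2: "has_pd (0, axis k 1) (I \<times> D) (\<lambda>z. partial l (u (fst z)) (snd z)) (\<lambda>z. partial k (partial l (u (fst z))) (snd z))" for k l :: 2
    unfolding has_pd_def using c by (auto intro!: partial_line)
  have tm: "has_pd dT (I \<times> D) (\<lambda>z. u (fst z) (snd z)) (\<lambda>z. time_deriv u (fst z) (snd z))"
    unfolding has_pd_def
  proof
    fix z assume "z \<in> I \<times> D"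
    then have "(\<lambda>s. u s (snd z)) differentiable (at (fst z))" using c by auto
    then have "((\<lambda>s. u s (snd z)) has_real_derivative time_deriv u (fst z) (snd z)) (at (fst z))"
      unfolding time_deriv_def by (simp add: DERIV_deriv_iff_real_differentiable)
    then have "((\<lambda>s. u (s + fst z) (snd z)) has_real_derivative time_deriv u (fst z) (snd z)) (at 0)"
      using DERIV_shift[of "\<lambda>s. u s (snd z)" "time_deriv u (fst z) (snd z)" 0 "fst z"] by simp
    then show "((\<lambda>s. u (fst (z + s *\<^sub>R dT)) (snd (z + s *\<^sub>R dT))) has_real_derivative time_deriv u (fst z) (snd z)) (at 0)"
      by (simp add: add.commute)
  qed
  have c2: "continuous_on (I \<times> D) (\<lambda>z. partial k (partial l (u (fst z))) (snd z))" for k l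
    using c by (simp add: case_prod_unfold)
  have c1: "continuous_on (I \<times> D) (\<lambda>z. partial k (u (fst z)) (snd z))" for k :: 2
  proof -
    have "continuous_on (I \<times> D) (\<lambda>z. grad (u (fst z)) (snd z) $ k)"
      using c by (intro continuous_intros) (simp add: case_prod_unfold)
    then show ?thesis by (simp add: grad_def)
  qed
  have cc: "continuous_on (I \<times> D) (jet u i)" for i
    using c1 c2 c cu by (cases i) (simp_all add: jet_simps case_prod_unfold)
  have sym: "partial 2 (partial 1 (u (fst z))) (snd z) = partial 1 (partial 2 (u (fst z))) (snd z)" if "z \<in> I \<times> D" for z
    by (rule mixed_partials[OF U that sp sp sp2 sp2 c2 c2])
  have "has_pd dX (I \<times> D) (\<lambda>z. partial 2 (u (fst z)) (snd z)) (\<lambda>z. partial 2 (partial 1 (u (fst z))) (snd z))"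
    by (rule has_pd_cong_open[OF U sp2]) (use sym in auto)
  then show ?thesis unfolding C12_def using sp sp2 tm cc by (simp add: jet_simps)
qed

definition jshift :: "pt \<Rightarrow> (ix \<Rightarrow> pt \<Rightarrow> real) \<Rightarrow> ix \<Rightarrow> pt \<Rightarrow> real" where "jshift p j i z = j i (z + p)"

lemma solves_jshift:
  assumes "solves C U j" "\<And>z. z \<in> V \<Longrightarrow> z + p \<in> U"
  shows "solves C V (jshift p j)"
proof -
  have j: "C12 U j" using assms by (simp add: solves_def)
  have pd: "has_pd e V (jshift p j i) (jshift p j k)" if "has_pd e U (j i) (j k)" for e i k
    unfolding has_pd_def
  proof
    fix z assume z: "z \<in> V"
    have e: "(\<lambda>s. j i (z + s *\<^sub>R e + p)) = (\<lambda>s. j i (z + p + s *\<^sub>R e))" by (simp add: add_ac)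
    show "((\<lambda>s. jshift p j i (z + s *\<^sub>R e)) has_real_derivative jshift p j k z) (at 0)"
      unfolding jshift_def e by (rule has_pdD[OF that assms(2)[OF z]])
  qed
  have "continuous_on V (jshift p j i)" for i
    unfolding jshift_def[abs_def] by (rule continuous_on_compose2[OF C12D(8)[OF j]]) (use assms(2) in \<open>auto intro!: continuous_intros\<close>)
  then have "C12 V (jshift p j)" unfolding C12_def using C12D(1-7)[OF j] pd by simp
  moreover have "heat (jshift p j) z = heat j (z + p)" "gsq (jshift p j) z = gsq j (z + p)" for z
    by (simp_all add: heat_def gsq_def jshift_def)
  ultimately show ?thesis using assms unfolding solves_def by (simp add: jshift_def)
qed

section \<open>Geometry of the cone\<close>

lemma tan_ge_self: assumes "0 \<le> x" "x < pi/2" shows "x \<le> tan x"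
proof (cases "x = 0")
  case False
  then have x: "0 < x" using assms by simp
  have c: "0 < cos y" if "0 \<le> y" "y \<le> x" for y using that assms by (intro cos_gt_zero_pi) auto
  obtain y where y: "0 < y" "y < x" "tan x - tan 0 = (x - 0) * inverse ((cos y)\<^sup>2)"
    using MVT2[OF x, of tan "\<lambda>y. inverse ((cos y)\<^sup>2)"] c by (force intro: DERIV_tan)
  have "(cos y)\<^sup>2 \<le> 1" by (simp add: abs_square_le_1)
  then have "1 \<le> inverse ((cos y)\<^sup>2)" using c[of y] y by (intro one_le_inverse) auto
  then have "x * 1 \<le> x * inverse ((cos y)\<^sup>2)" using x by (intro mult_left_mono) auto
  then show ?thesis using y by simp
qed simp

text \<open>47.5\<degree> = 45\<degree> + 2.5\<degree>, and tan(45\<degree> + x) = (1 + s) / (1 - s)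
  with s = tan x. For x = pi / 72 the bound s \<ge> pi / 72 > 0.0436 suffices, since the claim
  requires s \<ge> 91 / 2091 = 0.04352... .\<close>

lemma tan_half_angle_ge:
  assumes "95 * (pi / 180) \<le> \<theta>" "\<theta> < pi" shows "1091/1000 \<le> tan (\<theta> / 2)"
proof -
  define s where "s = tan (pi / 72)"
  have p: "3.14 \<le> pi" using pi_approx(1) by simp
  have c: "cos (pi / 72) \<noteq> 0" "cos (pi / 4) \<noteq> 0" "cos (pi / 4 + pi / 72) \<noteq> 0"
    using cos_gt_zero_pi[of "pi / 72"] cos_gt_zero_pi[of "pi / 4"] cos_gt_zero_pi[of "pi / 4 + pi / 72"] by auto
  have s: "4353/100000 \<le> s"
    using tan_ge_self[of "pi / 72"] p by (simp add: s_def)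
  have s1: "s < 1" using tan_monotone[of "pi / 72" "pi / 4"] by (simp add: s_def tan_45)
  have t: "tan (pi / 4 + pi / 72) = (1 + s) / (1 - s)"
    using tan_add[OF c(2,1,3)] by (simp add: s_def tan_45)
  have "1091/1000 * (1 - s) \<le> 1 + s" using s by (simp add: algebra_simps)
  then have "1091/1000 \<le> tan (pi / 4 + pi / 72)" unfolding t using s1 by (simp add: le_divide_eq)
  also have "\<dots> \<le> tan (\<theta> / 2)" using assms by (intro tan_mono_le) auto
  finally show ?thesis .
qed

lemma closed_conical_domain: "closed (conical_domain \<theta>)"
proof (cases "\<theta> < pi")
  case True
  then have "conical_domain \<theta> = {x. 0 \<le> x $ 1 \<and> \<bar>x $ 2\<bar> \<le> tan (\<theta> / 2) * x $ 1}" by (simp add: conical_domain_def)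
  then show ?thesis by (simp, intro closed_Collect_conj closed_Collect_le continuous_intros)
next
  case False
  then have "conical_domain \<theta> = {x. 0 \<le> x $ 1}" by (simp add: conical_domain_def)
  then show ?thesis by (simp, intro closed_Collect_le continuous_intros)
qed

text \<open>The domain is closed under addition and contains the sector of slope 1.091. A translate
  of the open sector by a point of the domain is open and contained in the domain, hence in its
  interior.\<close>

lemma open_sector_add_conical_domain:
  assumes "95 * (pi / 180) \<le> \<theta>" and y: "y \<in> conical_domain \<theta>" and x: "x \<in> open_sector (1091/1000)"
  shows "y + x \<in> interior (conical_domain \<theta>)"
proof -
  have sub: "(\<lambda>x. y + x) ` open_sector (1091/1000) \<subseteq> conical_domain \<theta>"
  proof safe
    fix x :: "real^2" assume x: "x \<in> open_sector (1091/1000)"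
    then have x1: "0 \<le> x $ 1" "\<bar>x $ 2\<bar> \<le> 1091/1000 * x $ 1" by (auto simp: open_sector_def)
    show "y + x \<in> conical_domain \<theta>"
    proof (cases "\<theta> < pi")
      case True
      have "1091/1000 * x $ 1 \<le> tan (\<theta> / 2) * x $ 1" using tan_half_angle_ge[OF assms(1) True] x1 by (intro mult_right_mono)
      moreover have "\<bar>y $ 2\<bar> \<le> tan (\<theta> / 2) * y $ 1" "0 \<le> y $ 1" using y True by (auto simp: conical_domain_def)
      ultimately show ?thesis using x1 abs_triangle_ineq[of "y $ 2" "x $ 2"] True
        by (simp add: conical_domain_def distrib_left)
    next
      case False
      then show ?thesis using y x1 by (simp add: conical_domain_def)
    qed
  qed
  have "open ((\<lambda>x. y + x) ` open_sector (1091/1000))" by (intro open_translation open_sector_open)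
  then show ?thesis using sub x interiorI by blast
qed

text \<open>\<open>open_sector_vanish\<close> speaks of the axis of a sector with apex 0 and of time
  0. Translating in time by \<open>s\<close>, and in space so that the given point lies on the axis,
  brings every interior point within its reach, with the same \<open>\<tau>\<close> for all of
  them.\<close>

lemma vanish_step:
  fixes u :: "real \<Rightarrow> real^2 \<Rightarrow> real"
  assumes th: "95 * (pi / 180) \<le> \<theta>" and cu: "continuous_on ({0..1} \<times> conical_domain \<theta>) (\<lambda>(t, x). u t x)"
    and sol: "solves C ({0<..<1} \<times> interior (conical_domain \<theta>)) (jet u)" and C: "0 \<le> C"
    and M: "\<forall>t\<in>{0..1}. \<forall>x\<in>conical_domain \<theta>. \<bar>u t x\<bar> \<le> M"
    and s: "0 \<le> s" "s < 1" and zero: "\<And>x. x \<in> conical_domain \<theta> \<Longrightarrow> u s x = 0"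
  obtains \<tau> where "0 < \<tau>" "s + \<tau> < 1" "\<And>t x. s < t \<Longrightarrow> t < s + \<tau> \<Longrightarrow> x \<in> interior (conical_domain \<theta>) \<Longrightarrow> u t x = 0"
proof -
  have T: "0 < 1 - s" using s by simp
  obtain \<tau> where tau: "0 < \<tau>" "\<tau> < 1 - s" "\<And>u M p. solves C ({0<..<1 - s} \<times> open_sector (1091/1000)) u \<Longrightarrow>
    (\<And>z. z \<in> {0<..<1 - s} \<times> open_sector (1091/1000) \<Longrightarrow> \<bar>u Jv z\<bar> \<le> M) \<Longrightarrow>
    (\<And>k e. 0 < e \<Longrightarrow> \<exists>d>0. \<forall>z\<in>{0<..<1 - s} \<times> (open_sector (1091/1000) \<inter> cball 0 k). fst z < d \<longrightarrow> \<bar>u Jv z\<bar> \<le> e) \<Longrightarrow>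
    0 < fst p \<Longrightarrow> fst p < \<tau> \<Longrightarrow> 0 < snd p $ 1 \<Longrightarrow> snd p $ 2 = 0 \<Longrightarrow> u Jv p = 0"
    using open_sector_vanish[OF C T] by blast
  define D where "D = conical_domain \<theta>"
  show thesis
  proof (rule that[OF tau(1)])
    show "s + \<tau> < 1" using tau(2) by simp
    fix t :: real and x :: "real^2" assume t: "s < t" "t < s + \<tau>" and x: "x \<in> interior (conical_domain \<theta>)"
    obtain r where r: "0 < r" "cball x r \<subseteq> interior D" using x open_contains_cball[of "interior D"] by (auto simp: D_def)
    \<comment> \<open>The new apex: \<open>x\<close> lies on the axis of the translated sector, at
      distance \<open>r\<close> from it.\<close>
    define y where "y = x - r *\<^sub>R axis 1 1"
    have "norm (r *\<^sub>R (axis 1 1 :: real^2)) = r" using r by (simp add: norm_axis_1)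
    then have "y \<in> cball x r" by (simp add: y_def dist_norm)
    then have y: "y \<in> D" using r interior_subset by blast
    have yx: "y + x' \<in> interior D" if "x' \<in> open_sector (1091/1000)" for x'
      using open_sector_add_conical_domain[OF th _ that] y by (simp add: D_def)
    define w where "w = jshift (s, y) (jet u)"
    have wv: "w Jv z = u (fst z + s) (snd z + y)" for z by (simp add: w_def jshift_def jet_simps)
    have mem: "z + (s, y) \<in> {0<..<1} \<times> interior D" if "z \<in> {0<..<1 - s} \<times> open_sector (1091/1000)" for z
      using that yx[of "snd z"] s by (cases z) (auto simp: add.commute)
    have "w Jv (t - s, r *\<^sub>R axis 1 1) = 0"
    proof (rule tau(3)[of w M])
      show "solves C ({0<..<1 - s} \<times> open_sector (1091/1000)) w"
        unfolding w_def by (rule solves_jshift[OF sol]) (use mem in \<open>simp add: D_def\<close>)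
      show "\<bar>w Jv z\<bar> \<le> M" if "z \<in> {0<..<1 - s} \<times> open_sector (1091/1000)" for z
        using mem[OF that] M interior_subset[of D] unfolding wv by (cases z) (auto simp: D_def)
      show "\<exists>d>0. \<forall>z\<in>{0<..<1 - s} \<times> (open_sector (1091/1000) \<inter> cball 0 k). fst z < d \<longrightarrow> \<bar>w Jv z\<bar> \<le> e" if e: "0 < e" for k e
      proof -
        \<comment> \<open>Vanishing at time \<open>s\<close> is turned into uniform smallness
          shortly afterwards by uniform continuity on this compact set, which contains the time
          \<open>s\<close> itself.\<close>
        define Q :: "pt set" where "Q = {0..1} \<times> (D \<inter> cball y k)"
        have "compact Q" unfolding Q_def D_def by (intro compact_Times closed_Int_compact closed_conical_domain) auto
        moreover have "continuous_on Q (\<lambda>(t, x). u t x)" by (rule continuous_on_subset[OF cu]) (auto simp: Q_def D_def)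
        ultimately have "uniformly_continuous_on Q (\<lambda>(t, x). u t x)" by (intro compact_uniformly_continuous)
        then obtain d where d: "0 < d" "\<And>p q. p \<in> Q \<Longrightarrow> q \<in> Q \<Longrightarrow> dist q p < d \<Longrightarrow> dist (case q of (t, x) \<Rightarrow> u t x) (case p of (t, x) \<Rightarrow> u t x) < e"
          unfolding uniformly_continuous_on_def using e by metis
        have "\<bar>w Jv z\<bar> \<le> e" if z: "z \<in> {0<..<1 - s} \<times> (open_sector (1091/1000) \<inter> cball 0 k)" "fst z < d" for z
        proof -
          have zi: "y + snd z \<in> D" "norm (snd z) \<le> k" "0 < fst z" "fst z < 1 - s"
            using z yx[of "snd z"] interior_subset[of D] by auto
          then have "(s, y + snd z) \<in> Q" "(fst z + s, y + snd z) \<in> Q" using s by (auto simp: Q_def dist_norm)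
          from d(2)[OF this] have "dist (u (fst z + s) (y + snd z)) (u s (y + snd z)) < e"
            using z zi by (simp add: dist_Pair_Pair dist_real_def)
          then show ?thesis using zero zi(1) by (simp add: wv D_def dist_real_def add.commute)
        qed
        then show ?thesis using d(1) by blast
      qed
      show "0 < fst (t - s, r *\<^sub>R axis 1 1 :: real^2)" "fst (t - s, r *\<^sub>R axis 1 1 :: real^2) < \<tau>" using t by auto
      show "0 < snd (t - s, r *\<^sub>R axis 1 1 :: real^2) $ 1" "snd (t - s, r *\<^sub>R axis 1 1 :: real^2) $ 2 = 0" using r by auto
    qed
    then show "u t x = 0" by (simp add: wv y_def)
  qed
qed

theorem proposition1p2:
  fixes \<theta> C M :: real and u :: "real \<Rightarrow> real^2 \<Rightarrow> real"
  assumes "95 * (pi / 180) \<le> \<theta>" and "\<theta> \<le> pi"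
    and "continuous_on ({0..1} \<times> conical_domain \<theta>) (\<lambda>(t, x). u t x)"
    and "C12_on {0<..<1} (interior (conical_domain \<theta>)) u"
    and "\<forall>t\<in>{0<..<1}. \<forall>x\<in>interior (conical_domain \<theta>).
           \<bar>time_deriv u t x + laplacian (u t) x\<bar> \<le> C * (\<bar>u t x\<bar> + norm (grad (u t) x))"
    and "\<forall>x\<in>conical_domain \<theta>. u 0 x = 0"
    and "\<forall>t\<in>{0..1}. \<forall>x\<in>conical_domain \<theta>. \<bar>u t x\<bar> \<le> M"
  shows "\<forall>t\<in>{0..1}. \<forall>x\<in>conical_domain \<theta>. u t x = 0"
proof -
  define D where "D = conical_domain \<theta>"
  \<comment> \<open>The constant \<open>C\<close> is arbitrary, whereas the estimates ask for a
    nonnegative one.\<close>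
  define C' where "C' = max C 0"
  have C': "0 \<le> C'" by (simp add: C'_def)
  have jC: "C12 ({0<..<1} \<times> interior D) (jet u)"
  proof (rule C12_jet)
    show "continuous_on ({0<..<1} \<times> interior D) (\<lambda>(t, x). u t x)"
      by (rule continuous_on_subset[OF assms(3)]) (use interior_subset[of D] in \<open>auto simp: D_def\<close>)
  qed (use assms(4) in \<open>auto simp: D_def\<close>)
  have sol: "solves C' ({0<..<1} \<times> interior D) (jet u)"
    unfolding solves_def
  proof (intro conjI jC ballI)
    fix z :: pt assume z: "z \<in> {0<..<1} \<times> interior D"
    have "heat (jet u) z = time_deriv u (fst z) (snd z) + laplacian (u (fst z)) (snd z)"
      by (simp add: heat_def jet_simps laplacian_def sum_2)
    moreover have "sqrt (gsq (jet u) z) = norm (grad (u (fst z)) (snd z))"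
      by (simp add: gsq_def jet_simps norm_vec_def L2_set_def sum_2 grad_def)
    moreover have "C * (\<bar>jet u Jv z\<bar> + sqrt (gsq (jet u) z)) \<le> C' * (\<bar>jet u Jv z\<bar> + sqrt (gsq (jet u) z))"
      by (intro mult_right_mono) (auto simp: C'_def)
    moreover have "\<bar>time_deriv u (fst z) (snd z) + laplacian (u (fst z)) (snd z)\<bar>
        \<le> C * (\<bar>jet u Jv z\<bar> + norm (grad (u (fst z)) (snd z)))"
      using bspec[OF bspec[OF assms(5), of "fst z"], of "snd z"] z by (auto simp: D_def jet_simps)
    ultimately show "\<bar>heat (jet u) z\<bar> \<le> C' * (\<bar>jet u Jv z\<bar> + sqrt (gsq (jet u) z))" by (metis order_trans)
  qed
  \<comment> \<open>The length of a step depends on the remaining time \<open>1 - s\<close>, so a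
    count of equal steps is replaced by a supremum. By continuity in time \<open>u\<close> also
    vanishes at the supremum, from where one more step could be made.\<close>
  define A where "A = {s\<in>{0..1}. \<forall>t\<in>{0..s}. \<forall>x\<in>D. u t x = 0}"
  have A0: "0 \<in> A" using assms(6) by (auto simp: A_def D_def)
  have bA: "bdd_above A" by (rule bdd_aboveI[of _ 1]) (auto simp: A_def)
  define s where "s = Sup A"
  have "x \<le> 1" if "x \<in> A" for x using that by (simp add: A_def)
  then have s01: "0 \<le> s" "s \<le> 1"
    unfolding s_def using A0 by (auto intro!: cSup_upper[OF A0 bA] cSup_least)
  have below: "u t x = 0" if "0 \<le> t" "t < s" "x \<in> D" for t x
  proof -
    have "t < Sup A" "A \<noteq> {}" using A0 that(2) by (auto simp: s_def)
    then obtain s' where "s' \<in> A" "t < s'" by (rule less_cSupE)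
    then show ?thesis using that by (auto simp: A_def)
  qed
  have ct: "continuous_on {0..1} (\<lambda>t. u t x)" if "x \<in> D" for x
  proof -
    have "continuous_on {0..1} (\<lambda>t. (\<lambda>(t, x). u t x) (t, x))"
      by (rule continuous_on_compose2[OF assms(3)]) (use that in \<open>auto simp: D_def intro!: continuous_intros\<close>)
    then show ?thesis by simp
  qed
  have at_s: "u s x = 0" if x: "x \<in> D" for x
  proof (cases "s = 0")
    case True
    then show ?thesis using assms(6) x by (simp add: D_def)
  next
    case False
    then have s0: "0 < s" using s01 by simp
    have "continuous_on {0..s} (\<lambda>t. u t x)" by (rule continuous_on_subset[OF ct[OF x]]) (use s01 in auto)
    moreover have "closure {0..<s} = {0..s}" using s0 by simp
    ultimately show ?thesis
      using continuous_constant_on_closure[of "{0..<s}" "\<lambda>t. u t x" 0 s] below x s0 by auto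
  qed
  have "s = 1"
  proof (rule ccontr)
    assume "s \<noteq> 1"
    then have s1: "s < 1" using s01 by simp
    obtain \<tau> where tau: "0 < \<tau>" "s + \<tau> < 1" "\<And>t x. s < t \<Longrightarrow> t < s + \<tau> \<Longrightarrow> x \<in> interior D \<Longrightarrow> u t x = 0"
      using vanish_step[OF assms(1,3) sol[unfolded D_def] C' assms(7) s01(1) s1] at_s unfolding D_def by blast
    have ext: "u t x = 0" if t: "s < t" "t < s + \<tau>" and x: "x \<in> D" for t x
    proof -
      \<comment> \<open>The step gives zeros at interior points only. A boundary point is the limit
        of interior points along the axis direction, and \<open>u\<close> is continuous up to the
        boundary.\<close>
      have xe: "x + r *\<^sub>R axis 1 1 \<in> interior D" if "0 < r" for r
        using open_sector_add_conical_domain[OF assms(1), of x "r *\<^sub>R axis 1 1"] x that by (simp add: D_def open_sector_def)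
      have t01: "t \<in> {0..1}" using t tau s01 by auto
      have "continuous_on {0..1} (\<lambda>r. (\<lambda>(t, x). u t x) (t, x + r *\<^sub>R axis 1 1))"
      proof (rule continuous_on_compose2[OF assms(3)])
        show "(\<lambda>r. (t, x + r *\<^sub>R axis 1 1)) ` {0..1} \<subseteq> {0..1} \<times> conical_domain \<theta>"
        proof
          fix p assume "p \<in> (\<lambda>r. (t, x + r *\<^sub>R axis 1 1)) ` {0..1}"
          then obtain r where r: "0 \<le> r" "p = (t, x + r *\<^sub>R axis 1 1)" by auto
          have "x + r *\<^sub>R axis 1 1 \<in> D" using xe[of r] interior_subset[of D] x r(1) by (cases "r = 0") auto
          then show "p \<in> {0..1} \<times> conical_domain \<theta>" using r t01 by (simp add: D_def)
        qed
      qed (intro continuous_intros)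
      then have "continuous_on (closure {0<..1}) (\<lambda>r. u t (x + r *\<^sub>R axis 1 1))" by simp
      from continuous_constant_on_closure[OF this, of 0 0] show ?thesis using tau(3)[OF t xe] by auto
    qed
    have "s + \<tau> / 2 \<in> A"
      unfolding A_def
    proof (intro CollectI conjI ballI)
      show "s + \<tau> / 2 \<in> {0..1}" using s01 tau by auto
      fix t :: real and x :: "real^2" assume "t \<in> {0..s + \<tau> / 2}" "x \<in> D"
      then show "u t x = 0" using below[of t x] at_s[of x] ext[of t x] tau(1) by (cases t s rule: linorder_cases) auto
    qed
    then have "s + \<tau> / 2 \<le> s" unfolding s_def by (rule cSup_upper[OF _ bA])
    then show False using tau(1) by simp
  qed
  then show ?thesis using below at_s unfolding D_def by (metis atLeastAtMost_iff order_le_less)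
qed

end
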